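(* Let $\alpha\in(1,2)$ and let $\{\xi_n\}_{n\ge0}$ be the symmetric $\alpha$-stable moving average $\xi_n=\int_{\mathbb R}a(n-x)M(dx)$, where $a\in L^\alpha(\mathbb R,dx)$ and $a(x)=0$ for $x<0$. Suppose that $K$ is a function satisfying Assumptions (K1), (K2) and (K3) stated in the context. If $$\sum_{m=1}^\infty\left(\int_{m-1}^m|a(x)|^\alpha dx\right)^{1/2}<\infty\qquad\text{and}\qquad\sum_{n=1}^\infty[\xi_0,\xi_n]_1<\infty,$$ then, as $N\to\infty$, $$N^{-1/2}S_N=N^{-1/2}\sum_{n=1}^N\left(K(\xi_n)-EK(\xi_n)\right)\xrightarrow{d}\mathcal N(0,\sigma^2),$$ where $$\sigma^2=\lim_{N\to\infty}N^{-1}\mathrm{Var}(S_N)=\mathrm{Var}(K(\xi_0))+2\sum_{n=1}^\infty\mathrm{Cov}(K(\xi_0),K(\xi_n)).$$ The limit defining $\sigma^2$ exists and is finite, and the series converges absolutely.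
   Context: $M$ is a symmetric $\alpha$-stable ($S\alpha S$) random measure on $\mathbb R$ with Lebesgue control measure, so that for real $u_1,\dots,u_k$ and integers $n_1,\dots,n_k$, $E\exp(i\sum_l u_l\xi_{n_l})=\exp(-\int_{\mathbb R}|\sum_l u_l a(n_l-x)|^\alpha dx)$. $[\xi_0,\xi_n]_1=\int_{\mathbb R}|a(-x)|^{\alpha-1}|a(n-x)|dx+\int_{\mathbb R}|a(n-x)|^{\alpha-1}|a(-x)|dx$. Assumptions on the function $K$ of a real variable: (K1) There are $\beta\in(0,\alpha/2)$ and $x_0>0$ such that $|K(x)|\le\mathrm{const}\,|x|^\beta$ for $|x|>x_0$. (K2) With the same $x_0$, the function $K(x)/x$ is non-increasing for $x>x_0$ and non-decreasing for $x<-x_0$. (K3) With the same $x_0$, $K$ is bounded on $|x|\le x_0$ except possibly at a finite number of points $x_1,\dots,x_p$, around which the function $K$ is integrable. $\mathcal N(0,\sigma^2)$ is the normal law with mean $0$ and variance $\sigma^2$; $\xrightarrow{d}$ is convergence in distribution.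
   Formalization: K is taken Borel measurable and E K(ξ_0)^2 < ∞ is assumed; this does not follow from (K1)–(K3): for a = 1_{[0,1)} and K(x) = |x|^{-1/2} on 0<|x|≤1, zero elsewhere, all hypotheses hold but Var(K(ξ_0)) = ∞. *)

theory Defs
  imports "HOL-Probability.Probability"
begin

text \<open>Sets on which a random measure with Lebesgue control measure is defined.\<close>

definition finite_borel :: "real set set" where
  "finite_borel = {A \<in> sets borel. emeasure lborel A < \<infinity>}"

text \<open>
  \<open>\<Phi>\<close> is a symmetric \<open>\<alpha>\<close>-stable random measure on the real line, over the probability space \<open>P\<close>,
  with Lebesgue control measure: \<open>\<Phi> A\<close> is symmetric \<open>\<alpha>\<close>-stable with scale parameter
  \<open>|A| powr (1/\<alpha>)\<close>, and \<open>\<Phi>\<close> is independently scattered and \<open>\<sigma>\<close>-additive almost surely (the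
  exceptional null set may depend on the sequence of sets).
\<close>

definition sas_random_measure ::
    "'w measure \<Rightarrow> real \<Rightarrow> (real set \<Rightarrow> 'w \<Rightarrow> real) \<Rightarrow> bool" where
  "sas_random_measure P \<alpha> \<Phi> \<longleftrightarrow>
     (\<forall>A\<in>finite_borel. \<Phi> A \<in> borel_measurable P) \<and>
     (\<forall>A\<in>finite_borel. \<forall>u.
        char (distr P borel (\<Phi> A)) u =
        complex_of_real (exp (- (measure lborel A * \<bar>u\<bar> powr \<alpha>)))) \<and>
     (\<forall>(A :: nat \<Rightarrow> real set) k.
        (\<forall>i<k. A i \<in> finite_borel) \<longrightarrow> disjoint_family_on A {..<k} \<longrightarrow>
        prob_space.indep_vars P (\<lambda>_. borel) (\<lambda>i. \<Phi> (A i)) {..<k}) \<and>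
     (\<forall>A :: nat \<Rightarrow> real set.
        (\<forall>i. A i \<in> finite_borel) \<longrightarrow> disjoint_family A \<longrightarrow> (\<Union>i. A i) \<in> finite_borel \<longrightarrow>
        (AE \<omega> in P. (\<lambda>i. \<Phi> (A i) \<omega>) sums \<Phi> (\<Union>i. A i) \<omega>))"

definition L_power :: "real \<Rightarrow> (real \<Rightarrow> real) \<Rightarrow> bool" where
  "L_power \<alpha> f \<longleftrightarrow> f \<in> borel_measurable borel \<and> integrable lborel (\<lambda>x. \<bar>f x\<bar> powr \<alpha>)"

text \<open>
  \<open>X\<close> is (a version of) the stochastic integral of \<open>f\<close> with respect to \<open>\<Phi>\<close>: the limit in probability
  of the integrals \<open>\<Sum>i. c i * \<Phi> (A i)\<close> of simple functions \<open>\<Sum>i. c i * indicator (A i)\<close>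
  converging to \<open>f\<close> in \<open>L\<^sup>\<alpha>\<close>. A relation rather than a function, since the
  integral is determined only up to almost sure equality.
\<close>

definition is_stable_integral ::
    "'w measure \<Rightarrow> real \<Rightarrow> (real set \<Rightarrow> 'w \<Rightarrow> real) \<Rightarrow> (real \<Rightarrow> real) \<Rightarrow> ('w \<Rightarrow> real) \<Rightarrow> bool" where
  "is_stable_integral P \<alpha> \<Phi> f X \<longleftrightarrow>
     L_power \<alpha> f \<and> X \<in> borel_measurable P \<and>
     (\<exists>(k :: nat \<Rightarrow> nat) (c :: nat \<Rightarrow> nat \<Rightarrow> real) (A :: nat \<Rightarrow> nat \<Rightarrow> real set).
        (\<forall>j. \<forall>i<k j. A j i \<in> finite_borel) \<and>
        (\<forall>j. disjoint_family_on (A j) {..<k j}) \<and>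
        (\<lambda>j. LINT x|lborel. \<bar>f x - (\<Sum>i<k j. c j i * indicator (A j i) x)\<bar> powr \<alpha>)
          \<longlonglongrightarrow> 0 \<and>
        (\<forall>\<epsilon>>0. (\<lambda>j. measure P {\<omega> \<in> space P.
            \<bar>X \<omega> - (\<Sum>i<k j. c j i * \<Phi> (A j i) \<omega>)\<bar> > \<epsilon>}) \<longlonglongrightarrow> 0))"

text \<open>
  The dependence measure \<open>[X, Y]\<^sub>1\<close> of the stable integrals \<open>X\<close>, \<open>Y\<close> with kernels \<open>f\<close>, \<open>g\<close>. For
  kernels in \<open>L\<^sup>\<alpha>\<close> with \<open>\<alpha> > 1\<close> both integrals are finite by Hoelder's inequality.
\<close>

definition bracket1 :: "real \<Rightarrow> (real \<Rightarrow> real) \<Rightarrow> (real \<Rightarrow> real) \<Rightarrow> real" where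
  "bracket1 \<alpha> f g =
     (LINT x|lborel. \<bar>f x\<bar> powr (\<alpha> - 1) * \<bar>g x\<bar>) +
     (LINT x|lborel. \<bar>g x\<bar> powr (\<alpha> - 1) * \<bar>f x\<bar>)"

definition K1 :: "real \<Rightarrow> real \<Rightarrow> (real \<Rightarrow> real) \<Rightarrow> bool" where
  "K1 \<alpha> x0 K \<longleftrightarrow>
     (\<exists>\<beta>. 0 < \<beta> \<and> \<beta> < \<alpha> / 2 \<and> (\<exists>C. \<forall>x. \<bar>x\<bar> > x0 \<longrightarrow> \<bar>K x\<bar> \<le> C * \<bar>x\<bar> powr \<beta>))"

definition K2 :: "real \<Rightarrow> (real \<Rightarrow> real) \<Rightarrow> bool" where
  "K2 x0 K \<longleftrightarrow>
     (\<forall>x y. x0 < x \<longrightarrow> x \<le> y \<longrightarrow> K y / y \<le> K x / x) \<and>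
     (\<forall>x y. x \<le> y \<longrightarrow> y < - x0 \<longrightarrow> K x / x \<le> K y / y)"

text \<open>
  Boundedness except at the finitely many points of \<open>S\<close> is boundedness away from every neighbourhood
  of \<open>S\<close>; \<open>K\<close> may blow up at the points of \<open>S\<close> but is integrable near each of them.
\<close>

definition K3 :: "real \<Rightarrow> (real \<Rightarrow> real) \<Rightarrow> bool" where
  "K3 x0 K \<longleftrightarrow>
     (\<exists>S. finite S \<and> S \<subseteq> {-x0..x0} \<and>
        (\<forall>\<epsilon>>0. bounded (K ` {x \<in> {-x0..x0}. \<forall>s\<in>S. \<epsilon> \<le> \<bar>x - s\<bar>})) \<and>
        (\<forall>s\<in>S. \<exists>\<epsilon>>0. set_integrable lborel {s - \<epsilon><..<s + \<epsilon>} K))"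

definition covariance :: "'w measure \<Rightarrow> ('w \<Rightarrow> real) \<Rightarrow> ('w \<Rightarrow> real) \<Rightarrow> real" where
  "covariance P X Y =
     (LINT \<omega>|P. (X \<omega> - (LINT \<omega>'|P. X \<omega>')) * (Y \<omega> - (LINT \<omega>'|P. Y \<omega>')))"

text \<open>Normal law with mean \<open>m\<close> and variance \<open>v\<close>; a point mass if \<open>v = 0\<close>.\<close>

definition normal_law :: "real \<Rightarrow> real \<Rightarrow> real measure" where
  "normal_law m v =
     (if v = 0 then return borel m else density lborel (normal_density m (sqrt v)))"

end

(* The noise in the slab (k - l - 1, k - l] contributes scale A_l = int_l^{l+1} |a|^alpha to xi_k. Let v t be
   the second moment of the conditional mean of K(xi_0) when noise of scale t, out of the total scale tau,
   is known. If some noise of scale r0 > 0 is always averaged out, K is replaced by its convolution with a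
   stable density, which is smooth enough, by (K1) and (K3), for v to be Lipschitz on [0, tau - r0]. So for
   large l discarding the slab at distance l changes K(xi_k), given the noise before it, by
   O(A_l^(1/2)) in L^2, and Cauchy-Schwarz over the slabs gives
   |Cov(K(xi_i), K(xi_j))| <= sum_l theta_l theta_{l+|i-j|} with sum_l theta_l < infinity, where theta_l is a
   constant for small l and O(A_l^(1/2)) otherwise. The same bound holds for the m-dependent
   approximations E[K(xi_i) | noise in (i-m, i]], which converge in L^2 because v is left continuous at
   tau. Blocks of length L separated by gaps of length m are independent and identically distributed,
   so the characteristic function of the normalised sum is, up to errors controlled by the covariance
   bound, a power of the characteristic function of one block. *)

theory Submission
  imports Defs
begin

section \<open>Joint laws from characteristic functions\<close>

lemma tilted_law:
  fixes X V :: "'a \<Rightarrow> real"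
  assumes "prob_space M" and [measurable]: "X \<in> borel_measurable M" "V \<in> borel_measurable M"
    and V: "\<And>x. \<bar>V x\<bar> \<le> 1" and c: "c = 2 + (LINT x|M. V x)"
  defines "T \<equiv> distr (density M (\<lambda>x. ennreal ((2 + V x) / c))) borel X"
  shows "c \<ge> 1" "real_distribution T"
    "char T u = (2 * (CLINT x|M. iexp (u * X x)) + (CLINT x|M. iexp (u * X x) * V x)) / c"
    "A \<in> sets borel \<Longrightarrow> (LINT x|T. indicator A x) =
      (2 * (LINT x|M. indicator A (X x)) + (LINT x|M. indicator A (X x) * V x)) / c"
proof -
  interpret M: prob_space M by fact
  have iM: "integrable M f" if "f \<in> borel_measurable M" "\<And>x. norm (f x) \<le> 1"
    for f :: "'a \<Rightarrow> 'c :: {banach, second_countable_topology}"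
    using that by (intro M.integrable_const_bound[of _ 1]) auto
  have V': "0 \<le> 2 + V x" "-1 \<le> V x" for x using V[of x] by auto
  have iV: "integrable M V" by (rule iM) (use V in auto)
  have "(LINT x|M. -1) \<le> (LINT x|M. V x)"
    by (rule integral_mono) (use V' iV in auto)
  thus c1: "c \<ge> 1" by (simp add: M.prob_space c)
  have c': "c = (LINT x|M. 2 + V x)" using iV by (simp add: c M.prob_space)
  define D where "D = density M (\<lambda>x. ennreal ((2 + V x) / c))"
  have [measurable_cong, simp]: "sets D = sets M" by (auto simp: D_def)
  have "prob_space D"
  proof
    have "emeasure D (space D) = (\<integral>\<^sup>+x. ennreal ((2 + V x) / c) \<partial>M)"
      unfolding D_def by (subst emeasure_density) (auto intro!: nn_integral_cong)
    also have "\<dots> = ennreal (LINT x|M. (2 + V x) / c)"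
      using c1 V' by (intro nn_integral_eq_integral) (auto intro!: iV)
    also have "(LINT x|M. (2 + V x) / c) = 1" using c1 unfolding c' by simp
    finally show "emeasure D (space D) = 1" by simp
  qed
  thus "real_distribution T"
    unfolding T_def D_def[symmetric] by (rule prob_space.real_distribution_distr) simp
  have intD: "(LINT x|D. f x) = (LINT x|M. ((2 + V x) / c) *\<^sub>R f x)" if "f \<in> borel_measurable M"
    for f :: "'a \<Rightarrow> 'c :: {banach, second_countable_topology}"
    unfolding D_def by (rule integral_density) (use that c1 V' in auto)
  have "char T u = (CLINT x|M. ((2 + V x) / c) *\<^sub>R iexp (u * X x))"
    unfolding char_def T_def D_def[symmetric] by (subst integral_distr) (auto simp: intD)
  also have "\<dots> = (CLINT x|M. (2 * iexp (u * X x) + iexp (u * X x) * V x) / c)"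
    by (intro Bochner_Integration.integral_cong)
       (auto simp: scaleR_conv_of_real algebra_simps add_divide_distrib)
  also have "\<dots> = (2 * (CLINT x|M. iexp (u * X x)) + (CLINT x|M. iexp (u * X x) * V x)) / c"
  proof -
    have "integrable M (\<lambda>x. iexp (u * X x) * V x)" "integrable M (\<lambda>x. iexp (u * X x))"
      by (auto intro!: iM V simp: norm_mult)
    thus ?thesis by simp
  qed
  finally show "char T u = (2 * (CLINT x|M. iexp (u * X x)) + (CLINT x|M. iexp (u * X x) * V x)) / c" .
  assume [measurable]: "A \<in> sets borel"
  have "(LINT x|T. indicator A x) = (LINT x|M. ((2 + V x) / c) *\<^sub>R (indicator A (X x) :: real))"
    unfolding T_def D_def[symmetric] by (subst integral_distr) (auto simp: intD)
  also have "\<dots> = (LINT x|M. (2 * indicator A (X x) + indicator A (X x) * V x) / c)"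
    by (intro Bochner_Integration.integral_cong) (auto simp: algebra_simps add_divide_distrib)
  also have "\<dots> = (2 * (LINT x|M. indicator A (X x)) + (LINT x|M. indicator A (X x) * V x)) / c"
    by (simp, subst Bochner_Integration.integral_add)
       (auto intro!: iM V simp: abs_mult split: split_indicator)
  finally show "(LINT x|T. indicator A x) =
      (2 * (LINT x|M. indicator A (X x)) + (LINT x|M. indicator A (X x) * V x)) / c" .
qed

lemma weighted_char_unique_real:
  fixes X :: "'a \<Rightarrow> real" and Y :: "'b \<Rightarrow> real" and V :: "'a \<Rightarrow> real" and W :: "'b \<Rightarrow> real"
  assumes "prob_space M" "prob_space N"
    and [measurable]: "X \<in> borel_measurable M" "Y \<in> borel_measurable N"
      "V \<in> borel_measurable M" "W \<in> borel_measurable N"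
    and V: "\<And>x. \<bar>V x\<bar> \<le> 1" and W: "\<And>x. \<bar>W x\<bar> \<le> 1"
    and ch: "\<And>u. (CLINT x|M. iexp (u * X x)) = (CLINT x|N. iexp (u * Y x))"
    and wch: "\<And>u. (CLINT x|M. iexp (u * X x) * V x) = (CLINT x|N. iexp (u * Y x) * W x)"
    and [measurable]: "A \<in> sets borel"
  shows "(LINT x|M. indicator A (X x) * V x) = (LINT x|N. indicator A (Y x) * W x)"
proof -
  interpret M: prob_space M by fact
  interpret N: prob_space N by fact
  define c where "c = 2 + (LINT x|M. V x)"
  have "complex_of_real (LINT x|M. V x) = complex_of_real (LINT x|N. W x)"
    using wch[of 0] by simp
  hence c': "c = 2 + (LINT x|N. W x)" unfolding c_def by (simp only: of_real_eq_iff)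
  note tM = tilted_law[OF assms(1,3,5) V c_def] and tN = tilted_law[OF assms(2,4,6) W c']
  have e1: "distr (density M (\<lambda>x. ennreal ((2 + V x) / c))) borel X =
      distr (density N (\<lambda>x. ennreal ((2 + W x) / c))) borel Y"
    by (rule Levy_uniqueness[OF tM(2) tN(2)], rule ext) (simp only: tM(3) tN(3) ch wch)
  have e2: "distr M borel X = distr N borel Y"
  proof (rule Levy_uniqueness)
    show "char (distr M borel X) = char (distr N borel Y)"
      by (simp add: char_def integral_distr ch fun_eq_iff del: of_real_mult)
  qed (auto intro!: M.real_distribution_distr N.real_distribution_distr)
  have "(LINT x|M. indicator A (X x)) = (LINT x|N. indicator A (Y x) :: real)"
  proof -
    have "(LINT x|distr M borel X. indicator A x) = (LINT x|distr N borel Y. indicator A x :: real)"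
      unfolding e2 ..
    thus ?thesis by (subst (asm) (1 2) integral_distr) auto
  qed
  moreover have "(2 * (LINT x|M. indicator A (X x)) + (LINT x|M. indicator A (X x) * V x)) / c =
      (2 * (LINT x|N. indicator A (Y x)) + (LINT x|N. indicator A (Y x) * W x)) / c"
    using arg_cong[OF e1, of "\<lambda>D. (LINT x|D. indicator A x :: real)"] tM(4)[of A] tN(4)[of A] by simp
  ultimately show ?thesis using tM(1) by simp
qed

lemma weighted_char_unique:
  fixes X :: "'a \<Rightarrow> real" and Y :: "'b \<Rightarrow> real" and V :: "'a \<Rightarrow> complex" and W :: "'b \<Rightarrow> complex"
  assumes "prob_space M" "prob_space N"
    and [measurable]: "X \<in> borel_measurable M" "Y \<in> borel_measurable N"
      "V \<in> borel_measurable M" "W \<in> borel_measurable N"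
    and V: "\<And>x. norm (V x) \<le> 1" and W: "\<And>x. norm (W x) \<le> 1"
    and ch: "\<And>u. (CLINT x|M. iexp (u * X x)) = (CLINT x|N. iexp (u * Y x))"
    and wch: "\<And>u. (CLINT x|M. iexp (u * X x) * V x) = (CLINT x|N. iexp (u * Y x) * W x)"
    and [measurable]: "A \<in> sets borel"
  shows "(CLINT x|M. indicator A (X x) * V x) = (CLINT x|N. indicator A (Y x) * W x)"
proof -
  interpret M: prob_space M by fact
  interpret N: prob_space N by fact
  have iM: "integrable M f" if "f \<in> borel_measurable M" "\<And>x. norm (f x) \<le> 1"
    for f :: "'a \<Rightarrow> complex"
    using that by (intro M.integrable_const_bound[of _ 1]) auto
  have iN: "integrable N f" if "f \<in> borel_measurable N" "\<And>x. norm (f x) \<le> 1"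
    for f :: "'b \<Rightarrow> complex"
    using that by (intro N.integrable_const_bound[of _ 1]) auto
  have wch': "(CLINT x|M. iexp (u * X x) * cnj (V x)) = (CLINT x|N. iexp (u * Y x) * cnj (W x))" for u
  proof -
    have "(CLINT x|M. cnj (iexp ((-u) * X x) * V x)) = (CLINT x|N. cnj (iexp ((-u) * Y x) * W x))"
      using arg_cong[OF wch[of "- u"], of cnj] by (simp only: Bochner_Integration.integral_cnj)
    thus ?thesis by (simp add: exp_cnj)
  qed
  have [measurable]: "cnj \<in> borel_measurable borel"
    by (intro borel_measurable_continuous_onI continuous_intros)
  have *: "complex_of_real (Re z) = (z + cnj z) / 2" "complex_of_real (Im z) = (z - cnj z) / (2 * \<i>)" for z
    by (auto simp: complex_eq_iff)
  have re: "(LINT x|M. indicator A (X x) * Re (V x)) = (LINT x|N. indicator A (Y x) * Re (W x))"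
  proof (rule weighted_char_unique_real[OF assms(1,2)])
    fix u
    have "(CLINT x|M. iexp (u * X x) * complex_of_real (Re (V x))) =
      ((CLINT x|M. iexp (u * X x) * V x) + (CLINT x|M. iexp (u * X x) * cnj (V x))) / 2"
      by (simp only: *, subst Bochner_Integration.integral_add[symmetric])
         (auto intro!: iM V simp: norm_mult algebra_simps simp flip: integral_divide_zero)
    also have "\<dots> = (CLINT x|N. iexp (u * Y x) * complex_of_real (Re (W x)))"
      unfolding wch wch'
      by (simp only: *, subst Bochner_Integration.integral_add[symmetric])
         (auto intro!: iN W simp: norm_mult algebra_simps simp flip: integral_divide_zero)
    finally show "(CLINT x|M. iexp (u * X x) * complex_of_real (Re (V x))) =
      (CLINT x|N. iexp (u * Y x) * complex_of_real (Re (W x)))" .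
  qed (use V W abs_Re_le_cmod ch in \<open>auto intro: order_trans\<close>)
  have im: "(LINT x|M. indicator A (X x) * Im (V x)) = (LINT x|N. indicator A (Y x) * Im (W x))"
  proof (rule weighted_char_unique_real[OF assms(1,2)])
    fix u
    have "(CLINT x|M. iexp (u * X x) * complex_of_real (Im (V x))) =
      ((CLINT x|M. iexp (u * X x) * V x) - (CLINT x|M. iexp (u * X x) * cnj (V x))) / (2 * \<i>)"
      by (simp only: *, subst Bochner_Integration.integral_diff[symmetric])
         (auto intro!: iM V simp: norm_mult algebra_simps simp flip: integral_divide_zero)
    also have "\<dots> = (CLINT x|N. iexp (u * Y x) * complex_of_real (Im (W x)))"
      unfolding wch wch'
      by (simp only: *, subst Bochner_Integration.integral_diff[symmetric])
         (auto intro!: iN W simp: norm_mult algebra_simps simp flip: integral_divide_zero)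
    finally show "(CLINT x|M. iexp (u * X x) * complex_of_real (Im (V x))) =
      (CLINT x|N. iexp (u * Y x) * complex_of_real (Im (W x)))" .
  qed (use V W abs_Im_le_cmod ch in \<open>auto intro: order_trans\<close>)
  have iM': "integrable M (\<lambda>x. indicator A (X x) * V x)"
    by (rule iM) (use V in \<open>auto simp: norm_mult split: split_indicator\<close>)
  have iN': "integrable N (\<lambda>x. indicator A (Y x) * W x)"
    by (rule iN) (use W in \<open>auto simp: norm_mult split: split_indicator\<close>)
  have ind: "Re (indicator B z * w) = indicator B z * Re w" "Im (indicator B z * w) = indicator B z * Im w"
    for B :: "real set" and z w by (auto split: split_indicator)
  show ?thesis
    unfolding complex_eq_iff integral_Re[OF iM', symmetric] integral_Im[OF iM', symmetric]
      integral_Re[OF iN', symmetric] integral_Im[OF iN', symmetric] ind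
    using re im by simp
qed

lemma joint_char_indicator:
  fixes X :: "'i \<Rightarrow> 'a \<Rightarrow> real" and Y :: "'i \<Rightarrow> 'b \<Rightarrow> real"
  assumes "prob_space M" "prob_space N" and I: "finite I"
    and X[measurable]: "\<And>i. i \<in> I \<Longrightarrow> X i \<in> borel_measurable M"
    and Y[measurable]: "\<And>i. i \<in> I \<Longrightarrow> Y i \<in> borel_measurable N"
    and ch: "\<And>u. (CLINT x|M. iexp (\<Sum>i\<in>I. u i * X i x)) = (CLINT x|N. iexp (\<Sum>i\<in>I. u i * Y i x))"
    and J: "J \<subseteq> I" and A: "\<And>i. i \<in> I \<Longrightarrow> A i \<in> sets borel"
  shows "(CLINT x|M. iexp (\<Sum>i\<in>I-J. u i * X i x) * (\<Prod>i\<in>J. indicator (A i) (X i x))) =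
    (CLINT x|N. iexp (\<Sum>i\<in>I-J. u i * Y i x) * (\<Prod>i\<in>J. indicator (A i) (Y i x)))"
proof -
  have "finite J" using I J finite_subset by auto
  thus ?thesis using J
  proof (induction J arbitrary: u rule: finite_induct)
    case empty
    thus ?case using ch by simp
  next
    case (insert j J)
    hence jI: "j \<in> I" and JI: "J \<subseteq> I" and eq: "I - J = insert j (I - insert j J)" by auto
    note [measurable] = X[OF jI] Y[OF jI] A[OF jI]
    have [measurable]: "i \<in> J \<Longrightarrow> X i \<in> borel_measurable M" "i \<in> J \<Longrightarrow> Y i \<in> borel_measurable N"
      "i \<in> J \<Longrightarrow> A i \<in> sets borel" for i using JI X Y A by auto
    have nrm: "norm (iexp t * (\<Prod>i\<in>J. indicator (B i) (z i)) :: complex) \<le> 1" for t B and z :: "'i \<Rightarrow> real"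
      by (auto simp: norm_mult prod_norm[symmetric] intro!: prod_le_1 split: split_indicator)
    have "(CLINT x|M. indicator (A j) (X j x) * (iexp (\<Sum>i\<in>I-insert j J. u i * X i x) * (\<Prod>i\<in>J. indicator (A i) (X i x)))) =
      (CLINT x|N. indicator (A j) (Y j x) * (iexp (\<Sum>i\<in>I-insert j J. u i * Y i x) * (\<Prod>i\<in>J. indicator (A i) (Y i x))))"
    proof (rule weighted_char_unique[OF assms(1,2)])
      fix t
      show "(CLINT x|M. iexp (t * X j x)) = (CLINT x|N. iexp (t * Y j x))"
        using ch[of "\<lambda>i. if i = j then t else 0"] I jI by (simp add: if_distrib if_distribR sum.delta cong: if_cong)
      have s: "(\<Sum>i\<in>I-J. (u(j := t)) i * z i) = t * z j + (\<Sum>i\<in>I-insert j J. u i * z i)" for z :: "'i \<Rightarrow> real"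
        unfolding eq using I by (subst sum.insert) (auto intro!: sum.cong)
      show "(CLINT x|M. iexp (t * X j x) * (iexp (\<Sum>i\<in>I-insert j J. u i * X i x) * (\<Prod>i\<in>J. indicator (A i) (X i x)))) =
        (CLINT x|N. iexp (t * Y j x) * (iexp (\<Sum>i\<in>I-insert j J. u i * Y i x) * (\<Prod>i\<in>J. indicator (A i) (Y i x))))"
        using insert.IH[OF JI, of "u(j := t)"] unfolding s
        by (simp add: exp_add ring_distribs mult.assoc)
    qed (auto intro!: nrm simp del: of_real_sum)
    thus ?case using insert.hyps by (simp add: mult_ac)
  qed
qed

theorem joint_char_unique:
  fixes X :: "'i \<Rightarrow> 'a \<Rightarrow> real" and Y :: "'i \<Rightarrow> 'b \<Rightarrow> real"
  assumes "prob_space M" "prob_space N" and I: "finite I"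
    and X[measurable]: "\<And>i. i \<in> I \<Longrightarrow> X i \<in> borel_measurable M"
    and Y[measurable]: "\<And>i. i \<in> I \<Longrightarrow> Y i \<in> borel_measurable N"
    and ch: "\<And>u. (CLINT x|M. iexp (\<Sum>i\<in>I. u i * X i x)) = (CLINT x|N. iexp (\<Sum>i\<in>I. u i * Y i x))"
  shows "distr M (PiM I (\<lambda>_. borel)) (\<lambda>x. \<lambda>i\<in>I. X i x) = distr N (PiM I (\<lambda>_. borel)) (\<lambda>x. \<lambda>i\<in>I. Y i x)"
proof (rule measure_eqI_PiM_finite[OF I])
  interpret M: prob_space M by fact
  interpret N: prob_space N by fact
  fix A :: "'i \<Rightarrow> real set" assume A: "\<And>i. i \<in> I \<Longrightarrow> A i \<in> sets borel"
  have S: "Pi\<^sub>E I A \<in> sets (PiM I (\<lambda>_. borel))" using I A by auto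
  define EM where "EM = {x \<in> space M. \<forall>i\<in>I. X i x \<in> A i}"
  define EN where "EN = {x \<in> space N. \<forall>i\<in>I. Y i x \<in> A i}"
  have [measurable]: "EM \<in> sets M" "EN \<in> sets N" unfolding EM_def EN_def using I A by measurable
  have pr: "(\<Prod>i\<in>I. indicator (A i) (z i)) = (if \<forall>i\<in>I. z i \<in> A i then 1 else (0::complex))" for z :: "'i \<Rightarrow> real"
    using I by (auto simp: indicator_def)
  have "complex_of_real (measure M EM) = (CLINT x|M. complex_of_real (indicator EM x))"
    by (subst integral_complex_of_real) simp
  also have "\<dots> = (CLINT x|M. (\<Prod>i\<in>I. indicator (A i) (X i x)))"
    unfolding pr by (rule Bochner_Integration.integral_cong) (auto simp: EM_def indicator_def)
  also have "\<dots> = (CLINT x|N. (\<Prod>i\<in>I. indicator (A i) (Y i x)))"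
    using joint_char_indicator[OF assms subset_refl A] by simp
  also have "\<dots> = (CLINT x|N. complex_of_real (indicator EN x))"
    unfolding pr by (rule Bochner_Integration.integral_cong) (auto simp: EN_def indicator_def)
  also have "\<dots> = complex_of_real (measure N EN)"
    by (subst integral_complex_of_real) simp
  finally have m: "measure M EM = measure N EN" by simp
  have "(\<lambda>x. \<lambda>i\<in>I. X i x) -` Pi\<^sub>E I A \<inter> space M = EM" "(\<lambda>x. \<lambda>i\<in>I. Y i x) -` Pi\<^sub>E I A \<inter> space N = EN"
    by (auto simp: EM_def EN_def PiE_iff)
  thus "emeasure (distr M (PiM I (\<lambda>_. borel)) (\<lambda>x. \<lambda>i\<in>I. X i x)) (Pi\<^sub>E I A) =
      emeasure (distr N (PiM I (\<lambda>_. borel)) (\<lambda>x. \<lambda>i\<in>I. Y i x)) (Pi\<^sub>E I A)"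
    using S m by (simp add: emeasure_distr M.emeasure_eq_measure N.emeasure_eq_measure)
next
  interpret M: prob_space M by fact
  have [measurable]: "(\<lambda>x. \<lambda>i\<in>I. X i x) \<in> measurable M (PiM I (\<lambda>_. borel))" by measurable
  interpret D: prob_space "distr M (PiM I (\<lambda>_. borel)) (\<lambda>x. \<lambda>i\<in>I. X i x)"
    by (rule M.prob_space_distr) simp
  show "range (\<lambda>_::nat. Pi\<^sub>E I (\<lambda>_. UNIV)) \<subseteq> prod_algebra I (\<lambda>_. borel)"
    using I by (auto intro!: prod_algebraI_finite)
  show "emeasure (distr M (PiM I (\<lambda>_. borel)) (\<lambda>x. \<lambda>i\<in>I. X i x)) (Pi\<^sub>E I (\<lambda>_. UNIV)) \<noteq> \<infinity>"
    by simp
qed (auto simp: space_PiM)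


theorem joint_char_indep:
  fixes X :: "'i \<Rightarrow> 'a \<Rightarrow> real" and Y :: "'j \<Rightarrow> 'a \<Rightarrow> real"
  assumes "prob_space M" and IJ: "finite I" "finite J"
    and X[measurable]: "\<And>i. i \<in> I \<Longrightarrow> X i \<in> borel_measurable M"
    and Y[measurable]: "\<And>j. j \<in> J \<Longrightarrow> Y j \<in> borel_measurable M"
    and ch: "\<And>u w. (CLINT x|M. iexp ((\<Sum>i\<in>I. u i * X i x) + (\<Sum>j\<in>J. w j * Y j x))) =
       (CLINT x|M. iexp (\<Sum>i\<in>I. u i * X i x)) * (CLINT x|M. iexp (\<Sum>j\<in>J. w j * Y j x))"
  shows "distr M (PiM I (\<lambda>_. borel) \<Otimes>\<^sub>M PiM J (\<lambda>_. borel)) (\<lambda>x. (\<lambda>i\<in>I. X i x, \<lambda>j\<in>J. Y j x)) =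
    distr M (PiM I (\<lambda>_. borel)) (\<lambda>x. \<lambda>i\<in>I. X i x) \<Otimes>\<^sub>M distr M (PiM J (\<lambda>_. borel)) (\<lambda>x. \<lambda>j\<in>J. Y j x)"
proof -
  interpret M: prob_space M by fact
  interpret MM: pair_prob_space M M ..
  define Z where "Z = case_sum X Y"
  define Z' where "Z' = case_sum (\<lambda>i x. X i (fst x)) (\<lambda>j x. Y j (snd x))"
  have Zm: "k \<in> I <+> J \<Longrightarrow> Z k \<in> borel_measurable M" for k by (auto simp: Z_def)
  have Zm': "k \<in> I <+> J \<Longrightarrow> Z' k \<in> borel_measurable (M \<Otimes>\<^sub>M M)" for k by (auto simp: Z'_def)
  have sm: "(\<Sum>k\<in>I <+> J. f k) = (\<Sum>i\<in>I. f (Inl i)) + (\<Sum>j\<in>J. f (Inr j))" for f :: "'i + 'j \<Rightarrow> real"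
    using IJ by (simp add: sum.Plus)
  have iM: "integrable M (\<lambda>x. iexp (g x))" if "g \<in> borel_measurable M" for g :: "'a \<Rightarrow> real"
    using that by (intro M.integrable_const_bound[of _ 1]) auto
  have law: "distr M (PiM (I <+> J) (\<lambda>_. borel)) (\<lambda>x. \<lambda>k\<in>I <+> J. Z k x) =
      distr (M \<Otimes>\<^sub>M M) (PiM (I <+> J) (\<lambda>_. borel)) (\<lambda>x. \<lambda>k\<in>I <+> J. Z' k x)"
  proof (rule joint_char_unique)
    fix u :: "'i + 'j \<Rightarrow> real"
    let ?f = "\<lambda>x. \<Sum>i\<in>I. u (Inl i) * X i x" and ?g = "\<lambda>x. \<Sum>j\<in>J. u (Inr j) * Y j x"
    have "(CLINT x|M \<Otimes>\<^sub>M M. iexp (\<Sum>k\<in>I <+> J. u k * Z' k x)) = (CLINT x|M \<Otimes>\<^sub>M M. iexp (?f (fst x)) * iexp (?g (snd x)))"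
      by (intro Bochner_Integration.integral_cong) (auto simp: Z'_def sm exp_add ring_distribs)
    also have "\<dots> = (CLINT x|M. CLINT y|M. iexp (?f x) * iexp (?g y))"
      by (subst MM.integral_fst'[symmetric]) (auto intro!: MM.integrable_const_bound[of _ 1] simp: norm_mult)
    also have "\<dots> = (CLINT x|M. iexp (?f x)) * (CLINT x|M. iexp (?g x))"
      by (simp add: iM)
    also have "\<dots> = (CLINT x|M. iexp (?f x + ?g x))" by (rule ch[symmetric])
    also have "\<dots> = (CLINT x|M. iexp (\<Sum>k\<in>I <+> J. u k * Z k x))"
      by (intro Bochner_Integration.integral_cong) (auto simp: Z_def sm)
    finally show "(CLINT x|M. iexp (\<Sum>k\<in>I <+> J. u k * Z k x)) = (CLINT x|M \<Otimes>\<^sub>M M. iexp (\<Sum>k\<in>I <+> J. u k * Z' k x))" ..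
  qed (use IJ Zm Zm' in \<open>auto intro: M.prob_space_axioms MM.prob_space_axioms\<close>)
  let ?PI = "PiM I (\<lambda>_. borel :: real measure)" and ?PJ = "PiM J (\<lambda>_. borel :: real measure)"
  define \<phi> where "\<phi> z = ((\<lambda>i\<in>I. z (Inl i)), (\<lambda>j\<in>J. z (Inr j)))" for z :: "'i + 'j \<Rightarrow> real"
  have \<phi>[measurable]: "\<phi> \<in> measurable (PiM (I <+> J) (\<lambda>_. borel)) (?PI \<Otimes>\<^sub>M ?PJ)"
    unfolding \<phi>_def by (intro measurable_Pair measurable_restrict measurable_component_singleton) auto
  have Zv: "(\<lambda>x. \<lambda>k\<in>I <+> J. Z k x) \<in> measurable M (PiM (I <+> J) (\<lambda>_. borel))"
    and Zv': "(\<lambda>x. \<lambda>k\<in>I <+> J. Z' k x) \<in> measurable (M \<Otimes>\<^sub>M M) (PiM (I <+> J) (\<lambda>_. borel))"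
    using Zm Zm' by (auto intro!: measurable_restrict)
  have [measurable]: "(\<lambda>x. \<lambda>i\<in>I. X i x) \<in> measurable M ?PI" "(\<lambda>x. \<lambda>j\<in>J. Y j x) \<in> measurable M ?PJ"
    by auto
  have "distr M (?PI \<Otimes>\<^sub>M ?PJ) (\<lambda>x. (\<lambda>i\<in>I. X i x, \<lambda>j\<in>J. Y j x)) =
      distr (distr M (PiM (I <+> J) (\<lambda>_. borel)) (\<lambda>x. \<lambda>k\<in>I <+> J. Z k x)) (?PI \<Otimes>\<^sub>M ?PJ) \<phi>"
    unfolding distr_distr[OF \<phi> Zv] by (auto intro!: distr_cong simp: \<phi>_def Z_def fun_eq_iff)
  also have "\<dots> = distr (M \<Otimes>\<^sub>M M) (?PI \<Otimes>\<^sub>M ?PJ) (\<lambda>(x, y). (\<lambda>i\<in>I. X i x, \<lambda>j\<in>J. Y j y))"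
    unfolding law distr_distr[OF \<phi> Zv'] by (auto intro!: distr_cong simp: \<phi>_def Z'_def fun_eq_iff)
  also have "\<dots> = distr M ?PI (\<lambda>x. \<lambda>i\<in>I. X i x) \<Otimes>\<^sub>M distr M ?PJ (\<lambda>x. \<lambda>j\<in>J. Y j x)"
    by (rule pair_measure_distr[symmetric])
       (auto intro!: prob_space_imp_sigma_finite M.prob_space_distr)
  finally show ?thesis .
qed

section \<open>Truncated moments\<close>

definition wsq :: "real \<Rightarrow> real \<Rightarrow> real" where
  "wsq p y = (if \<bar>y\<bar> \<le> 1 then y\<^sup>2 else \<bar>y\<bar> powr p)"

lemma wsq_nonneg [simp]: "0 \<le> wsq p y" by (simp add: wsq_def)

lemma wsq_measurable [measurable]: "wsq p \<in> borel_measurable borel"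
  unfolding wsq_def by measurable

lemma one_minus_cos_ge:
  fixes x :: real assumes "\<bar>x\<bar> \<le> 1" shows "x\<^sup>2 / 4 \<le> 1 - cos x"
proof -
  have s: "x\<^sup>2 \<le> 1" using assms by (simp add: abs_square_le_1)
  have "\<exists>t. cos x = (\<Sum>m<4. cos_coeff m * x ^ m) + (cos (t + 1 / 2 * real 4 * pi) / fact 4) * x ^ 4"
    using Maclaurin_cos_expansion[of x 4] by auto
  then obtain t where t: "cos x = (\<Sum>m<4. cos_coeff m * x ^ m) + (cos (t + 1 / 2 * real 4 * pi) / fact 4) * x ^ 4" ..
  have "(\<Sum>m<4. cos_coeff m * x ^ m) = 1 - x\<^sup>2 / 2"
  proof -
    have "{..<4::nat} = {0, 1, 2, 3}" by auto
    thus ?thesis by (simp add: cos_coeff_def)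
  qed
  moreover have "(cos (t + 1 / 2 * real 4 * pi) / fact 4) * x ^ 4 \<le> 1 / fact 4 * x ^ 4"
    by (intro mult_right_mono divide_right_mono) auto
  moreover have "x ^ 4 \<le> x\<^sup>2"
    using mult_right_mono[OF s, of "x\<^sup>2"] by (simp add: power2_eq_square power4_eq_xxxx mult_ac)
  moreover have "1 / fact 4 * x ^ 4 \<le> x ^ 4 / 4" by (simp add: fact_numeral)
  ultimately show ?thesis using t by linarith
qed

lemma wsq_le_cos_integral:
  assumes p: "0 < p"
  shows "ennreal (wsq p y / 32) \<le>
    (\<integral>\<^sup>+u. ennreal ((1 - cos (u * y)) * u powr (-1 - p)) * indicator {0<..1} u \<partial>lborel)"
proof -
  define m where "m = max 1 \<bar>y\<bar>"
  have m: "m \<ge> 1" "m > 0" "\<bar>y\<bar> \<le> m" by (auto simp: m_def)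
  define r where "r = \<bar>y\<bar> / m"
  have r: "0 \<le> r" "r \<le> 1" using m by (auto simp: r_def)
  have wm: "wsq p y = m powr p * r\<^sup>2"
    using p by (auto simp: wsq_def m_def r_def max_def power_divide)
  have pt: "ennreal (m powr p * m * r\<^sup>2 / 16) * indicator {1/(2*m)..1/m} u \<le>
      ennreal ((1 - cos (u * y)) * u powr (-1 - p)) * indicator {0<..1} u" for u
  proof (cases "u \<in> {1/(2*m)..1/m}")
    case True
    hence u: "1/(2*m) \<le> u" "u \<le> 1/m" by auto
    have u0: "0 < u" using u(1) m by (meson divide_pos_pos less_le_trans mult_pos_pos zero_less_numeral zero_less_one)
    have u1: "u \<le> 1" using order_trans[OF u(2), of 1] m by simp
    have uy: "\<bar>u * y\<bar> \<le> 1" "r / 2 \<le> \<bar>u * y\<bar>"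
    proof -
      have "\<bar>u * y\<bar> \<le> (1/m) * m" unfolding abs_mult using u u0 m by (intro mult_mono) auto
      thus "\<bar>u * y\<bar> \<le> 1" using m by simp
      have "r / 2 = 1/(2*m) * \<bar>y\<bar>" by (simp add: r_def)
      also have "\<dots> \<le> u * \<bar>y\<bar>" using u by (intro mult_right_mono) auto
      finally show "r / 2 \<le> \<bar>u * y\<bar>" using u0 by (simp add: abs_mult)
    qed
    have "r\<^sup>2 / 16 = (r/2)\<^sup>2 / 4" by (simp add: power_divide)
    also have "\<dots> \<le> \<bar>u * y\<bar>\<^sup>2 / 4" using uy r by (intro divide_right_mono power_mono) auto
    also have "\<dots> \<le> 1 - cos (u * y)" using one_minus_cos_ge[OF uy(1)] by simp
    finally have c: "r\<^sup>2 / 16 \<le> 1 - cos (u * y)" .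
    have "m powr p * m = m powr (1 + p)" using m by (simp add: powr_add)
    also have "\<dots> = (1/m) powr (-1 - p)" using m powr_minus_divide[of m "-1-p"] powr_divide[of 1 m "-1-p"] by (simp add: add.commute)
    also have "\<dots> \<le> u powr (-1 - p)" using u u0 p by (intro powr_mono2') auto
    finally have "m powr p * m \<le> u powr (-1 - p)" .
    with c have "(m powr p * m) * (r\<^sup>2 / 16) \<le> u powr (-1 - p) * (1 - cos (u * y))"
      by (intro mult_mono) auto
    thus ?thesis using True u0 u1 by (auto intro!: ennreal_leI simp: mult_ac)
  qed auto
  have w32: "wsq p y / 32 = (m powr p * m * r\<^sup>2 / 16) * (1/m - 1/(2*m))"
    using m by (simp add: wm field_simps)
  have "ennreal (wsq p y / 32) = (\<integral>\<^sup>+u. ennreal (m powr p * m * r\<^sup>2 / 16) * indicator {1/(2*m)..1/m} u \<partial>lborel)"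
  proof -
    have le: "1/(2*m) \<le> 1/m" using m by (simp add: frac_le)
    have "(\<integral>\<^sup>+u. ennreal (m powr p * m * r\<^sup>2 / 16) * indicator {1/(2*m)..1/m} u \<partial>lborel) =
        ennreal (m powr p * m * r\<^sup>2 / 16) * ennreal (1/m - 1/(2*m))"
      using le by (subst nn_integral_cmult_indicator) auto
    also have "\<dots> = ennreal (wsq p y / 32)"
      unfolding w32 using le m by (intro ennreal_mult[symmetric]) auto
    finally show ?thesis ..
  qed
  also have "\<dots> \<le> (\<integral>\<^sup>+u. ennreal ((1 - cos (u * y)) * u powr (-1 - p)) * indicator {0<..1} u \<partial>lborel)"
    by (intro nn_integral_mono pt)
  finally show ?thesis .
qed

text \<open>Integrating \<open>1 - Re (char M u)\<close> against \<open>u powr (-1 - p)\<close> over \<open>(0, 1]\<close> bounds the truncated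
  moment by a multiple of the scale \<open>b\<close>, with no reference to the tails of the law.\<close>

lemma stable_wsq_bound:
  fixes M :: "real measure"
  assumes "real_distribution M" and ch: "\<And>u. char M u = complex_of_real (exp (- (b * \<bar>u\<bar> powr \<alpha>)))"
    and b: "0 \<le> b" and p: "0 < p" "p < \<alpha>"
  shows "integrable M (wsq p)" "(LINT y|M. wsq p y) \<le> 32 / (\<alpha> - p) * b"
proof -
  interpret real_distribution M by fact
  interpret pair_sigma_finite M lborel ..
  have re: "(LINT y|M. 1 - cos (u * y)) = 1 - exp (- (b * \<bar>u\<bar> powr \<alpha>))" for u
  proof -
    have i: "integrable M (\<lambda>y. cos (u * y))" by (rule integrable_const_bound[of _ 1]) auto
    have "integrable M (\<lambda>y. iexp (u * y))" by (rule integrable_const_bound[of _ 1]) auto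
    from integral_Re[OF this] have "(LINT y|M. cos (u * y)) = exp (- (b * \<bar>u\<bar> powr \<alpha>))"
      using ch[of u] by (simp add: char_def Re_exp)
    thus ?thesis using i prob_space by simp
  qed
  have "(\<integral>\<^sup>+y. ennreal (wsq p y / 32) \<partial>M) \<le>
    (\<integral>\<^sup>+y. (\<integral>\<^sup>+u. ennreal ((1 - cos (u * y)) * u powr (-1 - p)) * indicator {0<..1} u \<partial>lborel) \<partial>M)"
    by (intro nn_integral_mono wsq_le_cos_integral p)
  also have "\<dots> = (\<integral>\<^sup>+u. (\<integral>\<^sup>+y. ennreal ((1 - cos (u * y)) * u powr (-1 - p)) * indicator {0<..1} u \<partial>M) \<partial>lborel)"
    by (rule Fubini'[symmetric]) measurable
  also have "\<dots> \<le> (\<integral>\<^sup>+u. ennreal (b * u powr (\<alpha> - p - 1)) * indicator {0..1} u \<partial>lborel)"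
  proof (rule nn_integral_mono)
    fix u :: real
    show "(\<integral>\<^sup>+y. ennreal ((1 - cos (u * y)) * u powr (-1 - p)) * indicator {0<..1} u \<partial>M) \<le>
       ennreal (b * u powr (\<alpha> - p - 1)) * indicator {0..1} u"
    proof (cases "u \<in> {0<..1}")
      case True
      have "integrable M (\<lambda>y. (1 - cos (u * y)) * u powr (-1 - p))"
      proof (intro integrable_mult_left integrable_const_bound[of _ 2] AE_I2)
        fix y show "norm (1 - cos (u * y)) \<le> 2"
          using cos_ge_minus_one[of "u * y"] cos_le_one[of "u * y"] unfolding real_norm_def by linarith
      qed auto
      hence "(\<integral>\<^sup>+y. ennreal ((1 - cos (u * y)) * u powr (-1 - p)) \<partial>M) =
        ennreal ((1 - exp (- (b * \<bar>u\<bar> powr \<alpha>))) * u powr (-1 - p))"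
        by (subst nn_integral_eq_integral) (auto simp: re)
      also have "\<dots> \<le> ennreal ((b * u powr \<alpha>) * u powr (-1 - p))"
        using True exp_ge_add_one_self[of "- (b * u powr \<alpha>)"]
        by (intro ennreal_leI mult_right_mono) (auto simp: abs_if)
      also have "(b * u powr \<alpha>) * u powr (-1 - p) = b * u powr (\<alpha> - p - 1)"
        by (simp flip: powr_add add: algebra_simps)
      finally show ?thesis using True by simp
    qed auto
  qed
  also have "\<dots> = ennreal (b * (1 / (\<alpha> - p)))"
  proof -
    have "((\<lambda>u. b * u powr (\<alpha> - p - 1)) has_integral b * (1 powr (\<alpha> - p - 1 + 1) / (\<alpha> - p - 1 + 1))) {0..1}"
      using p by (intro has_integral_mult_right has_integral_powr_from_0) auto
    thus ?thesis
      using p b nn_integral_has_integral_lebesgue[of "{0..1}" "\<lambda>u. b * u powr (\<alpha> - p - 1)"]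
      by (simp add: mult.commute[of "indicator _ _"] ennreal_mult'' ennreal_indicator)
  qed
  finally have le: "(\<integral>\<^sup>+y. ennreal (wsq p y / 32) \<partial>M) \<le> ennreal (b * (1 / (\<alpha> - p)))" .
  have int: "integrable M (\<lambda>y. wsq p y / 32)"
    using le by (intro integrableI_bounded) (auto simp: less_top[symmetric] top_unique)
  from integrable_mult_right[OF this, of 32] show "integrable M (wsq p)" by simp
  have "(LINT y|M. wsq p y / 32) \<le> b * (1 / (\<alpha> - p))"
    using le int b p by (subst (asm) nn_integral_eq_integral) (auto simp: ennreal_le_iff)
  thus "(LINT y|M. wsq p y) \<le> 32 / (\<alpha> - p) * b" by (simp add: field_simps)
qed

section \<open>The density of a symmetric stable law\<close>

lemma integrable_even:
  fixes g :: "real \<Rightarrow> real"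
  assumes [measurable]: "g \<in> borel_measurable borel" and even: "\<And>x. g (- x) = g x"
    and g: "integrable lborel (\<lambda>x. indicator {0<..} x * g x)"
  shows "integrable lborel g" "(LINT x|lborel. g x) = 2 * (LINT x|lborel. indicator {0<..} x * g x)"
proof -
  have mirror: "indicator {0<..} (0 + -1 * x) * g (0 + -1 * x) = indicator {..<0} x * g x" for x
    by (auto simp: even indicator_def)
  have g': "integrable lborel (\<lambda>x. indicator {..<0} x * g x)"
    using lborel_integrable_real_affine[OF g, of "-1" 0] unfolding mirror by simp
  have eq': "(LINT x|lborel. indicator {..<0} x * g x) = (LINT x|lborel. indicator {0<..} x * g x)"
    using lborel_integral_real_affine[of "-1" "\<lambda>x. indicator {0<..} x * g x" 0] unfolding mirror by simp
  have AE0: "AE x in lborel. g x = indicator {..<0} x * g x + indicator {0<..} x * g x"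
    using AE_lborel_singleton[of 0] by eventually_elim (auto simp: indicator_def)
  have "integrable lborel (\<lambda>x. indicator {..<0} x * g x + indicator {0<..} x * g x)"
    using g g' by simp
  thus "integrable lborel g" using AE0 by (subst integrable_cong_AE[OF _ _ AE0]) auto
  have "(LINT x|lborel. g x) = (LINT x|lborel. indicator {..<0} x * g x + indicator {0<..} x * g x)"
    using AE0 by (intro integral_cong_AE) auto
  thus "(LINT x|lborel. g x) = 2 * (LINT x|lborel. indicator {0<..} x * g x)"
    using g g' eq' by simp
qed

lemma integrable_inverse_1_plus_square: "integrable lborel (\<lambda>x::real. 1 / (1 + x\<^sup>2))"
proof (rule integrable_even)
  have "einterval 0 \<infinity> = {0<..}" by (auto simp: einterval_def)
  thus "integrable lborel (\<lambda>x::real. indicator {0<..} x * (1 / (1 + x\<^sup>2)))"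
    using integrable_I0i_1_div_plus_square
    by (simp add: interval_lebesgue_integrable_def set_integrable_def)
qed auto

lemma powr_exp_integrable_aux:
  fixes u q r \<alpha> :: real
  assumes "0 < r" "1 < \<alpha>" "0 \<le> q" "q \<le> 4" "0 < u"
  shows "u powr q * exp (- r * u powr \<alpha>) \<le> exp r * (1 + 6 / r) ^ 6 * (1 / (1 + u\<^sup>2))"
proof -
  have "u \<le> 1 + u powr \<alpha>"
  proof (cases "u \<le> 1")
    case False
    hence "u powr 1 \<le> u powr \<alpha>" using assms by (intro powr_mono) auto
    thus ?thesis using assms by simp
  qed (use powr_ge_zero[of u \<alpha>] in linarith)
  hence "r * u \<le> r + r * u powr \<alpha>"
    using mult_left_mono[of u "1 + u powr \<alpha>" r] assms by (simp add: algebra_simps)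
  hence e1: "exp (- r * u powr \<alpha>) \<le> exp r * exp (- r * u)" by (simp flip: exp_add)
  have q: "u powr q \<le> (1 + u) ^ 4"
  proof -
    have "u powr q \<le> (1 + u) powr q" using assms by (intro powr_mono2) auto
    also have "\<dots> \<le> (1 + u) powr 4" using assms by (intro powr_mono) auto
    also have "\<dots> = (1 + u) ^ 4" using assms by (subst powr_numeral) auto
    finally show ?thesis .
  qed
  have sq: "1 + u\<^sup>2 \<le> (1 + u)\<^sup>2" using assms by (simp add: power2_eq_square algebra_simps)
  have "(1 + u) ^ 6 \<le> ((1 + 6 / r) * (1 + r * u / 6)) ^ 6"
    using assms by (intro power_mono) (auto simp: field_simps)
  also have "\<dots> = (1 + 6 / r) ^ 6 * (1 + r * u / 6) ^ 6" by (rule power_mult_distrib)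
  also have "\<dots> \<le> (1 + 6 / r) ^ 6 * exp (r * u)"
  proof (rule mult_left_mono)
    have "0 < r * u" using assms by simp
    hence "- real 6 \<le> r * u" by linarith
    from exp_ge_one_plus_x_over_n_power_n[OF this] show "(1 + r * u / 6) ^ 6 \<le> exp (r * u)" by simp
  qed (use assms in auto)
  finally have c: "(1 + u) ^ 6 \<le> (1 + 6 / r) ^ 6 * exp (r * u)" .
  have "u powr q * exp (- r * u powr \<alpha>) * (1 + u\<^sup>2) = (u powr q * (1 + u\<^sup>2)) * exp (- r * u powr \<alpha>)" by simp
  also have "\<dots> \<le> ((1 + u) ^ 4 * (1 + u)\<^sup>2) * (exp r * exp (- r * u))"
    using assms by (intro mult_mono q sq e1) auto
  also have "\<dots> = (1 + u) ^ 6 * (exp r * exp (- r * u))" by (simp flip: power_add)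
  also have "\<dots> \<le> ((1 + 6 / r) ^ 6 * exp (r * u)) * (exp r * exp (- r * u))"
    by (intro mult_right_mono c) auto
  also have "\<dots> = exp r * (1 + 6 / r) ^ 6" by (simp add: exp_minus)
  finally show ?thesis by (simp add: field_simps add_pos_nonneg)
qed

lemma powr_exp_integrable:
  fixes q r \<alpha> :: real
  assumes "0 < r" "1 < \<alpha>" "0 \<le> q" "q \<le> 4"
  shows "integrable lborel (\<lambda>u. indicator {0<..} u * (u powr q * exp (- r * u powr \<alpha>)))"
proof (rule Bochner_Integration.integrable_bound)
  show "integrable lborel (\<lambda>u::real. exp r * (1 + 6 / r) ^ 6 * (1 / (1 + u\<^sup>2)))"
    by (intro integrable_mult_right integrable_inverse_1_plus_square)
  show "AE u in lborel. norm (indicator {0<..} u * (u powr q * exp (- r * u powr \<alpha>))) \<le> norm (exp r * (1 + 6 / r) ^ 6 * (1 / (1 + u\<^sup>2)))"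
  proof (rule AE_I2)
    fix u :: real
    have nn: "0 \<le> exp r * (1 + 6 / r) ^ 6 * (1 / (1 + u\<^sup>2))"
      using assms by (intro mult_nonneg_nonneg zero_le_power) auto
    show "norm (indicator {0<..} u * (u powr q * exp (- r * u powr \<alpha>))) \<le> norm (exp r * (1 + 6 / r) ^ 6 * (1 / (1 + u\<^sup>2)))"
      using powr_exp_integrable_aux[OF assms, of u] nn
      unfolding real_norm_def abs_of_nonneg[OF nn] by (cases "u > 0") auto
  qed
qed measurable

lemma integral_swap_interval:
  fixes g s :: "real \<Rightarrow> real"
  assumes g: "integrable lborel g" and [measurable]: "s \<in> borel_measurable borel" and s: "\<And>x. \<bar>s x\<bar> \<le> 1"
  shows "(LINT x|lborel. indicator {a..b} x * (LINT t|lborel. g t * s (t * x))) =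
      (LINT t|lborel. g t * (LINT x|lborel. indicator {a..b} x * s (t * x)))"
    "integrable lborel (\<lambda>x. indicator {a..b} x * (LINT t|lborel. g t * s (t * x)))"
proof -
  have [measurable]: "g \<in> borel_measurable borel" using g by (auto dest: borel_measurable_integrable)
  have gs: "integrable lborel (\<lambda>t. g t * s (t * x))" for x
    by (rule Bochner_Integration.integrable_bound[OF g]) (auto simp: abs_mult intro!: AE_I2 mult_left_le s)
  have ab: "integrable lborel (\<lambda>x. indicator {a..b} x * c)" for c :: real
    by (intro integrable_mult_left integrable_real_indicator) (auto simp: emeasure_lborel_Icc_eq)
  have i: "integrable (lborel \<Otimes>\<^sub>M lborel) (\<lambda>(x, t). indicator {a..b} x * (g t * s (t * x)))"
  proof (rule lborel_pair.Fubini_integrable)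
    show "integrable lborel (\<lambda>x. LINT t|lborel. norm (case (x, t) of (x, t) \<Rightarrow> indicator {a..b} x * (g t * s (t * x))))"
    proof (rule Bochner_Integration.integrable_bound[OF ab[of "LINT t|lborel. \<bar>g t\<bar>"]])
      show "AE x in lborel. norm (LINT t|lborel. norm (case (x, t) of (x, t) \<Rightarrow> indicator {a..b} x * (g t * s (t * x)))) \<le>
          norm (indicator {a..b} x * (LINT t|lborel. \<bar>g t\<bar>))"
      proof (rule AE_I2)
        fix x
        have "(LINT t|lborel. \<bar>g t * s (t * x)\<bar>) \<le> (LINT t|lborel. \<bar>g t\<bar>)"
        proof (rule integral_mono)
          show "\<bar>g t * s (t * x)\<bar> \<le> \<bar>g t\<bar>" for t
            using mult_left_le[OF s[of "t * x"], of "\<bar>g t\<bar>"] by (simp add: abs_mult)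
        qed (use integrable_abs[OF g] integrable_abs[OF gs] in auto)
        thus "norm (LINT t|lborel. norm (case (x, t) of (x, t) \<Rightarrow> indicator {a..b} x * (g t * s (t * x)))) \<le>
          norm (indicator {a..b} x * (LINT t|lborel. \<bar>g t\<bar>))"
          by (auto simp: abs_mult split: split_indicator)
      qed
    qed measurable
  qed (auto intro!: gs)
  show "(LINT x|lborel. indicator {a..b} x * (LINT t|lborel. g t * s (t * x))) =
      (LINT t|lborel. g t * (LINT x|lborel. indicator {a..b} x * s (t * x)))"
  proof -
    have e: "indicator {a..b} x * (g t * s (t * x)) = g t * (indicator {a..b} x * s (t * x))" for x t
      by simp
    have "(LINT x|lborel. indicator {a..b} x * (LINT t|lborel. g t * s (t * x))) =
        (LINT x|lborel. LINT t|lborel. indicator {a..b} x * (g t * s (t * x)))"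
      by (simp only: integral_mult_right_zero)
    also have "\<dots> = (LINT t|lborel. LINT x|lborel. indicator {a..b} x * (g t * s (t * x)))"
      by (rule lborel_pair.Fubini_integral[OF i, symmetric])
    finally show ?thesis by (simp only: e integral_mult_right_zero)
  qed
  show "integrable lborel (\<lambda>x. indicator {a..b} x * (LINT t|lborel. g t * s (t * x)))"
    using lborel_pair.integrable_fst'[OF i] by simp
qed

lemma lborel_integral_cos:
  fixes a b t :: real
  assumes "a \<le> b" "t \<noteq> 0"
  shows "(LINT x|lborel. indicator {a..b} x * cos (t * x)) = (sin (t * b) - sin (t * a)) / t"
proof -
  have "(LINT x|lborel. indicator {a..b} x *\<^sub>R cos (t * x)) = sin (t * b) / t - sin (t * a) / t"
    using assms by (intro integral_FTC_Icc) (auto intro!: derivative_eq_intros continuous_intros simp flip: has_real_derivative_iff_has_vector_derivative)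
  thus ?thesis by (simp add: diff_divide_distrib)
qed

lemma lborel_integral_sin:
  fixes a b t :: real
  assumes "a \<le> b"
  shows "t * (LINT x|lborel. indicator {a..b} x * sin (t * x)) = cos (t * a) - cos (t * b)"
proof (cases "t = 0")
  case False
  have "(LINT x|lborel. indicator {a..b} x *\<^sub>R sin (t * x)) = - cos (t * b) / t - - cos (t * a) / t"
    using assms False by (intro integral_FTC_Icc) (auto intro!: derivative_eq_intros continuous_intros simp flip: has_real_derivative_iff_has_vector_derivative)
  thus ?thesis using False by (simp add: field_simps)
qed simp

locale stable_law = real_distribution M for M :: "real measure" +
  fixes r \<alpha> :: real
  assumes r: "0 < r" and alpha: "1 < \<alpha>" "\<alpha> < 2"
    and char_eq: "\<And>u. char M u = complex_of_real (exp (- (r * \<bar>u\<bar> powr \<alpha>)))"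
begin

definition chf :: "real \<Rightarrow> real" where "chf t = exp (- (r * \<bar>t\<bar> powr \<alpha>))"

definition dens :: "real \<Rightarrow> real" where
  "dens x = (LINT t|lborel. chf t * cos (t * x)) / (2 * pi)"

definition dens' :: "real \<Rightarrow> real" where
  "dens' x = - (LINT t|lborel. t * chf t * sin (t * x)) / (2 * pi)"

lemma chf_measurable [measurable]: "chf \<in> borel_measurable borel" unfolding chf_def by measurable

lemma chf_pos: "0 < chf t" by (simp add: chf_def)

lemma chf_integrable: "integrable lborel chf"
proof (rule integrable_even)
  have "integrable lborel (\<lambda>u. indicator {0<..} u * (u powr 0 * exp (- r * u powr \<alpha>)))"
    by (rule powr_exp_integrable) (use r alpha in auto)
  also have "(\<lambda>u. indicator {0<..} u * (u powr 0 * exp (- r * u powr \<alpha>))) = (\<lambda>u. indicator {0<..} u * chf u)"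
    by (auto simp: chf_def indicator_def)
  finally show "integrable lborel (\<lambda>u. indicator {0<..} u * chf u)" .
qed (auto simp: chf_def)

lemma chf_integrable1: "integrable lborel (\<lambda>t. t * chf t)"
proof -
  have "integrable lborel (\<lambda>t. \<bar>t\<bar> * chf t)"
  proof (rule integrable_even)
    have "integrable lborel (\<lambda>u. indicator {0<..} u * (u powr 1 * exp (- r * u powr \<alpha>)))"
      by (rule powr_exp_integrable) (use r alpha in auto)
    also have "(\<lambda>u. indicator {0<..} u * (u powr 1 * exp (- r * u powr \<alpha>))) = (\<lambda>u. indicator {0<..} u * (\<bar>u\<bar> * chf u))"
      by (auto simp: chf_def indicator_def)
    finally show "integrable lborel (\<lambda>u. indicator {0<..} u * (\<bar>u\<bar> * chf u))" .
  qed (auto simp: chf_def)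
  thus ?thesis
    by (rule Bochner_Integration.integrable_bound) (auto simp: abs_mult)
qed

lemma dens_measurable [measurable]: "dens \<in> borel_measurable borel"
  unfolding dens_def by measurable

lemma dens_bound: "\<exists>c\<ge>0. \<forall>x. \<bar>dens x\<bar> \<le> c"
proof (intro exI[of _ "(LINT t|lborel. chf t) / (2 * pi)"] conjI allI)
  fix x
  have i: "integrable lborel (\<lambda>t. chf t * cos (t * x))"
    by (rule Bochner_Integration.integrable_bound[OF chf_integrable]) (auto simp: abs_mult intro!: mult_left_le)
  have "\<bar>LINT t|lborel. chf t * cos (t * x)\<bar> \<le> (LINT t|lborel. \<bar>chf t * cos (t * x)\<bar>)" by (rule integral_abs_bound)
  also have "\<dots> \<le> (LINT t|lborel. chf t)"
  proof (rule integral_mono)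
    show "\<bar>chf t * cos (t * x)\<bar> \<le> chf t" for t
      using chf_pos[of t] by (simp add: abs_mult mult_left_le)
  qed (use integrable_abs[OF i] chf_integrable in auto)
  finally show "\<bar>dens x\<bar> \<le> (LINT t|lborel. chf t) / (2 * pi)" by (simp add: dens_def divide_right_mono)
qed (auto intro!: divide_nonneg_pos integral_nonneg_AE chf_pos[THEN less_imp_le])

lemma dens_diff:
  assumes "a \<le> b"
  shows "dens b - dens a = (LINT x|lborel. indicator {a..b} x * dens' x)"
    and "integrable lborel (\<lambda>x. indicator {a..b} x * dens' x)"
proof -
  have ic: "integrable lborel (\<lambda>t. chf t * cos (t * x))" for x
    by (rule Bochner_Integration.integrable_bound[OF chf_integrable]) (auto simp: abs_mult intro!: mult_left_le)
  note sw = integral_swap_interval[OF chf_integrable1, of sin a b, simplified abs_sin_le_one]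
  have "dens b - dens a = (LINT t|lborel. chf t * cos (t * b) - chf t * cos (t * a)) / (2 * pi)"
    using ic by (simp add: dens_def diff_divide_distrib)
  also have "(LINT t|lborel. chf t * cos (t * b) - chf t * cos (t * a)) =
      (LINT t|lborel. - (t * chf t * (LINT x|lborel. indicator {a..b} x * sin (t * x))))"
  proof (rule Bochner_Integration.integral_cong)
    fix t
    have "chf t * cos (t * b) - chf t * cos (t * a) = - (chf t * (cos (t * a) - cos (t * b)))"
      by (simp add: algebra_simps)
    also have "\<dots> = - (chf t * (t * (LINT x|lborel. indicator {a..b} x * sin (t * x))))"
      unfolding lborel_integral_sin[OF assms] ..
    finally show "chf t * cos (t * b) - chf t * cos (t * a) = - (t * chf t * (LINT x|lborel. indicator {a..b} x * sin (t * x)))"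
      by simp
  qed simp
  also have "\<dots> = - (LINT x|lborel. indicator {a..b} x * (LINT t|lborel. t * chf t * sin (t * x)))"
    using sw(1) by simp
  also have "\<dots> / (2 * pi) = (LINT x|lborel. - (1 / (2 * pi)) * (indicator {a..b} x * (LINT t|lborel. t * chf t * sin (t * x))))"
    by (subst integral_mult_right_zero) simp
  also have "\<dots> = (LINT x|lborel. indicator {a..b} x * dens' x)"
    by (simp add: dens'_def)
  finally show "dens b - dens a = (LINT x|lborel. indicator {a..b} x * dens' x)" .
  show "integrable lborel (\<lambda>x. indicator {a..b} x * dens' x)"
    using integrable_mult_right[OF sw(2), of "- 1 / (2 * pi)"] by (simp add: dens'_def algebra_simps)
qed

text \<open>Two integrations by parts: \<open>- h cos (u x) / x + h' sin (u x) / x\<^sup>2\<close>, with \<open>h u = u * chf u\<close>, is an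
  antiderivative of \<open>h sin (u x) + h'' sin (u x) / x\<^sup>2\<close> which vanishes at both ends. Near \<open>0\<close> the second
  derivative \<open>h''\<close> behaves like \<open>u powr (\<alpha> - 1)\<close>, so it is integrable because \<open>\<alpha> > 1\<close>.\<close>

lemma dens'_bound: "\<exists>C\<ge>0. \<forall>x. \<bar>dens' x\<bar> \<le> C / (1 + x\<^sup>2)"
proof -
  define h2 where "h2 u = (r\<^sup>2 * \<alpha>\<^sup>2 * u powr (2 * \<alpha> - 1) - (r * \<alpha>\<^sup>2 + r * \<alpha>) * u powr (\<alpha> - 1)) * exp (- r * u powr \<alpha>)" for u
  define h1 where "h1 u = (1 - r * \<alpha> * u powr \<alpha>) * exp (- r * u powr \<alpha>)" for u
  have [measurable]: "h2 \<in> borel_measurable borel" unfolding h2_def by measurable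
  have ih2: "integrable lborel (\<lambda>u. indicator {0<..} u * h2 u)"
  proof -
    have "integrable lborel (\<lambda>u. r\<^sup>2 * \<alpha>\<^sup>2 * (indicator {0<..} u * (u powr (2 * \<alpha> - 1) * exp (- r * u powr \<alpha>))) -
        (r * \<alpha>\<^sup>2 + r * \<alpha>) * (indicator {0<..} u * (u powr (\<alpha> - 1) * exp (- r * u powr \<alpha>))))"
      using r alpha by (intro Bochner_Integration.integrable_diff integrable_mult_right powr_exp_integrable) auto
    also have "(\<lambda>u. r\<^sup>2 * \<alpha>\<^sup>2 * (indicator {0<..} u * (u powr (2 * \<alpha> - 1) * exp (- r * u powr \<alpha>))) -
        (r * \<alpha>\<^sup>2 + r * \<alpha>) * (indicator {0<..} u * (u powr (\<alpha> - 1) * exp (- r * u powr \<alpha>)))) = (\<lambda>u. indicator {0<..} u * h2 u)"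
      by (auto simp: h2_def algebra_simps)
    finally show ?thesis .
  qed
  define c0 where "c0 = (LINT t|lborel. \<bar>t * chf t\<bar>)"
  define c2 where "c2 = (LINT u|lborel. \<bar>indicator {0<..} u * h2 u\<bar>)"
  have isin: "integrable lborel (\<lambda>t. t * chf t * sin (t * x))" for x
    by (rule Bochner_Integration.integrable_bound[OF chf_integrable1]) (auto simp: abs_mult intro!: mult_left_le)
  have b0: "\<bar>LINT t|lborel. t * chf t * sin (t * x)\<bar> \<le> c0" for x
  proof -
    have "\<bar>LINT t|lborel. t * chf t * sin (t * x)\<bar> \<le> (LINT t|lborel. \<bar>t * chf t * sin (t * x)\<bar>)" by (rule integral_abs_bound)
    also have "\<dots> \<le> c0" unfolding c0_def
    proof (rule integral_mono)
      show "\<bar>t * chf t * sin (t * x)\<bar> \<le> \<bar>t * chf t\<bar>" for t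
        using mult_left_le[OF abs_sin_le_one[of "t * x"], of "\<bar>t * chf t\<bar>"] by (simp add: abs_mult)
    qed (use integrable_abs[OF isin] integrable_abs[OF chf_integrable1] in auto)
    finally show ?thesis .
  qed
  have b2: "x\<^sup>2 * \<bar>LINT t|lborel. t * chf t * sin (t * x)\<bar> \<le> 2 * c2" for x
  proof (cases "x = 0")
    case True
    thus ?thesis by (simp add: c2_def)
  next
    case x: False
    have half: "integrable lborel (\<lambda>t. indicator {0<..} t * (t * chf t * sin (t * x)))"
      using integrable_mult_indicator[OF _ isin[of x], of "{0<..}"] by simp
    have ev: "(LINT t|lborel. t * chf t * sin (t * x)) = 2 * (LINT t|lborel. indicator {0<..} t * (t * chf t * sin (t * x)))"
      by (rule integrable_even(2)[OF _ _ half]) (auto simp: chf_def)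
    have ih: "integrable lborel (\<lambda>u. indicator {0<..} u * h2 u * sin (u * x))"
      by (rule Bochner_Integration.integrable_bound[OF ih2]) (auto simp: abs_mult intro!: mult_left_le)
    define A where "A u = - (u * exp (- r * u powr \<alpha>)) * cos (u * x) / x + h1 u * sin (u * x) / x\<^sup>2" for u
    define A' where "A' u = u * exp (- r * u powr \<alpha>) * sin (u * x) + h2 u * sin (u * x) / x\<^sup>2" for u
    have dA: "(A has_real_derivative A' u) (at u)" if "u > 0" for u
    proof -
      have d1: "((\<lambda>u. u powr \<alpha>) has_real_derivative \<alpha> * u powr (\<alpha> - 1)) (at u)"
        using that by (rule has_real_derivative_powr)
      define e where "e v = exp (- r * v powr \<alpha>)" for v
      have de: "(e has_real_derivative (- r * (\<alpha> * u powr (\<alpha> - 1))) * e u) (at u)"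
        unfolding e_def by (rule derivative_eq_intros d1 refl | simp)+
      define c where "c = 1 / x"
      have c: "c * x = 1" using x by (simp add: c_def)
      have A: "A = (\<lambda>u. c * (- (u * e u) * cos (u * x)) + c\<^sup>2 * ((1 - r * \<alpha> * u powr \<alpha>) * e u * sin (u * x)))"
        by (auto simp: A_def h1_def e_def c_def power_divide)
      define p where "p = u powr (\<alpha> - 1)"
      define E where "E = e u"
      define S where "S = sin (u * x)"
      define C where "C = cos (u * x)"
      have pw: "u powr \<alpha> = u * p" "u powr (2 * \<alpha> - 1) = u * p * p"
      proof -
        have "u powr 1 * u powr (\<alpha> - 1) = u powr \<alpha>" "u powr 1 * u powr (\<alpha> - 1) * u powr (\<alpha> - 1) = u powr (2 * \<alpha> - 1)"
          unfolding powr_add[symmetric] by (simp_all add: algebra_simps)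
        thus "u powr \<alpha> = u * p" "u powr (2 * \<alpha> - 1) = u * p * p" using that by (simp_all add: p_def)
      qed
      have "(A has_real_derivative
          (c * ((- (E + u * ((- r * (\<alpha> * p)) * E))) * C + (u * E) * (S * x)) +
          c\<^sup>2 * (((- r * \<alpha> * (\<alpha> * p)) * E + (1 - r * \<alpha> * (u * p)) * ((- r * (\<alpha> * p)) * E)) * S +
          (1 - r * \<alpha> * (u * p)) * E * (C * x)))) (at u)"
        unfolding A
        by (rule derivative_eq_intros d1 de refl)+
           (simp add: E_def S_def C_def pw flip: p_def, simp add: algebra_simps)
      also have "c * ((- (E + u * ((- r * (\<alpha> * p)) * E))) * C + (u * E) * (S * x)) +
          c\<^sup>2 * (((- r * \<alpha> * (\<alpha> * p)) * E + (1 - r * \<alpha> * (u * p)) * ((- r * (\<alpha> * p)) * E)) * S +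
          (1 - r * \<alpha> * (u * p)) * E * (C * x)) =
          u * E * S * (c * x) + c\<^sup>2 * ((r\<^sup>2 * \<alpha>\<^sup>2 * (u * p * p) - (r * \<alpha>\<^sup>2 + r * \<alpha>) * p) * E) * S +
          c * (1 - r * \<alpha> * (u * p)) * E * C * (c * x - 1)"
        by (simp add: algebra_simps power2_eq_square)
      also have "\<dots> = A' u"
        unfolding c by (simp add: A'_def h2_def pw E_def e_def S_def c_def power_divide flip: p_def)
      finally show ?thesis .
    qed
    have "(LBINT u=0..\<infinity>. A' u) = 0 - 0"
    proof (rule interval_integral_FTC_integrable[where F = A])
      show "(0::ereal) < \<infinity>" by simp
      show "(A has_vector_derivative A' u) (at u)" if "0 < ereal u" for u
        using dA[of u] that by (simp add: has_real_derivative_iff_has_vector_derivative)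
      show "isCont A' u" if "0 < ereal u" for u
      proof -
        have "u > 0" using that by simp
        thus ?thesis unfolding A'_def h2_def using x by (intro continuous_intros) auto
      qed
      have E: "einterval 0 \<infinity> = {0<..}" by (auto simp: einterval_def)
      have "integrable lborel (\<lambda>u. indicator {0<..} u * (u * chf u * sin (u * x)) + (indicator {0<..} u * h2 u * sin (u * x)) / x\<^sup>2)"
        using half ih by (intro Bochner_Integration.integrable_add integrable_divide_zero) auto
      also have "(\<lambda>u. indicator {0<..} u * (u * chf u * sin (u * x)) + (indicator {0<..} u * h2 u * sin (u * x)) / x\<^sup>2) = (\<lambda>u. indicator {0<..} u *\<^sub>R A' u)"
        by (auto simp: A'_def chf_def indicator_def)
      finally show "set_integrable lborel (einterval 0 \<infinity>) A'" unfolding E set_integrable_def .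
      have lim0: "(A \<longlongrightarrow> 0) (at_right 0)"
      proof -
        have U: "((\<lambda>u. u powr \<alpha>) \<longlongrightarrow> 0) (at_right 0)"
        proof (rule tendsto_sandwich[OF _ _ tendsto_const])
          show "\<forall>\<^sub>F u in at_right 0. u powr \<alpha> \<le> (u::real)"
            using eventually_at_right_real[OF zero_less_one]
            by eventually_elim (use powr_mono'[of 1 \<alpha>] alpha in auto)
          show "((\<lambda>u::real. u) \<longlongrightarrow> 0) (at_right 0)" by (intro tendsto_intros)
        qed auto
        have "(A \<longlongrightarrow> - (0 * exp (- r * 0)) * cos (0 * x) / x + (1 - r * \<alpha> * 0) * exp (- r * 0) * sin (0 * x) / x\<^sup>2) (at_right 0)"
          unfolding A_def h1_def using x by (intro tendsto_intros U) auto
        thus ?thesis by simp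
      qed
      thus "((A \<circ> real_of_ereal) \<longlongrightarrow> 0) (at_right 0)"
        by (simp add: ereal_tendsto_simps zero_ereal_def)
      have "(A \<longlongrightarrow> 0) at_top"
      proof -
        have T: "((\<lambda>u. u powr q * exp (- r * u powr \<alpha>)) \<longlongrightarrow> 0) at_top" if q: "0 \<le> q" "q \<le> 4" for q
        proof (rule Lim_null_comparison)
          let ?D = "exp r * (1 + 6 / r) ^ 6"
          show "\<forall>\<^sub>F u in at_top. norm (u powr q * exp (- r * u powr \<alpha>)) \<le> ?D * inverse u"
            using eventually_gt_at_top[of "0::real"]
          proof eventually_elim
            case (elim u)
            have "u * 2 \<le> 1 + u\<^sup>2" using sum_squares_bound[of u 1] by simp
            hence "1 / (1 + u\<^sup>2) \<le> 1 / u" using elim by (intro divide_left_mono) (auto intro: mult_pos_pos add_pos_nonneg)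
            hence "?D * (1 / (1 + u\<^sup>2)) \<le> ?D * inverse u"
              using r by (intro mult_left_mono) (auto simp: inverse_eq_divide)
            thus ?case using powr_exp_integrable_aux[OF r alpha(1) q elim] by simp
          qed
          show "((\<lambda>u::real. ?D * inverse u) \<longlongrightarrow> 0) at_top"
            by (intro tendsto_mult_right_zero tendsto_inverse_0_at_top filterlim_ident)
        qed
        have sc: "((\<lambda>u. p u * s u) \<longlongrightarrow> 0) at_top" if "(p \<longlongrightarrow> 0) at_top" "\<And>u. \<bar>s u\<bar> \<le> 1" for p s :: "real \<Rightarrow> real"
          by (rule tendsto_rabs_zero_cancel, rule Lim_null_comparison[OF _ tendsto_rabs_zero[OF that(1)]])
             (auto simp: abs_mult intro!: always_eventually mult_left_le that(2))
        have A: "A u = (- 1 / x) * ((u powr 1 * exp (- r * u powr \<alpha>)) * cos (u * x)) +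
            (1 / x\<^sup>2) * ((u powr 0 * exp (- r * u powr \<alpha>)) * sin (u * x)) -
            (r * \<alpha> / x\<^sup>2) * ((u powr \<alpha> * exp (- r * u powr \<alpha>)) * sin (u * x))" if "u > 0" for u
          using that x by (simp add: A_def h1_def field_simps)
        have "((\<lambda>u. (- 1 / x) * ((u powr 1 * exp (- r * u powr \<alpha>)) * cos (u * x)) +
            (1 / x\<^sup>2) * ((u powr 0 * exp (- r * u powr \<alpha>)) * sin (u * x)) -
            (r * \<alpha> / x\<^sup>2) * ((u powr \<alpha> * exp (- r * u powr \<alpha>)) * sin (u * x))) \<longlongrightarrow> (- 1 / x) * 0 + (1 / x\<^sup>2) * 0 - (r * \<alpha> / x\<^sup>2) * 0) at_top"
          using alpha by (intro tendsto_diff tendsto_add tendsto_mult_left sc T) auto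
        thus ?thesis
          by (rule Lim_transform_eventually[OF tendsto_eq_rhs])
             (auto intro!: eventually_mono[OF eventually_gt_at_top[of 0]] simp: A)
      qed
      thus "((A \<circ> real_of_ereal) \<longlongrightarrow> 0) (at_left \<infinity>)"
        by (simp add: ereal_tendsto_simps)
    qed
    hence "(LINT u|lborel. indicator {0<..} u *\<^sub>R A' u) = 0"
      by (simp add: interval_lebesgue_integral_def set_lebesgue_integral_def einterval_def zero_ereal_def greaterThan_def)
    moreover have "(LINT u|lborel. indicator {0<..} u *\<^sub>R A' u) =
        (LINT u|lborel. indicator {0<..} u * (u * chf u * sin (u * x)) + (indicator {0<..} u * h2 u * sin (u * x)) / x\<^sup>2)"
      by (rule Bochner_Integration.integral_cong) (auto simp: A'_def chf_def indicator_def)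
    ultimately have eq0: "(LINT u|lborel. indicator {0<..} u * (u * chf u * sin (u * x))) +
        (LINT u|lborel. indicator {0<..} u * h2 u * sin (u * x)) / x\<^sup>2 = 0"
      using half ih by simp
    have "\<bar>LINT u|lborel. indicator {0<..} u * h2 u * sin (u * x)\<bar> \<le> (LINT u|lborel. \<bar>indicator {0<..} u * h2 u * sin (u * x)\<bar>)"
      by (rule integral_abs_bound)
    also have "\<dots> \<le> c2" unfolding c2_def
    proof (rule integral_mono)
      show "\<bar>indicator {0<..} u * h2 u * sin (u * x)\<bar> \<le> \<bar>indicator {0<..} u * h2 u\<bar>" for u
        using mult_left_le[OF abs_sin_le_one[of "u * x"], of "\<bar>indicator {0<..} u * h2 u\<bar>"] by (simp add: abs_mult)
    qed (use integrable_abs[OF ih] integrable_abs[OF ih2] in auto)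
    finally have c2: "\<bar>LINT u|lborel. indicator {0<..} u * h2 u * sin (u * x)\<bar> \<le> c2" .
    have "x\<^sup>2 * (LINT u|lborel. indicator {0<..} u * (u * chf u * sin (u * x))) = - (LINT u|lborel. indicator {0<..} u * h2 u * sin (u * x))"
      using eq0 x by (simp add: field_simps)
    from arg_cong[OF this, of abs] have "x\<^sup>2 * \<bar>LINT u|lborel. indicator {0<..} u * (u * chf u * sin (u * x))\<bar> = \<bar>LINT u|lborel. indicator {0<..} u * h2 u * sin (u * x)\<bar>"
      by (simp only: abs_mult abs_minus_cancel abs_power2)
    thus ?thesis unfolding ev using c2 by (simp add: abs_mult)
  qed
  show ?thesis
  proof (intro exI[of _ "(c0 + 2 * c2) / (2 * pi)"] conjI allI)
    show "0 \<le> (c0 + 2 * c2) / (2 * pi)" by (auto simp: c0_def c2_def)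
    fix x
    have "(1 + x\<^sup>2) * \<bar>LINT t|lborel. t * chf t * sin (t * x)\<bar> \<le> c0 + 2 * c2"
      using b0[of x] b2[of x] by (simp add: algebra_simps)
    hence "(1 + x\<^sup>2) * \<bar>dens' x\<bar> \<le> (c0 + 2 * c2) / (2 * pi)"
      by (simp add: dens'_def divide_right_mono)
    moreover have "0 < 1 + x\<^sup>2" by (simp add: add_pos_nonneg)
    ultimately show "\<bar>dens' x\<bar> \<le> (c0 + 2 * c2) / (2 * pi) / (1 + x\<^sup>2)"
      by (simp only: pos_le_divide_eq mult.commute)
  qed
qed


lemma dens_lipschitz: "\<exists>c\<ge>0. \<forall>x y. \<bar>dens x - dens y\<bar> \<le> c * \<bar>x - y\<bar>"
proof -
  obtain C where C: "C \<ge> 0" "\<And>x. \<bar>dens' x\<bar> \<le> C / (1 + x\<^sup>2)" using dens'_bound by blast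
  have C': "\<bar>dens' x\<bar> \<le> C" for x
  proof -
    have "C / (1 + x\<^sup>2) \<le> C / 1" using C by (intro divide_left_mono) (auto intro: mult_pos_pos add_pos_nonneg)
    thus ?thesis using C(2)[of x] by simp
  qed
  have *: "\<bar>dens b - dens a\<bar> \<le> C * (b - a)" if "a \<le> b" for a b
  proof -
    have i: "integrable lborel (\<lambda>x. indicator {a..b} x * C)"
      by (intro integrable_mult_left integrable_real_indicator) (auto simp: emeasure_lborel_Icc_eq)
    have "\<bar>dens b - dens a\<bar> \<le> (LINT x|lborel. \<bar>indicator {a..b} x * dens' x\<bar>)"
      unfolding dens_diff[OF that] by (rule integral_abs_bound)
    also have "\<dots> \<le> (LINT x|lborel. indicator {a..b} x * C)"
    proof (rule integral_mono)
      show "\<bar>indicator {a..b} x * dens' x\<bar> \<le> indicator {a..b} x * C" for x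
        using C'[of x] by (auto split: split_indicator)
    qed (use i integrable_abs[OF dens_diff(2)[OF that]] in auto)
    also have "\<dots> = C * (b - a)" using that by simp
    finally show ?thesis .
  qed
  show ?thesis
  proof (intro exI[of _ C] conjI allI C)
    fix x y show "\<bar>dens x - dens y\<bar> \<le> C * \<bar>x - y\<bar>"
      using *[of x y] *[of y x] by (cases "x \<le> y") (auto simp: abs_minus_commute)
  qed
qed

lemma measure_interval_nonatom:
  assumes "a \<le> b" "measure M {a} = 0" "measure M {b} = 0"
  shows "measure M {a<..b} = (LINT x|lborel. indicator {a..b} x * dens x)"
proof -
  define F where "F t = (iexp (-(t * a)) - iexp (-(t * b))) / (\<i> * t) * char M t" for t :: real
  have [measurable]: "F \<in> borel_measurable borel" unfolding F_def by measurable
  have ch: "char M t = complex_of_real (chf t)" for t unfolding char_eq chf_def ..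
  have Fb: "norm (F t) \<le> (b - a) * chf t" for t
  proof (cases "t = 0")
    case True
    thus ?thesis using assms chf_pos[of 0] by (simp add: F_def)
  next
    case False
    have "norm (F t) = norm ((iexp (- t * b) - iexp (- t * a)) / (\<i> * t)) * chf t"
      using chf_pos[of t] by (simp add: F_def ch norm_mult norm_divide norm_minus_commute)
    also have "norm ((iexp (- t * b) - iexp (- t * a)) / (\<i> * t)) = norm ((iexp (- t * b) - iexp (- t * a)) / (\<i> * complex_of_real (- t)))"
      by (simp add: norm_divide norm_mult)
    also have "\<dots> \<le> b - a" using False by (intro Levy_Inversion_aux2 assms) auto
    finally show ?thesis using chf_pos[of t] by (simp add: mult_right_mono)
  qed
  have iF: "integrable lborel F"
    by (rule Bochner_Integration.integrable_bound[OF integrable_mult_right[OF chf_integrable, of "b - a"]])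
       (use Fb assms chf_pos in \<open>auto simp: abs_mult less_imp_le\<close>)
  have lim: "(\<lambda>n. 1 / (2 * pi) * (CLBINT t=-real n..real n. F t)) \<longlonglongrightarrow> 1 / (2 * pi) * (CLINT t|lborel. F t)"
  proof (intro tendsto_mult_left)
    have "(\<lambda>n. CLINT t|lborel. indicator {-real n<..<real n} t *\<^sub>R F t) \<longlonglongrightarrow> (CLINT t|lborel. F t)"
    proof (rule integral_dominated_convergence[where w="\<lambda>t. norm (F t)"])
      show "AE t in lborel. (\<lambda>n. indicator {-real n<..<real n} t *\<^sub>R F t) \<longlonglongrightarrow> F t"
      proof (rule AE_I2)
        fix t
        have "\<forall>\<^sub>F n in sequentially. \<bar>t\<bar> < real n"
          using filterlim_real_sequentially by (auto simp: filterlim_at_top_dense)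
        hence "\<forall>\<^sub>F n in sequentially. F t = indicator {-real n<..<real n} t *\<^sub>R F t"
          by eventually_elim (auto simp: indicator_def abs_less_iff)
        thus "(\<lambda>n. indicator {-real n<..<real n} t *\<^sub>R F t) \<longlonglongrightarrow> F t"
          by (rule Lim_transform_eventually[OF tendsto_const])
      qed
      show "AE t in lborel. norm (indicator {-real n<..<real n} t *\<^sub>R F t) \<le> norm (F t)" for n
        by (auto split: split_indicator)
    qed (use iF in auto)
    moreover have "(CLBINT t=-real n..real n. F t) = (CLINT t|lborel. indicator {-real n<..<real n} t *\<^sub>R F t)" for n
      by (simp add: interval_lebesgue_integral_def set_lebesgue_integral_def einterval_def greaterThanLessThan_def greaterThan_def lessThan_def Int_def)
    ultimately show "(\<lambda>n. CLBINT t=-real n..real n. F t) \<longlonglongrightarrow> (CLINT t|lborel. F t)" by simp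
  qed
  have "(\<lambda>T. 1 / (2 * pi) * (CLBINT t=-real T..real T. (iexp (-(t * a)) - iexp (-(t * b))) / (\<i> * t) * char M t)) \<longlonglongrightarrow> complex_of_real (measure M {a<..b})"
    using Levy_Inversion[OF assms] by simp
  hence "complex_of_real (measure M {a<..b}) = 1 / (2 * pi) * (CLINT t|lborel. F t)"
    using LIMSEQ_unique lim unfolding F_def by blast
  hence "measure M {a<..b} = Re (1 / (2 * pi) * (CLINT t|lborel. F t))" by (metis Re_complex_of_real)
  also have "\<dots> = (LINT t|lborel. Re (F t)) / (2 * pi)"
    using integral_Re[OF iF] by (simp add: Re_divide_of_real)
  also have "(LINT t|lborel. Re (F t)) = (LINT t|lborel. chf t * (LINT x|lborel. indicator {a..b} x * cos (t * x)))"
  proof (rule integral_cong_AE)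
    show "AE t in lborel. Re (F t) = chf t * (LINT x|lborel. indicator {a..b} x * cos (t * x))"
      using AE_lborel_singleton[of 0]
    proof eventually_elim
      case (elim t)
      have "Re (F t) = (sin (t * b) - sin (t * a)) / t * chf t"
        unfolding F_def ch using elim by (simp add: Re_divide Im_exp Re_exp power2_eq_square field_simps)
      thus ?case unfolding lborel_integral_cos[OF assms(1) elim] by simp
    qed
  qed measurable
  also have "\<dots> / (2 * pi) = (LINT x|lborel. indicator {a..b} x * (LINT t|lborel. chf t * cos (t * x))) / (2 * pi)"
    using integral_swap_interval(1)[OF chf_integrable, of cos a b] by simp
  also have "\<dots> = (LINT x|lborel. (1 / (2 * pi)) * (indicator {a..b} x * (LINT t|lborel. chf t * cos (t * x))))"
    by (subst integral_mult_right_zero) simp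
  also have "\<dots> = (LINT x|lborel. indicator {a..b} x * dens x)" by (simp add: dens_def)
  finally show ?thesis .
qed

lemma dens_interval_integrable: "integrable lborel (\<lambda>x. indicator {a..b} x * dens x)"
proof -
  obtain c where c: "c \<ge> 0" "\<And>x. \<bar>dens x\<bar> \<le> c" using dens_bound by blast
  have "integrable lborel (\<lambda>x. indicator {a..b} x * c)"
    by (intro integrable_mult_left integrable_real_indicator) (auto simp: emeasure_lborel_Icc_eq)
  thus ?thesis
    by (rule Bochner_Integration.integrable_bound) (use c in \<open>auto simp: abs_mult split: split_indicator\<close>)
qed

lemma nonatom_between:
  assumes "a < b" shows "\<exists>x\<in>{a<..<b}. measure M {x} = 0"
proof (rule ccontr)
  assume "\<not> ?thesis"
  hence "{a<..<b} \<subseteq> {x. measure M {x} \<noteq> 0}" by auto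
  hence "countable {a<..<b}" using countable_support countable_subset by blast
  thus False using uncountable_open_interval[of a b] assms by simp
qed

lemma no_atoms: "measure M {x} = 0"
proof (rule ccontr)
  assume "measure M {x} \<noteq> 0"
  hence pos: "measure M {x} > 0" by (simp add: zero_less_measure_iff)
  obtain c where c: "c \<ge> 0" "\<And>x. \<bar>dens x\<bar> \<le> c" using dens_bound by blast
  define e where "e = measure M {x} / (4 * (c + 1))"
  have e: "e > 0" using pos c by (auto simp: e_def)
  obtain a where a: "a \<in> {x - e<..<x}" "measure M {a} = 0" using nonatom_between[of "x - e" x] e by auto
  obtain b where b: "b \<in> {x<..<x + e}" "measure M {b} = 0" using nonatom_between[of x "x + e"] e by auto
  have i: "integrable lborel (\<lambda>x. indicator {a..b} x * c)"
    by (intro integrable_mult_left integrable_real_indicator) (auto simp: emeasure_lborel_Icc_eq)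
  have "measure M {x} \<le> measure M {a<..b}" using a b by (intro finite_measure_mono) auto
  also have "\<dots> = (LINT x|lborel. indicator {a..b} x * dens x)"
    using a b by (intro measure_interval_nonatom) auto
  also have "\<dots> \<le> (LINT x|lborel. indicator {a..b} x * c)"
  proof (rule integral_mono)
    show "indicator {a..b} x * dens x \<le> indicator {a..b} x * c" for x
      using c(2)[of x] by (auto split: split_indicator)
  qed (use i dens_interval_integrable in auto)
  also have "\<dots> = c * (b - a)" using a b by simp
  also have "\<dots> \<le> c * (2 * e)" using a b c by (intro mult_left_mono) auto
  also have "\<dots> \<le> (c + 1) * (2 * e)" using e by (intro mult_right_mono) auto
  also have "\<dots> = measure M {x} / 2" using c by (simp add: e_def field_simps)
  finally show False using pos by simp
qed

lemma measure_interval: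
  assumes "a \<le> b" shows "measure M {a<..b} = (LINT x|lborel. indicator {a..b} x * dens x)"
  using assms no_atoms by (intro measure_interval_nonatom) auto

lemma dens_nonneg: "0 \<le> dens x"
proof (rule ccontr)
  assume neg: "\<not> 0 \<le> dens x"
  obtain c where c: "c \<ge> 0" "\<And>x y. \<bar>dens x - dens y\<bar> \<le> c * \<bar>x - y\<bar>" using dens_lipschitz by blast
  define e where "e = - dens x / (2 * (c + 1))"
  have e: "e > 0" using neg c unfolding e_def by (intro divide_pos_pos) auto
  have ce: "c * e \<le> - dens x / 2"
  proof -
    have "c * e \<le> (c + 1) * e" using e by (intro mult_right_mono) auto
    also have "\<dots> = - dens x / 2" using c by (simp add: e_def field_simps)
    finally show ?thesis .
  qed
  have i: "integrable lborel (\<lambda>y. indicator {x..x+e} y * (dens x / 2))"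
    by (intro integrable_mult_left integrable_real_indicator) (auto simp: emeasure_lborel_Icc_eq)
  have "0 \<le> measure M {x<..x+e}" by simp
  also have "\<dots> = (LINT y|lborel. indicator {x..x+e} y * dens y)" using e by (intro measure_interval) auto
  also have "\<dots> \<le> (LINT y|lborel. indicator {x..x+e} y * (dens x / 2))"
  proof (rule integral_mono)
    fix y
    show "indicator {x..x+e} y * dens y \<le> indicator {x..x+e} y * (dens x / 2)"
    proof (cases "y \<in> {x..x+e}")
      case True
      have "dens y - dens x \<le> c * \<bar>y - x\<bar>" using c(2)[of y x] by simp
      also have "\<dots> \<le> c * e" using True c by (intro mult_left_mono) auto
      also note ce
      finally show ?thesis using True by simp
    qed simp
  qed (use i dens_interval_integrable in auto)
  also have "\<dots> = e * (dens x / 2)" using e by simp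
  also have "\<dots> < 0" using e neg by (intro mult_pos_neg) auto
  finally show False by simp
qed

theorem density_eq: "M = density lborel (\<lambda>x. ennreal (dens x))"
proof (rule measure_eqI_lessThan)
  let ?D = "density lborel (\<lambda>x. ennreal (dens x))"
  have int: "emeasure M {a<..b} = emeasure ?D {a<..b}" if "a \<le> b" for a b
  proof -
    have "emeasure ?D {a<..b} = (\<integral>\<^sup>+x. ennreal (dens x) * indicator {a<..b} x \<partial>lborel)"
      by (rule emeasure_density) auto
    also have "\<dots> = (\<integral>\<^sup>+x. ennreal (indicator {a..b} x * dens x) \<partial>lborel)"
    proof (rule nn_integral_cong_AE)
      show "AE x in lborel. ennreal (dens x) * indicator {a<..b} x = ennreal (indicator {a..b} x * dens x)"
        using AE_lborel_singleton[of a] by eventually_elim (auto simp: indicator_def)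
    qed
    also have "\<dots> = ennreal (LINT x|lborel. indicator {a..b} x * dens x)"
      using dens_nonneg by (intro nn_integral_eq_integral dens_interval_integrable) auto
    finally show ?thesis using measure_interval[OF that] by (simp add: emeasure_eq_measure)
  qed
  show "emeasure M {x<..} = emeasure ?D {x<..}" for x
  proof -
    have U: "(\<Union>n. {x<..x + real n}) = {x<..}"
    proof (intro subset_antisym subsetI)
      fix y assume "y \<in> {x<..}"
      moreover obtain n where "y - x \<le> real n" using real_arch_simple by blast
      ultimately show "y \<in> (\<Union>n. {x<..x + real n})" by (intro UN_I[of n]) auto
    qed auto
    have inc: "incseq (\<lambda>n. {x<..x + real n})" by (auto simp: incseq_def)
    have "(\<lambda>n. emeasure M {x<..x + real n}) \<longlonglongrightarrow> emeasure M (\<Union>n. {x<..x + real n})"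
      by (intro Lim_emeasure_incseq inc) auto
    moreover have "(\<lambda>n. emeasure ?D {x<..x + real n}) \<longlonglongrightarrow> emeasure ?D (\<Union>n. {x<..x + real n})"
      by (intro Lim_emeasure_incseq inc) auto
    ultimately show ?thesis unfolding U using int[of x "x + real n" for n] LIMSEQ_unique by simp
  qed
qed (auto simp: emeasure_eq_measure)

end

section \<open>Smoothing by stable noise\<close>

lemma powr_abs_subadd:
  fixes x y \<beta> :: real assumes "0 < \<beta>" "\<beta> \<le> 1"
  shows "\<bar>x + y\<bar> powr \<beta> \<le> \<bar>x\<bar> powr \<beta> + \<bar>y\<bar> powr \<beta>"
proof (cases "\<bar>x\<bar> + \<bar>y\<bar> = 0")
  case False
  define s where "s = \<bar>x\<bar> + \<bar>y\<bar>"
  have s: "s > 0" using False by (simp add: s_def)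
  have *: "t / s \<le> (t / s) powr \<beta>" if "0 \<le> t" "t \<le> s" for t
    using powr_mono'[of \<beta> 1 "t / s"] assms s that by (cases "t = 0") auto
  have "1 = \<bar>x\<bar> / s + \<bar>y\<bar> / s" using s by (simp add: s_def add_divide_distrib[symmetric])
  also have "\<dots> \<le> (\<bar>x\<bar> / s) powr \<beta> + (\<bar>y\<bar> / s) powr \<beta>" by (intro add_mono *) (auto simp: s_def)
  also have "\<dots> = (\<bar>x\<bar> powr \<beta> + \<bar>y\<bar> powr \<beta>) / s powr \<beta>"
    using s by (simp add: powr_divide add_divide_distrib)
  finally have "s powr \<beta> \<le> \<bar>x\<bar> powr \<beta> + \<bar>y\<bar> powr \<beta>" using s by (simp add: pos_le_divide_eq)
  moreover have "\<bar>x + y\<bar> powr \<beta> \<le> s powr \<beta>" using assms by (intro powr_mono2) (auto simp: s_def)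
  ultimately show ?thesis by linarith
next
  case True
  hence "x = 0" "y = 0" by auto
  thus ?thesis by simp
qed

lemma powr_abs_le_wsq: "0 < p \<Longrightarrow> \<bar>y\<bar> powr p \<le> 1 + wsq p y"
  by (auto simp: wsq_def intro: order_trans[OF powr_le1])

lemma integrable_powr_over_1_plus_square:
  assumes "0 < \<beta>" "\<beta> < 1"
  shows "integrable lborel (\<lambda>v::real. \<bar>v\<bar> powr \<beta> / (1 + v\<^sup>2))"
proof (rule integrable_even)
  have h: "((\<lambda>x. x powr (\<beta> - 2)) has_integral - (1 powr (\<beta> - 2 + 1)) / (\<beta> - 2 + 1)) {1..}"
    using assms by (intro has_integral_powr_to_inf) auto
  have nn: "(\<integral>\<^sup>+x. ennreal (x powr (\<beta> - 2)) * indicator {1..} x \<partial>lborel) = ennreal (- (1 powr (\<beta> - 2 + 1)) / (\<beta> - 2 + 1))"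
    by (rule nn_integral_has_integral_lebesgue'[OF _ h]) auto
  have "integrable lborel (\<lambda>x. indicator {1..} x * x powr (\<beta> - 2))"
  proof (rule integrableI_bounded)
    have "(\<integral>\<^sup>+x. ennreal (norm (indicator {1..} x * x powr (\<beta> - 2))) \<partial>lborel) =
        (\<integral>\<^sup>+x. ennreal (x powr (\<beta> - 2)) * indicator {1..} x \<partial>lborel)"
      by (intro nn_integral_cong) (auto split: split_indicator)
    also have "\<dots> < \<infinity>" unfolding nn by simp
    finally show "(\<integral>\<^sup>+x. ennreal (norm (indicator {1..} x * x powr (\<beta> - 2))) \<partial>lborel) < \<infinity>" .
  qed auto
  moreover have "integrable lborel (\<lambda>x::real. indicator {0..1} x * (1::real))"
    by (intro integrable_mult_left integrable_real_indicator) auto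
  ultimately have i: "integrable lborel (\<lambda>x. indicator {0..1} x * 1 + indicator {1..} x * x powr (\<beta> - 2))"
    by (intro Bochner_Integration.integrable_add)
  show "integrable lborel (\<lambda>v. indicator {0<..} v * (\<bar>v\<bar> powr \<beta> / (1 + v\<^sup>2)))"
  proof (rule Bochner_Integration.integrable_bound[OF i _ AE_I2])
    fix v :: real
    show "norm (indicator {0<..} v * (\<bar>v\<bar> powr \<beta> / (1 + v\<^sup>2))) \<le> norm (indicator {0..1} v * 1 + indicator {1..} v * v powr (\<beta> - 2))"
    proof (cases "v \<le> 1")
      case True
      have "v powr \<beta> / (1 + v\<^sup>2) \<le> 1 / 1" if "0 < v" using True that assms by (intro frac_le powr_le1) auto
      thus ?thesis using True by (auto split: split_indicator)
    next
      case False
      hence "0 < v\<^sup>2" "0 < 1 + v\<^sup>2" by (simp_all add: add_pos_nonneg)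
      hence "v powr \<beta> / (1 + v\<^sup>2) \<le> v powr \<beta> / v\<^sup>2" by (intro divide_left_mono mult_pos_pos) auto
      also have "\<dots> = v powr (\<beta> - 2)" using False by (simp add: powr_diff powr_numeral)
      finally show ?thesis using False by (auto split: split_indicator)
    qed
  qed measurable
qed auto

context stable_law
begin

lemma dens_shift: "\<exists>C\<ge>0. \<forall>v z. \<bar>z\<bar> \<le> 1 \<longrightarrow> \<bar>dens (v - z) - dens v\<bar> \<le> C * \<bar>z\<bar> / (1 + v\<^sup>2)"
proof -
  obtain C where C: "C \<ge> 0" "\<And>x. \<bar>dens' x\<bar> \<le> C / (1 + x\<^sup>2)" using dens'_bound by blast
  have *: "\<bar>dens b - dens a\<bar> \<le> (3 * C / (1 + v\<^sup>2)) * (b - a)"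
    if "a \<le> b" and near: "\<And>x. a \<le> x \<Longrightarrow> x \<le> b \<Longrightarrow> \<bar>x - v\<bar> \<le> 1" for a b v
  proof -
    have i: "integrable lborel (\<lambda>x. indicator {a..b} x * (3 * C / (1 + v\<^sup>2)))"
      by (intro integrable_mult_left integrable_real_indicator) (auto simp: emeasure_lborel_Icc_eq)
    have "\<bar>dens b - dens a\<bar> \<le> (LINT x|lborel. \<bar>indicator {a..b} x * dens' x\<bar>)"
      unfolding dens_diff[OF that(1)] by (rule integral_abs_bound)
    also have "\<dots> \<le> (LINT x|lborel. indicator {a..b} x * (3 * C / (1 + v\<^sup>2)))"
    proof (rule integral_mono)
      fix x
      have "\<bar>dens' x\<bar> \<le> 3 * C / (1 + v\<^sup>2)" if "x \<in> {a..b}"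
      proof -
        have "(x - v)\<^sup>2 \<le> 1" using near[of x] that by (simp add: abs_square_le_1)
        hence d: "2 * (x - v)\<^sup>2 \<le> 2 * 1" by (rule mult_left_mono) simp
        have "v\<^sup>2 \<le> 2 * x\<^sup>2 + 2 * (x - v)\<^sup>2"
          using zero_le_power2[of "2 * x - v"] by (simp add: power2_eq_square algebra_simps)
        also have "\<dots> \<le> 2 * x\<^sup>2 + 2 * 1" by (rule add_left_mono[OF d])
        also have "\<dots> \<le> 3 * x\<^sup>2 + 2" by simp
        finally have le: "1 + v\<^sup>2 \<le> 3 * (1 + x\<^sup>2)" by simp
        have pos: "0 < 1 + v\<^sup>2" "0 < 1 + x\<^sup>2" by (auto intro: add_pos_nonneg)
        have "C / (1 + x\<^sup>2) = 3 * C / (3 * (1 + x\<^sup>2))" by (rule mult_divide_mult_cancel_left[symmetric]) simp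
        also have "\<dots> \<le> 3 * C / (1 + v\<^sup>2)"
          using le pos C by (intro divide_left_mono mult_pos_pos) auto
        finally show ?thesis using C(2)[of x] by linarith
      qed
      thus "\<bar>indicator {a..b} x * dens' x\<bar> \<le> indicator {a..b} x * (3 * C / (1 + v\<^sup>2))"
        by (auto split: split_indicator)
    qed (use i integrable_abs[OF dens_diff(2)[OF that(1)]] in auto)
    also have "\<dots> = (3 * C / (1 + v\<^sup>2)) * (b - a)" using that by simp
    finally show ?thesis .
  qed
  show ?thesis
  proof (intro exI[of _ "3 * C"] conjI allI impI)
    fix v z :: real assume z: "\<bar>z\<bar> \<le> 1"
    show "\<bar>dens (v - z) - dens v\<bar> \<le> 3 * C * \<bar>z\<bar> / (1 + v\<^sup>2)"
    proof (cases "z \<ge> 0")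
      case True
      have "\<bar>dens v - dens (v - z)\<bar> \<le> (3 * C / (1 + v\<^sup>2)) * (v - (v - z))"
        using True z by (intro *) auto
      thus ?thesis using True by (simp add: abs_minus_commute)
    next
      case False
      have "\<bar>dens (v - z) - dens v\<bar> \<le> (3 * C / (1 + v\<^sup>2)) * ((v - z) - v)"
        using False z by (intro *) auto
      thus ?thesis using False by simp
    qed
  qed (use C in auto)
qed

theorem smoothing:
  fixes K :: "real \<Rightarrow> real"
  assumes [measurable]: "K \<in> borel_measurable borel" and \<beta>: "0 < \<beta>" "\<beta> < \<alpha> / 2"
    and CK: "\<And>x. x0 < \<bar>x\<bar> \<Longrightarrow> \<bar>K x\<bar> \<le> CK * \<bar>x\<bar> powr \<beta>"
    and Kint: "integrable lborel (\<lambda>x. indicator {-x0..x0} x * K x)"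
  shows "integrable M (\<lambda>y. K (x + y))"
    and "\<exists>C\<ge>0. \<forall>x z. ((LINT y|M. K (x + z + y)) - (LINT y|M. K (x + y)))\<^sup>2 \<le> C * (2 + wsq (2 * \<beta>) x) * wsq (2 * \<beta>) z"
proof -
  define Kn where "Kn x = \<bar>indicator {-x0..x0} x * K x\<bar>" for x
  have [measurable]: "Kn \<in> borel_measurable borel" unfolding Kn_def by measurable
  define D where "D = \<bar>CK\<bar>"
  have \<beta>1: "\<beta> < 1" "\<beta> \<le> 1" "\<beta> < \<alpha>" using \<beta> alpha by auto
  have Kb: "\<bar>K (x + y)\<bar> \<le> Kn (x + y) + D * (\<bar>x\<bar> powr \<beta> + \<bar>y\<bar> powr \<beta>)" for x y
  proof (cases "x0 < \<bar>x + y\<bar>")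
    case True
    have "\<bar>K (x + y)\<bar> \<le> CK * \<bar>x + y\<bar> powr \<beta>" by (rule CK[OF True])
    also have "\<dots> \<le> D * \<bar>x + y\<bar> powr \<beta>" unfolding D_def by (intro mult_right_mono) auto
    also have "\<dots> \<le> D * (\<bar>x\<bar> powr \<beta> + \<bar>y\<bar> powr \<beta>)"
      using \<beta> \<beta>1 by (intro mult_left_mono powr_abs_subadd) (auto simp: D_def)
    finally show ?thesis by (simp add: Kn_def add_increasing)
  next
    case False
    hence "x + y \<in> {-x0..x0}" by auto
    thus ?thesis by (simp add: Kn_def D_def)
  qed
  have iKn: "integrable lborel (\<lambda>y. Kn (x + y))" for x
    using lborel_integrable_real_affine[OF integrable_abs[OF Kint], of 1 x] by (simp add: Kn_def)
  define kn where "kn = (LINT v|lborel. Kn v)"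
  have kn: "(LINT y|lborel. Kn (x + y)) = kn" for x
    using lborel_integral_real_affine[of 1 Kn x] by (simp add: kn_def)
  have kn0: "kn \<ge> 0" unfolding kn_def by (rule integral_nonneg_AE) (auto simp: Kn_def)
  obtain c where c: "c \<ge> 0" "\<And>x. \<bar>dens x\<bar> \<le> c" using dens_bound by blast
  have M: "integrable M (wsq \<beta>)"
    by (rule stable_wsq_bound(1)[of M r \<alpha>]) (use char_eq r \<beta> \<beta>1 in \<open>auto intro: real_distribution_axioms\<close>)
  define m where "m = (LINT y|M. wsq \<beta> y)"
  have m0: "m \<ge> 0" unfolding m_def by (rule integral_nonneg_AE) auto
  have int_dens: "integrable M f \<longleftrightarrow> integrable lborel (\<lambda>y. dens y * f y)" "(LINT y|M. f y) = (LINT y|lborel. dens y * f y)"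
    if [measurable]: "f \<in> borel_measurable borel" for f :: "real \<Rightarrow> real"
    using dens_nonneg integrable_density[of f lborel dens] integral_density[of f lborel dens] by (auto simp flip: density_eq)
  have iMn: "integrable M (\<lambda>y. Kn (x + y))" "(LINT y|M. Kn (x + y)) \<le> c * kn" for x
  proof -
    have b: "integrable lborel (\<lambda>y. c * Kn (x + y))" using iKn by simp
    have i: "integrable lborel (\<lambda>y. dens y * Kn (x + y))"
      by (rule Bochner_Integration.integrable_bound[OF b]) (use c in \<open>auto simp: abs_mult intro!: AE_I2 mult_right_mono\<close>)
    thus "integrable M (\<lambda>y. Kn (x + y))" by (subst int_dens) auto
    have "(LINT y|M. Kn (x + y)) = (LINT y|lborel. dens y * Kn (x + y))" by (subst int_dens) auto
    also have "\<dots> \<le> (LINT y|lborel. c * Kn (x + y))"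
    proof (rule integral_mono[OF i b])
      show "dens y * Kn (x + y) \<le> c * Kn (x + y)" for y
        using c(2)[of y] by (intro mult_right_mono) (auto simp: Kn_def)
    qed
    finally show "(LINT y|M. Kn (x + y)) \<le> c * kn" by (simp add: kn)
  qed
  have iM: "integrable M (\<lambda>y. Kn (x + y) + D * (\<bar>x\<bar> powr \<beta> + (1 + wsq \<beta> y)))" for x
    using iMn M by (intro Bochner_Integration.integrable_add integrable_mult_right) auto
  have Kb': "\<bar>K (x + y)\<bar> \<le> Kn (x + y) + D * (\<bar>x\<bar> powr \<beta> + (1 + wsq \<beta> y))" for x y
  proof -
    have "D * (\<bar>x\<bar> powr \<beta> + \<bar>y\<bar> powr \<beta>) \<le> D * (\<bar>x\<bar> powr \<beta> + (1 + wsq \<beta> y))"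
      using powr_abs_le_wsq[OF \<beta>(1), of y] by (intro mult_left_mono) (auto simp: D_def)
    thus ?thesis using Kb[of x y] by linarith
  qed
  show iK: "integrable M (\<lambda>y. K (x + y))" for x
  proof (rule Bochner_Integration.integrable_bound[OF iM[of x] _ AE_I2])
    show "norm (K (x + y)) \<le> norm (Kn (x + y) + D * (\<bar>x\<bar> powr \<beta> + (1 + wsq \<beta> y)))" for y
      using Kb'[of x y] by simp
  qed measurable
  define G where "G x = (LINT y|M. K (x + y))" for x
  define C1 where "C1 = c * kn + D * (1 + m) + D"
  have C1: "C1 \<ge> 0" using c kn0 m0 by (auto simp: C1_def D_def)
  have Gb: "\<bar>G x\<bar> \<le> C1 * (1 + \<bar>x\<bar> powr \<beta>)" for x
  proof -
    have "\<bar>G x\<bar> \<le> (LINT y|M. \<bar>K (x + y)\<bar>)" unfolding G_def by (rule integral_abs_bound)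
    also have "\<dots> \<le> (LINT y|M. Kn (x + y) + D * (\<bar>x\<bar> powr \<beta> + (1 + wsq \<beta> y)))"
      by (rule integral_mono[OF integrable_abs[OF iK] iM Kb'])
    also have "\<dots> = (LINT y|M. Kn (x + y)) + D * (\<bar>x\<bar> powr \<beta> + (1 + m))"
      using iMn M prob_space by (simp add: m_def)
    also have "\<dots> \<le> c * kn + D * (\<bar>x\<bar> powr \<beta> + (1 + m))" using iMn(2) by simp
    also have "\<dots> \<le> C1 * (1 + \<bar>x\<bar> powr \<beta>)"
      unfolding C1_def using c kn0 m0 by (simp add: algebra_simps D_def)
    finally show ?thesis .
  qed
  obtain C2 where C2: "C2 \<ge> 0" "\<And>v z. \<bar>z\<bar> \<le> 1 \<Longrightarrow> \<bar>dens (v - z) - dens v\<bar> \<le> C2 * \<bar>z\<bar> / (1 + v\<^sup>2)"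
    using dens_shift by blast
  define I0 where "I0 = (LINT v|lborel. 1 / (1 + v\<^sup>2 :: real))"
  define I1 where "I1 = (LINT v|lborel. \<bar>v\<bar> powr \<beta> / (1 + v\<^sup>2))"
  have I01: "I0 \<ge> 0" "I1 \<ge> 0" unfolding I0_def I1_def by (auto intro!: integral_nonneg_AE)
  define C3 where "C3 = C2 * (kn + D * (I0 + I1))"
  have C3: "C3 \<ge> 0" using C2 kn0 I01 by (auto simp: C3_def D_def)
  have Gd: "\<bar>G (x + z) - G x\<bar> \<le> C3 * (1 + \<bar>x\<bar> powr \<beta>) * \<bar>z\<bar>" if z: "\<bar>z\<bar> \<le> 1" for x z
  proof -
    have i1: "integrable lborel (\<lambda>w. dens w * K (x + w))" for x
      using iK[of x] by (subst (asm) int_dens) auto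
    have i2: "integrable lborel (\<lambda>w. dens (w - z) * K (x + w))"
      using lborel_integrable_real_affine[OF i1[of "x + z"], of 1 "- z"] by simp
    have "G (x + z) = (LINT w|lborel. dens w * K (x + z + w))" unfolding G_def by (subst int_dens) auto
    also have "\<dots> = (LINT w|lborel. dens (w - z) * K (x + w))"
      by (subst lborel_integral_real_affine[of 1 _ "- z"]) auto
    finally have "G (x + z) - G x = (LINT w|lborel. dens (w - z) * K (x + w)) - (LINT w|lborel. dens w * K (x + w))"
      unfolding G_def by (subst (2) int_dens) auto
    also have "\<dots> = (LINT w|lborel. dens (w - z) * K (x + w) - dens w * K (x + w))" using i1 i2 by simp
    finally have eq: "G (x + z) - G x = (LINT w|lborel. dens (w - z) * K (x + w) - dens w * K (x + w))" .
    define B where "B w = C2 * \<bar>z\<bar> * (Kn (x + w) + D * (\<bar>x\<bar> powr \<beta> * (1 / (1 + w\<^sup>2)) + \<bar>w\<bar> powr \<beta> / (1 + w\<^sup>2)))" for w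
    have iB: "integrable lborel B" unfolding B_def
      using iKn integrable_inverse_1_plus_square integrable_powr_over_1_plus_square[OF \<beta>(1) \<beta>1(1)]
      by (intro integrable_mult_right Bochner_Integration.integrable_add) auto
    have "\<bar>G (x + z) - G x\<bar> \<le> (LINT w|lborel. \<bar>dens (w - z) * K (x + w) - dens w * K (x + w)\<bar>)"
      unfolding eq by (rule integral_abs_bound)
    also have "\<dots> \<le> (LINT w|lborel. B w)"
    proof (rule integral_mono[OF _ iB])
      show "integrable lborel (\<lambda>w. \<bar>dens (w - z) * K (x + w) - dens w * K (x + w)\<bar>)" using i1 i2 by simp
      fix w :: real
      have pos: "0 < 1 + w\<^sup>2" by (simp add: add_pos_nonneg)
      have "\<bar>dens (w - z) * K (x + w) - dens w * K (x + w)\<bar> = \<bar>dens (w - z) - dens w\<bar> * \<bar>K (x + w)\<bar>"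
        by (simp flip: abs_mult left_diff_distrib)
      also have "\<dots> \<le> (C2 * \<bar>z\<bar> / (1 + w\<^sup>2)) * (Kn (x + w) + D * (\<bar>x\<bar> powr \<beta> + \<bar>w\<bar> powr \<beta>))"
        using C2 z pos by (intro mult_mono C2(2) Kb) auto
      also have "\<dots> = C2 * \<bar>z\<bar> * (Kn (x + w) / (1 + w\<^sup>2) + D * (\<bar>x\<bar> powr \<beta> * (1 / (1 + w\<^sup>2)) + \<bar>w\<bar> powr \<beta> / (1 + w\<^sup>2)))"
        by (simp add: divide_inverse algebra_simps)
      also have "\<dots> \<le> B w"
      proof -
        have "Kn (x + w) / (1 + w\<^sup>2) \<le> Kn (x + w) / 1"
          using pos by (intro divide_left_mono) (auto simp: Kn_def)
        thus ?thesis unfolding B_def using C2 by (intro mult_left_mono add_right_mono) auto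
      qed
      finally show "\<bar>dens (w - z) * K (x + w) - dens w * K (x + w)\<bar> \<le> B w" .
    qed
    also have "\<dots> = C2 * \<bar>z\<bar> * (kn + D * (\<bar>x\<bar> powr \<beta> * I0 + I1))"
      unfolding B_def I0_def I1_def kn[of x, symmetric]
      by (simp only: integral_mult_right_zero Bochner_Integration.integral_add integrable_mult_right
          Bochner_Integration.integrable_add iKn integrable_inverse_1_plus_square
          integrable_powr_over_1_plus_square[OF \<beta>(1) \<beta>1(1)])
    also have "\<dots> \<le> C2 * \<bar>z\<bar> * ((kn + D * (I0 + I1)) * (1 + \<bar>x\<bar> powr \<beta>))"
      using C2 kn0 I01 by (intro mult_left_mono) (auto simp: algebra_simps D_def)
    finally show ?thesis by (simp add: C3_def mult_ac)
  qed
  define C where "C = (C3 + 4 * C1)\<^sup>2 * 2"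
  have "(G (x + z) - G x)\<^sup>2 \<le> C * (2 + wsq (2 * \<beta>) x) * wsq (2 * \<beta>) z" for x z
  proof -
    define w where "w = (if \<bar>z\<bar> \<le> 1 then \<bar>z\<bar> else \<bar>z\<bar> powr \<beta>)"
    have w0: "w \<ge> 0" by (simp add: w_def)
    have ww: "w\<^sup>2 = wsq (2 * \<beta>) z"
      by (auto simp: w_def wsq_def powr_add[symmetric] power2_eq_square)
    have "\<bar>G (x + z) - G x\<bar> \<le> (C3 + 4 * C1) * (1 + \<bar>x\<bar> powr \<beta>) * w"
    proof (cases "\<bar>z\<bar> \<le> 1")
      case True
      have "\<bar>G (x + z) - G x\<bar> \<le> C3 * ((1 + \<bar>x\<bar> powr \<beta>) * w)" using Gd[OF True] True by (simp add: w_def mult_ac)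
      also have "\<dots> \<le> (C3 + 4 * C1) * ((1 + \<bar>x\<bar> powr \<beta>) * w)"
        using C1 w0 by (intro mult_right_mono) auto
      finally show ?thesis by (simp add: mult.assoc)
    next
      case False
      have z1: "1 \<le> \<bar>z\<bar> powr \<beta>" using False \<beta> by (intro ge_one_powr_ge_zero) auto
      have "\<bar>G (x + z) - G x\<bar> \<le> \<bar>G (x + z)\<bar> + \<bar>G x\<bar>" by simp
      also have "\<dots> \<le> C1 * (1 + \<bar>x + z\<bar> powr \<beta>) + C1 * (1 + \<bar>x\<bar> powr \<beta>)" by (intro add_mono Gb)
      also have "\<dots> \<le> C1 * (1 + (\<bar>x\<bar> powr \<beta> + \<bar>z\<bar> powr \<beta>)) + C1 * (1 + \<bar>x\<bar> powr \<beta>)"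
        using C1 \<beta> \<beta>1 by (intro add_right_mono mult_left_mono add_left_mono powr_abs_subadd) auto
      also have "\<dots> = C1 * (2 * (1 + \<bar>x\<bar> powr \<beta>) + \<bar>z\<bar> powr \<beta>)" by (simp add: algebra_simps)
      also have "\<dots> \<le> C1 * (4 * ((1 + \<bar>x\<bar> powr \<beta>) * \<bar>z\<bar> powr \<beta>))"
      proof (intro mult_left_mono C1)
        have "(1 + \<bar>x\<bar> powr \<beta>) * 1 \<le> (1 + \<bar>x\<bar> powr \<beta>) * \<bar>z\<bar> powr \<beta>" using z1 by (intro mult_left_mono) auto
        moreover have "1 * \<bar>z\<bar> powr \<beta> \<le> (1 + \<bar>x\<bar> powr \<beta>) * \<bar>z\<bar> powr \<beta>" by (intro mult_right_mono) auto
        ultimately show "2 * (1 + \<bar>x\<bar> powr \<beta>) + \<bar>z\<bar> powr \<beta> \<le> 4 * ((1 + \<bar>x\<bar> powr \<beta>) * \<bar>z\<bar> powr \<beta>)" 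
          using powr_ge_zero[of "\<bar>z\<bar>" \<beta>] by linarith
      qed
      also have "\<dots> = 4 * C1 * ((1 + \<bar>x\<bar> powr \<beta>) * w)" using False by (simp add: w_def)
      also have "\<dots> \<le> (C3 + 4 * C1) * ((1 + \<bar>x\<bar> powr \<beta>) * w)"
        using C3 w0 by (intro mult_right_mono) auto
      finally show ?thesis by (simp add: mult.assoc)
    qed
    hence "\<bar>G (x + z) - G x\<bar>\<^sup>2 \<le> ((C3 + 4 * C1) * (1 + \<bar>x\<bar> powr \<beta>) * w)\<^sup>2" by (intro power_mono) auto
    also have "\<dots> = (C3 + 4 * C1)\<^sup>2 * (1 + \<bar>x\<bar> powr \<beta>)\<^sup>2 * wsq (2 * \<beta>) z" by (simp add: power_mult_distrib ww)
    also have "\<dots> \<le> (C3 + 4 * C1)\<^sup>2 * (2 * (2 + wsq (2 * \<beta>) x)) * wsq (2 * \<beta>) z"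
    proof (intro mult_right_mono mult_left_mono)
      have "(1 + \<bar>x\<bar> powr \<beta>)\<^sup>2 \<le> 2 * (1 + (\<bar>x\<bar> powr \<beta>)\<^sup>2)"
        using sum_squares_bound[of 1 "\<bar>x\<bar> powr \<beta>"] by (simp add: power2_sum)
      also have "(\<bar>x\<bar> powr \<beta>)\<^sup>2 = \<bar>x\<bar> powr (2 * \<beta>)" by (simp add: power2_eq_square flip: powr_add)
      also have "2 * (1 + \<bar>x\<bar> powr (2 * \<beta>)) \<le> 2 * (2 + wsq (2 * \<beta>) x)"
        using powr_abs_le_wsq[of "2 * \<beta>" x] \<beta> by simp
      finally show "(1 + \<bar>x\<bar> powr \<beta>)\<^sup>2 \<le> 2 * (2 + wsq (2 * \<beta>) x)" by simp
    qed auto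
    finally show ?thesis by (simp add: C_def algebra_simps)
  qed
  thus "\<exists>C\<ge>0. \<forall>x z. ((LINT y|M. K (x + z + y)) - (LINT y|M. K (x + y)))\<^sup>2 \<le> C * (2 + wsq (2 * \<beta>) x) * wsq (2 * \<beta>) z"
    unfolding G_def by (intro exI[of _ C]) (auto simp: C_def)
qed

end

section \<open>Stable stochastic integrals\<close>

abbreviation pw :: "real \<Rightarrow> (real \<Rightarrow> real) \<Rightarrow> real" where
  "pw \<alpha> f \<equiv> (LINT x|lborel. \<bar>f x\<bar> powr \<alpha>)"

lemma pw_nonneg [simp]: "0 \<le> pw \<alpha> f" by (rule integral_nonneg_AE) auto

lemma powr_abs_add_le:
  fixes x y t \<alpha> :: real
  assumes "0 < t" "t < 1" "1 \<le> \<alpha>"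
  shows "\<bar>x + y\<bar> powr \<alpha> \<le> (1 - t) powr (1 - \<alpha>) * \<bar>x\<bar> powr \<alpha> + t powr (1 - \<alpha>) * \<bar>y\<bar> powr \<alpha>"
proof (cases "x = 0 \<or> y = 0")
  case True
  have "1 \<le> (1 - t) powr (1 - \<alpha>)" "1 \<le> t powr (1 - \<alpha>)"
    using assms powr_mono2'[of "1 - \<alpha>" "1 - t" 1] powr_mono2'[of "1 - \<alpha>" t 1] by auto
  thus ?thesis
    using True mult_right_mono[of 1 "(1 - t) powr (1 - \<alpha>)" "\<bar>x\<bar> powr \<alpha>"]
      mult_right_mono[of 1 "t powr (1 - \<alpha>)" "\<bar>y\<bar> powr \<alpha>"] by auto
next
  case False
  have "\<bar>x + y\<bar> powr \<alpha> \<le> (\<bar>x\<bar> + \<bar>y\<bar>) powr \<alpha>" using assms by (intro powr_mono2) auto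
  also have "\<bar>x\<bar> + \<bar>y\<bar> = (1 - t) *\<^sub>R (\<bar>x\<bar> / (1 - t)) + t *\<^sub>R (\<bar>y\<bar> / t)" using assms by simp
  also have "\<dots> powr \<alpha> \<le> (1 - t) * (\<bar>x\<bar> / (1 - t)) powr \<alpha> + t * (\<bar>y\<bar> / t) powr \<alpha>"
    using assms False by (intro convex_onD[OF powr_convex]) auto
  also have "(1 - t) * (\<bar>x\<bar> / (1 - t)) powr \<alpha> = (1 - t) powr (1 - \<alpha>) * \<bar>x\<bar> powr \<alpha>"
    using assms by (simp add: powr_divide powr_diff)
  also have "t * (\<bar>y\<bar> / t) powr \<alpha> = t powr (1 - \<alpha>) * \<bar>y\<bar> powr \<alpha>"
    using assms by (simp add: powr_divide powr_diff)
  finally show ?thesis .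
qed

lemma L_power_add:
  assumes "1 \<le> \<alpha>" "L_power \<alpha> f" "L_power \<alpha> g"
  shows "L_power \<alpha> (\<lambda>x. f x + g x)"
proof -
  note [measurable] = assms(2,3)[unfolded L_power_def, THEN conjunct1]
  have "integrable lborel (\<lambda>x. \<bar>f x + g x\<bar> powr \<alpha>)"
  proof (rule Bochner_Integration.integrable_bound)
    show "integrable lborel (\<lambda>x. (1 - 1/2) powr (1 - \<alpha>) * \<bar>f x\<bar> powr \<alpha> + (1/2) powr (1 - \<alpha>) * \<bar>g x\<bar> powr \<alpha>)"
      using assms by (intro Bochner_Integration.integrable_add integrable_mult_right) (auto simp: L_power_def)
    show "AE x in lborel. norm (\<bar>f x + g x\<bar> powr \<alpha>) \<le> norm ((1 - 1/2) powr (1 - \<alpha>) * \<bar>f x\<bar> powr \<alpha> + (1/2) powr (1 - \<alpha>) * \<bar>g x\<bar> powr \<alpha>)"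
      using powr_abs_add_le[of "1/2" \<alpha> "f _" "g _"] assms by (auto intro!: AE_I2)
  qed auto
  thus ?thesis unfolding L_power_def by auto
qed

lemma pw_add_le:
  assumes "1 \<le> \<alpha>" "L_power \<alpha> f" "L_power \<alpha> g" "0 < t" "t < 1"
  shows "pw \<alpha> (\<lambda>x. f x + g x) \<le> (1 - t) powr (1 - \<alpha>) * pw \<alpha> f + t powr (1 - \<alpha>) * pw \<alpha> g"
proof -
  have i: "integrable lborel (\<lambda>x. \<bar>f x\<bar> powr \<alpha>)" "integrable lborel (\<lambda>x. \<bar>g x\<bar> powr \<alpha>)"
    using assms by (auto simp: L_power_def)
  have "pw \<alpha> (\<lambda>x. f x + g x) \<le> (LINT x|lborel. (1 - t) powr (1 - \<alpha>) * \<bar>f x\<bar> powr \<alpha> + t powr (1 - \<alpha>) * \<bar>g x\<bar> powr \<alpha>)"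
    using assms L_power_add[OF assms(1-3)] i
    by (intro integral_mono powr_abs_add_le) (auto simp: L_power_def)
  also have "\<dots> = (1 - t) powr (1 - \<alpha>) * pw \<alpha> f + t powr (1 - \<alpha>) * pw \<alpha> g"
    using i by simp
  finally show ?thesis .
qed

lemma L_power_cmult:
  assumes "L_power \<alpha> f" shows "L_power \<alpha> (\<lambda>x. c * f x)"
  using assms by (auto simp: L_power_def abs_mult powr_mult)

lemma pw_cmult: "pw \<alpha> (\<lambda>x. c * f x) = \<bar>c\<bar> powr \<alpha> * pw \<alpha> f"
  by (simp add: abs_mult powr_mult)

lemma L_power_indicator:
  assumes "L_power \<alpha> f" "B \<in> sets borel" shows "L_power \<alpha> (\<lambda>x. indicator B x * f x)"
proof -
  have "integrable lborel (\<lambda>x. \<bar>indicator B x * f x\<bar> powr \<alpha>)"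
    by (rule Bochner_Integration.integrable_bound[of _ "\<lambda>x. \<bar>f x\<bar> powr \<alpha>"])
       (use assms in \<open>auto simp: L_power_def split: split_indicator\<close>)
  thus ?thesis using assms by (auto simp: L_power_def)
qed

lemma L_power_diff:
  assumes "1 \<le> \<alpha>" "L_power \<alpha> f" "L_power \<alpha> g"
  shows "L_power \<alpha> (\<lambda>x. f x - g x)"
  using L_power_add[OF assms(1,2) L_power_cmult[OF assms(3), of "-1"]] by simp

lemma pw_tendsto:
  assumes \<alpha>: "1 < \<alpha>" and f: "L_power \<alpha> f" and g: "\<And>n. L_power \<alpha> (g n)"
    and lim: "(\<lambda>n. pw \<alpha> (\<lambda>x. f x - g n x)) \<longlonglongrightarrow> 0"
  shows "(\<lambda>n. pw \<alpha> (g n)) \<longlonglongrightarrow> pw \<alpha> f"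
proof -
  define d where "d n = pw \<alpha> (\<lambda>x. f x - g n x) + 1 / (n + 1)" for n :: nat
  have dpos: "d n > 0" for n unfolding d_def by (intro add_nonneg_pos) auto
  have dlim: "d \<longlonglongrightarrow> 0"
    unfolding d_def using tendsto_add[OF lim LIMSEQ_inverse_real_of_nat] by (simp add: field_simps)
  text \<open>The balance \<open>t = d powr (1 / (2 * (\<alpha> - 1)))\<close> makes both \<open>t\<close> and \<open>t powr (1 - \<alpha>) * d\<close> vanish.\<close>
  define e where "e = 1 / (2 * (\<alpha> - 1))"
  have e: "e > 0" "e * (1 - \<alpha>) = - (1/2)" using \<alpha> by (auto simp: e_def field_simps)
  define t where "t n = d n powr e" for n
  have tpos: "t n > 0" for n using dpos[of n] by (simp add: t_def)
  have tlim: "t \<longlonglongrightarrow> 0"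
    unfolding t_def using tendsto_powr2[OF dlim tendsto_const[of e] _ e(1)] dpos e by (simp add: less_imp_le)
  define s where "s n = t n powr (1 - \<alpha>) * d n" for n
  have s_eq: "s n = sqrt (d n)" for n
  proof -
    have "s n = d n powr (-(1/2)) * d n powr 1" using dpos[of n] by (simp add: s_def t_def powr_powr e)
    also have "\<dots> = d n powr (1/2)" unfolding powr_add[symmetric] by simp
    finally show ?thesis using dpos[of n] by (simp add: powr_half_sqrt)
  qed
  have slim: "s \<longlonglongrightarrow> 0" unfolding s_eq using tendsto_real_sqrt[OF dlim] by simp
  have ev: "\<forall>\<^sub>F n in sequentially. t n < 1" using order_tendstoD(2)[OF tlim] by simp
  have pd: "pw \<alpha> (\<lambda>x. f x - g n x) \<le> d n" for n by (simp add: d_def)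
  have pd': "pw \<alpha> (\<lambda>x. g n x - f x) \<le> d n" for n using pd[of n] by (simp add: abs_minus_commute)
  have up: "\<forall>\<^sub>F n in sequentially. pw \<alpha> (g n) \<le> (1 - t n) powr (1 - \<alpha>) * pw \<alpha> f + s n"
    using ev
  proof eventually_elim
    case (elim n)
    have "pw \<alpha> (\<lambda>x. f x + (g n x - f x)) \<le> (1 - t n) powr (1 - \<alpha>) * pw \<alpha> f + t n powr (1 - \<alpha>) * pw \<alpha> (\<lambda>x. g n x - f x)"
      using \<alpha> elim tpos by (intro pw_add_le f L_power_diff g) auto
    moreover have "t n powr (1 - \<alpha>) * pw \<alpha> (\<lambda>x. g n x - f x) \<le> s n"
      unfolding s_def by (intro mult_left_mono pd') auto
    ultimately show ?case by simp
  qed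
  have lo: "\<forall>\<^sub>F n in sequentially. (1 - t n) powr (\<alpha> - 1) * (pw \<alpha> f - s n) \<le> pw \<alpha> (g n)"
    using ev
  proof eventually_elim
    case (elim n)
    have "pw \<alpha> (\<lambda>x. g n x + (f x - g n x)) \<le> (1 - t n) powr (1 - \<alpha>) * pw \<alpha> (g n) + t n powr (1 - \<alpha>) * pw \<alpha> (\<lambda>x. f x - g n x)"
      using \<alpha> elim tpos by (intro pw_add_le f L_power_diff g) auto
    moreover have "t n powr (1 - \<alpha>) * pw \<alpha> (\<lambda>x. f x - g n x) \<le> s n"
      unfolding s_def by (intro mult_left_mono pd) auto
    ultimately have "pw \<alpha> f - s n \<le> (1 - t n) powr (1 - \<alpha>) * pw \<alpha> (g n)" by simp
    hence "(1 - t n) powr (\<alpha> - 1) * (pw \<alpha> f - s n) \<le> (1 - t n) powr (\<alpha> - 1) * ((1 - t n) powr (1 - \<alpha>) * pw \<alpha> (g n))"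
      by (intro mult_left_mono) auto
    also have "\<dots> = ((1 - t n) powr (\<alpha> - 1) * (1 - t n) powr (1 - \<alpha>)) * pw \<alpha> (g n)"
      by (rule mult.assoc[symmetric])
    also have "(1 - t n) powr (\<alpha> - 1) * (1 - t n) powr (1 - \<alpha>) = 1"
      unfolding powr_add[symmetric] using elim by simp
    also have "1 * pw \<alpha> (g n) = pw \<alpha> (g n)" by simp
    finally show ?case .
  qed
  have "(\<lambda>n. (1 - t n) powr (1 - \<alpha>) * pw \<alpha> f + s n) \<longlonglongrightarrow> (1 - 0) powr (1 - \<alpha>) * pw \<alpha> f + 0"
    by (intro tendsto_intros tlim slim) auto
  moreover have "(\<lambda>n. (1 - t n) powr (\<alpha> - 1) * (pw \<alpha> f - s n)) \<longlonglongrightarrow> (1 - 0) powr (\<alpha> - 1) * (pw \<alpha> f - 0)"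
    by (intro tendsto_intros tlim slim) auto
  ultimately show ?thesis using tendsto_sandwich[OF lo up] by simp
qed

lemma sum_lessThan_add:
  fixes f :: "nat \<Rightarrow> 'a :: comm_monoid_add"
  shows "(\<Sum>i<k + m. f i) = (\<Sum>i<k. f i) + (\<Sum>i<m. f (k + i))"
  by (induction m) (auto simp: add.assoc)

locale stable_noise = prob_space P for P :: "'w measure" +
  fixes \<alpha> :: real and \<Phi> :: "real set \<Rightarrow> 'w \<Rightarrow> real"
  assumes alpha: "1 < \<alpha>" "\<alpha> < 2"
    and random_measure: "sas_random_measure P \<alpha> \<Phi>"
begin

lemma noise_measurable [measurable]: "A \<in> finite_borel \<Longrightarrow> \<Phi> A \<in> borel_measurable P"
  using random_measure by (simp add: sas_random_measure_def)

lemma noise_char: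
  "A \<in> finite_borel \<Longrightarrow> char (distr P borel (\<Phi> A)) u = complex_of_real (exp (- (measure lborel A * \<bar>u\<bar> powr \<alpha>)))"
  using random_measure by (simp add: sas_random_measure_def)

lemma noise_sums:
  fixes A :: "nat \<Rightarrow> real set"
  assumes "\<And>i. A i \<in> finite_borel" "disjoint_family A" "(\<Union>i. A i) \<in> finite_borel"
  shows "AE \<omega> in P. (\<lambda>i. \<Phi> (A i) \<omega>) sums \<Phi> (\<Union>i. A i) \<omega>"
  using random_measure assms by (simp add: sas_random_measure_def)

lemma noise_indep:
  fixes A :: "nat \<Rightarrow> real set"
  assumes "\<And>i. i < k \<Longrightarrow> A i \<in> finite_borel" "disjoint_family_on A {..<k}"
  shows "indep_vars (\<lambda>_. borel) (\<lambda>i. \<Phi> (A i)) {..<k}"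
  using random_measure assms by (simp add: sas_random_measure_def)

lemma finite_borel_empty: "{} \<in> finite_borel" by (simp add: finite_borel_def)

lemma finite_borel_subset: "A \<in> finite_borel \<Longrightarrow> B \<in> sets borel \<Longrightarrow> B \<subseteq> A \<Longrightarrow> B \<in> finite_borel"
  by (auto simp: finite_borel_def intro: le_less_trans[OF emeasure_mono])

lemma finite_borel_Un:
  assumes "A \<in> finite_borel" "B \<in> finite_borel" shows "A \<union> B \<in> finite_borel"
proof -
  have "emeasure lborel (A \<union> B) \<le> emeasure lborel A + emeasure lborel B"
    using assms by (intro emeasure_subadditive) (auto simp: finite_borel_def)
  also have "\<dots> < \<infinity>" using assms by (auto simp: finite_borel_def)
  finally show ?thesis using assms by (auto simp: finite_borel_def)
qed

lemma noise_empty: "AE \<omega> in P. \<Phi> {} \<omega> = 0"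
proof -
  have "AE \<omega> in P. (\<lambda>i::nat. \<Phi> {} \<omega>) sums \<Phi> {} \<omega>"
    using noise_sums[of "\<lambda>_. {}"] finite_borel_empty by (simp add: disjoint_family_on_def)
  thus ?thesis
  proof eventually_elim
    case (elim \<omega>)
    from summable_LIMSEQ_zero[OF sums_summable[OF elim]] show ?case
      by (simp add: LIMSEQ_const_iff)
  qed
qed

lemma noise_Un:
  assumes "A \<in> finite_borel" "B \<in> finite_borel" "A \<inter> B = {}"
  shows "AE \<omega> in P. \<Phi> (A \<union> B) \<omega> = \<Phi> A \<omega> + \<Phi> B \<omega>"
proof -
  define S where "S i = (if i = 0 then A else if i = 1 then B else {})" for i :: nat
  have U: "(\<Union>i. S i) = A \<union> B" by (auto simp: S_def split: if_splits)
  have "AE \<omega> in P. (\<lambda>i. \<Phi> (S i) \<omega>) sums \<Phi> (\<Union>i. S i) \<omega>"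
    using assms by (intro noise_sums)
      (auto simp: U finite_borel_Un, auto simp: S_def finite_borel_empty disjoint_family_on_def)
  with noise_empty show ?thesis
  proof eventually_elim
    case (elim \<omega>)
    have "(\<lambda>i. \<Phi> (S i) \<omega>) sums (\<Sum>i<2. \<Phi> (S i) \<omega>)"
      by (rule sums_finite) (auto simp: S_def elim)
    with elim have "\<Phi> (\<Union>i. S i) \<omega> = (\<Sum>i<2. \<Phi> (S i) \<omega>)" by (auto dest: sums_unique2)
    thus ?case unfolding U by (simp add: S_def numeral_2_eq_2)
  qed
qed

lemma finite_borel_UN:
  fixes D :: "nat \<Rightarrow> real set"
  assumes "\<And>i. i < k \<Longrightarrow> D i \<in> finite_borel" shows "(\<Union>i<k. D i) \<in> finite_borel"
  using assms by (induction k) (auto simp: lessThan_Suc finite_borel_empty intro!: finite_borel_Un)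

lemma noise_UN:
  fixes D :: "nat \<Rightarrow> real set"
  assumes "\<And>i. i < k \<Longrightarrow> D i \<in> finite_borel" "disjoint_family_on D {..<k}"
  shows "AE \<omega> in P. \<Phi> (\<Union>i<k. D i) \<omega> = (\<Sum>i<k. \<Phi> (D i) \<omega>)"
  using assms
proof (induction k)
  case 0
  thus ?case using noise_empty by simp
next
  case (Suc k)
  have "AE \<omega> in P. \<Phi> (\<Union>i<k. D i) \<omega> = (\<Sum>i<k. \<Phi> (D i) \<omega>)"
    using Suc.prems by (intro Suc.IH) (auto simp: disjoint_family_on_def)
  moreover have "AE \<omega> in P. \<Phi> ((\<Union>i<k. D i) \<union> D k) \<omega> = \<Phi> (\<Union>i<k. D i) \<omega> + \<Phi> (D k) \<omega>"
  proof (intro noise_Un finite_borel_UN)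
    have "D i \<inter> D k = {}" if "i < k" for i
      using disjoint_family_onD[OF Suc.prems(2), of i k] that by simp
    thus "(\<Union>i<k. D i) \<inter> D k = {}" by blast
  qed (use Suc.prems in auto)
  ultimately show ?case
    by eventually_elim (simp add: lessThan_Suc Un_commute)
qed

text \<open>\<open>simple_integral f X\<close>: \<open>f\<close> is a step function, with not necessarily disjoint steps, and \<open>X\<close> is its integral.\<close>

inductive simple_integral :: "(real \<Rightarrow> real) \<Rightarrow> ('w \<Rightarrow> real) \<Rightarrow> bool" where
  zero: "simple_integral (\<lambda>_. 0) (\<lambda>_. 0)"
| step: "simple_integral f X \<Longrightarrow> A \<in> finite_borel \<Longrightarrow>
    simple_integral (\<lambda>x. f x + c * indicator A x) (\<lambda>\<omega>. X \<omega> + c * \<Phi> A \<omega>)"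

lemma simple_integral_add:
  assumes "simple_integral f X" "simple_integral g Y"
  shows "simple_integral (\<lambda>x. f x + g x) (\<lambda>\<omega>. X \<omega> + Y \<omega>)"
  using assms(2)
proof (induction rule: simple_integral.induct)
  case (step g Y A c)
  from simple_integral.step[OF step.IH step.hyps(2), of c] show ?case by (simp add: add.assoc)
qed (use assms in simp)

lemma simple_integral_cmult:
  assumes "simple_integral f X" shows "simple_integral (\<lambda>x. c * f x) (\<lambda>\<omega>. c * X \<omega>)"
  using assms
proof (induction rule: simple_integral.induct)
  case (step g Y A d)
  from simple_integral.step[OF step.IH step.hyps(2), of "c * d"] show ?case by (simp add: algebra_simps)
qed (use simple_integral.zero in simp)

lemma simple_integral_sum:
  assumes "\<And>i. i < (k::nat) \<Longrightarrow> A i \<in> finite_borel"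
  shows "simple_integral (\<lambda>x. \<Sum>i<k. c i * indicator (A i) x) (\<lambda>\<omega>. \<Sum>i<k. c i * \<Phi> (A i) \<omega>)"
  using assms by (induction k) (auto intro!: simple_integral.intros)

lemma simple_integral_restrict:
  assumes "simple_integral f X" "B \<in> sets borel"
  shows "\<exists>Y. simple_integral (\<lambda>x. indicator B x * f x) Y"
  using assms(1)
proof (induction rule: simple_integral.induct)
  case zero
  show ?case using simple_integral.zero by auto
next
  case (step f X A c)
  then obtain Y where "simple_integral (\<lambda>x. indicator B x * f x) Y" by blast
  moreover have "B \<inter> A \<in> finite_borel"
    using step.hyps assms(2) by (intro finite_borel_subset[OF step.hyps(2)]) (auto simp: finite_borel_def)
  ultimately have "simple_integral (\<lambda>x. indicator B x * f x + c * indicator (B \<inter> A) x) (\<lambda>\<omega>. Y \<omega> + c * \<Phi> (B \<inter> A) \<omega>)"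
    by (rule simple_integral.step)
  moreover have "(\<lambda>x. indicator B x * f x + c * indicator (B \<inter> A) x) = (\<lambda>x. indicator B x * (f x + c * indicator A x))"
    by (auto simp: fun_eq_iff split: split_indicator)
  ultimately show ?case by auto
qed

lemma simple_integral_measurable:
  assumes "simple_integral f X" shows "X \<in> borel_measurable P" "f \<in> borel_measurable borel"
  using assms by (induction rule: simple_integral.induct) (auto simp: finite_borel_def)

lemma simple_integral_disjoint:
  assumes "simple_integral f X"
  shows "\<exists>(k::nat) d D. (\<forall>i<k. D i \<in> finite_borel) \<and> disjoint_family_on D {..<k} \<and>
    f = (\<lambda>x. \<Sum>i<k. d i * indicator (D i) x) \<and> (AE \<omega> in P. X \<omega> = (\<Sum>i<k. d i * \<Phi> (D i) \<omega>))"
  using assms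
proof (induction rule: simple_integral.induct)
  case zero
  show ?case by (rule exI[of _ "0::nat"]) (simp add: disjoint_family_on_def)
next
  case (step f X A c)
  then obtain k d D where D: "\<And>i. i < (k::nat) \<Longrightarrow> D i \<in> finite_borel" and disj: "disjoint_family_on D {..<k}"
    and f: "f = (\<lambda>x. \<Sum>i<k. d i * indicator (D i) x)" and X: "AE \<omega> in P. X \<omega> = (\<Sum>i<k. d i * \<Phi> (D i) \<omega>)"
    by blast
  have A: "A \<in> finite_borel" and Ab: "A \<in> sets borel" and Db: "\<And>i. i < k \<Longrightarrow> D i \<in> sets borel"
    using step D by (auto simp: finite_borel_def)
  define E where "E i = (if i < k then D i \<inter> A else if i < k + k then D (i - k) - A else A - (\<Union>j<k. D j))" for i
  define e where "e i = (if i < k then d i + c else if i < k + k then d (i - k) else c)" for i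
  have Dj: "D i \<inter> D j = {}" if "i < k" "j < k" "i \<noteq> j" for i j
    using disj that by (auto simp: disjoint_family_on_def)
  have Ef: "E i \<in> finite_borel" for i
  proof -
    consider "i < k" | "\<not> i < k" "i < k + k" | "\<not> i < k + k" by linarith
    thus ?thesis
    proof cases
      case 1
      thus ?thesis using A Ab Db by (auto simp: E_def intro!: finite_borel_subset[OF A])
    next
      case 2
      hence "i - k < k" by simp
      thus ?thesis using 2 Ab Db by (auto simp: E_def intro!: finite_borel_subset[OF D[of "i - k"]])
    next
      case 3
      thus ?thesis using Ab Db by (auto simp: E_def intro!: finite_borel_subset[OF A] sets.Diff sets.finite_UN)
    qed
  qed
  have Ed: "disjoint_family_on E {..<k + k + 1}"
    unfolding disjoint_family_on_def
  proof (intro ballI impI)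
    fix i j assume "i \<in> {..<k+k+1}" "j \<in> {..<k+k+1}" "i \<noteq> j"
    hence ij: "i < k + k + 1" "j < k + k + 1" "i \<noteq> j" by auto
    have "False" if x: "x \<in> E i" "x \<in> E j" for x
    proof -
      have uniq: "u = v" if "u < k" "v < k" "x \<in> D u" "x \<in> D v" for u v
        using Dj[of u v] that by auto
      have *: "(l < k \<and> x \<in> D l \<and> x \<in> A) \<or> (\<not> l < k \<and> l - k < k \<and> x \<in> D (l - k) \<and> x \<notin> A) \<or>
          (\<not> l < k + k \<and> x \<in> A \<and> (\<forall>m<k. x \<notin> D m))" if "x \<in> E l" for l
        using that by (auto simp: E_def split: if_splits)
      from *[OF x(1)] show False
      proof (elim disjE conjE)
        assume "i < k" "x \<in> D i" "x \<in> A"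
        thus False using *[OF x(2)] uniq[of i j] ij by auto
      next
        assume "\<not> i < k" "i - k < k" "x \<in> D (i - k)" "x \<notin> A"
        thus False using *[OF x(2)] uniq[of "i - k" "j - k"] ij by auto
      next
        assume "\<not> i < k + k" "x \<in> A" "\<forall>m<k. x \<notin> D m"
        thus False using *[OF x(2)] ij by auto
      qed
    qed
    thus "E i \<inter> E j = {}" by blast
  qed
  have sumE: "(\<Sum>i<k + k + 1. e i * h (E i)) =
      (\<Sum>i<k. (d i + c) * h (D i \<inter> A)) + (\<Sum>i<k. d i * h (D i - A)) + c * h (A - (\<Union>j<k. D j))"
    for h :: "real set \<Rightarrow> real"
    by (simp add: sum_lessThan_add E_def e_def)
  have "(\<lambda>x. f x + c * indicator A x) = (\<lambda>x. \<Sum>i<k + k + 1. e i * indicator (E i) x)"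
  proof
    fix x
    have "indicator A x = (\<Sum>i<k. indicator (D i \<inter> A) x) + (indicator (A - (\<Union>j<k. D j)) x :: real)"
    proof (cases "x \<in> A \<and> (\<exists>i<k. x \<in> D i)")
      case True
      then obtain i where i: "i < k" "x \<in> D i" "x \<in> A" by auto
      have "(\<Sum>j<k. indicator (D j \<inter> A) x) = (\<Sum>j<k. if j = i then 1 else 0 :: real)"
        using i Dj[OF _ i(1)] by (intro sum.cong) (auto simp: indicator_def)
      thus ?thesis using i by (auto simp: indicator_def)
    qed (auto simp: indicator_def)
    moreover define p where "p i = (indicator (D i \<inter> A) x :: real)" for i
    moreover define q where "q i = (indicator (D i - A) x :: real)" for i
    moreover define r where "r = (indicator (A - (\<Union>j<k. D j)) x :: real)"
    moreover have "indicator (D i) x = p i + q i" for i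
      by (auto simp: p_def q_def split: split_indicator)
    moreover have "(\<Sum>i<k + k + 1. e i * indicator (E i) x) = (\<Sum>i<k. (d i + c) * p i) + (\<Sum>i<k. d i * q i) + c * r"
      using sumE[of "\<lambda>S. indicator S x"] unfolding p_def q_def r_def .
    ultimately have "f x = (\<Sum>i<k. d i * (p i + q i))" "indicator A x = (\<Sum>i<k. p i) + r"
      "(\<Sum>i<k + k + 1. e i * indicator (E i) x) = (\<Sum>i<k. (d i + c) * p i) + (\<Sum>i<k. d i * q i) + c * r"
      by (simp_all only: f)
    thus "f x + c * indicator A x = (\<Sum>i<k + k + 1. e i * indicator (E i) x)"
      by (simp only: sum_distrib_left sum.distrib algebra_simps)
  qed
  moreover have "AE \<omega> in P. X \<omega> + c * \<Phi> A \<omega> = (\<Sum>i<k + k + 1. e i * \<Phi> (E i) \<omega>)"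
  proof -
    have fb: "D i - A \<in> finite_borel" "D i \<inter> A \<in> finite_borel" if "i < k" for i
      using finite_borel_subset[OF D[OF that], of "D i - A"] finite_borel_subset[OF D[OF that], of "D i \<inter> A"]
        Ab Db[OF that] by auto
    have fb': "A - (\<Union>j<k. D j) \<in> finite_borel"
      using Ab Db by (auto intro!: finite_borel_subset[OF A] sets.Diff sets.finite_UN)
    have eqA: "(\<Union>i<k. D i \<inter> A) \<union> (A - (\<Union>j<k. D j)) = A" by auto
    have "AE \<omega> in P. \<forall>i\<in>{..<k}. \<Phi> (D i) \<omega> = \<Phi> (D i \<inter> A) \<omega> + \<Phi> (D i - A) \<omega>"
    proof (rule AE_finite_allI)
      fix i assume "i \<in> {..<k}"
      thus "AE \<omega> in P. \<Phi> (D i) \<omega> = \<Phi> (D i \<inter> A) \<omega> + \<Phi> (D i - A) \<omega>"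
        using noise_Un[of "D i \<inter> A" "D i - A"] fb by (auto simp: Int_Diff_Un)
    qed auto
    moreover have "AE \<omega> in P. \<Phi> ((\<Union>i<k. D i \<inter> A) \<union> (A - (\<Union>j<k. D j))) \<omega> = \<Phi> (\<Union>i<k. D i \<inter> A) \<omega> + \<Phi> (A - (\<Union>j<k. D j)) \<omega>"
      using fb fb' by (intro noise_Un finite_borel_UN) auto
    moreover have "AE \<omega> in P. \<Phi> (\<Union>i<k. D i \<inter> A) \<omega> = (\<Sum>i<k. \<Phi> (D i \<inter> A) \<omega>)"
    proof (intro noise_UN)
      show "disjoint_family_on (\<lambda>i. D i \<inter> A) {..<k}"
        using Dj unfolding disjoint_family_on_def by blast
    qed (use fb in auto)
    ultimately show ?thesis using X
    proof eventually_elim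
      case (elim \<omega>)
      have "\<Phi> A \<omega> = (\<Sum>i<k. \<Phi> (D i \<inter> A) \<omega>) + \<Phi> (A - (\<Union>j<k. D j)) \<omega>"
        using elim(2,3) unfolding eqA by simp
      moreover have "(\<Sum>i<k. d i * \<Phi> (D i) \<omega>) = (\<Sum>i<k. d i * (\<Phi> (D i \<inter> A) \<omega> + \<Phi> (D i - A) \<omega>))"
        using elim(1) by (intro sum.cong) auto
      ultimately show ?case
        unfolding elim(4) sumE[of "\<lambda>S. \<Phi> S \<omega>"] by (simp add: sum_distrib_left sum.distrib algebra_simps)
    qed
  qed
  ultimately have "(\<forall>i<k + k + 1. E i \<in> finite_borel) \<and> disjoint_family_on E {..<k + k + 1} \<and>
    (\<lambda>x. f x + c * indicator A x) = (\<lambda>x. \<Sum>i<k + k + 1. e i * indicator (E i) x) \<and>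
    (AE \<omega> in P. X \<omega> + c * \<Phi> A \<omega> = (\<Sum>i<k + k + 1. e i * \<Phi> (E i) \<omega>))"
    using Ef Ed by blast
  thus ?case by blast
qed

lemma simple_integral_char:
  assumes "simple_integral f X"
  shows "L_power \<alpha> f" "(CLINT \<omega>|P. iexp (X \<omega>)) = complex_of_real (exp (- pw \<alpha> f))"
proof -
  obtain k d D where D: "\<And>i. i < (k::nat) \<Longrightarrow> D i \<in> finite_borel" and disj: "disjoint_family_on D {..<k}"
    and f: "f = (\<lambda>x. \<Sum>i<k. d i * indicator (D i) x)" and X: "AE \<omega> in P. X \<omega> = (\<Sum>i<k. d i * \<Phi> (D i) \<omega>)"
    using simple_integral_disjoint[OF assms] by blast
  note [measurable] = simple_integral_measurable[OF assms] noise_measurable[OF D]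
  have pf: "\<bar>f x\<bar> powr \<alpha> = (\<Sum>i<k. \<bar>d i\<bar> powr \<alpha> * indicator (D i) x)" for x
  proof (cases "\<exists>i<k. x \<in> D i")
    case True
    then obtain i where i: "i < k" "x \<in> D i" by auto
    have ind: "indicator (D j) x = (if j = i then 1 else 0 :: real)" if "j < k" for j
      using disj i that by (auto simp: disjoint_family_on_def indicator_def)
    have "(\<Sum>j<k. h j * indicator (D j) x) = (\<Sum>j<k. if j = i then h j else 0)" for h :: "nat \<Rightarrow> real"
      by (intro sum.cong) (auto simp: ind)
    thus ?thesis using i(1) by (simp add: f)
  next
    case False
    hence "(\<Sum>j<k. h j * indicator (D j) x) = 0" for h :: "nat \<Rightarrow> real"
      by (intro sum.neutral) auto
    thus ?thesis by (simp add: f)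
  qed
  have iD: "integrable lborel (\<lambda>x. \<bar>d i\<bar> powr \<alpha> * indicator (D i) x)" if "i < k" for i
    using D[OF that] by (auto simp: finite_borel_def intro!: integrable_mult_right)
  have "integrable lborel (\<lambda>x. \<bar>f x\<bar> powr \<alpha>)"
    unfolding pf using iD by (intro Bochner_Integration.integrable_sum) simp
  thus "L_power \<alpha> f" unfolding L_power_def using simple_integral_measurable[OF assms] by simp
  have pwf: "pw \<alpha> f = (\<Sum>i<k. \<bar>d i\<bar> powr \<alpha> * measure lborel (D i))"
    unfolding pf using iD by (subst Bochner_Integration.integral_sum) (auto)
  have "(CLINT \<omega>|P. iexp (X \<omega>)) = (CLINT \<omega>|P. iexp (\<Sum>i<k. d i * \<Phi> (D i) \<omega>))"
  proof (rule integral_cong_AE)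
    show "AE \<omega> in P. iexp (X \<omega>) = iexp (\<Sum>i<k. d i * \<Phi> (D i) \<omega>)" using X by eventually_elim simp
  qed (auto simp del: of_real_sum)
  also have "\<dots> = char (distr P borel (\<lambda>\<omega>. \<Sum>i<k. d i * \<Phi> (D i) \<omega>)) 1"
    unfolding char_def by (subst integral_distr) (auto simp del: of_real_sum)
  also have "\<dots> = (\<Prod>i<k. char (distr P borel (\<lambda>\<omega>. d i * \<Phi> (D i) \<omega>)) 1)"
    by (intro char_distr_sum indep_vars_compose2[OF noise_indep[OF D disj]]) auto
  also have "\<dots> = (\<Prod>i<k. complex_of_real (exp (- (\<bar>d i\<bar> powr \<alpha> * measure lborel (D i)))))"
  proof (rule prod.cong)
    fix i assume "i \<in> {..<k}"
    hence i: "D i \<in> finite_borel" using D by auto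
    note [measurable] = noise_measurable[OF i]
    have "char (distr P borel (\<lambda>\<omega>. d i * \<Phi> (D i) \<omega>)) 1 = char (distr P borel (\<Phi> (D i))) (d i)"
      unfolding char_def by (simp add: integral_distr)
    also have "\<dots> = complex_of_real (exp (- (\<bar>d i\<bar> powr \<alpha> * measure lborel (D i))))"
      unfolding noise_char[OF i] by (simp add: mult.commute)
    finally show "char (distr P borel (\<lambda>\<omega>. d i * \<Phi> (D i) \<omega>)) 1 = \<dots>" .
  qed simp
  also have "\<dots> = complex_of_real (exp (- pw \<alpha> f))"
    unfolding pwf of_real_prod[symmetric] sum_negf[symmetric] by (simp only: exp_sum finite_lessThan)
  finally show "(CLINT \<omega>|P. iexp (X \<omega>)) = complex_of_real (exp (- pw \<alpha> f))" .
qed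

end

lemma iexp_diff_le: "cmod (iexp a - iexp b) \<le> \<bar>a - b\<bar>"
proof -
  have "iexp a - iexp b = iexp b * (iexp (a - b) - 1)"
    by (simp add: algebra_simps flip: exp_add)
  hence "cmod (iexp a - iexp b) = cmod (iexp (a - b) - 1)" by (simp add: norm_mult)
  also have "\<dots> \<le> \<bar>a - b\<bar>" using iexp_approx1[of "a - b" 0] by simp
  finally show ?thesis .
qed

lemma pw_disjoint_add:
  assumes "L_power \<alpha> f" "L_power \<alpha> g" "\<And>x. f x = 0 \<or> g x = 0"
  shows "pw \<alpha> (\<lambda>x. f x + g x) = pw \<alpha> f + pw \<alpha> g"
proof -
  have "pw \<alpha> (\<lambda>x. f x + g x) = (LINT x|lborel. \<bar>f x\<bar> powr \<alpha> + \<bar>g x\<bar> powr \<alpha>)"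
  proof (rule Bochner_Integration.integral_cong)
    fix x show "\<bar>f x + g x\<bar> powr \<alpha> = \<bar>f x\<bar> powr \<alpha> + \<bar>g x\<bar> powr \<alpha>"
      using assms(3)[of x] by auto
  qed simp
  also have "\<dots> = pw \<alpha> f + pw \<alpha> g"
    using assms by (intro Bochner_Integration.integral_add) (auto simp: L_power_def)
  finally show ?thesis .
qed

context stable_noise
begin

definition SI :: "(real \<Rightarrow> real) \<Rightarrow> ('w \<Rightarrow> real) \<Rightarrow> bool" where
  "SI f X \<longleftrightarrow> L_power \<alpha> f \<and> X \<in> borel_measurable P \<and>
    (\<forall>\<epsilon>>0. \<exists>g Y. simple_integral g Y \<and> pw \<alpha> (\<lambda>x. f x - g x) < \<epsilon> \<and>
      prob {\<omega>\<in>space P. \<epsilon> < \<bar>X \<omega> - Y \<omega>\<bar>} < \<epsilon>)"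

lemma SI_measurable: "SI f X \<Longrightarrow> X \<in> borel_measurable P"
  and SI_L_power: "SI f X \<Longrightarrow> L_power \<alpha> f"
  by (auto simp: SI_def)

lemma SI_approx:
  assumes "SI f X" "\<epsilon> > 0"
  obtains g Y where "simple_integral g Y" "pw \<alpha> (\<lambda>x. f x - g x) < \<epsilon>"
    "prob {\<omega>\<in>space P. \<epsilon> < \<bar>X \<omega> - Y \<omega>\<bar>} < \<epsilon>"
  using assms unfolding SI_def by blast

lemma SI_char:
  assumes X: "SI f X" shows "(CLINT \<omega>|P. iexp (X \<omega>)) = complex_of_real (exp (- pw \<alpha> f))"
proof -
  have "\<forall>\<epsilon>>0. \<exists>g Y. simple_integral g Y \<and> pw \<alpha> (\<lambda>x. f x - g x) < \<epsilon> \<and>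
      prob {\<omega>\<in>space P. \<epsilon> < \<bar>X \<omega> - Y \<omega>\<bar>} < \<epsilon>"
    using X unfolding SI_def by blast
  hence "\<forall>n. \<exists>g Y. simple_integral g Y \<and> pw \<alpha> (\<lambda>x. f x - g x) < 1 / real (Suc n) \<and>
      prob {\<omega>\<in>space P. 1 / real (Suc n) < \<bar>X \<omega> - Y \<omega>\<bar>} < 1 / real (Suc n)"
    by (intro allI) (erule allE, erule mp, simp)
  then obtain g Y where "\<forall>n. simple_integral (g n) (Y n) \<and> pw \<alpha> (\<lambda>x. f x - g n x) < 1 / real (Suc n) \<and>
      prob {\<omega>\<in>space P. 1 / real (Suc n) < \<bar>X \<omega> - Y n \<omega>\<bar>} < 1 / real (Suc n)"
    unfolding choice_iff by blast
  hence gY: "\<And>n. simple_integral (g n) (Y n)" and g: "\<And>n. pw \<alpha> (\<lambda>x. f x - g n x) < 1 / Suc n"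
    and Y: "\<And>n. prob {\<omega>\<in>space P. 1 / Suc n < \<bar>X \<omega> - Y n \<omega>\<bar>} < 1 / Suc n"
    by blast+
  note [measurable] = SI_measurable[OF X] simple_integral_measurable(1)[OF gY]
  have inv: "(\<lambda>n. 1 / real (Suc n)) \<longlonglongrightarrow> 0"
    using LIMSEQ_inverse_real_of_nat by (simp add: inverse_eq_divide)
  have "(\<lambda>n. pw \<alpha> (g n)) \<longlonglongrightarrow> pw \<alpha> f"
  proof (rule pw_tendsto)
    show "(\<lambda>n. pw \<alpha> (\<lambda>x. f x - g n x)) \<longlonglongrightarrow> 0"
      by (rule tendsto_sandwich[OF _ _ tendsto_const inv]) (auto intro!: always_eventually less_imp_le[OF g] simp del: of_nat_Suc)
  qed (use alpha SI_L_power[OF X] simple_integral_char(1)[OF gY] in auto)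
  hence "(\<lambda>n. complex_of_real (exp (- pw \<alpha> (g n)))) \<longlonglongrightarrow> complex_of_real (exp (- pw \<alpha> f))"
    by (intro tendsto_intros)
  hence 1: "(\<lambda>n. CLINT \<omega>|P. iexp (Y n \<omega>)) \<longlonglongrightarrow> complex_of_real (exp (- pw \<alpha> f))"
    by (simp only: simple_integral_char(2)[OF gY])
  have bd: "cmod ((CLINT \<omega>|P. iexp (Y n \<omega>)) - (CLINT \<omega>|P. iexp (X \<omega>))) \<le> 3 * (1 / Suc n)" for n
  proof -
    define E where "E = {\<omega>\<in>space P. 1 / Suc n < \<bar>X \<omega> - Y n \<omega>\<bar>}"
    have [measurable]: "E \<in> sets P" unfolding E_def by measurable
    have i: "integrable P (\<lambda>\<omega>. iexp (Y n \<omega>))" "integrable P (\<lambda>\<omega>. iexp (X \<omega>))"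
      by (auto intro!: integrable_const_bound[of _ 1])
    have iE: "integrable P (\<lambda>\<omega>. 1 / Suc n + 2 * indicator E \<omega>)"
      by (intro Bochner_Integration.integrable_add integrable_mult_right) (auto intro!: integrable_const_bound[of _ 1])
    have "cmod ((CLINT \<omega>|P. iexp (Y n \<omega>)) - (CLINT \<omega>|P. iexp (X \<omega>))) = cmod (CLINT \<omega>|P. iexp (Y n \<omega>) - iexp (X \<omega>))"
      using i by simp
    also have "\<dots> \<le> (LINT \<omega>|P. cmod (iexp (Y n \<omega>) - iexp (X \<omega>)))" by (rule integral_norm_bound)
    also have "\<dots> \<le> (LINT \<omega>|P. 1 / Suc n + 2 * indicator E \<omega>)"
    proof (rule integral_mono)
      fix \<omega> assume w: "\<omega> \<in> space P"
      show "cmod (iexp (Y n \<omega>) - iexp (X \<omega>)) \<le> 1 / Suc n + 2 * indicator E \<omega>"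
      proof (cases "\<omega> \<in> E")
        case True
        have "cmod (iexp (Y n \<omega>) - iexp (X \<omega>)) \<le> 1 + 1"
          by (rule norm_triangle_le_diff) simp
        also have "\<dots> \<le> 1 / Suc n + 2 * indicator E \<omega>" using True by simp
        finally show ?thesis .
      next
        case False
        thus ?thesis using iexp_diff_le[of "Y n \<omega>" "X \<omega>"] w by (auto simp: E_def abs_minus_commute)
      qed
    qed (use i iE in auto)
    also have "\<dots> = 1 / Suc n + 2 * prob E"
      by (subst Bochner_Integration.integral_add) (auto simp: prob_space emeasure_eq_measure)
    also have "\<dots> \<le> 3 * (1 / Suc n)" using Y[of n] unfolding E_def[symmetric] by linarith
    finally show ?thesis .
  qed
  have "(\<lambda>n. (CLINT \<omega>|P. iexp (Y n \<omega>)) - (CLINT \<omega>|P. iexp (X \<omega>))) \<longlonglongrightarrow> 0"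
    by (rule Lim_null_comparison[OF always_eventually, OF allI, OF bd]) (use tendsto_mult_left[OF inv, of 3] in simp)
  hence "(\<lambda>n. CLINT \<omega>|P. iexp (Y n \<omega>)) \<longlonglongrightarrow> (CLINT \<omega>|P. iexp (X \<omega>))" by (simp add: LIM_zero_iff)
  thus ?thesis using 1 LIMSEQ_unique by blast
qed

lemma half_powr_le: "(1/2) powr (1 - \<alpha>) \<le> 2"
proof -
  have "(1/2) powr (1 - \<alpha>) \<le> (1/2) powr (-1)" using alpha by (intro powr_mono') auto
  thus ?thesis by (simp add: powr_minus)
qed

lemma pw_add_le2:
  assumes "L_power \<alpha> f" "L_power \<alpha> g"
  shows "pw \<alpha> (\<lambda>x. f x + g x) \<le> 2 * pw \<alpha> f + 2 * pw \<alpha> g"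
proof -
  have "pw \<alpha> (\<lambda>x. f x + g x) \<le> (1/2) powr (1 - \<alpha>) * pw \<alpha> f + (1/2) powr (1 - \<alpha>) * pw \<alpha> g"
    using pw_add_le[OF _ assms, of "1/2"] alpha by simp
  also have "\<dots> \<le> 2 * pw \<alpha> f + 2 * pw \<alpha> g"
    using half_powr_le by (intro add_mono mult_right_mono) auto
  finally show ?thesis .
qed

lemma SI_simple: "simple_integral f X \<Longrightarrow> SI f X"
  unfolding SI_def
  by (auto intro!: simple_integral_char simple_integral_measurable exI[of _ f] exI[of _ X])

lemma SI_add:
  assumes "SI f X" "SI g Y" shows "SI (\<lambda>x. f x + g x) (\<lambda>\<omega>. X \<omega> + Y \<omega>)"
  unfolding SI_def
proof (intro conjI allI impI)
  note [measurable] = assms[THEN SI_measurable]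
  show "(\<lambda>\<omega>. X \<omega> + Y \<omega>) \<in> borel_measurable P" by measurable
  show "L_power \<alpha> (\<lambda>x. f x + g x)" using assms alpha by (intro L_power_add) (auto simp: SI_def)
  fix \<epsilon> :: real assume \<epsilon>: "\<epsilon> > 0"
  obtain f' X' where 1: "simple_integral f' X'" "pw \<alpha> (\<lambda>x. f x - f' x) < \<epsilon>/8"
    "prob {\<omega>\<in>space P. \<epsilon>/8 < \<bar>X \<omega> - X' \<omega>\<bar>} < \<epsilon>/8" using SI_approx[OF assms(1), of "\<epsilon>/8"] \<epsilon> by auto
  obtain g' Y' where 2: "simple_integral g' Y'" "pw \<alpha> (\<lambda>x. g x - g' x) < \<epsilon>/8"
    "prob {\<omega>\<in>space P. \<epsilon>/8 < \<bar>Y \<omega> - Y' \<omega>\<bar>} < \<epsilon>/8" using SI_approx[OF assms(2), of "\<epsilon>/8"] \<epsilon> by auto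
  note [measurable] = simple_integral_measurable(1)[OF 1(1)] simple_integral_measurable(1)[OF 2(1)]
  have "pw \<alpha> (\<lambda>x. (f x - f' x) + (g x - g' x)) \<le> 2 * pw \<alpha> (\<lambda>x. f x - f' x) + 2 * pw \<alpha> (\<lambda>x. g x - g' x)"
    using assms[THEN SI_L_power] alpha simple_integral_char(1)[OF 1(1)] simple_integral_char(1)[OF 2(1)]
    by (intro pw_add_le2 L_power_diff) auto
  also have "\<dots> < \<epsilon>" using 1 2 \<epsilon> by linarith
  also have "(\<lambda>x. (f x - f' x) + (g x - g' x)) = (\<lambda>x. f x + g x - (f' x + g' x))" by auto
  finally have pwlt: "pw \<alpha> (\<lambda>x. f x + g x - (f' x + g' x)) < \<epsilon>" .
  have "prob {\<omega>\<in>space P. \<epsilon> < \<bar>X \<omega> + Y \<omega> - (X' \<omega> + Y' \<omega>)\<bar>} \<le>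
      prob ({\<omega>\<in>space P. \<epsilon>/8 < \<bar>X \<omega> - X' \<omega>\<bar>} \<union> {\<omega>\<in>space P. \<epsilon>/8 < \<bar>Y \<omega> - Y' \<omega>\<bar>})"
    using \<epsilon> by (intro finite_measure_mono) (auto simp: abs_if split: if_splits)
  also have "\<dots> \<le> prob {\<omega>\<in>space P. \<epsilon>/8 < \<bar>X \<omega> - X' \<omega>\<bar>} + prob {\<omega>\<in>space P. \<epsilon>/8 < \<bar>Y \<omega> - Y' \<omega>\<bar>}"
    by (intro measure_Un_le) auto
  also have "\<dots> < \<epsilon>" using 1 2 \<epsilon> by linarith
  finally show "\<exists>h Z. simple_integral h Z \<and> pw \<alpha> (\<lambda>x. f x + g x - h x) < \<epsilon> \<and>
      prob {\<omega>\<in>space P. \<epsilon> < \<bar>X \<omega> + Y \<omega> - Z \<omega>\<bar>} < \<epsilon>"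
    using simple_integral_add[OF 1(1) 2(1)] pwlt by blast
qed

lemma SI_cmult:
  assumes "SI f X" shows "SI (\<lambda>x. c * f x) (\<lambda>\<omega>. c * X \<omega>)"
  unfolding SI_def
proof (intro conjI allI impI)
  note [measurable] = assms[THEN SI_measurable]
  show "(\<lambda>\<omega>. c * X \<omega>) \<in> borel_measurable P" by measurable
  show "L_power \<alpha> (\<lambda>x. c * f x)" using assms by (intro L_power_cmult) (auto simp: SI_def)
  fix \<epsilon> :: real assume \<epsilon>: "\<epsilon> > 0"
  define D where "D = 1 + \<bar>c\<bar> + \<bar>c\<bar> powr \<alpha>"
  have D: "D \<ge> 1" "\<bar>c\<bar> powr \<alpha> < D" "\<bar>c\<bar> \<le> D" "D > 0" by (auto simp: D_def intro: add_pos_nonneg add_nonneg_nonneg)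
  define \<delta> where "\<delta> = \<epsilon> / D"
  have \<delta>: "0 < \<delta>" "\<delta> \<le> \<epsilon>" "\<delta> * D = \<epsilon>" using D \<epsilon> by (auto simp: \<delta>_def divide_le_eq mult_le_cancel_left1)
  obtain f' X' where 1: "simple_integral f' X'" "pw \<alpha> (\<lambda>x. f x - f' x) < \<delta>"
    "prob {\<omega>\<in>space P. \<delta> < \<bar>X \<omega> - X' \<omega>\<bar>} < \<delta>" using SI_approx[OF assms(1) \<delta>(1)] by auto
  note [measurable] = simple_integral_measurable(1)[OF 1(1)]
  have "pw \<alpha> (\<lambda>x. c * (f x - f' x)) = \<bar>c\<bar> powr \<alpha> * pw \<alpha> (\<lambda>x. f x - f' x)" by (rule pw_cmult)
  also have "\<dots> \<le> \<bar>c\<bar> powr \<alpha> * \<delta>" using 1 by (intro mult_left_mono) auto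
  also have "\<dots> < D * \<delta>" using D \<delta> by (intro mult_strict_right_mono) auto
  finally have pwlt: "pw \<alpha> (\<lambda>x. c * f x - c * f' x) < \<epsilon>" using \<delta> by (simp add: right_diff_distrib mult.commute)
  have "prob {\<omega>\<in>space P. \<epsilon> < \<bar>c * X \<omega> - c * X' \<omega>\<bar>} \<le> prob {\<omega>\<in>space P. \<delta> < \<bar>X \<omega> - X' \<omega>\<bar>}"
  proof (intro finite_measure_mono subsetI CollectI conjI)
    fix \<omega> assume "\<omega> \<in> {\<omega>\<in>space P. \<epsilon> < \<bar>c * X \<omega> - c * X' \<omega>\<bar>}"
    hence w: "\<omega> \<in> space P" and "\<epsilon> < \<bar>c\<bar> * \<bar>X \<omega> - X' \<omega>\<bar>"
      by (auto simp: abs_mult[symmetric] right_diff_distrib)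
    hence "\<delta> * D < \<bar>c\<bar> * \<bar>X \<omega> - X' \<omega>\<bar>" using \<delta> by simp
    also have "\<dots> \<le> D * \<bar>X \<omega> - X' \<omega>\<bar>" using D by (intro mult_right_mono) auto
    finally show "\<delta> < \<bar>X \<omega> - X' \<omega>\<bar>" using D by (simp add: mult.commute)
    show "\<omega> \<in> space P" by fact
  qed measurable
  also have "\<dots> < \<epsilon>" using 1 \<delta> by linarith
  finally show "\<exists>h Z. simple_integral h Z \<and> pw \<alpha> (\<lambda>x. c * f x - h x) < \<epsilon> \<and>
      prob {\<omega>\<in>space P. \<epsilon> < \<bar>c * X \<omega> - Z \<omega>\<bar>} < \<epsilon>"
    using simple_integral_cmult[OF 1(1), of c] pwlt by blast
qed

lemma SI_sum:
  assumes "finite I" "\<And>i. i \<in> I \<Longrightarrow> SI (f i) (X i)"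
  shows "SI (\<lambda>x. \<Sum>i\<in>I. u i * f i x) (\<lambda>\<omega>. \<Sum>i\<in>I. u i * X i \<omega>)"
  using assms
proof (induction rule: finite_induct)
  case empty
  show ?case using SI_simple[OF simple_integral.zero] by simp
next
  case (insert i I)
  have "SI (\<lambda>x. u i * f i x + (\<Sum>i\<in>I. u i * f i x)) (\<lambda>\<omega>. u i * X i \<omega> + (\<Sum>i\<in>I. u i * X i \<omega>))"
    using insert by (intro SI_add SI_cmult) auto
  thus ?case using insert.hyps by simp
qed

lemma SI_char1:
  assumes "SI f X"
  shows "char (distr P borel X) u = complex_of_real (exp (- (pw \<alpha> f * \<bar>u\<bar> powr \<alpha>)))"
proof -
  note [measurable] = SI_measurable[OF assms]
  have "char (distr P borel X) u = (CLINT \<omega>|P. iexp (u * X \<omega>))"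
    unfolding char_def by (subst integral_distr) auto
  also have "\<dots> = complex_of_real (exp (- (pw \<alpha> f * \<bar>u\<bar> powr \<alpha>)))"
    unfolding SI_char[OF SI_cmult[OF assms]] pw_cmult by (simp only: mult.commute)
  finally show ?thesis .
qed

theorem SI_law:
  assumes I: "finite I" and X: "\<And>i. i \<in> I \<Longrightarrow> SI (f i) (X i)" and Y: "\<And>i. i \<in> I \<Longrightarrow> SI (g i) (Y i)"
    and eq: "\<And>u. pw \<alpha> (\<lambda>x. \<Sum>i\<in>I. u i * f i x) = pw \<alpha> (\<lambda>x. \<Sum>i\<in>I. u i * g i x)"
  shows "distr P (PiM I (\<lambda>_. borel)) (\<lambda>x. \<lambda>i\<in>I. X i x) = distr P (PiM I (\<lambda>_. borel)) (\<lambda>x. \<lambda>i\<in>I. Y i x)"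
  using SI_char[OF SI_sum[OF I X]] SI_char[OF SI_sum[OF I Y]] eq
  by (intro joint_char_unique) (auto intro: prob_space_axioms I SI_measurable X Y simp del: of_real_sum)

theorem SI_indep:
  assumes IJ: "finite I" "finite J" and X: "\<And>i. i \<in> I \<Longrightarrow> SI (f i) (X i)" and Y: "\<And>j. j \<in> J \<Longrightarrow> SI (g j) (Y j)"
    and f: "\<And>i x. i \<in> I \<Longrightarrow> x \<notin> B \<Longrightarrow> f i x = 0" and g: "\<And>j x. j \<in> J \<Longrightarrow> x \<in> B \<Longrightarrow> g j x = 0"
  shows "distr P (PiM I (\<lambda>_. borel) \<Otimes>\<^sub>M PiM J (\<lambda>_. borel)) (\<lambda>x. (\<lambda>i\<in>I. X i x, \<lambda>j\<in>J. Y j x)) =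
    distr P (PiM I (\<lambda>_. borel)) (\<lambda>x. \<lambda>i\<in>I. X i x) \<Otimes>\<^sub>M distr P (PiM J (\<lambda>_. borel)) (\<lambda>x. \<lambda>j\<in>J. Y j x)"
proof (rule joint_char_indep)
  fix u w
  note S = SI_sum[OF IJ(1) X, of "\<lambda>i. i" u] SI_sum[OF IJ(2) Y, of "\<lambda>i. i" w]
  have "pw \<alpha> (\<lambda>x. (\<Sum>i\<in>I. u i * f i x) + (\<Sum>j\<in>J. w j * g j x)) =
      pw \<alpha> (\<lambda>x. \<Sum>i\<in>I. u i * f i x) + pw \<alpha> (\<lambda>x. \<Sum>j\<in>J. w j * g j x)"
  proof (rule pw_disjoint_add)
    fix x show "(\<Sum>i\<in>I. u i * f i x) = 0 \<or> (\<Sum>j\<in>J. w j * g j x) = 0"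
      using f g by (cases "x \<in> B") (auto intro: sum.neutral)
  qed (auto intro!: SI_L_power S)
  thus "(CLINT x|P. iexp ((\<Sum>i\<in>I. u i * X i x) + (\<Sum>j\<in>J. w j * Y j x))) =
       (CLINT x|P. iexp (\<Sum>i\<in>I. u i * X i x)) * (CLINT x|P. iexp (\<Sum>j\<in>J. w j * Y j x))"
    using SI_char[OF SI_add[OF S]] SI_char[OF S(1)] SI_char[OF S(2)]
    by (simp only: exp_add[symmetric] of_real_mult[symmetric] minus_add_distrib add.commute)
qed (auto intro: prob_space_axioms IJ SI_measurable X Y)

lemma SI_tail:
  assumes "SI f X" "0 < \<delta>" "\<delta> \<le> 1"
  shows "prob {\<omega>\<in>space P. \<delta> < \<bar>X \<omega>\<bar>} \<le> 64 / \<alpha> * pw \<alpha> f / \<delta>\<^sup>2"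
proof -
  note [measurable] = SI_measurable[OF assms(1)]
  define p where "p = \<alpha> / 2"
  have p: "0 < p" "p < \<alpha>" "\<alpha> - p = \<alpha> / 2" using alpha by (auto simp: p_def)
  have "real_distribution (distr P borel X)" by (rule real_distribution_distr) simp
  note M = stable_wsq_bound[OF this SI_char1[OF assms(1)] pw_nonneg p(1,2)]
  have i: "integrable P (\<lambda>\<omega>. wsq p (X \<omega>))" using M(1) by (simp add: integrable_distr_eq)
  have "prob {\<omega>\<in>space P. \<delta> < \<bar>X \<omega>\<bar>} \<le> prob {\<omega>\<in>space P. \<delta>\<^sup>2 \<le> wsq p (X \<omega>)}"
  proof (intro finite_measure_mono subsetI CollectI conjI)
    fix \<omega> assume "\<omega> \<in> {\<omega>\<in>space P. \<delta> < \<bar>X \<omega>\<bar>}"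
    hence w: "\<omega> \<in> space P" "\<delta> < \<bar>X \<omega>\<bar>" by auto
    show "\<delta>\<^sup>2 \<le> wsq p (X \<omega>)"
    proof (cases "\<bar>X \<omega>\<bar> \<le> 1")
      case True
      thus ?thesis using w assms power_mono[of \<delta> "\<bar>X \<omega>\<bar>" 2] by (simp add: wsq_def)
    next
      case False
      have "\<delta>\<^sup>2 \<le> 1" using assms by (simp add: power_le_one)
      also have "1 \<le> \<bar>X \<omega>\<bar> powr p" using False p by (intro ge_one_powr_ge_zero) auto
      finally show ?thesis using False by (simp add: wsq_def)
    qed
    show "\<omega> \<in> space P" by fact
  qed measurable
  also have "\<dots> \<le> (LINT \<omega>|P. wsq p (X \<omega>)) / \<delta>\<^sup>2"
    using i assms by (intro integral_Markov_inequality_measure[where A="{}"]) auto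
  also have "(LINT \<omega>|P. wsq p (X \<omega>)) = (LINT y|distr P borel X. wsq p y)" by (subst integral_distr) auto
  also have "\<dots> / \<delta>\<^sup>2 \<le> 32 / (\<alpha> - p) * pw \<alpha> f / \<delta>\<^sup>2" using M(2) by (intro divide_right_mono) auto
  finally show ?thesis using p alpha by simp
qed

lemma SI_exists:
  assumes f: "L_power \<alpha> f" and app: "\<And>\<epsilon>. \<epsilon> > 0 \<Longrightarrow> \<exists>g Y. simple_integral g Y \<and> pw \<alpha> (\<lambda>x. f x - g x) < \<epsilon>"
  shows "\<exists>X. SI f X"
proof -
  have "\<forall>n::nat. \<exists>g Y. simple_integral g Y \<and> pw \<alpha> (\<lambda>x. f x - g x) < (1/8) ^ n"
    by (intro allI app) simp
  then obtain g Y where "\<forall>n. simple_integral (g n) (Y n) \<and> pw \<alpha> (\<lambda>x. f x - g n x) < (1/8) ^ n"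
    unfolding choice_iff by blast
  hence gY: "\<And>n. simple_integral (g n) (Y n)" and g: "\<And>n. pw \<alpha> (\<lambda>x. f x - g n x) < (1/8) ^ n"
    by blast+
  note [measurable] = simple_integral_measurable(1)[OF gY]
  have Lg: "L_power \<alpha> (g n)" for n using simple_integral_char(1)[OF gY] .
  define E where "E n = {\<omega>\<in>space P. (1/2) ^ n < \<bar>Y n \<omega> - Y (Suc n) \<omega>\<bar>}" for n
  have [measurable]: "E n \<in> sets P" for n unfolding E_def by measurable
  have PE: "prob (E n) \<le> 256 / \<alpha> * (1/2) ^ n" for n
  proof -
    have S: "SI (\<lambda>x. g n x + -1 * g (Suc n) x) (\<lambda>\<omega>. Y n \<omega> + -1 * Y (Suc n) \<omega>)"
      by (intro SI_add SI_cmult SI_simple gY)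
    have "pw \<alpha> (\<lambda>x. (f x - g (Suc n) x) + -1 * (f x - g n x)) \<le> 2 * pw \<alpha> (\<lambda>x. f x - g (Suc n) x) + 2 * pw \<alpha> (\<lambda>x. -1 * (f x - g n x))"
      using alpha by (intro pw_add_le2 L_power_cmult L_power_diff f Lg) auto
    also have "pw \<alpha> (\<lambda>x. -1 * (f x - g n x)) = pw \<alpha> (\<lambda>x. f x - g n x)" unfolding pw_cmult by simp
    also have "2 * pw \<alpha> (\<lambda>x. f x - g (Suc n) x) + 2 * pw \<alpha> (\<lambda>x. f x - g n x) \<le> 4 * (1/8) ^ n"
    proof -
      have "(1/8::real) ^ Suc n = (1/8) ^ n / 8" "(0::real) \<le> (1/8) ^ n" by simp_all
      thus ?thesis using g[of n] g[of "Suc n"] by linarith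
    qed
    finally have d: "pw \<alpha> (\<lambda>x. g n x + -1 * g (Suc n) x) \<le> 4 * (1/8) ^ n" by (simp add: algebra_simps)
    have "prob (E n) \<le> 64 / \<alpha> * pw \<alpha> (\<lambda>x. g n x + -1 * g (Suc n) x) / ((1/2) ^ n)\<^sup>2"
      using SI_tail[OF S, of "(1/2)^n"] unfolding E_def by (simp add: power_le_one)
    also have "\<dots> \<le> 64 / \<alpha> * (4 * (1/8) ^ n) / ((1/2) ^ n)\<^sup>2"
      using alpha by (intro divide_right_mono mult_left_mono d) auto
    also have "\<dots> = 256 / \<alpha> * (1/2) ^ n"
    proof -
      have "(1/8::real) ^ n = (1/2) ^ n * ((1/2) ^ n)\<^sup>2"
        unfolding power2_eq_square power_mult_distrib[symmetric] by simp
      thus ?thesis by simp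
    qed
    finally show ?thesis .
  qed
  have "summable (\<lambda>n. prob (E n))"
  proof (rule summable_comparison_test_ev[OF always_eventually])
    show "\<forall>n. norm (prob (E n)) \<le> 256 / \<alpha> * (1/2) ^ n" using PE by simp
  qed (intro summable_mult summable_geometric, simp)
  hence AEe: "AE \<omega> in P. eventually (\<lambda>n. \<omega> \<in> space P - E n) sequentially"
    by (intro borel_cantelli_AE1) (auto simp: emeasure_eq_measure)
  have AEc: "AE \<omega> in P. convergent (\<lambda>n. Y n \<omega>)"
    using AEe
  proof eventually_elim
    case (elim \<omega>)
    hence "\<forall>\<^sub>F n in sequentially. norm (Y (Suc n) \<omega> - Y n \<omega>) \<le> (1/2) ^ n"
      by eventually_elim (auto simp: E_def abs_minus_commute)
    hence "summable (\<lambda>n. Y (Suc n) \<omega> - Y n \<omega>)"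
      by (rule summable_comparison_test_ev) (auto intro: summable_geometric)
    hence "convergent (\<lambda>n. (\<Sum>i<n. Y (Suc i) \<omega> - Y i \<omega>) + Y 0 \<omega>)"
      unfolding summable_iff_convergent by (intro convergent_add convergent_const)
    moreover have "(\<lambda>n. (\<Sum>i<n. Y (Suc i) \<omega> - Y i \<omega>) + Y 0 \<omega>) = (\<lambda>n. Y n \<omega>)"
    proof
      show "(\<Sum>i<n. Y (Suc i) \<omega> - Y i \<omega>) + Y 0 \<omega> = Y n \<omega>" for n
        by (induction n) auto
    qed
    ultimately show ?case by simp
  qed
  define X where "X \<omega> = lim (\<lambda>n. Y n \<omega>)" for \<omega>
  have [measurable]: "X \<in> borel_measurable P" unfolding X_def by measurable
  have AEl: "AE \<omega> in P. (\<lambda>n. Y n \<omega>) \<longlonglongrightarrow> X \<omega>"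
    using AEc by eventually_elim (simp add: X_def convergent_LIMSEQ_iff)
  have "(\<lambda>n. LINT \<omega>|P. min 1 \<bar>X \<omega> - Y n \<omega>\<bar>) \<longlonglongrightarrow> (LINT \<omega>|P. 0)"
  proof (rule integral_dominated_convergence[where w="\<lambda>_. 1"])
    show "AE \<omega> in P. (\<lambda>n. min 1 \<bar>X \<omega> - Y n \<omega>\<bar>) \<longlonglongrightarrow> 0"
      using AEl
    proof eventually_elim
      case (elim \<omega>)
      have "(\<lambda>n. min 1 \<bar>X \<omega> - Y n \<omega>\<bar>) \<longlonglongrightarrow> min 1 \<bar>X \<omega> - X \<omega>\<bar>" by (intro tendsto_intros elim)
      thus ?case by simp
    qed
  qed auto
  hence m0: "(\<lambda>n. LINT \<omega>|P. min 1 \<bar>X \<omega> - Y n \<omega>\<bar>) \<longlonglongrightarrow> 0" by simp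
  have "SI f X" unfolding SI_def
  proof (intro conjI allI impI f)
    show "X \<in> borel_measurable P" by measurable
    fix \<epsilon> :: real assume \<epsilon>: "\<epsilon> > 0"
    define e where "e = min \<epsilon> 1"
    have e: "0 < e" "e \<le> \<epsilon>" "e \<le> 1" using \<epsilon> by (auto simp: e_def)
    have "\<forall>\<^sub>F n in sequentially. (LINT \<omega>|P. min 1 \<bar>X \<omega> - Y n \<omega>\<bar>) < e * e"
      using e by (intro order_tendstoD[OF m0]) auto
    moreover have "\<forall>\<^sub>F n in sequentially. (1/8::real) ^ n < \<epsilon>"
      using \<epsilon> by (intro order_tendstoD(2)[OF LIMSEQ_realpow_zero]) auto
    ultimately obtain n where n: "(LINT \<omega>|P. min 1 \<bar>X \<omega> - Y n \<omega>\<bar>) < e * e" "(1/8::real) ^ n < \<epsilon>"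
      using eventually_happens[OF eventually_conj] by force
    have "prob {\<omega>\<in>space P. \<epsilon> < \<bar>X \<omega> - Y n \<omega>\<bar>} \<le> prob {\<omega>\<in>space P. e \<le> min 1 \<bar>X \<omega> - Y n \<omega>\<bar>}"
      using e by (intro finite_measure_mono) auto
    also have "\<dots> \<le> (LINT \<omega>|P. min 1 \<bar>X \<omega> - Y n \<omega>\<bar>) / e"
      using e by (intro integral_Markov_inequality_measure[where A="{}"]) (auto intro!: integrable_const_bound[of _ 1])
    also have "\<dots> < e" using n e by (simp add: divide_less_eq)
    finally have "prob {\<omega>\<in>space P. \<epsilon> < \<bar>X \<omega> - Y n \<omega>\<bar>} < \<epsilon>" using e by linarith
    moreover have "pw \<alpha> (\<lambda>x. f x - g n x) < \<epsilon>" using g[of n] n by linarith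
    ultimately show "\<exists>g Y. simple_integral g Y \<and> pw \<alpha> (\<lambda>x. f x - g x) < \<epsilon> \<and>
        prob {\<omega>\<in>space P. \<epsilon> < \<bar>X \<omega> - Y \<omega>\<bar>} < \<epsilon>" using gY by blast
  qed
  thus ?thesis by blast
qed

lemma SI_restrict:
  assumes X: "SI f X" and B: "B \<in> sets borel"
  shows "\<exists>Y. SI (\<lambda>x. indicator B x * f x) Y"
proof (rule SI_exists)
  show "L_power \<alpha> (\<lambda>x. indicator B x * f x)" using SI_L_power[OF X] B by (rule L_power_indicator)
  fix \<epsilon> :: real assume "\<epsilon> > 0"
  then obtain g Y where g: "simple_integral g Y" "pw \<alpha> (\<lambda>x. f x - g x) < \<epsilon>"
    using SI_approx[OF X] by metis
  have L: "L_power \<alpha> (\<lambda>x. f x - g x)"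
    using alpha SI_L_power[OF X] simple_integral_char(1)[OF g(1)] by (intro L_power_diff) auto
  have "pw \<alpha> (\<lambda>x. indicator B x * (f x - g x)) \<le> pw \<alpha> (\<lambda>x. f x - g x)"
    using L L_power_indicator[OF L B]
    by (intro integral_mono) (auto simp: L_power_def split: split_indicator)
  hence "pw \<alpha> (\<lambda>x. indicator B x * f x - indicator B x * g x) < \<epsilon>" using g by (simp add: right_diff_distrib)
  thus "\<exists>h Y. simple_integral h Y \<and> pw \<alpha> (\<lambda>x. indicator B x * f x - h x) < \<epsilon>"
    using simple_integral_restrict[OF g(1) B] by blast
qed

lemma SI_stable_integral:
  assumes "is_stable_integral P \<alpha> \<Phi> f X" shows "SI f X"
proof -
  obtain k :: "nat \<Rightarrow> nat" and c A where X: "L_power \<alpha> f" "X \<in> borel_measurable P"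
    and A: "\<And>j i. i < k j \<Longrightarrow> A j i \<in> finite_borel"
    and l1: "(\<lambda>j. pw \<alpha> (\<lambda>x. f x - (\<Sum>i<k j. c j i * indicator (A j i) x))) \<longlonglongrightarrow> 0"
    and l2: "\<And>\<epsilon>. \<epsilon> > 0 \<Longrightarrow> (\<lambda>j. prob {\<omega> \<in> space P. \<bar>X \<omega> - (\<Sum>i<k j. c j i * \<Phi> (A j i) \<omega>)\<bar> > \<epsilon>}) \<longlonglongrightarrow> 0"
    using assms unfolding is_stable_integral_def by blast
  show ?thesis unfolding SI_def
  proof (intro conjI X allI impI)
    fix \<epsilon> :: real assume \<epsilon>: "\<epsilon> > 0"
    have "\<forall>\<^sub>F j in sequentially. pw \<alpha> (\<lambda>x. f x - (\<Sum>i<k j. c j i * indicator (A j i) x)) < \<epsilon> \<and>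
      prob {\<omega> \<in> space P. \<bar>X \<omega> - (\<Sum>i<k j. c j i * \<Phi> (A j i) \<omega>)\<bar> > \<epsilon>} < \<epsilon>"
      using \<epsilon> by (intro eventually_conj order_tendstoD(2)[OF l1] order_tendstoD(2)[OF l2]) auto
    then obtain j where "pw \<alpha> (\<lambda>x. f x - (\<Sum>i<k j. c j i * indicator (A j i) x)) < \<epsilon> \<and>
      prob {\<omega> \<in> space P. \<bar>X \<omega> - (\<Sum>i<k j. c j i * \<Phi> (A j i) \<omega>)\<bar> > \<epsilon>} < \<epsilon>"
      using eventually_happens by force
    thus "\<exists>g Y. simple_integral g Y \<and> pw \<alpha> (\<lambda>x. f x - g x) < \<epsilon> \<and>
        prob {\<omega>\<in>space P. \<epsilon> < \<bar>X \<omega> - Y \<omega>\<bar>} < \<epsilon>"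
      using simple_integral_sum[of "k j" "A j" "c j", OF A] by blast
  qed
qed

end

section \<open>Central limit theorem by block approximation\<close>

lemma L2_mult_integrable:
  fixes f g :: "'a \<Rightarrow> real"
  assumes [measurable]: "f \<in> borel_measurable M" "g \<in> borel_measurable M"
    and f: "integrable M (\<lambda>x. (f x)\<^sup>2)" and g: "integrable M (\<lambda>x. (g x)\<^sup>2)"
  shows "integrable M (\<lambda>x. f x * g x)"
proof (rule Bochner_Integration.integrable_bound[OF Bochner_Integration.integrable_add[OF f g] _ AE_I2])
  fix x
  have "2 * \<bar>f x * g x\<bar> \<le> (f x)\<^sup>2 + (g x)\<^sup>2"
    using sum_squares_bound[of "\<bar>f x\<bar>" "\<bar>g x\<bar>"] by (simp add: abs_mult)
  moreover have "0 \<le> \<bar>f x * g x\<bar>" by simp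
  ultimately show "norm (f x * g x) \<le> norm ((f x)\<^sup>2 + (g x)\<^sup>2)" by simp
qed measurable

lemma L2_add_integrable:
  fixes f g :: "'a \<Rightarrow> real"
  assumes "f \<in> borel_measurable M" "g \<in> borel_measurable M"
    and "integrable M (\<lambda>x. (f x)\<^sup>2)" and "integrable M (\<lambda>x. (g x)\<^sup>2)"
  shows "integrable M (\<lambda>x. (f x + g x)\<^sup>2)"
  using assms(3,4) L2_mult_integrable[OF assms] by (simp add: power2_sum mult.assoc)

lemma L2_cmult_integrable:
  fixes f :: "'a \<Rightarrow> real"
  assumes "integrable M (\<lambda>x. (f x)\<^sup>2)" shows "integrable M (\<lambda>x. (c * f x)\<^sup>2)"
  using assms by (simp add: power_mult_distrib)

lemma L2_diff_integrable:
  fixes f g :: "'a \<Rightarrow> real"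
  assumes "f \<in> borel_measurable M" "g \<in> borel_measurable M"
    and "integrable M (\<lambda>x. (f x)\<^sup>2)" and "integrable M (\<lambda>x. (g x)\<^sup>2)"
  shows "integrable M (\<lambda>x. (f x - g x)\<^sup>2)"
  using assms(3,4) L2_mult_integrable[OF assms] by (simp add: power2_diff mult.assoc)

lemma L2_sum_integrable:
  fixes f :: "'i \<Rightarrow> 'a \<Rightarrow> real"
  assumes "finite A" "\<And>i. i \<in> A \<Longrightarrow> f i \<in> borel_measurable M"
    and "\<And>i. i \<in> A \<Longrightarrow> integrable M (\<lambda>x. (f i x)\<^sup>2)"
  shows "integrable M (\<lambda>x. (\<Sum>i\<in>A. f i x)\<^sup>2)"
  using assms
proof (induction rule: finite_induct)
  case (insert i A)
  have "integrable M (\<lambda>x. (f i x + (\<Sum>i\<in>A. f i x))\<^sup>2)"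
    using insert by (intro L2_add_integrable) auto
  thus ?case using insert.hyps by simp
qed simp

lemma Cauchy_Schwarz_integral:
  fixes f g :: "'a \<Rightarrow> real"
  assumes [measurable]: "f \<in> borel_measurable M" "g \<in> borel_measurable M"
    and f: "integrable M (\<lambda>x. (f x)\<^sup>2)" and g: "integrable M (\<lambda>x. (g x)\<^sup>2)"
  shows "\<bar>LINT x|M. f x * g x\<bar> \<le> sqrt (LINT x|M. (f x)\<^sup>2) * sqrt (LINT x|M. (g x)\<^sup>2)"
proof -
  define a where "a = sqrt (LINT x|M. (f x)\<^sup>2)"
  define b where "b = sqrt (LINT x|M. (g x)\<^sup>2)"
  have a2: "(LINT x|M. (f x)\<^sup>2) = a\<^sup>2" and b2: "(LINT x|M. (g x)\<^sup>2) = b\<^sup>2" and ab: "a \<ge> 0" "b \<ge> 0"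
    by (auto simp: a_def b_def integral_nonneg_AE)
  have z: "(LINT x|M. h x * k x) = 0" if "(LINT x|M. (h x)\<^sup>2) = 0" "integrable M (\<lambda>x. (h x)\<^sup>2)"
    for h k :: "'a \<Rightarrow> real"
  proof (rule integral_eq_zero_AE)
    have "AE x in M. (h x)\<^sup>2 = 0" using that by (subst (asm) integral_nonneg_eq_0_iff_AE) auto
    thus "AE x in M. h x * k x = 0" by eventually_elim simp
  qed
  show ?thesis
  proof (cases "a = 0 \<or> b = 0")
    case True
    hence "(LINT x|M. f x * g x) = 0"
      using z[of f g] z[of g f] f g a2 b2 by (auto simp: mult.commute)
    thus ?thesis using ab by (simp flip: a_def b_def)
  next
    case False
    hence ab': "a > 0" "b > 0" using ab by auto
    have i: "integrable M (\<lambda>x. (b / a * (f x)\<^sup>2 + a / b * (g x)\<^sup>2) / 2)" using f g by simp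
    have "\<bar>LINT x|M. f x * g x\<bar> \<le> (LINT x|M. \<bar>f x * g x\<bar>)" by (rule integral_abs_bound)
    also have "\<dots> \<le> (LINT x|M. (b / a * (f x)\<^sup>2 + a / b * (g x)\<^sup>2) / 2)"
    proof (rule integral_mono[OF integrable_abs[OF L2_mult_integrable[OF assms]] i])
      fix x
      define p where "p = sqrt (b / a) * \<bar>f x\<bar>"
      define q where "q = sqrt (a / b) * \<bar>g x\<bar>"
      have "sqrt (b / a) * sqrt (a / b) = 1" using ab' by (simp flip: real_sqrt_mult)
      hence "p * q = \<bar>f x * g x\<bar>" by (simp add: p_def q_def abs_mult)
      moreover have "p\<^sup>2 = b / a * (f x)\<^sup>2" "q\<^sup>2 = a / b * (g x)\<^sup>2"
        using ab' by (simp_all add: p_def q_def power_mult_distrib)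
      ultimately show "\<bar>f x * g x\<bar> \<le> (b / a * (f x)\<^sup>2 + a / b * (g x)\<^sup>2) / 2"
        using sum_squares_bound[of p q] by simp
    qed
    also have "\<dots> = (b / a * a\<^sup>2 + a / b * b\<^sup>2) / 2" using f g by (simp add: a2 b2)
    also have "\<dots> = a * b" using ab' by (simp add: power2_eq_square)
    finally show ?thesis by (simp flip: a_def b_def)
  qed
qed

lemma cesaro_mean:
  fixes a :: "nat \<Rightarrow> real"
  assumes "a \<longlonglongrightarrow> L" shows "(\<lambda>N. (\<Sum>n<N. a n) / real N) \<longlonglongrightarrow> L"
proof (rule LIMSEQ_I)
  fix e :: real assume e: "e > 0"
  obtain N0 where N0: "\<And>n. n \<ge> N0 \<Longrightarrow> \<bar>a n - L\<bar> < e / 2"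
    using LIMSEQ_D[OF assms, of "e/2"] e by auto
  define B where "B = (\<Sum>n<N0. \<bar>a n - L\<bar>)"
  obtain N1 where N1: "2 * B / e < real N1" using reals_Archimedean2 by blast
  show "\<exists>no. \<forall>n\<ge>no. norm ((\<Sum>n<n. a n) / real n - L) < e"
  proof (intro exI[of _ "max (Suc N0) (Suc N1)"] allI impI)
    fix n assume n: "max (Suc N0) (Suc N1) \<le> n"
    hence pos: "real n > 0" by simp
    have Bn: "B < e / 2 * n"
    proof -
      have "2 * B / e < real n" using N1 n by linarith
      thus ?thesis using e by (simp add: field_simps)
    qed
    have "(\<Sum>i<n. a i) / real n - L = (\<Sum>i<n. a i - L) / real n"
      using pos by (simp add: sum_subtractf field_simps)
    hence "norm ((\<Sum>i<n. a i) / real n - L) \<le> (\<Sum>i<n. \<bar>a i - L\<bar>) / real n"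
      using pos by (simp add: divide_right_mono)
    also have "(\<Sum>i<n. \<bar>a i - L\<bar>) = B + (\<Sum>i\<in>{N0..<n}. \<bar>a i - L\<bar>)"
    using sum.atLeastLessThan_concat[of 0 N0 n "\<lambda>i. \<bar>a i - L\<bar>"] n by (simp add: B_def lessThan_atLeast0)
    also have "(\<Sum>i\<in>{N0..<n}. \<bar>a i - L\<bar>) \<le> (\<Sum>i\<in>{N0..<n}. e / 2)"
      using N0 by (intro sum_mono) (auto intro: less_imp_le)
    also have "\<dots> \<le> n * (e / 2)" using e by simp
    finally have "norm ((\<Sum>i<n. a i) / real n - L) \<le> (B + n * (e / 2)) / n"
      using pos by (simp add: divide_right_mono)
    also have "\<dots> < e"
    proof -
      have "e * n = n * (e / 2) + n * (e / 2)" "e / 2 * n = n * (e / 2)" by simp_all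
      thus ?thesis unfolding pos_divide_less_eq[OF pos] using Bn by linarith
    qed
    finally show "norm ((\<Sum>i<n. a i) / real n - L) < e" .
  qed
qed

lemma abs_exp_diff_le:
  fixes x y :: real assumes "0 \<le> x" "0 \<le> y" shows "\<bar>exp (- x) - exp (- y)\<bar> \<le> \<bar>x - y\<bar>"
proof -
  have *: "\<bar>exp (- x) - exp (- y)\<bar> \<le> y - x" if "0 \<le> x" "x \<le> y" for x y :: real
  proof -
    define d where "d = y - x"
    have "exp (- x) - exp (- y) = exp (- x) * (1 - exp (- d))" by (simp add: d_def algebra_simps flip: exp_add)
    also have "\<dots> \<le> 1 * (1 - exp (- d))" using that by (intro mult_right_mono) (auto simp: d_def)
    also have "\<dots> \<le> d"
      using exp_ge_add_one_self[of "- d"] by (simp only: mult_1 diff_le_eq add_uminus_conv_diff add.commute)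
    also have "d = y - x" by (rule d_def)
    finally show ?thesis using that by simp
  qed
  show ?thesis using *[of x y] *[of y x] assms by (cases "x \<le> y") (auto simp: abs_minus_commute)
qed

lemma exp_minus_approx:
  fixes y :: real assumes "0 \<le> y" shows "\<bar>exp (- y) - (1 + - y)\<bar> \<le> y\<^sup>2"
proof -
  have "exp (- y) \<le> 1 / (1 + y)"
    using exp_ge_add_one_self[of y] assms by (simp add: exp_minus inverse_eq_divide frac_le)
  also have "\<dots> \<le> 1 - y + y\<^sup>2"
  proof -
    have "0 \<le> y ^ 3" using assms by simp
    hence "1 \<le> (1 - y + y\<^sup>2) * (1 + y)" by (simp add: algebra_simps power2_eq_square power3_eq_cube)
    thus ?thesis using assms by (simp add: pos_divide_le_eq)
  qed
  finally show ?thesis using exp_ge_add_one_self[of "- y"] by linarith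
qed

lemma (in prob_space) char_L2_diff:
  fixes X Y :: "'a \<Rightarrow> real"
  assumes [measurable]: "X \<in> borel_measurable M" "Y \<in> borel_measurable M"
    and i2: "integrable M (\<lambda>x. (X x - Y x)\<^sup>2)"
  shows "cmod ((CLINT x|M. iexp (X x)) - (CLINT x|M. iexp (Y x))) \<le> sqrt (expectation (\<lambda>x. (X x - Y x)\<^sup>2))"
proof -
  have ie: "cmod (iexp a - iexp b) \<le> \<bar>a - b\<bar>" for a b
  proof -
    have "iexp a - iexp b = iexp b * (iexp (a - b) - 1)" by (simp add: algebra_simps flip: exp_add)
    hence "cmod (iexp a - iexp b) = cmod (iexp (a - b) - 1)" by (simp add: norm_mult)
    also have "\<dots> \<le> \<bar>a - b\<bar>" using iexp_approx1[of "a - b" 0] by simp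
    finally show ?thesis .
  qed
  have i: "integrable M (\<lambda>x. iexp (X x))" "integrable M (\<lambda>x. iexp (Y x))"
    by (auto intro!: integrable_const_bound[of _ 1])
  have i1: "integrable M (\<lambda>x. X x - Y x)"
    by (rule square_integrable_imp_integrable[OF _ i2]) measurable
  have "cmod ((CLINT x|M. iexp (X x)) - (CLINT x|M. iexp (Y x))) = cmod (CLINT x|M. iexp (X x) - iexp (Y x))"
    using i by simp
  also have "\<dots> \<le> (LINT x|M. cmod (iexp (X x) - iexp (Y x)))" by (rule integral_norm_bound)
  also have "\<dots> \<le> (LINT x|M. \<bar>X x - Y x\<bar>)"
    by (rule integral_mono[OF _ integrable_abs[OF i1] ie]) (use i in simp)
  also have "\<dots> \<le> sqrt (expectation (\<lambda>x. (X x - Y x)\<^sup>2))"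
    using Cauchy_Schwarz_integral[of "\<lambda>x. \<bar>X x - Y x\<bar>" M "\<lambda>_. 1"] i2 by (simp add: prob_space)
  finally show ?thesis .
qed

text \<open>The characteristic function of a sum of \<open>J N\<close> independent copies of \<open>B / sqrt N\<close> when \<open>J N / N\<close>
  converges; unlike in the classical theorem the variance \<open>s\<close> may vanish.\<close>

lemma (in prob_space) char_power_limit:
  fixes B :: "'a \<Rightarrow> real"
  assumes [measurable]: "B \<in> borel_measurable M" and B2: "integrable M (\<lambda>x. (B x)\<^sup>2)"
    and B0: "expectation B = 0" and s: "s = expectation (\<lambda>x. (B x)\<^sup>2)"
    and J: "(\<lambda>N. real (J N) / real N) \<longlonglongrightarrow> q"
  shows "(\<lambda>N. (CLINT x|M. iexp (u / sqrt (real N) * B x)) ^ J N) \<longlonglongrightarrow> complex_of_real (exp (- (u\<^sup>2 * s / 2 * q)))"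
proof -
  define \<phi> where "\<phi> t = (CLINT x|M. iexp (t * B x))" for t
  define a where "a = u\<^sup>2 * s / 2"
  have s0: "s \<ge> 0" unfolding s by (rule integral_nonneg_AE) auto
  have a0: "a \<ge> 0" using s0 by (simp add: a_def)
  have B1: "integrable M B" by (rule square_integrable_imp_integrable[OF _ B2]) measurable
  have \<phi>1: "cmod (\<phi> t) \<le> 1" for t
  proof -
    have "cmod (\<phi> t) \<le> (LINT x|M. cmod (iexp (t * B x)))" unfolding \<phi>_def by (rule integral_norm_bound)
    thus ?thesis by (simp add: prob_space)
  qed
  define R where "R t = expectation (\<lambda>x. min (6 * (B x)\<^sup>2) (\<bar>t\<bar> * \<bar>B x\<bar>^3))" for t
  have app: "cmod (\<phi> t - (1 - t\<^sup>2 * s / 2)) \<le> t\<^sup>2 / 6 * R t" for t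
  proof -
    have "cmod (char (distr M borel B) t - (1 - t\<^sup>2 * s / 2)) \<le> t\<^sup>2 / 6 * R t"
      unfolding R_def by (rule char_approx3'[OF _ B1 B2 B0]) (auto simp: s B0)
    thus ?thesis by (simp add: char_def integral_distr \<phi>_def)
  qed
  have app': "cmod (\<phi> t - complex_of_real (1 - t\<^sup>2 * s / 2)) \<le> t\<^sup>2 / 6 * R t" for t
    using app[of t] by simp
  have R0: "(\<lambda>N. R (u / sqrt (real N))) \<longlonglongrightarrow> 0"
  proof -
    have "(\<lambda>N. R (u / sqrt (real N))) \<longlonglongrightarrow> (LINT x|M. 0)"
      unfolding R_def
    proof (rule integral_dominated_convergence[where w="\<lambda>x. 6 * (B x)\<^sup>2"])
      show "AE x in M. (\<lambda>N. min (6 * (B x)\<^sup>2) (\<bar>u / sqrt (real N)\<bar> * \<bar>B x\<bar>^3)) \<longlonglongrightarrow> 0"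
      proof (rule AE_I2)
        fix x
        have "(\<lambda>N. u / sqrt (real N)) \<longlonglongrightarrow> 0"
          by (intro tendsto_divide_0[OF tendsto_const] filterlim_at_top_imp_at_infinity
              filterlim_compose[OF sqrt_at_top filterlim_real_sequentially])
        hence "(\<lambda>N. min (6 * (B x)\<^sup>2) (\<bar>u / sqrt (real N)\<bar> * \<bar>B x\<bar>^3)) \<longlonglongrightarrow> min (6 * (B x)\<^sup>2) (\<bar>0\<bar> * \<bar>B x\<bar>^3)"
          by (intro tendsto_intros)
        thus "(\<lambda>N. min (6 * (B x)\<^sup>2) (\<bar>u / sqrt (real N)\<bar> * \<bar>B x\<bar>^3)) \<longlonglongrightarrow> 0" by simp
      qed
    qed (use B2 in auto)
    thus ?thesis by simp
  qed
  have inv: "(\<lambda>N. 1 / real N) \<longlonglongrightarrow> 0" by (rule lim_1_over_n)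
  define E where "E N = real (J N) / real N * (u\<^sup>2 / 6 * R (u / sqrt (real N)) + a\<^sup>2 * (1 / real N))" for N
  have E0: "E \<longlonglongrightarrow> 0"
  proof -
    have "E \<longlonglongrightarrow> q * (u\<^sup>2 / 6 * 0 + a\<^sup>2 * 0)" unfolding E_def by (intro tendsto_intros J R0 inv)
    thus ?thesis by simp
  qed
  have bd: "\<forall>\<^sub>F N in sequentially. cmod (\<phi> (u / sqrt (real N)) ^ J N - complex_of_real (exp (- (a / real N))) ^ J N) \<le> E N"
    using eventually_gt_at_top[of "nat \<lceil>a\<rceil>"]
  proof eventually_elim
    case (elim N)
    have N: "real N > 0" "a / real N \<le> 1"
    proof -
      show "real N > 0" using elim by simp
      moreover have "a \<le> real N" using elim by linarith
      ultimately show "a / real N \<le> 1" by simp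
    qed
    have "cmod (\<phi> (u / sqrt (real N)) - complex_of_real (1 - a / real N)) \<le> u\<^sup>2 / real N / 6 * R (u / sqrt (real N))"
    proof -
      have "(u / sqrt (real N))\<^sup>2 = u\<^sup>2 / real N" "u\<^sup>2 / real N * s / 2 = a / real N"
        using N by (simp_all add: a_def power_divide)
      with app'[of "u / sqrt (real N)"] show ?thesis by (simp only:)
    qed
    moreover have "cmod (complex_of_real (1 - a / real N) - complex_of_real (exp (- (a / real N)))) \<le> (a / real N)\<^sup>2"
    proof -
      have "\<bar>exp (- (a / real N)) - (1 + - (a / real N))\<bar> \<le> (a / real N)\<^sup>2"
        using N a0 by (intro exp_minus_approx) auto
      hence "\<bar>(1 - a / real N) - exp (- (a / real N))\<bar> \<le> (a / real N)\<^sup>2" by (simp add: abs_minus_commute)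
      thus ?thesis unfolding of_real_diff[symmetric] norm_of_real .
    qed
    ultimately have d: "cmod (\<phi> (u / sqrt (real N)) - complex_of_real (exp (- (a / real N)))) \<le>
        u\<^sup>2 / real N / 6 * R (u / sqrt (real N)) + (a / real N)\<^sup>2"
      by (rule norm_diff_triangle_le)
    have "cmod (\<phi> (u / sqrt (real N)) ^ J N - complex_of_real (exp (- (a / real N))) ^ J N) \<le>
      real (J N) * cmod (\<phi> (u / sqrt (real N)) - complex_of_real (exp (- (a / real N))))"
      using a0 N by (intro norm_power_diff \<phi>1) auto
    also have "\<dots> \<le> real (J N) * (u\<^sup>2 / real N / 6 * R (u / sqrt (real N)) + (a / real N)\<^sup>2)"
      by (intro mult_left_mono d) auto
    also have "\<dots> = E N"
      using N by (simp add: E_def power2_eq_square add_divide_distrib distrib_left)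
    finally show ?case .
  qed
  have "(\<lambda>N. \<phi> (u / sqrt (real N)) ^ J N - complex_of_real (exp (- (a / real N))) ^ J N) \<longlonglongrightarrow> 0"
    by (rule Lim_null_comparison[OF bd E0])
  moreover have "(\<lambda>N. complex_of_real (exp (- (a / real N))) ^ J N) \<longlonglongrightarrow> complex_of_real (exp (- (a * q)))"
  proof -
    have "(\<lambda>N. complex_of_real (exp (- (a * (real (J N) / real N))))) \<longlonglongrightarrow> complex_of_real (exp (- (a * q)))"
      by (intro tendsto_intros J)
    moreover have "complex_of_real (exp (- (a * (real (J N) / real N)))) = complex_of_real (exp (- (a / real N))) ^ J N" for N
      by (simp flip: exp_of_nat_mult of_real_power)
    ultimately show ?thesis by simp
  qed
  ultimately have "(\<lambda>N. \<phi> (u / sqrt (real N)) ^ J N) \<longlonglongrightarrow> 0 + complex_of_real (exp (- (a * q)))"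
    using tendsto_add by fastforce
  thus ?thesis by (simp add: \<phi>_def a_def)
qed


lemma expectation_sum_square:
  fixes Z :: "'i \<Rightarrow> 'a \<Rightarrow> real"
  assumes A: "finite A" and Z: "\<And>i. i \<in> A \<Longrightarrow> Z i \<in> borel_measurable M" "\<And>i. i \<in> A \<Longrightarrow> integrable M (\<lambda>x. (Z i x)\<^sup>2)"
  shows "(LINT x|M. (\<Sum>i\<in>A. Z i x)\<^sup>2) = (\<Sum>i\<in>A. \<Sum>j\<in>A. LINT x|M. Z i x * Z j x)"
proof -
  have i: "integrable M (\<lambda>x. Z i x * Z j x)" if "i \<in> A" "j \<in> A" for i j
    using that Z by (intro L2_mult_integrable) auto
  have "(LINT x|M. (\<Sum>i\<in>A. Z i x)\<^sup>2) = (LINT x|M. (\<Sum>i\<in>A. \<Sum>j\<in>A. Z i x * Z j x))"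
    by (simp add: power2_eq_square sum_product)
  also have "\<dots> = (\<Sum>i\<in>A. LINT x|M. (\<Sum>j\<in>A. Z i x * Z j x))"
    by (intro Bochner_Integration.integral_sum Bochner_Integration.integrable_sum i)
  also have "\<dots> = (\<Sum>i\<in>A. \<Sum>j\<in>A. LINT x|M. Z i x * Z j x)"
    by (intro sum.cong refl Bochner_Integration.integral_sum i)
  finally show ?thesis .
qed

lemma sum_square_bound:
  fixes Z :: "nat \<Rightarrow> 'a \<Rightarrow> real"
  assumes A: "finite A" and Z: "\<And>i. Z i \<in> borel_measurable M" "\<And>i. integrable M (\<lambda>x. (Z i x)\<^sup>2)"
    and c: "summable c" and bd: "\<And>i k. \<bar>LINT x|M. Z i x * Z (i + k) x\<bar> \<le> c k"
  shows "(LINT x|M. (\<Sum>i\<in>A. Z i x)\<^sup>2) \<le> real (card A) * (2 * suminf c)"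
proof -
  have c0: "0 \<le> c k" for k using bd[of 0 k] by linarith
  have part: "(\<Sum>j\<in>B. c (h j)) \<le> suminf c" if "finite B" "inj_on h B" for h :: "nat \<Rightarrow> nat" and B
  proof -
    have "(\<Sum>j\<in>B. c (h j)) = sum c (h ` B)" using that by (simp add: sum.reindex)
    also have "\<dots> \<le> suminf c" using that c c0 by (intro sum_le_suminf) auto
    finally show ?thesis .
  qed
  have row: "(\<Sum>j\<in>A. LINT x|M. Z i x * Z j x) \<le> 2 * suminf c" for i
  proof -
    have "(\<Sum>j\<in>A. LINT x|M. Z i x * Z j x) = (\<Sum>j\<in>A \<inter> {i..}. LINT x|M. Z i x * Z j x) + (\<Sum>j\<in>A \<inter> {..<i}. LINT x|M. Z i x * Z j x)"
      using A by (subst sum.union_disjoint[symmetric]) (auto intro!: sum.cong)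
    also have "(\<Sum>j\<in>A \<inter> {i..}. LINT x|M. Z i x * Z j x) \<le> (\<Sum>j\<in>A \<inter> {i..}. c (j - i))"
    proof (rule sum_mono)
      fix j assume "j \<in> A \<inter> {i..}"
      hence "i + (j - i) = j" by simp
      thus "(LINT x|M. Z i x * Z j x) \<le> c (j - i)" using bd[of i "j - i"] by simp
    qed
    also have "(\<Sum>j\<in>A \<inter> {..<i}. LINT x|M. Z i x * Z j x) \<le> (\<Sum>j\<in>A \<inter> {..<i}. c (i - j))"
    proof (rule sum_mono)
      fix j assume "j \<in> A \<inter> {..<i}"
      hence "j + (i - j) = i" by simp
      thus "(LINT x|M. Z i x * Z j x) \<le> c (i - j)" using bd[of j "i - j"] by (simp add: mult.commute)
    qed
    also have "(\<Sum>j\<in>A \<inter> {i..}. c (j - i)) \<le> suminf c" using A by (intro part) (auto simp: inj_on_def)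
    also have "(\<Sum>j\<in>A \<inter> {..<i}. c (i - j)) \<le> suminf c" using A by (intro part) (auto simp: inj_on_def)
    finally show ?thesis by simp
  qed
  have "(LINT x|M. (\<Sum>i\<in>A. Z i x)\<^sup>2) = (\<Sum>i\<in>A. \<Sum>j\<in>A. LINT x|M. Z i x * Z j x)"
    using A Z by (intro expectation_sum_square) auto
  also have "\<dots> \<le> (\<Sum>i\<in>A. 2 * suminf c)" by (intro sum_mono row)
  finally show ?thesis by simp
qed

lemma variance_limit:
  fixes X :: "nat \<Rightarrow> 'a \<Rightarrow> real"
  assumes X: "\<And>i. X i \<in> borel_measurable M" "\<And>i. integrable M (\<lambda>x. (X i x)\<^sup>2)"
    and stat: "\<And>i k. (LINT x|M. X i x * X (i + k) x) = \<gamma> k" and \<gamma>: "summable (\<lambda>k. \<gamma> (Suc k))"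
  shows "(\<lambda>N. (LINT x|M. (\<Sum>i<N. X i x)\<^sup>2) / real N) \<longlonglongrightarrow> \<gamma> 0 + 2 * (\<Sum>k. \<gamma> (Suc k))"
proof -
  have eq: "(LINT x|M. (\<Sum>i<N. X i x)\<^sup>2) = (\<Sum>n<N. \<gamma> 0 + 2 * (\<Sum>k<n. \<gamma> (Suc k)))" for N
  proof (induction N)
    case (Suc N)
    have sq: "(\<Sum>i<Suc N. X i x)\<^sup>2 = (\<Sum>i<N. X i x)\<^sup>2 + (2 * (\<Sum>i<N. X i x * X N x) + X N x * X N x)" for x
      by (simp add: power2_sum power2_eq_square algebra_simps flip: sum_distrib_right)
    have i: "integrable M (\<lambda>x. X i x * X j x)" for i j by (intro L2_mult_integrable X)
    have "(LINT x|M. (\<Sum>i<Suc N. X i x)\<^sup>2) = (LINT x|M. (\<Sum>i<N. X i x)\<^sup>2) +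
        (2 * (\<Sum>i<N. LINT x|M. X i x * X N x) + (LINT x|M. X N x * X N x))"
      unfolding sq using i L2_sum_integrable[of "{..<N}" X M] X by simp
    also have "(\<Sum>i<N. LINT x|M. X i x * X N x) = (\<Sum>i<N. \<gamma> (N - i))"
    proof (rule sum.cong)
      fix i assume "i \<in> {..<N}"
      thus "(LINT x|M. X i x * X N x) = \<gamma> (N - i)" using stat[of i "N - i"] by simp
    qed simp
    also have "\<dots> = (\<Sum>k<N. \<gamma> (Suc k))"
      using sum.nat_diff_reindex[of "\<lambda>k. \<gamma> (Suc k)" N] by (auto intro!: sum.cong simp: Suc_diff_Suc)
    also have "(LINT x|M. X N x * X N x) = \<gamma> 0" using stat[of N 0] by simp
    finally show ?case using Suc.IH by simp
  qed simp
  have "(\<lambda>n. \<gamma> 0 + 2 * (\<Sum>k<n. \<gamma> (Suc k))) \<longlonglongrightarrow> \<gamma> 0 + 2 * (\<Sum>k. \<gamma> (Suc k))"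
    by (intro tendsto_intros summable_LIMSEQ \<gamma>)
  from cesaro_mean[OF this] show ?thesis unfolding eq .
qed

lemma L2_norm_square_diff:
  fixes X Y :: "'a \<Rightarrow> real"
  assumes X: "X \<in> borel_measurable M" "integrable M (\<lambda>x. (X x)\<^sup>2)"
    and Y: "Y \<in> borel_measurable M" "integrable M (\<lambda>x. (Y x)\<^sup>2)"
    and b: "(LINT x|M. (X x)\<^sup>2) \<le> b" "(LINT x|M. (Y x)\<^sup>2) \<le> b" "(LINT x|M. (X x - Y x)\<^sup>2) \<le> d"
  shows "\<bar>(LINT x|M. (Y x)\<^sup>2) - (LINT x|M. (X x)\<^sup>2)\<bar> \<le> sqrt d * sqrt (4 * b)"
proof -
  have "(LINT x|M. (X x)\<^sup>2) - (LINT x|M. (Y x)\<^sup>2) = (LINT x|M. (X x - Y x) * (X x + Y x))"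
    using X Y by (simp add: power2_eq_square algebra_simps)
  hence "\<bar>(LINT x|M. (Y x)\<^sup>2) - (LINT x|M. (X x)\<^sup>2)\<bar> = \<bar>LINT x|M. (X x - Y x) * (X x + Y x)\<bar>" by (simp add: abs_minus_commute)
  also have "\<dots> \<le> sqrt (LINT x|M. (X x - Y x)\<^sup>2) * sqrt (LINT x|M. (X x + Y x)\<^sup>2)"
    using X Y by (intro Cauchy_Schwarz_integral L2_diff_integrable L2_add_integrable) auto
  also have "\<dots> \<le> sqrt d * sqrt (4 * b)"
  proof (intro mult_mono real_sqrt_le_mono b)
    have "(LINT x|M. (X x + Y x)\<^sup>2) \<le> (LINT x|M. 2 * (X x)\<^sup>2 + 2 * (Y x)\<^sup>2)"
    proof (rule integral_mono)
      show "(X x + Y x)\<^sup>2 \<le> 2 * (X x)\<^sup>2 + 2 * (Y x)\<^sup>2" for x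
        using sum_squares_bound[of "X x" "Y x"] by (simp add: power2_sum)
    qed (use X Y in \<open>auto intro: L2_add_integrable\<close>)
    also have "\<dots> \<le> 4 * b" using X Y b by simp
    finally show "(LINT x|M. (X x + Y x)\<^sup>2) \<le> 4 * b" .
  next
    have "0 \<le> (LINT x|M. (X x - Y x)\<^sup>2)" by (rule integral_nonneg_AE) auto
    hence "0 \<le> d" using b(3) by (rule order_trans)
    thus "0 \<le> sqrt d" by simp
  qed (auto intro: integral_nonneg_AE)
  finally show ?thesis .
qed

locale block_approximation = prob_space M for M :: "'a measure" +
  fixes X :: "nat \<Rightarrow> 'a \<Rightarrow> real" and Y :: "nat \<Rightarrow> nat \<Rightarrow> 'a \<Rightarrow> real"
    and c \<gamma> \<delta> :: "nat \<Rightarrow> real"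
  assumes X: "\<And>i. X i \<in> borel_measurable M" "\<And>i. integrable M (\<lambda>x. (X i x)\<^sup>2)"
    and Y: "\<And>m i. Y m i \<in> borel_measurable M" "\<And>m i. integrable M (\<lambda>x. (Y m i x)\<^sup>2)"
    and c: "summable c"
    and XX: "\<And>i k. \<bar>expectation (\<lambda>x. X i x * X (i + k) x)\<bar> \<le> c k"
    and YY: "\<And>m i k. \<bar>expectation (\<lambda>x. Y m i x * Y m (i + k) x)\<bar> \<le> c k"
    and DD: "\<And>m i k. \<bar>expectation (\<lambda>x. (X i x - Y m i x) * (X (i + k) x - Y m (i + k) x))\<bar> \<le> c k"
    and \<delta>: "\<And>m i. expectation (\<lambda>x. (X i x - Y m i x)\<^sup>2) \<le> \<delta> m" "\<delta> \<longlonglongrightarrow> 0"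
    and stat: "\<And>i k. expectation (\<lambda>x. X i x * X (i + k) x) = \<gamma> k"
    and Y0: "\<And>m i. expectation (Y m i) = 0"
    and blocks: "\<And>m L J u. (CLINT x|M. iexp (u * (\<Sum>j<J. \<Sum>l<L. Y m (j * (L + m) + l) x))) =
        (CLINT x|M. iexp (u * (\<Sum>l<L. Y m l x))) ^ J"
begin

definition sigma2 where "sigma2 = \<gamma> 0 + 2 * (\<Sum>k. \<gamma> (Suc k))"

lemma c_nonneg: "0 \<le> c k" using XX[of 0 k] by linarith

lemma summable_gamma: "summable (\<lambda>k. \<bar>\<gamma> (Suc k)\<bar>)"
  by (rule summable_comparison_test[of _ "\<lambda>k. c (Suc k)"])
     (use XX[unfolded stat] c in \<open>auto simp: summable_Suc_iff\<close>)

lemma sigma2_limit: "(\<lambda>N. expectation (\<lambda>x. (\<Sum>i<N. X i x)\<^sup>2) / real N) \<longlonglongrightarrow> sigma2"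
  unfolding sigma2_def
  by (rule variance_limit[OF X stat]) (use summable_rabs_cancel[OF summable_gamma] in auto)

lemma sigma2_nonneg: "0 \<le> sigma2"
  by (rule LIMSEQ_le_const[OF sigma2_limit]) (auto intro!: exI[of _ 0] divide_nonneg_nonneg integral_nonneg_AE)

definition eta where "eta m = 2 * (\<Sum>k. min (c k) (\<delta> m))"

lemma delta_nonneg: "0 \<le> \<delta> m"
proof -
  have "0 \<le> expectation (\<lambda>x. (X 0 x - Y m 0 x)\<^sup>2)" by (rule integral_nonneg_AE) auto
  thus ?thesis using \<delta>(1)[of 0 m] by linarith
qed

lemma summable_min: "summable (\<lambda>k. min (c k) (\<delta> m))"
  by (rule summable_comparison_test[OF _ c]) (use c_nonneg delta_nonneg in auto)

lemma eta_limit: "eta \<longlonglongrightarrow> 0"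
proof -
  have "((\<lambda>m. \<Sum>k. min (c k) (\<delta> m)) \<longlongrightarrow> (\<Sum>k::nat. 0)) sequentially"
  proof (rule tannerys_theorem[THEN conjunct2, THEN conjunct2])
    show "(\<lambda>m. min (c k) (\<delta> m)) \<longlonglongrightarrow> 0" for k
      using tendsto_min[OF tendsto_const[of "c k"] \<delta>(2)] c_nonneg[of k] by simp
    show "\<forall>\<^sub>F (k, m) in sequentially \<times>\<^sub>F sequentially. norm (min (c k) (\<delta> m)) \<le> c k"
      using c_nonneg delta_nonneg by (intro always_eventually) auto
  qed (use c in auto)
  from tendsto_mult_left[OF this, of 2] show ?thesis unfolding eta_def by simp
qed

lemma approx_bound:
  assumes "finite A"
  shows "expectation (\<lambda>x. (\<Sum>i\<in>A. X i x - Y m i x)\<^sup>2) \<le> real (card A) * eta m"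
  unfolding eta_def
proof (rule sum_square_bound[OF assms])
  fix i k
  have D: "(\<lambda>x. X i x - Y m i x) \<in> borel_measurable M" "integrable M (\<lambda>x. (X i x - Y m i x)\<^sup>2)" for i
    using X Y by (auto intro: L2_diff_integrable)
  have "\<bar>expectation (\<lambda>x. (X i x - Y m i x) * (X (i + k) x - Y m (i + k) x))\<bar> \<le>
      sqrt (expectation (\<lambda>x. (X i x - Y m i x)\<^sup>2)) * sqrt (expectation (\<lambda>x. (X (i + k) x - Y m (i + k) x)\<^sup>2))"
    by (intro Cauchy_Schwarz_integral D)
  also have "\<dots> \<le> sqrt (\<delta> m) * sqrt (\<delta> m)"
    using delta_nonneg by (intro mult_mono real_sqrt_le_mono \<delta>(1)) (auto intro: integral_nonneg_AE)
  also have "\<dots> = \<delta> m" using delta_nonneg by simp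
  finally show "\<bar>expectation (\<lambda>x. (X i x - Y m i x) * (X (i + k) x - Y m (i + k) x))\<bar> \<le> min (c k) (\<delta> m)"
    using DD[of i m k] by simp
qed (use X Y summable_min in \<open>auto intro: L2_diff_integrable\<close>)

definition C where "C = 2 * suminf c"

lemma C_nonneg: "0 \<le> C" using suminf_nonneg[OF c c_nonneg] by (simp add: C_def)

lemma eta_nonneg: "0 \<le> eta m"
  using suminf_nonneg[OF summable_min[of m]] c_nonneg delta_nonneg by (simp add: eta_def)

lemma block_sum:
  fixes p L m N :: nat and f :: "nat \<Rightarrow> real"
  assumes "p = L + m" "p > 0"
  defines "B \<equiv> (\<lambda>(j, l). j * p + l) ` ({..<N div p} \<times> {..<L})"
  shows "(\<Sum>j<N div p. \<Sum>l<L. f (j * p + l)) = (\<Sum>n\<in>B. f n)" "B \<subseteq> {..<N}"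
    "real (card ({..<N} - B)) \<le> real N * (real m / real p) + real p"
proof -
  have inj: "inj_on (\<lambda>(j, l). j * p + l) ({..<N div p} \<times> {..<L})"
  proof (rule inj_onI, clarsimp)
    fix j l j' l' assume "l < L" "l' < L" and eq: "j * p + l = j' * p + l'"
    hence "l < p" "l' < p" using assms by auto
    thus "j = j' \<and> l = l'"
      using arg_cong[OF eq, of "\<lambda>n. n div p"] arg_cong[OF eq, of "\<lambda>n. n mod p"] by simp
  qed
  show "(\<Sum>j<N div p. \<Sum>l<L. f (j * p + l)) = (\<Sum>n\<in>B. f n)"
    unfolding B_def by (subst sum.reindex[OF inj]) (simp add: sum.cartesian_product case_prod_unfold)
  show sub: "B \<subseteq> {..<N}"
  proof (clarsimp simp: B_def)
    fix j l assume "j < N div p" "l < L"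
    hence "j * p + l < j * p + p" using assms by simp
    also have "\<dots> = Suc j * p" by simp
    also have "\<dots> \<le> (N div p) * p" using \<open>j < N div p\<close> by (intro mult_le_mono1) auto
    also have "\<dots> \<le> N" by simp
    finally show "j * p + l < N" .
  qed
  have cB: "card B = (N div p) * L" unfolding B_def using inj by (simp add: card_image)
  have "card ({..<N} - B) = N - (N div p) * L"
    using sub cB by (simp add: card_Diff_subset finite_subset[OF sub])
  moreover have "N < (N div p) * p + p"
    using assms(2) by (metis add.commute dividend_less_times_div mult.commute)
  moreover have "(N div p) * p = (N div p) * L + (N div p) * m" using assms(1) by (simp add: distrib_left)
  ultimately have "card ({..<N} - B) \<le> (N div p) * m + p" by linarith
  hence "real (card ({..<N} - B)) \<le> real ((N div p) * m + p)" by (rule of_nat_mono)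
  also have "\<dots> \<le> real N / real p * real m + real p"
  proof -
    have "real (N div p) * real m \<le> real N / real p * real m"
      by (intro mult_right_mono of_nat_div_le_of_nat) auto
    thus ?thesis by simp
  qed
  finally show "real (card ({..<N} - B)) \<le> real N * (real m / real p) + real p" by simp
qed

lemma block_error:
  assumes "p = L + m" "p > 0" "N > 0"
  shows "expectation (\<lambda>x. ((\<Sum>i<N. X i x) - (\<Sum>j<N div p. \<Sum>l<L. Y m (j * p + l) x))\<^sup>2) / real N \<le>
    2 * eta m + 2 * C * (real m / real p + real p / real N)"
proof -
  define B where "B = (\<lambda>(j, l). j * p + l) ` ({..<N div p} \<times> {..<L})"
  define A where "A = {..<N} - B"
  note bs = block_sum[OF assms(1,2), where N = N, folded B_def]
  have finA: "finite A" by (simp add: A_def)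
  have "(\<Sum>i<N. X i x) - (\<Sum>j<N div p. \<Sum>l<L. Y m (j * p + l) x) = (\<Sum>i<N. X i x - Y m i x) + (\<Sum>n\<in>A. Y m n x)" for x
    using bs(1)[of "\<lambda>n. Y m n x"] sum.subset_diff[OF bs(2), of "\<lambda>n. Y m n x"] by (simp add: A_def sum_subtractf)
  hence "expectation (\<lambda>x. ((\<Sum>i<N. X i x) - (\<Sum>j<N div p. \<Sum>l<L. Y m (j * p + l) x))\<^sup>2) =
      expectation (\<lambda>x. ((\<Sum>i<N. X i x - Y m i x) + (\<Sum>n\<in>A. Y m n x))\<^sup>2)" by simp
  also have "\<dots> \<le> expectation (\<lambda>x. 2 * (\<Sum>i<N. X i x - Y m i x)\<^sup>2 + 2 * (\<Sum>n\<in>A. Y m n x)\<^sup>2)"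
  proof (rule integral_mono)
    show "(u + v)\<^sup>2 \<le> 2 * u\<^sup>2 + 2 * v\<^sup>2" for u v :: real
      using sum_squares_bound[of u v] by (simp add: power2_sum)
  next
    have *: "integrable M (\<lambda>x. (\<Sum>i<N. X i x - Y m i x)\<^sup>2)" "integrable M (\<lambda>x. (\<Sum>n\<in>A. Y m n x)\<^sup>2)"
      using X Y finA by (auto intro!: L2_sum_integrable L2_diff_integrable)
    thus "integrable M (\<lambda>x. 2 * (\<Sum>i<N. X i x - Y m i x)\<^sup>2 + 2 * (\<Sum>n\<in>A. Y m n x)\<^sup>2)" by simp
    show "integrable M (\<lambda>x. ((\<Sum>i<N. X i x - Y m i x) + (\<Sum>n\<in>A. Y m n x))\<^sup>2)"
      using X Y by (intro L2_add_integrable * borel_measurable_sum borel_measurable_diff)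
  qed
  also have "\<dots> = 2 * expectation (\<lambda>x. (\<Sum>i<N. X i x - Y m i x)\<^sup>2) + 2 * expectation (\<lambda>x. (\<Sum>n\<in>A. Y m n x)\<^sup>2)"
  proof -
    have "integrable M (\<lambda>x. (\<Sum>i<N. X i x - Y m i x)\<^sup>2)" "integrable M (\<lambda>x. (\<Sum>n\<in>A. Y m n x)\<^sup>2)"
      using X Y finA by (auto intro!: L2_sum_integrable L2_diff_integrable)
    thus ?thesis by simp
  qed
  also have "\<dots> \<le> 2 * (real N * eta m) + 2 * ((real N * (real m / real p) + real p) * C)"
  proof (intro add_mono mult_left_mono)
    show "expectation (\<lambda>x. (\<Sum>i<N. X i x - Y m i x)\<^sup>2) \<le> real N * eta m" using approx_bound[of "{..<N}" m] by simp
    have "expectation (\<lambda>x. (\<Sum>n\<in>A. Y m n x)\<^sup>2) \<le> real (card A) * C"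
      unfolding C_def by (rule sum_square_bound[OF finA Y c YY])
    also have "\<dots> \<le> (real N * (real m / real p) + real p) * C"
      using bs(3) C_nonneg by (intro mult_right_mono) (auto simp: A_def)
    finally show "expectation (\<lambda>x. (\<Sum>n\<in>A. Y m n x)\<^sup>2) \<le> (real N * (real m / real p) + real p) * C" .
  qed auto
  finally have "expectation (\<lambda>x. ((\<Sum>i<N. X i x) - (\<Sum>j<N div p. \<Sum>l<L. Y m (j * p + l) x))\<^sup>2) / real N \<le>
      (2 * (real N * eta m) + 2 * ((real N * (real m / real p) + real p) * C)) / real N"
    by (intro divide_right_mono) auto
  also have "\<dots> = 2 * eta m + 2 * C * (real m / real p + real p / real N)"
    using assms by (simp add: field_simps)
  finally show ?thesis .
qed

lemma div_limit: "p > 0 \<Longrightarrow> (\<lambda>N. real (N div p) / real N) \<longlonglongrightarrow> 1 / real p"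
proof (rule tendsto_sandwich)
  assume p: "p > 0"
  show "\<forall>\<^sub>F N in sequentially. 1 / real p - 1 / real N \<le> real (N div p) / real N"
    using eventually_gt_at_top[of 0]
  proof eventually_elim
    case (elim N)
    have "real N / real p - 1 \<le> real (N div p)"
    proof -
      have "N < (N div p) * p + p"
        using p by (metis add.commute dividend_less_times_div mult.commute)
      hence "real N < real ((N div p) * p + p)" by (rule of_nat_less_iff[THEN iffD2])
      hence "real N < (real (N div p) + 1) * real p" by (simp add: distrib_right)
      hence "real N / real p < real (N div p) + 1" using p by (simp add: pos_divide_less_eq)
      thus ?thesis by simp
    qed
    hence "(real N / real p - 1) / real N \<le> real (N div p) / real N" by (rule divide_right_mono) simp
    thus ?case using elim by (simp add: diff_divide_distrib)
  qed
  show "\<forall>\<^sub>F N in sequentially. real (N div p) / real N \<le> 1 / real p"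
    using eventually_gt_at_top[of 0]
  proof eventually_elim
    case (elim N)
    have "real (N div p) / real N \<le> (real N / real p) / real N"
      by (intro divide_right_mono of_nat_div_le_of_nat) auto
    thus ?case using elim by simp
  qed
  show "(\<lambda>N. 1 / real p - 1 / real N) \<longlonglongrightarrow> 1 / real p"
    using tendsto_diff[OF tendsto_const lim_1_over_n, of "1 / real p"] by simp
qed simp

definition rate where
  "rate u m L = \<bar>u\<bar> * sqrt (2 * eta m + 2 * C * (real m / real (L + m))) +
     u\<^sup>2 / 2 * (sqrt (eta m) * sqrt (4 * C) + \<bar>expectation (\<lambda>x. (\<Sum>i<L. X i x)\<^sup>2) / real L * (real L / real (L + m)) - sigma2\<bar>)"

lemma char_error:
  assumes L: "L > 0" and e: "rate u m L < e"
  shows "\<forall>\<^sub>F N in sequentially. cmod ((CLINT x|M. iexp (u / sqrt (real N) * (\<Sum>i<N. X i x))) - exp (- (u\<^sup>2 * sigma2 / 2))) < e"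
proof -
  define p where "p = L + m"
  have p: "p > 0" using L by (simp add: p_def)
  define T where "T N x = (\<Sum>j<N div p. \<Sum>l<L. Y m (j * p + l) x)" for N x
  define B where "B x = (\<Sum>l<L. Y m l x)" for x
  define s where "s = expectation (\<lambda>x. (B x)\<^sup>2)"
  have [measurable]: "\<And>i. X i \<in> borel_measurable M" "\<And>i. Y m i \<in> borel_measurable M" using X Y by auto
  have Bm[measurable]: "B \<in> borel_measurable M" and [measurable]: "\<And>N. T N \<in> borel_measurable M"
    unfolding B_def T_def by measurable
  have B2: "integrable M (\<lambda>x. (B x)\<^sup>2)" unfolding B_def using Y by (intro L2_sum_integrable) auto
  have Y1: "integrable M (Y m i)" for i by (rule square_integrable_imp_integrable[OF Y])
  have B0: "expectation B = 0" unfolding B_def using Y1 Y0 by simp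
  have S2: "integrable M (\<lambda>x. (\<Sum>i<N. X i x)\<^sup>2)" for N using X by (intro L2_sum_integrable) auto
  have T2: "integrable M (\<lambda>x. (T N x)\<^sup>2)" for N
    unfolding T_def using Y by (intro L2_sum_integrable borel_measurable_sum) auto
  define E1 where "E1 N = \<bar>u\<bar> * sqrt (2 * eta m + 2 * C * (real m / real p + real p / real N))" for N
  define E2 where "E2 N = cmod ((CLINT x|M. iexp (u / sqrt (real N) * B x)) ^ (N div p) - exp (- (u\<^sup>2 * s / 2 * (1 / real p))))" for N
  define e3 where "e3 = \<bar>exp (- (u\<^sup>2 * s / 2 * (1 / real p))) - exp (- (u\<^sup>2 * sigma2 / 2))\<bar>"
  have s0: "s \<ge> 0" unfolding s_def by (rule integral_nonneg_AE) auto
  have bd: "\<forall>\<^sub>F N in sequentially. cmod ((CLINT x|M. iexp (u / sqrt (real N) * (\<Sum>i<N. X i x))) - exp (- (u\<^sup>2 * sigma2 / 2))) \<le> E1 N + E2 N + e3"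
    using eventually_gt_at_top[of 0]
  proof eventually_elim
    case (elim N)
    let ?S = "\<lambda>x. \<Sum>i<N. X i x"
    have i: "integrable M (\<lambda>x. (?S x - T N x)\<^sup>2)" using S2 T2 by (intro L2_diff_integrable) auto
    have i': "integrable M (\<lambda>x. (u / sqrt (real N) * ?S x - u / sqrt (real N) * T N x)\<^sup>2)"
      using L2_cmult_integrable[OF i, of "u / sqrt (real N)"] by (simp add: right_diff_distrib)
    have "cmod ((CLINT x|M. iexp (u / sqrt (real N) * ?S x)) - (CLINT x|M. iexp (u / sqrt (real N) * T N x))) \<le>
        sqrt (expectation (\<lambda>x. (u / sqrt (real N) * ?S x - u / sqrt (real N) * T N x)\<^sup>2))"
      by (intro char_L2_diff i') measurable
    also have "expectation (\<lambda>x. (u / sqrt (real N) * ?S x - u / sqrt (real N) * T N x)\<^sup>2) = expectation (\<lambda>x. u\<^sup>2 / real N * (?S x - T N x)\<^sup>2)"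
      by (intro Bochner_Integration.integral_cong refl)
         (simp only: right_diff_distrib[symmetric] power_mult_distrib power_divide real_sqrt_pow2 of_nat_0_le_iff)
    also have "\<dots> = u\<^sup>2 * (expectation (\<lambda>x. (?S x - T N x)\<^sup>2) / real N)" by simp
    also have "sqrt \<dots> \<le> E1 N"
      unfolding E1_def real_sqrt_mult real_sqrt_abs
      using block_error[OF p_def p elim] by (intro mult_left_mono real_sqrt_le_mono) (auto simp: T_def)
    finally have 1: "cmod ((CLINT x|M. iexp (u / sqrt (real N) * ?S x)) - (CLINT x|M. iexp (u / sqrt (real N) * T N x))) \<le> E1 N" .
    have "(CLINT x|M. iexp (u / sqrt (real N) * T N x)) = (CLINT x|M. iexp (u / sqrt (real N) * B x)) ^ (N div p)"
      unfolding T_def B_def p_def by (rule blocks)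
    hence 2: "cmod ((CLINT x|M. iexp (u / sqrt (real N) * T N x)) - exp (- (u\<^sup>2 * s / 2 * (1 / real p)))) \<le> E2 N"
      by (simp add: E2_def)
    have 3: "cmod (complex_of_real (exp (- (u\<^sup>2 * s / 2 * (1 / real p)))) - complex_of_real (exp (- (u\<^sup>2 * sigma2 / 2)))) \<le> e3"
      unfolding e3_def of_real_diff[symmetric] norm_of_real by simp
    show ?case
      using norm_diff_triangle_le[OF norm_diff_triangle_le[OF 1 2] 3] by simp
  qed
  have E1lim: "E1 \<longlonglongrightarrow> \<bar>u\<bar> * sqrt (2 * eta m + 2 * C * (real m / real p + 0))"
    unfolding E1_def by (intro tendsto_intros)
  have "(\<lambda>N. (CLINT x|M. iexp (u / sqrt (real N) * B x)) ^ (N div p)) \<longlonglongrightarrow> complex_of_real (exp (- (u\<^sup>2 * s / 2 * (1 / real p))))"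
    by (rule char_power_limit[OF Bm B2 B0 s_def div_limit[OF p]])
  hence E2lim: "E2 \<longlonglongrightarrow> 0"
    unfolding E2_def by (intro tendsto_norm_zero) (simp add: LIM_zero_iff)
  define V where "V = expectation (\<lambda>x. (\<Sum>i<L. X i x)\<^sup>2)"
  have V: "V \<le> real L * C" "s \<le> real L * C"
    unfolding V_def s_def B_def C_def
    using sum_square_bound[where A = "{..<L}", OF _ X c XX] sum_square_bound[where A = "{..<L}", OF _ Y[of m] c YY] by auto
  have ap: "expectation (\<lambda>x. ((\<Sum>i<L. X i x) - B x)\<^sup>2) \<le> real L * eta m"
    using approx_bound[of "{..<L}" m] by (simp add: B_def sum_subtractf)
  have "\<bar>s - V\<bar> \<le> sqrt (real L * eta m) * sqrt (4 * (real L * C))"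
    unfolding s_def V_def
    by (rule L2_norm_square_diff[OF _ S2 Bm B2]) (use V ap in \<open>auto simp: V_def s_def\<close>)
  also have "\<dots> = real L * (sqrt (eta m) * sqrt (4 * C))"
    using eta_nonneg C_nonneg by (simp add: real_sqrt_mult mult_ac)
  finally have sV: "\<bar>s - V\<bar> / real p \<le> real L * (sqrt (eta m) * sqrt (4 * C)) / real p"
    by (rule divide_right_mono) simp
  also have "\<dots> \<le> real p * (sqrt (eta m) * sqrt (4 * C)) / real p"
    using eta_nonneg C_nonneg by (intro divide_right_mono mult_right_mono) (auto simp: p_def)
  also have "\<dots> = sqrt (eta m) * sqrt (4 * C)" using p by simp
  finally have sV: "\<bar>s - V\<bar> / real p \<le> sqrt (eta m) * sqrt (4 * C)" .
  have "e3 \<le> \<bar>u\<^sup>2 * s / 2 * (1 / real p) - u\<^sup>2 * sigma2 / 2\<bar>"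
    unfolding e3_def using s0 sigma2_nonneg by (intro abs_exp_diff_le) auto
  also have "\<dots> = \<bar>u\<^sup>2 / 2 * (s / real p - sigma2)\<bar>"
    by (simp add: right_diff_distrib)
  also have "\<dots> = u\<^sup>2 / 2 * \<bar>s / real p - sigma2\<bar>"
    unfolding abs_mult by simp
  also have "\<dots> \<le> u\<^sup>2 / 2 * (sqrt (eta m) * sqrt (4 * C) + \<bar>V / real L * (real L / real p) - sigma2\<bar>)"
  proof (intro mult_left_mono)
    have "\<bar>s / real p - V / real p\<bar> = \<bar>s - V\<bar> / real p" by (simp flip: diff_divide_distrib)
    moreover have "V / real L * (real L / real p) = V / real p" using L by simp
    ultimately show "\<bar>s / real p - sigma2\<bar> \<le> sqrt (eta m) * sqrt (4 * C) + \<bar>V / real L * (real L / real p) - sigma2\<bar>"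
      using sV by linarith
  qed simp
  finally have e3: "e3 \<le> u\<^sup>2 / 2 * (sqrt (eta m) * sqrt (4 * C) + \<bar>V / real L * (real L / real p) - sigma2\<bar>)" .
  have "(\<lambda>N. E1 N + E2 N + e3) \<longlonglongrightarrow> \<bar>u\<bar> * sqrt (2 * eta m + 2 * C * (real m / real p + 0)) + 0 + e3"
    by (intro tendsto_add E1lim E2lim tendsto_const)
  moreover have "\<bar>u\<bar> * sqrt (2 * eta m + 2 * C * (real m / real p + 0)) + 0 + e3 < e"
    using e e3 unfolding rate_def p_def V_def by simp
  ultimately have "\<forall>\<^sub>F N in sequentially. E1 N + E2 N + e3 < e" by (rule order_tendstoD)
  with bd show ?thesis by eventually_elim simp
qed

theorem char_limit:
  "(\<lambda>N. CLINT x|M. iexp (u / sqrt (real N) * (\<Sum>i<N. X i x))) \<longlonglongrightarrow> complex_of_real (exp (- (u\<^sup>2 * sigma2 / 2)))"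
proof (rule tendstoI)
  fix e :: real assume e: "e > 0"
  define r where "r m = \<bar>u\<bar> * sqrt (2 * eta m + 2 * C * 0) + u\<^sup>2 / 2 * (sqrt (eta m) * sqrt (4 * C) + \<bar>sigma2 * 1 - sigma2\<bar>)" for m
  have "r \<longlonglongrightarrow> \<bar>u\<bar> * sqrt (2 * 0 + 2 * C * 0) + u\<^sup>2 / 2 * (sqrt 0 * sqrt (4 * C) + \<bar>sigma2 * 1 - sigma2\<bar>)"
    unfolding r_def by (intro tendsto_intros eta_limit)
  hence "\<forall>\<^sub>F m in sequentially. r m < e" using e by (intro order_tendstoD(2)) auto
  then obtain m where m: "r m < e" by (auto dest: eventually_happens)
  have l1: "(\<lambda>L. real m / real (L + m)) \<longlonglongrightarrow> 0"
    using LIMSEQ_ignore_initial_segment[OF tendsto_mult_left[OF lim_1_over_n, of "real m"], of m] by simp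
  have l2: "(\<lambda>L. real L / real (L + m)) \<longlonglongrightarrow> 1"
  proof -
    have "(\<lambda>L. 1 - real m / real (L + m)) \<longlonglongrightarrow> 1 - 0" by (intro tendsto_intros l1)
    moreover have "\<forall>\<^sub>F L in sequentially. 1 - real m / real (L + m) = real L / real (L + m)"
      using eventually_gt_at_top[of 0] by eventually_elim (simp add: field_simps)
    ultimately show ?thesis by (simp add: Lim_transform_eventually)
  qed
  have "(\<lambda>L. rate u m L) \<longlonglongrightarrow> r m"
    unfolding rate_def r_def by (intro tendsto_intros l1 l2 sigma2_limit)
  hence "\<forall>\<^sub>F L in sequentially. rate u m L < e" using m by (rule order_tendstoD)
  hence "\<forall>\<^sub>F L in sequentially. rate u m L < e \<and> L > 0" using eventually_gt_at_top[of 0] by eventually_elim simp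
  then obtain L where L: "rate u m L < e" "L > 0" by (auto dest: eventually_happens)
  show "\<forall>\<^sub>F N in sequentially. dist (CLINT x|M. iexp (u / sqrt (real N) * (\<Sum>i<N. X i x))) (complex_of_real (exp (- (u\<^sup>2 * sigma2 / 2)))) < e"
    using char_error[OF L(2,1)] by (simp add: dist_norm)
qed

end

section \<open>Conditional means given part of the noise\<close>

context pair_prob_space
begin

definition proj :: "('a \<times> 'b \<Rightarrow> real) \<Rightarrow> 'a \<Rightarrow> real" where
  "proj f x = (LINT y|M2. f (x, y))"

lemma proj_measurable [measurable]:
  assumes [measurable]: "f \<in> borel_measurable (M1 \<Otimes>\<^sub>M M2)" shows "proj f \<in> borel_measurable M1"
  unfolding proj_def by measurable

lemma integral_fst_comp:
  fixes h :: "'a \<Rightarrow> real"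
  assumes [measurable]: "h \<in> borel_measurable M1"
  shows "integrable (M1 \<Otimes>\<^sub>M M2) (\<lambda>z. h (fst z)) \<longleftrightarrow> integrable M1 h" "(LINT z|(M1 \<Otimes>\<^sub>M M2). h (fst z)) = (LINT x|M1. h x)"
proof -
  have d: "distr (M1 \<Otimes>\<^sub>M M2) M1 fst = M1"
    by (rule M2.distr_pair_fst)
  have "integrable (distr (M1 \<Otimes>\<^sub>M M2) M1 fst) h \<longleftrightarrow> integrable (M1 \<Otimes>\<^sub>M M2) (\<lambda>z. h (fst z))"
    by (rule integrable_distr_eq) auto
  thus "integrable (M1 \<Otimes>\<^sub>M M2) (\<lambda>z. h (fst z)) \<longleftrightarrow> integrable M1 h" unfolding d by simp
  have "(LINT x|distr (M1 \<Otimes>\<^sub>M M2) M1 fst. h x) = (LINT z|(M1 \<Otimes>\<^sub>M M2). h (fst z))"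
    by (rule integral_distr) auto
  thus "(LINT z|(M1 \<Otimes>\<^sub>M M2). h (fst z)) = (LINT x|M1. h x)" unfolding d by simp
qed

lemma proj_L2:
  assumes f[measurable]: "f \<in> borel_measurable (M1 \<Otimes>\<^sub>M M2)" and f2: "integrable (M1 \<Otimes>\<^sub>M M2) (\<lambda>z. (f z)\<^sup>2)"
  shows "integrable M1 (\<lambda>x. (proj f x)\<^sup>2)"
proof (rule Bochner_Integration.integrable_bound)
  show "integrable M1 (\<lambda>x. LINT y|M2. (f (x, y))\<^sup>2)" by (rule integrable_fst'[OF f2])
  show "AE x in M1. norm ((proj f x)\<^sup>2) \<le> norm (LINT y|M2. (f (x, y))\<^sup>2)"
    using AE_integrable_fst'[OF f2] AE_space
  proof eventually_elim
    case (elim x)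
    have [measurable]: "(\<lambda>y. f (x, y)) \<in> borel_measurable M2" using elim by measurable
    have nn: "0 \<le> (LINT y|M2. (f (x, y))\<^sup>2)" by (rule integral_nonneg_AE) auto
    have "\<bar>proj f x\<bar> \<le> sqrt (LINT y|M2. (f (x, y))\<^sup>2)"
      using Cauchy_Schwarz_integral[of "\<lambda>y. f (x, y)" M2 "\<lambda>_. 1"] elim
      by (simp add: proj_def M2.prob_space)
    hence "\<bar>proj f x\<bar>\<^sup>2 \<le> (sqrt (LINT y|M2. (f (x, y))\<^sup>2))\<^sup>2" by (intro power_mono) auto
    thus ?case using nn by simp
  qed
qed measurable

lemma proj_inner:
  assumes f[measurable]: "f \<in> borel_measurable (M1 \<Otimes>\<^sub>M M2)" "integrable (M1 \<Otimes>\<^sub>M M2) (\<lambda>z. (f z)\<^sup>2)"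
    and h[measurable]: "h \<in> borel_measurable M1" "integrable M1 (\<lambda>x. (h x)\<^sup>2)"
  shows "(LINT z|(M1 \<Otimes>\<^sub>M M2). f z * h (fst z)) = (LINT x|M1. proj f x * h x)"
proof -
  have h2: "integrable (M1 \<Otimes>\<^sub>M M2) (\<lambda>z. (h (fst z))\<^sup>2)"
    using h integral_fst_comp(1)[of "\<lambda>x. (h x)\<^sup>2"] by simp
  have i: "integrable (M1 \<Otimes>\<^sub>M M2) (\<lambda>z. f z * h (fst z))"
    by (rule L2_mult_integrable[OF _ _ f(2) h2]) measurable
  have "(LINT z|(M1 \<Otimes>\<^sub>M M2). f z * h (fst z)) = (LINT x|M1. LINT y|M2. f (x, y) * h x)"
    using integral_fst'[OF i] by simp
  thus ?thesis by (simp add: proj_def)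
qed

lemma proj_residual:
  assumes f[measurable]: "f \<in> borel_measurable (M1 \<Otimes>\<^sub>M M2)" "integrable (M1 \<Otimes>\<^sub>M M2) (\<lambda>z. (f z)\<^sup>2)"
    and g[measurable]: "g \<in> borel_measurable (M1 \<Otimes>\<^sub>M M2)" "integrable (M1 \<Otimes>\<^sub>M M2) (\<lambda>z. (g z)\<^sup>2)"
  shows "integrable (M1 \<Otimes>\<^sub>M M2) (\<lambda>z. (f z - proj f (fst z))\<^sup>2)"
    and "(LINT z|(M1 \<Otimes>\<^sub>M M2). (f z - proj f (fst z)) * (g z - proj g (fst z))) =
      (LINT z|(M1 \<Otimes>\<^sub>M M2). f z * g z) - (LINT x|M1. proj f x * proj g x)"
proof -
  note pf = proj_L2[OF f] and pg = proj_L2[OF g]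
  have pf': "integrable (M1 \<Otimes>\<^sub>M M2) (\<lambda>z. (proj f (fst z))\<^sup>2)" and pg': "integrable (M1 \<Otimes>\<^sub>M M2) (\<lambda>z. (proj g (fst z))\<^sup>2)"
    using pf pg integral_fst_comp(1)[of "\<lambda>x. (proj f x)\<^sup>2"] integral_fst_comp(1)[of "\<lambda>x. (proj g x)\<^sup>2"] by auto
  show "integrable (M1 \<Otimes>\<^sub>M M2) (\<lambda>z. (f z - proj f (fst z))\<^sup>2)"
    by (rule L2_diff_integrable[OF _ _ f(2) pf']) measurable
  have i1: "integrable (M1 \<Otimes>\<^sub>M M2) (\<lambda>z. f z * g z)" by (rule L2_mult_integrable[OF _ _ f(2) g(2)]) measurable
  have i2: "integrable (M1 \<Otimes>\<^sub>M M2) (\<lambda>z. f z * proj g (fst z))" by (rule L2_mult_integrable[OF _ _ f(2) pg']) measurable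
  have i3: "integrable (M1 \<Otimes>\<^sub>M M2) (\<lambda>z. g z * proj f (fst z))" by (rule L2_mult_integrable[OF _ _ g(2) pf']) measurable
  have i4: "integrable (M1 \<Otimes>\<^sub>M M2) (\<lambda>z. proj f (fst z) * proj g (fst z))" by (rule L2_mult_integrable[OF _ _ pf' pg']) measurable
  have "(LINT z|(M1 \<Otimes>\<^sub>M M2). (f z - proj f (fst z)) * (g z - proj g (fst z))) =
      (LINT z|(M1 \<Otimes>\<^sub>M M2). f z * g z - f z * proj g (fst z) - g z * proj f (fst z) + proj f (fst z) * proj g (fst z))"
    by (intro Bochner_Integration.integral_cong) (auto simp: algebra_simps)
  also have "\<dots> = (LINT z|(M1 \<Otimes>\<^sub>M M2). f z * g z) - (LINT z|(M1 \<Otimes>\<^sub>M M2). f z * proj g (fst z)) -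
      (LINT z|(M1 \<Otimes>\<^sub>M M2). g z * proj f (fst z)) + (LINT z|(M1 \<Otimes>\<^sub>M M2). proj f (fst z) * proj g (fst z))"
    using i1 i2 i3 i4 by simp
  also have "(LINT z|(M1 \<Otimes>\<^sub>M M2). f z * proj g (fst z)) = (LINT x|M1. proj f x * proj g x)"
    by (rule proj_inner[OF f _ pg]) measurable
  also have "(LINT z|(M1 \<Otimes>\<^sub>M M2). g z * proj f (fst z)) = (LINT x|M1. proj g x * proj f x)"
    by (rule proj_inner[OF g _ pf]) measurable
  also have "(LINT z|(M1 \<Otimes>\<^sub>M M2). proj f (fst z) * proj g (fst z)) = (LINT x|M1. proj f x * proj g x)"
    by (rule integral_fst_comp(2)[of "\<lambda>x. proj f x * proj g x"]) measurable
  finally show "(LINT z|(M1 \<Otimes>\<^sub>M M2). (f z - proj f (fst z)) * (g z - proj g (fst z))) =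
      (LINT z|(M1 \<Otimes>\<^sub>M M2). f z * g z) - (LINT x|M1. proj f x * proj g x)" by (simp add: mult.commute)
qed

lemma proj_residual_square:
  assumes f[measurable]: "f \<in> borel_measurable (M1 \<Otimes>\<^sub>M M2)" "integrable (M1 \<Otimes>\<^sub>M M2) (\<lambda>z. (f z)\<^sup>2)"
  shows "(LINT z|(M1 \<Otimes>\<^sub>M M2). (f z - proj f (fst z))\<^sup>2) = (LINT z|(M1 \<Otimes>\<^sub>M M2). (f z)\<^sup>2) - (LINT x|M1. (proj f x)\<^sup>2)"
  using proj_residual(2)[OF f f] by (simp add: power2_eq_square)

lemma proj_covariance:
  assumes f[measurable]: "f \<in> borel_measurable (M1 \<Otimes>\<^sub>M M2)" "integrable (M1 \<Otimes>\<^sub>M M2) (\<lambda>z. (f z)\<^sup>2)"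
    and g[measurable]: "g \<in> borel_measurable (M1 \<Otimes>\<^sub>M M2)" "integrable (M1 \<Otimes>\<^sub>M M2) (\<lambda>z. (g z)\<^sup>2)"
  shows "\<bar>(LINT z|(M1 \<Otimes>\<^sub>M M2). f z * g z) - (LINT x|M1. proj f x * proj g x)\<bar> \<le>
    sqrt ((LINT z|(M1 \<Otimes>\<^sub>M M2). (f z)\<^sup>2) - (LINT x|M1. (proj f x)\<^sup>2)) *
    sqrt ((LINT z|(M1 \<Otimes>\<^sub>M M2). (g z)\<^sup>2) - (LINT x|M1. (proj g x)\<^sup>2))"
  unfolding proj_residual(2)[OF f g, symmetric] proj_residual_square[OF f, symmetric] proj_residual_square[OF g, symmetric]
  by (intro Cauchy_Schwarz_integral proj_residual(1)[OF f f] proj_residual(1)[OF g g]) measurable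

lemma proj_optimal:
  assumes f[measurable]: "f \<in> borel_measurable (M1 \<Otimes>\<^sub>M M2)" "integrable (M1 \<Otimes>\<^sub>M M2) (\<lambda>z. (f z)\<^sup>2)"
    and h[measurable]: "h \<in> borel_measurable M1" "integrable (M1 \<Otimes>\<^sub>M M2) (\<lambda>z. (f z - h (fst z))\<^sup>2)"
    and int: "AE x in M1. integrable M2 (\<lambda>y. f (x, y))"
  shows "(LINT z|(M1 \<Otimes>\<^sub>M M2). (f z)\<^sup>2) - (LINT x|M1. (proj f x)\<^sup>2) \<le> (LINT z|(M1 \<Otimes>\<^sub>M M2). (f z - h (fst z))\<^sup>2)"
proof -
  define f' where "f' z = f z - h (fst z)" for z
  have [measurable]: "f' \<in> borel_measurable (M1 \<Otimes>\<^sub>M M2)" unfolding f'_def by measurable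
  have f'2: "integrable (M1 \<Otimes>\<^sub>M M2) (\<lambda>z. (f' z)\<^sup>2)" using h by (simp add: f'_def)
  have "AE x in M1. proj f' x = proj f x - h x"
    using int
  proof eventually_elim
    case (elim x)
    thus ?case by (simp add: proj_def f'_def M2.prob_space)
  qed
  hence "AE z in M1 \<Otimes>\<^sub>M M2. (f' z - proj f' (fst z))\<^sup>2 = (f z - proj f (fst z))\<^sup>2"
  proof -
    assume ae: "AE x in M1. proj f' x = proj f x - h x"
    have "AE x in distr (M1 \<Otimes>\<^sub>M M2) M1 fst. proj f' x = proj f x - h x"
      unfolding M2.distr_pair_fst by (rule ae)
    hence "AE z in M1 \<Otimes>\<^sub>M M2. proj f' (fst z) = proj f (fst z) - h (fst z)" by (subst (asm) AE_distr_iff) auto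
    thus ?thesis by eventually_elim (simp add: f'_def)
  qed
  hence "(LINT z|(M1 \<Otimes>\<^sub>M M2). (f' z - proj f' (fst z))\<^sup>2) = (LINT z|(M1 \<Otimes>\<^sub>M M2). (f z - proj f (fst z))\<^sup>2)"
    by (intro integral_cong_AE) measurable
  hence "(LINT z|(M1 \<Otimes>\<^sub>M M2). (f z)\<^sup>2) - (LINT x|M1. (proj f x)\<^sup>2) = (LINT z|(M1 \<Otimes>\<^sub>M M2). (f' z)\<^sup>2) - (LINT x|M1. (proj f' x)\<^sup>2)"
    using proj_residual_square[OF f] proj_residual_square[of f'] f'2 by simp
  moreover have "0 \<le> (LINT x|M1. (proj f' x)\<^sup>2)" by (rule integral_nonneg_AE) auto
  ultimately show ?thesis by (simp add: f'_def)
qed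

end

context stable_noise
begin

definition mu :: "real \<Rightarrow> real measure" where "mu r = distr P borel (\<Phi> {0..<r})"

lemma interval_finite_borel: "0 \<le> r \<Longrightarrow> {0..<r} \<in> finite_borel"
  by (simp add: finite_borel_def emeasure_lborel_Ico)

lemma mu_char: "0 \<le> r \<Longrightarrow> char (mu r) u = complex_of_real (exp (- (r * \<bar>u\<bar> powr \<alpha>)))"
  unfolding mu_def by (subst noise_char[OF interval_finite_borel]) (auto simp: measure_def emeasure_lborel_Ico)

lemma mu_distribution: "0 \<le> r \<Longrightarrow> real_distribution (mu r)"
  unfolding mu_def using noise_measurable[OF interval_finite_borel] by (intro real_distribution_distr) auto

lemma mu_eqI:
  assumes "real_distribution N" "\<And>u. char N u = complex_of_real (exp (- (r * \<bar>u\<bar> powr \<alpha>)))" "0 \<le> r"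
  shows "N = mu r"
  using assms by (intro Levy_uniqueness mu_distribution ext) (auto simp: mu_char)

lemma mu_0: "mu 0 = return borel 0"
proof -
  interpret R: prob_space "return borel (0::real)" by (rule prob_space_return) simp
  have "real_distribution (return borel (0::real))" by unfold_locales auto
  from mu_eqI[OF this, of 0] show ?thesis by (simp add: char_def integral_return)
qed

lemma SI_distr: "SI f X \<Longrightarrow> distr P borel X = mu (pw \<alpha> f)"
  by (intro mu_eqI real_distribution_distr SI_measurable SI_char1 pw_nonneg) auto

lemma SI_integral:
  assumes "SI f X" and [measurable]: "F \<in> borel_measurable borel"
  shows "(LINT \<omega>|P. F (X \<omega>)) = (LINT y|mu (pw \<alpha> f). F y :: real)"
    and "integrable P (\<lambda>\<omega>. F (X \<omega>)) \<longleftrightarrow> integrable (mu (pw \<alpha> f)) F"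
  using SI_measurable[OF assms(1)] unfolding SI_distr[OF assms(1), symmetric]
  by (simp_all add: integral_distr integrable_distr_eq)

lemma sets_mu [measurable_cong, simp]: "sets (mu r) = sets borel" by (simp add: mu_def)

lemma mu_conv:
  assumes "0 \<le> r" "0 \<le> s"
  shows "mu (r + s) = distr (mu r \<Otimes>\<^sub>M mu s) borel (\<lambda>(x, y). x + y)"
proof -
  interpret r: real_distribution "mu r" by (rule mu_distribution) fact
  interpret s: real_distribution "mu s" by (rule mu_distribution) fact
  interpret rs: pair_prob_space "mu r" "mu s" ..
  have "real_distribution (distr (mu r \<Otimes>\<^sub>M mu s) borel (\<lambda>(x, y). x + y))"
    by (rule rs.real_distribution_distr) measurable
  moreover have "char (distr (mu r \<Otimes>\<^sub>M mu s) borel (\<lambda>(x, y). x + y)) u = complex_of_real (exp (- ((r + s) * \<bar>u\<bar> powr \<alpha>)))" for u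
  proof -
    have i: "integrable (mu r) (\<lambda>x. iexp (u * x))" "integrable (mu s) (\<lambda>x. iexp (u * x))"
      by (auto intro!: r.integrable_const_bound[of _ 1] s.integrable_const_bound[of _ 1])
    have "char (distr (mu r \<Otimes>\<^sub>M mu s) borel (\<lambda>(x, y). x + y)) u = (CLINT z|(mu r \<Otimes>\<^sub>M mu s). iexp (u * fst z) * iexp (u * snd z))"
      unfolding char_def by (subst integral_distr) (auto simp: case_prod_unfold distrib_left exp_add intro!: Bochner_Integration.integral_cong)
    also have "\<dots> = (CLINT x|mu r. CLINT y|mu s. iexp (u * x) * iexp (u * y))"
      by (subst rs.integral_fst'[symmetric]) (auto intro!: rs.integrable_const_bound[of _ 1] simp: norm_mult)
    also have "\<dots> = char (mu r) u * char (mu s) u" using i by (simp add: char_def)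
    also have "\<dots> = complex_of_real (exp (- ((r + s) * \<bar>u\<bar> powr \<alpha>)))"
      unfolding mu_char[OF assms(1)] mu_char[OF assms(2)] of_real_mult[symmetric] exp_add[symmetric]
      by (simp add: algebra_simps)
    finally show ?thesis .
  qed
  ultimately show ?thesis using assms by (intro mu_eqI[symmetric]) auto
qed

lemma mu_conv_integral:
  assumes "0 \<le> r" "0 \<le> s" and [measurable]: "F \<in> borel_measurable borel"
  shows "(LINT z|(mu r \<Otimes>\<^sub>M mu s). F (fst z + snd z)) = (LINT y|mu (r + s). F y :: real)"
    and "integrable (mu r \<Otimes>\<^sub>M mu s) (\<lambda>z. F (fst z + snd z)) \<longleftrightarrow> integrable (mu (r + s)) F"
  unfolding mu_conv[OF assms(1,2)] by (simp_all add: integral_distr integrable_distr_eq case_prod_unfold)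

lemma mu_wsq:
  assumes "0 \<le> b" "0 < p" "p < \<alpha>"
  shows "integrable (mu b) (wsq p)" "(LINT y|mu b. wsq p y) \<le> 32 / (\<alpha> - p) * b"
  using stable_wsq_bound[OF mu_distribution mu_char] assms by auto

end

text \<open>\<open>\<tau>\<close> is the scale of the stationary marginal. The smoothed functional \<open>Kr r x\<close> is the mean of \<open>K\<close> at \<open>x\<close> plus
  independent noise of scale \<open>r\<close>, and \<open>v t\<close> is the second moment of the conditional mean of \<open>K\<close> when
  noise of scale \<open>t\<close> out of \<open>\<tau>\<close> is known.\<close>

locale stable_functional = stable_noise P \<alpha> \<Phi> for P :: "'w measure" and \<alpha> \<Phi> +
  fixes K :: "real \<Rightarrow> real" and x0 \<beta> CK \<tau> :: real
  assumes K_measurable [measurable]: "K \<in> borel_measurable borel"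
    and beta: "0 < \<beta>" "\<beta> < \<alpha> / 2"
    and K_growth: "\<And>x. x0 < \<bar>x\<bar> \<Longrightarrow> \<bar>K x\<bar> \<le> CK * \<bar>x\<bar> powr \<beta>"
    and K_local: "integrable lborel (\<lambda>x. indicator {-x0..x0} x * K x)"
    and tau: "0 \<le> \<tau>" and K_L2: "integrable (mu \<tau>) (\<lambda>x. (K x)\<^sup>2)"
begin

definition Kr :: "real \<Rightarrow> real \<Rightarrow> real" where "Kr r x = (LINT y|mu r. K (x + y))"

definition v :: "real \<Rightarrow> real" where "v t = (LINT y|mu t. (Kr (\<tau> - t) y)\<^sup>2)"

lemma stable_law_mu: "0 < r \<Longrightarrow> stable_law (mu r) r \<alpha>"
  using mu_distribution[of r] alpha mu_char[of r] unfolding stable_law_def stable_law_axioms_def by auto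

lemma K_integrable: assumes "0 \<le> r" shows "integrable (mu r) (\<lambda>y. K (x + y))"
proof (cases "r = 0")
  case True
  thus ?thesis by (auto intro!: integrableI_bounded simp: mu_0 nn_integral_return)
next
  case False
  then interpret S: stable_law "mu r" r \<alpha> using assms by (intro stable_law_mu) auto
  show ?thesis by (rule S.smoothing(1)[OF K_measurable beta K_growth K_local])
qed

lemma Kr_0: "Kr 0 x = K x" by (simp add: Kr_def mu_0 integral_return)

lemma Kr_measurable [measurable]: "0 \<le> r \<Longrightarrow> Kr r \<in> borel_measurable borel"
proof -
  assume "0 \<le> r"
  then interpret R: real_distribution "mu r" by (rule mu_distribution)
  show ?thesis unfolding Kr_def by measurable
qed

lemma Kr_add:
  assumes "0 \<le> r" "0 \<le> s"
  shows "integrable (mu s) (\<lambda>y. Kr r (x + y))" "(LINT y|mu s. Kr r (x + y)) = Kr (s + r) x"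
proof -
  interpret r: real_distribution "mu r" by (rule mu_distribution) fact
  interpret s: real_distribution "mu s" by (rule mu_distribution) fact
  interpret sr: pair_prob_space "mu s" "mu r" ..
  have "integrable (mu (s + r)) (\<lambda>y. K (x + y))" using assms by (intro K_integrable) auto
  hence i: "integrable (mu s \<Otimes>\<^sub>M mu r) (\<lambda>z. K (x + (fst z + snd z)))"
    using assms by (subst mu_conv_integral(2)[of s r "\<lambda>y. K (x + y)"]) auto
  show "integrable (mu s) (\<lambda>y. Kr r (x + y))"
    using sr.integrable_fst'[OF i] by (simp add: Kr_def add.assoc)
  have "Kr (s + r) x = (LINT z|(mu s \<Otimes>\<^sub>M mu r). K (x + (fst z + snd z)))"
    unfolding Kr_def using assms by (subst mu_conv_integral(1)[of s r "\<lambda>y. K (x + y)"]) auto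
  also have "\<dots> = (LINT y|mu s. Kr r (x + y))"
    using sr.integral_fst'[OF i] by (simp add: Kr_def add.assoc)
  finally show "(LINT y|mu s. Kr r (x + y)) = Kr (s + r) x" ..
qed

lemma Kr_L2: assumes "0 \<le> t" "t \<le> \<tau>" shows "integrable (mu t) (\<lambda>y. (Kr (\<tau> - t) y)\<^sup>2)"
proof -
  interpret t: real_distribution "mu t" using assms by (intro mu_distribution)
  interpret s: real_distribution "mu (\<tau> - t)" using assms by (intro mu_distribution) auto
  interpret ts: pair_prob_space "mu t" "mu (\<tau> - t)" ..
  have "integrable (mu t \<Otimes>\<^sub>M mu (\<tau> - t)) (\<lambda>z. (K (fst z + snd z))\<^sup>2)"
    using assms K_L2 by (subst mu_conv_integral(2)[of t "\<tau> - t" "\<lambda>y. (K y)\<^sup>2"]) auto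
  from ts.proj_L2[OF _ this] show ?thesis by (simp add: ts.proj_def Kr_def)
qed

lemma v_step:
  assumes "0 \<le> t" "0 \<le> b" "t + b \<le> \<tau>"
  defines "f \<equiv> \<lambda>z. Kr (\<tau> - (t + b)) (fst z + snd z)"
  shows "integrable (mu t \<Otimes>\<^sub>M mu b) (\<lambda>z. (f z)\<^sup>2)" "(LINT z|(mu t \<Otimes>\<^sub>M mu b). (f z)\<^sup>2) = v (t + b)"
    "pair_prob_space.proj (mu b) f x = Kr (\<tau> - t) x"
    "pair_prob_space (mu t) (mu b)" "f \<in> borel_measurable (mu t \<Otimes>\<^sub>M mu b)"
proof -
  interpret t: real_distribution "mu t" using assms by (intro mu_distribution)
  interpret b: real_distribution "mu b" using assms by (intro mu_distribution) auto
  interpret tb: pair_prob_space "mu t" "mu b" ..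
  show "pair_prob_space (mu t) (mu b)" ..
  have [measurable]: "Kr (\<tau> - (t + b)) \<in> borel_measurable borel" using assms by (intro Kr_measurable) auto
  show "f \<in> borel_measurable (mu t \<Otimes>\<^sub>M mu b)" unfolding f_def by measurable
  show "integrable (mu t \<Otimes>\<^sub>M mu b) (\<lambda>z. (f z)\<^sup>2)" unfolding f_def
    using assms Kr_L2[of "t + b"] by (subst mu_conv_integral(2)[of t b "\<lambda>y. (Kr (\<tau> - (t + b)) y)\<^sup>2"]) auto
  show "(LINT z|(mu t \<Otimes>\<^sub>M mu b). (f z)\<^sup>2) = v (t + b)" unfolding f_def v_def
    using assms by (subst mu_conv_integral(1)[of t b "\<lambda>y. (Kr (\<tau> - (t + b)) y)\<^sup>2"]) auto
  show "tb.proj f x = Kr (\<tau> - t) x"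
    using Kr_add(2)[of "\<tau> - (t + b)" b x] assms by (simp add: tb.proj_def f_def)
qed

lemma v_mono: assumes "0 \<le> s" "s \<le> t" "t \<le> \<tau>" shows "v s \<le> v t"
proof -
  define b where "b = t - s"
  have b: "0 \<le> s" "0 \<le> b" "s + b \<le> \<tau>" "s + b = t" using assms by (auto simp: b_def)
  note st = v_step[OF b(1-3)]
  interpret sb: pair_prob_space "mu s" "mu b" by (rule st(4))
  have "0 \<le> (LINT z|(mu s \<Otimes>\<^sub>M mu b). (Kr (\<tau> - (s + b)) (fst z + snd z) - sb.proj (\<lambda>z. Kr (\<tau> - (s + b)) (fst z + snd z)) (fst z))\<^sup>2)"
    by (rule integral_nonneg_AE) auto
  also have "\<dots> = v t - v s"
    using sb.proj_residual_square[OF st(5) st(1)] unfolding st(2,3) by (simp add: v_def b(4))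
  finally show ?thesis by simp
qed

lemma v_nonneg: "0 \<le> v t" unfolding v_def by (rule integral_nonneg_AE) auto

lemma v_lipschitz:
  assumes "0 < r0" shows "\<exists>C\<ge>0. \<forall>t b. 0 \<le> t \<longrightarrow> 0 \<le> b \<longrightarrow> t + b \<le> \<tau> - r0 \<longrightarrow> v (t + b) - v t \<le> C * b"
proof -
  define p where "p = 2 * \<beta>"
  have p: "0 < p" "p < \<alpha>" using beta by (auto simp: p_def)
  interpret S: stable_law "mu r0" r0 \<alpha> by (rule stable_law_mu) fact
  obtain C where C: "C \<ge> 0" "\<And>x z. (Kr r0 (x + z) - Kr r0 x)\<^sup>2 \<le> C * (2 + wsq p x) * wsq p z"
    using S.smoothing(2)[OF K_measurable beta K_growth K_local] unfolding Kr_def p_def by blast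
  define c1 where "c1 = 32 / (\<alpha> - p)"
  have c1: "c1 \<ge> 0" using p by (simp add: c1_def)
  have "v (t + b) - v t \<le> C * (2 + c1 * \<tau>) * c1 * b" if tb: "0 \<le> t" "0 \<le> b" "t + b \<le> \<tau> - r0" for t b
  proof -
    define s where "s = \<tau> - (t + b) - r0"
    have s: "0 \<le> s" "\<tau> - (t + b) = s + r0" using tb by (auto simp: s_def)
    have tb': "0 \<le> t" "0 \<le> b" "t + b \<le> \<tau>" using tb assms by auto
    note st = v_step[OF tb']
    interpret t: real_distribution "mu t" using tb by (intro mu_distribution)
    interpret b: real_distribution "mu b" using tb by (intro mu_distribution) auto
    interpret tb: pair_prob_space "mu t" "mu b" ..
    interpret s: real_distribution "mu s" using s by (intro mu_distribution) auto
    have [measurable]: "Kr r0 \<in> borel_measurable borel" "Kr (s + r0) \<in> borel_measurable borel"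
      using assms s by (auto intro!: Kr_measurable)
    define B where "B x z = C * (2 + (LINT y|mu s. wsq p (x + y))) * wsq p z" for x z
    have iwx: "integrable (mu t \<Otimes>\<^sub>M mu s) (\<lambda>z. wsq p (fst z + snd z))"
      using tb s mu_wsq(1)[of "t + s" p] p by (subst mu_conv_integral(2)) auto
    interpret ts: pair_prob_space "mu t" "mu s" ..
    have iw: "integrable (mu t) (\<lambda>x. LINT y|mu s. wsq p (x + y))" using ts.integrable_fst'[OF iwx] by simp
    have "(LINT x|mu t. LINT y|mu s. wsq p (x + y)) = (LINT y|mu (t + s). wsq p y)"
      using ts.integral_fst'[OF iwx] tb s by (simp add: mu_conv_integral(1))
    also have "\<dots> \<le> c1 * (t + s)" unfolding c1_def using tb s p by (intro mu_wsq) auto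
    also have "\<dots> \<le> c1 * \<tau>" using tb assms c1 by (intro mult_left_mono) (auto simp: s_def)
    finally have iwb: "(LINT x|mu t. LINT y|mu s. wsq p (x + y)) \<le> c1 * \<tau>" .
    have wx: "AE x in mu t. integrable (mu s) (\<lambda>y. wsq p (x + y))" using ts.AE_integrable_fst'[OF iwx] by simp
    have pt: "AE x in mu t. \<forall>z. (Kr (s + r0) (x + z) - Kr (s + r0) x)\<^sup>2 \<le> B x z"
      using wx
    proof eventually_elim
      case (elim x)
      show ?case
      proof
        fix z
        have i: "integrable (mu s) (\<lambda>y. Kr r0 (x + z + y))" "integrable (mu s) (\<lambda>y. Kr r0 (x + y))"
          using assms s by (auto intro!: Kr_add)
        have e: "integrable (mu s) (\<lambda>y. C * (2 + wsq p (x + y)) * wsq p z)"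
          using elim by (intro integrable_mult_left integrable_mult_right Bochner_Integration.integrable_add) auto
        have le: "(Kr r0 (x + z + y) - Kr r0 (x + y))\<^sup>2 \<le> C * (2 + wsq p (x + y)) * wsq p z" for y
          using C(2)[of "x + y" z] by (simp add: add_ac)
        have i2: "integrable (mu s) (\<lambda>y. (Kr r0 (x + z + y) - Kr r0 (x + y))\<^sup>2)"
          by (rule Bochner_Integration.integrable_bound[OF e]) (use le in \<open>auto intro!: AE_I2 intro: order_trans[OF _ abs_ge_self]\<close>)
        have "Kr (s + r0) (x + z) - Kr (s + r0) x = (LINT y|mu s. Kr r0 (x + z + y) - Kr r0 (x + y))"
          using i assms s by (simp add: Kr_add(2))
        hence "\<bar>Kr (s + r0) (x + z) - Kr (s + r0) x\<bar> \<le> sqrt (LINT y|mu s. (Kr r0 (x + z + y) - Kr r0 (x + y))\<^sup>2)"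
          using Cauchy_Schwarz_integral[of "\<lambda>y. Kr r0 (x + z + y) - Kr r0 (x + y)" "mu s" "\<lambda>_. 1"] i2 s.prob_space by simp
        hence "\<bar>Kr (s + r0) (x + z) - Kr (s + r0) x\<bar>\<^sup>2 \<le> (sqrt (LINT y|mu s. (Kr r0 (x + z + y) - Kr r0 (x + y))\<^sup>2))\<^sup>2"
          by (intro power_mono) auto
        hence "(Kr (s + r0) (x + z) - Kr (s + r0) x)\<^sup>2 \<le> (LINT y|mu s. (Kr r0 (x + z + y) - Kr r0 (x + y))\<^sup>2)"
          by (simp add: integral_nonneg_AE)
        also have "\<dots> \<le> (LINT y|mu s. C * (2 + wsq p (x + y)) * wsq p z)"
          by (rule integral_mono[OF i2 e le])
        also have "\<dots> = B x z"
          unfolding B_def using elim s.prob_space by (simp add: distrib_left)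
        finally show "(Kr (s + r0) (x + z) - Kr (s + r0) x)\<^sup>2 \<le> B x z" .
      qed
    qed
    define g where "g x = C * (2 + (LINT y|mu s. wsq p (x + y)))" for x
    have [measurable]: "g \<in> borel_measurable borel" unfolding g_def by measurable
    have ig: "integrable (mu t) g" unfolding g_def using iw by (intro integrable_mult_right Bochner_Integration.integrable_add) auto
    have iwb2: "integrable (mu b) (wsq p)" using mu_wsq(1)[of b p] tb p by simp
    have iB: "integrable (mu t \<Otimes>\<^sub>M mu b) (\<lambda>z. g (fst z) * wsq p (snd z))"
    proof (rule tb.Fubini_integrable)
      have g0: "0 \<le> g x" for x unfolding g_def using C by (intro mult_nonneg_nonneg add_nonneg_nonneg integral_nonneg_AE) auto
      show "integrable (mu t) (\<lambda>x. LINT y|mu b. norm (g (fst (x, y)) * wsq p (snd (x, y))))"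
        using ig g0 by (simp add: abs_mult)
    qed (use iwb2 in auto)
    have aeB: "AE z in mu t \<Otimes>\<^sub>M mu b. (Kr (s + r0) (fst z + snd z) - Kr (s + r0) (fst z))\<^sup>2 \<le> g (fst z) * wsq p (snd z)"
    proof -
      have "AE x in distr (mu t \<Otimes>\<^sub>M mu b) (mu t) fst. \<forall>z. (Kr (s + r0) (x + z) - Kr (s + r0) x)\<^sup>2 \<le> B x z"
        unfolding b.distr_pair_fst by (rule pt)
      hence "AE z in mu t \<Otimes>\<^sub>M mu b. \<forall>z'. (Kr (s + r0) (fst z + z') - Kr (s + r0) (fst z))\<^sup>2 \<le> B (fst z) z'"
        by (rule AE_distrD[rotated]) measurable
      thus ?thesis by eventually_elim (simp add: B_def g_def)
    qed
    have iD: "integrable (mu t \<Otimes>\<^sub>M mu b) (\<lambda>z. (Kr (s + r0) (fst z + snd z) - Kr (s + r0) (fst z))\<^sup>2)"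
      by (rule Bochner_Integration.integrable_bound[OF iB]) (use aeB in \<open>auto elim!: eventually_mono\<close>)
    have "v (t + b) - v t \<le> (LINT z|(mu t \<Otimes>\<^sub>M mu b). (Kr (s + r0) (fst z + snd z) - Kr (s + r0) (fst z))\<^sup>2)"
    proof -
      have "(LINT z|(mu t \<Otimes>\<^sub>M mu b). (Kr (\<tau> - (t + b)) (fst z + snd z))\<^sup>2) - (LINT x|mu t. (tb.proj (\<lambda>z. Kr (\<tau> - (t + b)) (fst z + snd z)) x)\<^sup>2) \<le>
          (LINT z|(mu t \<Otimes>\<^sub>M mu b). (Kr (\<tau> - (t + b)) (fst z + snd z) - Kr (s + r0) (fst z))\<^sup>2)"
        by (rule tb.proj_optimal[OF st(5) st(1)])
           (use iD s assms tb in \<open>auto intro!: Kr_add(1)\<close>)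
      thus ?thesis unfolding st(2,3) s(2)[symmetric] by (simp add: v_def)
    qed
    also have "\<dots> \<le> (LINT z|(mu t \<Otimes>\<^sub>M mu b). g (fst z) * wsq p (snd z))"
      by (rule integral_mono_AE[OF iD iB aeB])
    also have "\<dots> = (LINT x|mu t. g x) * (LINT z|mu b. wsq p z)"
      using tb.integral_fst'[OF iB] by simp
    also have "(LINT x|mu t. g x) = C * (2 + (LINT x|mu t. LINT y|mu s. wsq p (x + y)))"
      unfolding g_def using iw t.prob_space by simp
    also have "\<dots> * (LINT z|mu b. wsq p z) \<le> (C * (2 + c1 * \<tau>)) * (c1 * b)"
    proof (intro mult_mono mult_left_mono add_left_mono iwb C)
      show "(LINT z|mu b. wsq p z) \<le> c1 * b" unfolding c1_def using tb p by (intro mu_wsq) auto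
    qed (use C c1 tau in \<open>auto intro!: integral_nonneg_AE\<close>)
    finally show ?thesis by (simp add: mult.assoc)
  qed
  moreover have "0 \<le> C * (2 + c1 * \<tau>) * c1" using C c1 tau by auto
  ultimately show ?thesis by blast
qed

end

section \<open>Left continuity of the conditional second moment\<close>

definition lipschitz_bounded :: "(real \<Rightarrow> real) \<Rightarrow> bool" where
  "lipschitz_bounded H \<longleftrightarrow> (\<exists>L\<ge>0. \<forall>x y. \<bar>H x - H y\<bar> \<le> L * \<bar>x - y\<bar>) \<and> (\<exists>B\<ge>0. \<forall>x. \<bar>H x\<bar> \<le> B)"

lemma lipschitz_bounded_measurable: "lipschitz_bounded H \<Longrightarrow> H \<in> borel_measurable borel"
proof -
  assume "lipschitz_bounded H"
  then obtain L where "\<forall>x y. \<bar>H x - H y\<bar> \<le> L * \<bar>x - y\<bar>" unfolding lipschitz_bounded_def by blast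
  moreover have "0 \<le> L"
    using calculation[rule_format, of 0 1] abs_ge_zero[of "H 0 - H 1"] by (simp del: abs_ge_zero)
  ultimately have "L-lipschitz_on UNIV H" by (auto intro!: lipschitz_onI simp: dist_real_def)
  thus ?thesis by (intro borel_measurable_continuous_onI lipschitz_on_continuous_on)
qed

lemma lipschitz_bounded_const: "lipschitz_bounded (\<lambda>_. c)"
  unfolding lipschitz_bounded_def by (auto intro!: exI[of _ 0] exI[of _ "\<bar>c\<bar>"])

lemma lipschitz_bounded_add:
  assumes "lipschitz_bounded H" "lipschitz_bounded G" shows "lipschitz_bounded (\<lambda>x. H x + G x)"
proof -
  obtain L L' B B' where H: "L \<ge> 0" "\<And>x y. \<bar>H x - H y\<bar> \<le> L * \<bar>x - y\<bar>" "B \<ge> 0" "\<And>x. \<bar>H x\<bar> \<le> B"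
    and G: "L' \<ge> 0" "\<And>x y. \<bar>G x - G y\<bar> \<le> L' * \<bar>x - y\<bar>" "B' \<ge> 0" "\<And>x. \<bar>G x\<bar> \<le> B'"
    using assms unfolding lipschitz_bounded_def by metis
  have "\<bar>H x + G x - (H y + G y)\<bar> \<le> (L + L') * \<bar>x - y\<bar>" for x y
    using H(2)[of x y] G(2)[of x y] by (simp add: distrib_right)
  moreover have "\<bar>H x + G x\<bar> \<le> B + B'" for x using H(4)[of x] G(4)[of x] by linarith
  ultimately show ?thesis unfolding lipschitz_bounded_def
    using H G by (intro conjI exI[of _ "L + L'"] exI[of _ "B + B'"]) auto
qed

lemma lipschitz_bounded_cmult:
  assumes "lipschitz_bounded H" shows "lipschitz_bounded (\<lambda>x. c * H x)"
proof -
  obtain L B where H: "L \<ge> 0" "\<And>x y. \<bar>H x - H y\<bar> \<le> L * \<bar>x - y\<bar>" "B \<ge> 0" "\<And>x. \<bar>H x\<bar> \<le> B"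
    using assms unfolding lipschitz_bounded_def by metis
  have "\<bar>c * H x - c * H y\<bar> \<le> (\<bar>c\<bar> * L) * \<bar>x - y\<bar>" for x y
    using mult_left_mono[OF H(2)[of x y], of "\<bar>c\<bar>"] by (simp add: mult.assoc flip: abs_mult right_diff_distrib)
  moreover have "\<bar>c * H x\<bar> \<le> \<bar>c\<bar> * B" for x using mult_left_mono[OF H(4)[of x], of "\<bar>c\<bar>"] by (simp add: abs_mult)
  ultimately show ?thesis unfolding lipschitz_bounded_def
    using H by (intro conjI exI[of _ "\<bar>c\<bar> * L"] exI[of _ "\<bar>c\<bar> * B"]) auto
qed

context real_distribution
begin

definition approximable :: "(real \<Rightarrow> real) \<Rightarrow> bool" where
  "approximable f \<longleftrightarrow> f \<in> borel_measurable borel \<and> integrable M (\<lambda>x. (f x)\<^sup>2) \<and>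
    (\<forall>e>0. \<exists>H. lipschitz_bounded H \<and> (LINT x|M. (f x - H x)\<^sup>2) < e)"

lemma lipschitz_bounded_L2: "lipschitz_bounded H \<Longrightarrow> integrable M (\<lambda>x. (H x)\<^sup>2)"
proof -
  assume H: "lipschitz_bounded H"
  note [measurable] = lipschitz_bounded_measurable[OF H]
  obtain B where B: "B \<ge> 0" "\<And>x. \<bar>H x\<bar> \<le> B" using H unfolding lipschitz_bounded_def by blast
  show ?thesis
    by (rule integrable_const_bound[of _ "B\<^sup>2"]) (use B in \<open>auto intro!: AE_I2 simp: abs_le_square_iff[symmetric]\<close>)
qed

lemma L2_dist_add:
  fixes f g :: "real \<Rightarrow> real"
  assumes "f \<in> borel_measurable borel" "g \<in> borel_measurable borel"
    and "integrable M (\<lambda>x. (f x)\<^sup>2)" "integrable M (\<lambda>x. (g x)\<^sup>2)"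
  shows "(LINT x|M. (f x + g x)\<^sup>2) \<le> 2 * (LINT x|M. (f x)\<^sup>2) + 2 * (LINT x|M. (g x)\<^sup>2)"
proof -
  have m: "f \<in> borel_measurable M" "g \<in> borel_measurable M" using assms by auto
  have "(LINT x|M. (f x + g x)\<^sup>2) \<le> (LINT x|M. 2 * (f x)\<^sup>2 + 2 * (g x)\<^sup>2)"
  proof (rule integral_mono)
    show "(f x + g x)\<^sup>2 \<le> 2 * (f x)\<^sup>2 + 2 * (g x)\<^sup>2" for x
      using sum_squares_bound[of "f x" "g x"] by (simp add: power2_sum)
  qed (use assms m in \<open>auto intro!: L2_add_integrable\<close>)
  thus ?thesis using assms by simp
qed

lemma approximable_limit:
  assumes f: "f \<in> borel_measurable borel" "integrable M (\<lambda>x. (f x)\<^sup>2)"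
    and g: "\<And>n. approximable (g n)" and lim: "(\<lambda>n. LINT x|M. (f x - g n x)\<^sup>2) \<longlonglongrightarrow> 0"
  shows "approximable f"
  unfolding approximable_def
proof (intro conjI f allI impI)
  fix e :: real assume e: "e > 0"
  have "\<forall>\<^sub>F n in sequentially. (LINT x|M. (f x - g n x)\<^sup>2) < e / 4" using e by (intro order_tendstoD(2)[OF lim]) auto
  then obtain n where n: "(LINT x|M. (f x - g n x)\<^sup>2) < e / 4" by (auto dest: eventually_happens)
  obtain H where H: "lipschitz_bounded H" "(LINT x|M. (g n x - H x)\<^sup>2) < e / 4"
    using g[of n] e unfolding approximable_def by (metis zero_less_divide_iff zero_less_numeral)
  have gm: "g n \<in> borel_measurable borel" "integrable M (\<lambda>x. (g n x)\<^sup>2)" using g[of n] by (auto simp: approximable_def)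
  have "(LINT x|M. ((f x - g n x) + (g n x - H x))\<^sup>2) \<le> 2 * (LINT x|M. (f x - g n x)\<^sup>2) + 2 * (LINT x|M. (g n x - H x)\<^sup>2)"
    using f gm lipschitz_bounded_measurable[OF H(1)] lipschitz_bounded_L2[OF H(1)]
    by (intro L2_dist_add L2_diff_integrable) auto
  also have "\<dots> < e" using n H by linarith
  finally show "\<exists>H. lipschitz_bounded H \<and> (LINT x|M. (f x - H x)\<^sup>2) < e" using H(1) by auto
qed

lemma approximable_add:
  assumes "approximable f" "approximable g" shows "approximable (\<lambda>x. f x + g x)"
  unfolding approximable_def
proof (intro conjI allI impI)
  have f: "f \<in> borel_measurable borel" "integrable M (\<lambda>x. (f x)\<^sup>2)" and g: "g \<in> borel_measurable borel" "integrable M (\<lambda>x. (g x)\<^sup>2)"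
    using assms by (auto simp: approximable_def)
  show "(\<lambda>x. f x + g x) \<in> borel_measurable borel" "integrable M (\<lambda>x. (f x + g x)\<^sup>2)"
    using f g by (auto intro!: L2_add_integrable)
  fix e :: real assume e: "e > 0"
  obtain H where H: "lipschitz_bounded H" "(LINT x|M. (f x - H x)\<^sup>2) < e / 4"
    using assms(1) e unfolding approximable_def by (metis zero_less_divide_iff zero_less_numeral)
  obtain G where G: "lipschitz_bounded G" "(LINT x|M. (g x - G x)\<^sup>2) < e / 4"
    using assms(2) e unfolding approximable_def by (metis zero_less_divide_iff zero_less_numeral)
  have "(LINT x|M. ((f x - H x) + (g x - G x))\<^sup>2) \<le> 2 * (LINT x|M. (f x - H x)\<^sup>2) + 2 * (LINT x|M. (g x - G x)\<^sup>2)"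
    using f g lipschitz_bounded_measurable[OF H(1)] lipschitz_bounded_L2[OF H(1)]
      lipschitz_bounded_measurable[OF G(1)] lipschitz_bounded_L2[OF G(1)]
    by (intro L2_dist_add L2_diff_integrable) auto
  also have "\<dots> < e" using H G by linarith
  also have "(\<lambda>x. ((f x - H x) + (g x - G x))\<^sup>2) = (\<lambda>x. (f x + g x - (H x + G x))\<^sup>2)" by (auto simp: algebra_simps)
  finally show "\<exists>F. lipschitz_bounded F \<and> (LINT x|M. (f x + g x - F x)\<^sup>2) < e"
    using lipschitz_bounded_add[OF H(1) G(1)] by blast
qed

lemma approximable_cmult:
  assumes "approximable f" shows "approximable (\<lambda>x. c * f x)"
  unfolding approximable_def
proof (intro conjI allI impI)
  show "(\<lambda>x. c * f x) \<in> borel_measurable borel" "integrable M (\<lambda>x. (c * f x)\<^sup>2)"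
    using assms by (auto simp: approximable_def power_mult_distrib)
  fix e :: real assume e: "e > 0"
  have c1: "1 + c\<^sup>2 > 0" by (simp add: add_pos_nonneg)
  have "\<forall>e>0. \<exists>H. lipschitz_bounded H \<and> (LINT x|M. (f x - H x)\<^sup>2) < e" using assms by (simp add: approximable_def)
  moreover have "e / (1 + c\<^sup>2) > 0" using e c1 by simp
  ultimately obtain H where H: "lipschitz_bounded H" "(LINT x|M. (f x - H x)\<^sup>2) < e / (1 + c\<^sup>2)" by blast
  have "(LINT x|M. (c * f x - c * H x)\<^sup>2) = c\<^sup>2 * (LINT x|M. (f x - H x)\<^sup>2)"
    by (simp add: power_mult_distrib flip: right_diff_distrib)
  also have "\<dots> \<le> (1 + c\<^sup>2) * (LINT x|M. (f x - H x)\<^sup>2)"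
    by (intro mult_right_mono integral_nonneg_AE) auto
  also have "\<dots> < e" using H(2) c1 by (simp add: pos_less_divide_eq mult.commute)
  finally show "\<exists>F. lipschitz_bounded F \<and> (LINT x|M. (c * f x - F x)\<^sup>2) < e"
    using lipschitz_bounded_cmult[OF H(1)] by blast
qed

lemma approximable_lipschitz: "lipschitz_bounded H \<Longrightarrow> approximable H"
  unfolding approximable_def
  by (auto intro!: lipschitz_bounded_measurable lipschitz_bounded_L2 exI[of _ H])

lemma approximable_dominated:
  assumes f: "f \<in> borel_measurable borel" and g: "\<And>n. approximable (g n)"
    and lim: "\<And>x. (\<lambda>n. g n x) \<longlonglongrightarrow> f x"
    and w: "w \<in> borel_measurable borel" "integrable M (\<lambda>x. (w x)\<^sup>2)" and bd: "\<And>n x. \<bar>g n x\<bar> \<le> w x" "\<And>x. \<bar>f x\<bar> \<le> w x"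
  shows "approximable f"
proof (rule approximable_limit[OF f _ g])
  have [measurable]: "f \<in> borel_measurable borel" "w \<in> borel_measurable borel" "\<And>n. g n \<in> borel_measurable borel"
    using f w g by (auto simp: approximable_def)
  show f2: "integrable M (\<lambda>x. (f x)\<^sup>2)"
    by (rule Bochner_Integration.integrable_bound[OF w(2)])
       (use bd(2) in \<open>auto intro!: AE_I2 simp: abs_le_square_iff[symmetric] intro: order_trans[OF _ abs_ge_self]\<close>)
  have "(\<lambda>n. LINT x|M. (f x - g n x)\<^sup>2) \<longlonglongrightarrow> (LINT x|M. 0)"
  proof (rule integral_dominated_convergence[where w="\<lambda>x. 4 * (w x)\<^sup>2"])
    show "AE x in M. (\<lambda>n. (f x - g n x)\<^sup>2) \<longlonglongrightarrow> 0"
    proof (rule AE_I2)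
      fix x
      have "(\<lambda>n. (f x - g n x)\<^sup>2) \<longlonglongrightarrow> (f x - f x)\<^sup>2" by (intro tendsto_intros lim)
      thus "(\<lambda>n. (f x - g n x)\<^sup>2) \<longlonglongrightarrow> 0" by simp
    qed
    show "AE x in M. norm ((f x - g n x)\<^sup>2) \<le> 4 * (w x)\<^sup>2" for n
    proof (rule AE_I2)
      fix x
      have "\<bar>f x - g n x\<bar> \<le> 2 * w x" using bd(1)[of n x] bd(2)[of x] by linarith
      hence "\<bar>f x - g n x\<bar>\<^sup>2 \<le> (2 * w x)\<^sup>2" by (intro power_mono) auto
      thus "norm ((f x - g n x)\<^sup>2) \<le> 4 * (w x)\<^sup>2" by (simp add: power_mult_distrib)
    qed
  qed (use w in auto)
  thus "(\<lambda>n. LINT x|M. (f x - g n x)\<^sup>2) \<longlonglongrightarrow> 0" by simp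
qed

lemma approximable_closed: assumes C: "closed C" shows "approximable (indicator C)"
proof (cases "C = {}")
  case True
  thus ?thesis using approximable_lipschitz[OF lipschitz_bounded_const[of 0]] by (simp add: indicator_def[abs_def])
next
  case False
  define g where "g n x = max 0 (1 - real n * infdist x C)" for n x
  have g01: "0 \<le> g n x" "g n x \<le> 1" for n x by (auto simp: g_def infdist_nonneg)
  show ?thesis
  proof (rule approximable_dominated[where w="\<lambda>_. 1" and g=g])
    show "approximable (g n)" for n
    proof (rule approximable_lipschitz)
      have "\<bar>g n x - g n y\<bar> \<le> real n * \<bar>x - y\<bar>" for x y
      proof -
        have "\<bar>g n x - g n y\<bar> \<le> \<bar>real n * infdist x C - real n * infdist y C\<bar>" by (auto simp: g_def)
        also have "\<dots> = real n * \<bar>infdist x C - infdist y C\<bar>" by (simp add: abs_mult flip: right_diff_distrib)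
        also have "\<dots> \<le> real n * \<bar>x - y\<bar>"
          using infdist_triangle_abs[of x C y] by (intro mult_left_mono) (auto simp: dist_real_def)
        finally show ?thesis .
      qed
      thus "lipschitz_bounded (g n)" unfolding lipschitz_bounded_def
        using g01 by (intro conjI exI[of _ "real n"] exI[of _ 1]) (auto simp: abs_of_nonneg)
    qed
    show "(\<lambda>n. g n x) \<longlonglongrightarrow> indicator C x" for x
    proof (cases "x \<in> C")
      case True
      thus ?thesis by (simp add: g_def)
    next
      case outside: False
      hence d: "infdist x C > 0" using in_closed_iff_infdist_zero[OF C False] infdist_nonneg[of x C] by (metis less_eq_real_def)
      obtain N where N: "1 / infdist x C < real N" using reals_Archimedean2 by blast
      have "\<forall>\<^sub>F n in sequentially. 0 = g n x"
        using eventually_ge_at_top[of N]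
      proof eventually_elim
        case (elim n)
        have "1 / infdist x C < real n" using N elim by linarith
        hence "1 < real n * infdist x C" using d by (simp add: pos_divide_less_eq)
        thus ?case by (simp add: g_def)
      qed
      thus ?thesis using outside by (simp add: Lim_transform_eventually[OF tendsto_const])
    qed
    show "\<bar>g n x\<bar> \<le> 1" for n x using g01[of n x] by simp
  qed (use C in \<open>auto split: split_indicator\<close>)
qed

lemma approximable_indicator: assumes "A \<in> sets borel" shows "approximable (indicator A)"
proof -
  have "Int_stable (Collect closed :: real set set)" by (auto simp: Int_stable_def closed_Int)
  moreover have "Collect closed \<subseteq> Pow (UNIV :: real set)" by simp
  moreover have "A \<in> sigma_sets UNIV (Collect closed)" using assms by (simp add: borel_eq_closed)
  ultimately show ?thesis
  proof (induction rule: sigma_sets_induct_disjoint)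
    case (basic A)
    thus ?case using approximable_closed by simp
  next
    case empty
    show ?case by (rule approximable_closed[OF closed_empty])
  next
    case (compl A)
    have "approximable (\<lambda>x. 1 + -1 * indicator A x)"
      by (rule approximable_add[OF approximable_lipschitz[OF lipschitz_bounded_const] approximable_cmult[OF compl(2)]])
    also have "(\<lambda>x. 1 + -1 * indicator A x :: real) = indicator (UNIV - A)" by (auto simp: indicator_def fun_eq_iff)
    finally show ?case .
  next
    case (union A)
    have Ab: "A i \<in> sets borel" for i using union by (auto simp: borel_eq_closed)
    have sum: "(\<Sum>i<n. indicator (A i) x) = (indicator (\<Union>i<n. A i) x :: real)" for n x
      using union(1) by (intro indicator_UN_disjoint[symmetric]) (auto simp: disjoint_family_on_def)
    show ?case
    proof (rule approximable_dominated[where w="\<lambda>_. 1"])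
      show "approximable (\<lambda>x. \<Sum>i<n. indicator (A i) x)" for n
      proof (induction n)
        case 0
        show ?case using approximable_lipschitz[OF lipschitz_bounded_const[of 0]] by simp
      qed (use union in \<open>auto intro!: approximable_add\<close>)
      show "(\<lambda>n. \<Sum>i<n. indicator (A i) x) \<longlonglongrightarrow> (indicator (\<Union>(range A)) x :: real)" for x
        unfolding sum by (rule LIMSEQ_indicator_UN)
    qed (use Ab in \<open>auto simp: sum split: split_indicator\<close>)
  qed
qed

theorem L2_lipschitz_dense:
  assumes [measurable]: "f \<in> borel_measurable borel" and f2: "integrable M (\<lambda>x. (f x)\<^sup>2)"
  shows "approximable f"
proof -
  obtain s where s: "\<And>i. simple_function borel (s i)" "\<And>x. (\<lambda>i. s i x) \<longlonglongrightarrow> f x" "\<And>i x. norm (s i x) \<le> 2 * norm (f x)"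
    using borel_measurable_implies_sequence_metric[OF assms(1), of 0] by (auto simp: dist_real_def)
  show ?thesis
  proof (rule approximable_dominated[where g=s and w="\<lambda>x. 2 * \<bar>f x\<bar>"])
    show "approximable (s i)" for i
    proof -
      have fin: "finite (range (s i))" using s(1)[of i] by (auto simp: simple_function_def)
      have rep: "s i = (\<lambda>x. \<Sum>y\<in>range (s i). y * indicator (s i -` {y}) x)"
      proof
        fix x
        have "(\<Sum>y\<in>range (s i). y * indicator (s i -` {y}) x) = (\<Sum>y\<in>range (s i). if y = s i x then y else 0)"
          by (intro sum.cong) (auto simp: indicator_def)
        thus "s i x = (\<Sum>y\<in>range (s i). y * indicator (s i -` {y}) x)" using fin by simp
      qed
      have "approximable (\<lambda>x. \<Sum>y\<in>Y. y * indicator (s i -` {y}) x)" if "finite Y" "Y \<subseteq> range (s i)" for Y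
        using that
      proof (induction rule: finite_induct)
        case empty
        show ?case using approximable_lipschitz[OF lipschitz_bounded_const[of 0]] by simp
      next
        case (insert y Y)
        have "s i -` {y} \<in> sets borel" using s(1)[of i] insert.prems by (auto simp: simple_function_def)
        hence "approximable (\<lambda>x. y * indicator (s i -` {y}) x + (\<Sum>y\<in>Y. y * indicator (s i -` {y}) x))"
          using insert by (intro approximable_add approximable_cmult approximable_indicator) auto
        thus ?case unfolding sum.insert[OF insert.hyps] .
      qed
      from this[OF fin subset_refl] show ?thesis using rep by simp
    qed
  qed (use s f2 in \<open>auto simp: power_mult_distrib\<close>)
qed

end

context stable_functional
begin

text \<open>For a bounded Lipschitz function \<open>H\<close> close to \<open>K\<close> in \<open>L\<^sup>2\<close>, noise of scale \<open>b\<close> changes \<open>H\<close> by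
  at most a multiple of \<open>wsq\<close>, whose mean is \<open>O(b)\<close>.\<close>

lemma v_left_continuous:
  assumes "\<epsilon> > 0" shows "\<exists>\<delta>>0. \<forall>b. 0 \<le> b \<longrightarrow> b \<le> \<tau> \<longrightarrow> b < \<delta> \<longrightarrow> v \<tau> - v (\<tau> - b) < \<epsilon>"
proof -
  interpret T: real_distribution "mu \<tau>" by (rule mu_distribution[OF tau])
  obtain H where H: "lipschitz_bounded H" "(LINT x|mu \<tau>. (K x - H x)\<^sup>2) < \<epsilon> / 4"
    using T.L2_lipschitz_dense[OF K_measurable K_L2] assms unfolding T.approximable_def
    by (metis zero_less_divide_iff zero_less_numeral)
  note [measurable] = lipschitz_bounded_measurable[OF H(1)]
  obtain L B where L: "L \<ge> 0" "\<And>x y. \<bar>H x - H y\<bar> \<le> L * \<bar>x - y\<bar>" and B: "B \<ge> 0" "\<And>x. \<bar>H x\<bar> \<le> B"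
    using H(1) unfolding lipschitz_bounded_def by metis
  define p where "p = \<alpha> / 2"
  have p: "0 < p" "p < \<alpha>" using alpha by (auto simp: p_def)
  define D where "D = L\<^sup>2 + 4 * B\<^sup>2"
  have D0: "D \<ge> 0" by (simp add: D_def)
  have Hw: "(H (x + y) - H x)\<^sup>2 \<le> D * wsq p y" for x y
  proof (cases "\<bar>y\<bar> \<le> 1")
    case True
    have "\<bar>H (x + y) - H x\<bar>\<^sup>2 \<le> (L * \<bar>y\<bar>)\<^sup>2" using L(2)[of "x + y" x] by (intro power_mono) auto
    also have "\<dots> = L\<^sup>2 * y\<^sup>2" by (simp add: power_mult_distrib)
    also have "\<dots> \<le> D * y\<^sup>2" by (intro mult_right_mono) (auto simp: D_def)
    finally show ?thesis using True by (simp add: wsq_def)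
  next
    case False
    have "\<bar>H (x + y) - H x\<bar>\<^sup>2 \<le> (2 * B)\<^sup>2" using B(2)[of "x + y"] B(2)[of x] by (intro power_mono) auto
    also have "\<dots> \<le> D * 1" by (simp add: D_def power_mult_distrib)
    also have "\<dots> \<le> D * \<bar>y\<bar> powr p" using False p D0 by (intro mult_left_mono ge_one_powr_ge_zero) auto
    finally show ?thesis using False by (simp add: wsq_def)
  qed
  define c1 where "c1 = D * (32 / (\<alpha> - p))"
  have c1: "c1 \<ge> 0" using D0 p by (simp add: c1_def)
  have main: "v \<tau> - v (\<tau> - b) \<le> \<epsilon> / 2 + 2 * c1 * b" if b: "0 \<le> b" "b \<le> \<tau>" for b
  proof -
    define t where "t = \<tau> - b"
    have t: "0 \<le> t" "t + b \<le> \<tau>" "t + b = \<tau>" "\<tau> - (t + b) = 0" using b by (auto simp: t_def)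
    note st = v_step[OF t(1) b(1) t(2), unfolded t(4), unfolded t(3)]
    interpret t: real_distribution "mu t" by (rule mu_distribution[OF t(1)])
    interpret b: real_distribution "mu b" by (rule mu_distribution[OF b(1)])
    interpret tb: pair_prob_space "mu t" "mu b" ..
    define f where "f = (\<lambda>z :: real \<times> real. Kr 0 (fst z + snd z))"
    define d where "d z = K (fst z + snd z) - H (fst z + snd z)" for z :: "real \<times> real"
    define h where "h z = H (fst z + snd z)" for z :: "real \<times> real"
    have [measurable]: "d \<in> borel_measurable (mu t \<Otimes>\<^sub>M mu b)" "h \<in> borel_measurable (mu t \<Otimes>\<^sub>M mu b)"
      unfolding d_def h_def by measurable
    have fm: "f \<in> borel_measurable (mu t \<Otimes>\<^sub>M mu b)" and f2: "integrable (mu t \<Otimes>\<^sub>M mu b) (\<lambda>z. (f z)\<^sup>2)"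
      using st(1,5) unfolding f_def by auto
    have fdh: "f z = d z + h z" for z by (simp add: f_def d_def h_def Kr_0)
    have KH: "integrable (mu \<tau>) (\<lambda>x. (K x - H x)\<^sup>2)"
      using K_L2 T.lipschitz_bounded_L2[OF H(1)] by (intro L2_diff_integrable) auto
    have d2: "integrable (mu t \<Otimes>\<^sub>M mu b) (\<lambda>z. (d z)\<^sup>2)" "(LINT z|(mu t \<Otimes>\<^sub>M mu b). (d z)\<^sup>2) = (LINT x|mu \<tau>. (K x - H x)\<^sup>2)"
      unfolding d_def using KH t b mu_conv_integral[of t b "\<lambda>x. (K x - H x)\<^sup>2"] by auto
    have h2: "integrable (mu t \<Otimes>\<^sub>M mu b) (\<lambda>z. (h z)\<^sup>2)"
      unfolding h_def using T.lipschitz_bounded_L2[OF H(1)] t b mu_conv_integral(2)[of t b "\<lambda>x. (H x)\<^sup>2"] by auto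
    have iH: "integrable (mu b) (\<lambda>y. H (x + y))" for x
      by (rule b.integrable_const_bound[of _ B]) (use B in auto)
    have ptb: "tb.proj f x = tb.proj d x + tb.proj h x" for x
      using iH[of x] K_integrable[OF b(1), of x] by (simp add: tb.proj_def f_def d_def h_def Kr_0)
    have "v \<tau> - v (\<tau> - b) = (LINT z|(mu t \<Otimes>\<^sub>M mu b). (f z - tb.proj f (fst z))\<^sup>2)"
      unfolding tb.proj_residual_square[OF fm f2] unfolding f_def st(2,3) by (simp add: v_def t_def)
    also have "\<dots> \<le> (LINT z|(mu t \<Otimes>\<^sub>M mu b). 2 * (d z - tb.proj d (fst z))\<^sup>2 + 2 * (h z - tb.proj h (fst z))\<^sup>2)"
    proof (rule integral_mono)
      show "(f z - tb.proj f (fst z))\<^sup>2 \<le> 2 * (d z - tb.proj d (fst z))\<^sup>2 + 2 * (h z - tb.proj h (fst z))\<^sup>2" for z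
      proof -
        have "f z - tb.proj f (fst z) = (d z - tb.proj d (fst z)) + (h z - tb.proj h (fst z))" by (simp add: fdh ptb)
        thus ?thesis using sum_squares_bound[of "d z - tb.proj d (fst z)" "h z - tb.proj h (fst z)"]
          by (simp only: power2_sum)
      qed
    qed (use tb.proj_residual(1)[OF fm f2 fm f2] tb.proj_residual(1)[of d d] tb.proj_residual(1)[of h h] d2 h2 in auto)
    also have "\<dots> = 2 * (LINT z|(mu t \<Otimes>\<^sub>M mu b). (d z - tb.proj d (fst z))\<^sup>2) + 2 * (LINT z|(mu t \<Otimes>\<^sub>M mu b). (h z - tb.proj h (fst z))\<^sup>2)"
      using tb.proj_residual(1)[of d d] tb.proj_residual(1)[of h h] d2 h2 by simp
    also have "(LINT z|(mu t \<Otimes>\<^sub>M mu b). (d z - tb.proj d (fst z))\<^sup>2) \<le> \<epsilon> / 4"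
    proof -
      have "0 \<le> (LINT x|mu t. (tb.proj d x)\<^sup>2)" by (rule integral_nonneg_AE) auto
      moreover have "(LINT z|(mu t \<Otimes>\<^sub>M mu b). (d z - tb.proj d (fst z))\<^sup>2) = (LINT x|mu \<tau>. (K x - H x)\<^sup>2) - (LINT x|mu t. (tb.proj d x)\<^sup>2)"
        using tb.proj_residual_square[of d] d2 by simp
      ultimately show ?thesis using H(2) by linarith
    qed
    also have "(LINT z|(mu t \<Otimes>\<^sub>M mu b). (h z - tb.proj h (fst z))\<^sup>2) \<le> c1 * b"
    proof -
      have iw: "integrable (mu b) (\<lambda>y. D * wsq p y)" using mu_wsq(1)[OF b(1) p] by simp
      interpret bt: pair_prob_space "mu b" "mu t" ..
      have iW: "integrable (mu t \<Otimes>\<^sub>M mu b) (\<lambda>z. D * wsq p (snd z))"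
      proof (rule tb.Fubini_integrable)
        show "integrable (mu t) (\<lambda>x. LINT y|mu b. norm (D * wsq p (snd (x, y))))" by simp
      qed (use iw in auto)
      have hH: "(h z - H (fst z))\<^sup>2 \<le> D * wsq p (snd z)" for z using Hw by (simp add: h_def)
      have ih: "integrable (mu t \<Otimes>\<^sub>M mu b) (\<lambda>z. (h z - H (fst z))\<^sup>2)"
        by (rule Bochner_Integration.integrable_bound[OF iW]) (use hH in \<open>auto intro!: AE_I2 intro: order_trans[OF _ abs_ge_self]\<close>)
      have "(LINT z|(mu t \<Otimes>\<^sub>M mu b). (h z - tb.proj h (fst z))\<^sup>2) \<le> (LINT z|(mu t \<Otimes>\<^sub>M mu b). (h z - H (fst z))\<^sup>2)"
        unfolding tb.proj_residual_square[OF _ h2, simplified]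
        by (rule tb.proj_optimal[OF _ h2 _ ih]) (use iH in \<open>auto simp: h_def\<close>)
      also have "\<dots> \<le> (LINT z|(mu t \<Otimes>\<^sub>M mu b). D * wsq p (snd z))" by (rule integral_mono[OF ih iW hH])
      also have "\<dots> = D * (LINT y|mu b. wsq p y)" using tb.integral_fst'[OF iW] t.prob_space by auto
      also have "\<dots> \<le> D * (32 / (\<alpha> - p) * b)" by (intro mult_left_mono mu_wsq b p D0)
      finally show ?thesis by (simp add: c1_def mult.assoc)
    qed
    finally show ?thesis by simp
  qed
  show ?thesis
  proof (intro exI[of _ "\<epsilon> / (4 * (c1 + 1))"] conjI allI impI)
    show "\<epsilon> / (4 * (c1 + 1)) > 0" using assms c1 by simp
    fix b assume b: "0 \<le> b" "b \<le> \<tau>" "b < \<epsilon> / (4 * (c1 + 1))"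
    have "2 * c1 * b \<le> 2 * (c1 + 1) * b" using b by (intro mult_right_mono) auto
    also have "\<dots> < 2 * (c1 + 1) * (\<epsilon> / (4 * (c1 + 1)))" using b c1 by (intro mult_strict_left_mono) auto
    also have "\<dots> = \<epsilon> / 2" using c1 by (simp add: field_simps)
    finally show "v \<tau> - v (\<tau> - b) < \<epsilon>" using main[OF b(1,2)] by linarith
  qed
qed

end

context stable_noise
begin

lemma decouple:
  fixes k :: "bool \<Rightarrow> real \<Rightarrow> real" and \<Psi> :: "(bool \<times> bool \<Rightarrow> real) \<Rightarrow> real"
  assumes X: "\<And>i. SI (k i) (X i)" and B: "B \<in> sets borel"
    and A: "\<And>i. SI (\<lambda>x. indicator (- B) x * k i x) (A i)" and Z: "\<And>i. SI (\<lambda>x. indicator B x * k i x) (Z i)"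
    and \<Psi>[measurable]: "\<Psi> \<in> borel_measurable (PiM UNIV (\<lambda>_. borel))"
  defines "DA \<equiv> distr P (PiM UNIV (\<lambda>_. borel)) (\<lambda>\<omega> i. A i \<omega>)" and "DZ \<equiv> distr P (PiM UNIV (\<lambda>_. borel)) (\<lambda>\<omega> i. Z i \<omega>)"
  shows "(LINT \<omega>|P. \<Psi> (\<lambda>(i, c). if c then A i \<omega> else X i \<omega>)) =
      (LINT z|(DA \<Otimes>\<^sub>M DZ). \<Psi> (\<lambda>(i, c). if c then fst z i else fst z i + snd z i))" (is ?eq)
    and "integrable P (\<lambda>\<omega>. \<Psi> (\<lambda>(i, c). if c then A i \<omega> else X i \<omega>)) \<longleftrightarrow>
      integrable (DA \<Otimes>\<^sub>M DZ) (\<lambda>z. \<Psi> (\<lambda>(i, c). if c then fst z i else fst z i + snd z i))" (is ?int)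
proof -
  let ?B = "PiM UNIV (\<lambda>_. borel) :: (bool \<Rightarrow> real) measure"
  let ?BB = "PiM UNIV (\<lambda>_. borel) :: (bool \<times> bool \<Rightarrow> real) measure"
  note [measurable] = SI_measurable[OF X] SI_measurable[OF A] SI_measurable[OF Z]
  define f where "f p = (if snd p then (\<lambda>x. indicator (- B) x * k (fst p) x) else k (fst p))" for p :: "bool \<times> bool"
  define W where "W p = (if snd p then A (fst p) else X (fst p))" for p :: "bool \<times> bool"
  define W' where "W' p = (if snd p then A (fst p) else (\<lambda>\<omega>. A (fst p) \<omega> + Z (fst p) \<omega>))" for p :: "bool \<times> bool"
  have split: "(\<lambda>x. indicator (- B) x * k i x + indicator B x * k i x) = k i" for i
    by (auto simp: fun_eq_iff split: split_indicator)
  have AZ: "SI (k i) (\<lambda>\<omega>. A i \<omega> + Z i \<omega>)" for i using SI_add[OF A[of i] Z[of i]] unfolding split .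
  have Wm[measurable]: "\<And>p. W p \<in> borel_measurable P" "\<And>p. W' p \<in> borel_measurable P"
    unfolding W_def W'_def by auto
  have vec: "(\<lambda>\<omega>. \<lambda>p\<in>UNIV. W p \<omega>) = (\<lambda>\<omega> (i, c). if c then A i \<omega> else X i \<omega>)"
    by (auto simp: W_def fun_eq_iff)
  have law: "distr P ?BB (\<lambda>\<omega>. \<lambda>p\<in>UNIV. W p \<omega>) = distr P ?BB (\<lambda>\<omega>. \<lambda>p\<in>UNIV. W' p \<omega>)"
    by (rule SI_law[where f = f and g = f]) (auto simp: f_def W_def W'_def X A AZ)
  define \<phi> where "\<phi> z = (\<lambda>(i, c). if c then fst z i else fst z i + snd z i)" for z :: "(bool \<Rightarrow> real) \<times> (bool \<Rightarrow> real)"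
  have \<phi>[measurable]: "\<phi> \<in> measurable (?B \<Otimes>\<^sub>M ?B) ?BB"
  proof (rule measurable_PiM_single')
    fix p :: "bool \<times> bool"
    have [measurable]: "(\<lambda>z. fst z i) \<in> borel_measurable (?B \<Otimes>\<^sub>M ?B)" "(\<lambda>z. snd z i) \<in> borel_measurable (?B \<Otimes>\<^sub>M ?B)" for i
      using measurable_compose[OF measurable_fst measurable_component_singleton[of i UNIV "\<lambda>_. borel"]]
        measurable_compose[OF measurable_snd measurable_component_singleton[of i UNIV "\<lambda>_. borel"]] by auto
    show "(\<lambda>z. \<phi> z p) \<in> borel_measurable (?B \<Otimes>\<^sub>M ?B)" unfolding \<phi>_def by (cases p) simp
  qed auto
  have ind: "distr P (?B \<Otimes>\<^sub>M ?B) (\<lambda>\<omega>. (\<lambda>i\<in>UNIV. A i \<omega>, \<lambda>i\<in>UNIV. Z i \<omega>)) =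
      distr P ?B (\<lambda>\<omega>. \<lambda>i\<in>UNIV. A i \<omega>) \<Otimes>\<^sub>M distr P ?B (\<lambda>\<omega>. \<lambda>i\<in>UNIV. Z i \<omega>)"
    by (rule SI_indep[where B = "- B" and f = "\<lambda>i x. indicator (- B) x * k i x" and g = "\<lambda>i x. indicator B x * k i x"])
       (auto intro!: A Z)
  have [measurable]: "(\<lambda>\<omega>. (\<lambda>i. A i \<omega>, \<lambda>i. Z i \<omega>)) \<in> measurable P (?B \<Otimes>\<^sub>M ?B)"
    by (intro measurable_Pair measurable_PiM_single') auto
  have law2: "distr P ?BB (\<lambda>\<omega>. \<lambda>p\<in>UNIV. W p \<omega>) = distr (DA \<Otimes>\<^sub>M DZ) ?BB \<phi>"
  proof -
    have "distr P ?BB (\<lambda>\<omega>. \<lambda>p\<in>UNIV. W' p \<omega>) = distr (distr P (?B \<Otimes>\<^sub>M ?B) (\<lambda>\<omega>. (\<lambda>i. A i \<omega>, \<lambda>i. Z i \<omega>))) ?BB \<phi>"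
      by (subst distr_distr) (auto intro!: distr_cong simp: \<phi>_def W'_def fun_eq_iff)
    also have "distr P (?B \<Otimes>\<^sub>M ?B) (\<lambda>\<omega>. (\<lambda>i. A i \<omega>, \<lambda>i. Z i \<omega>)) = DA \<Otimes>\<^sub>M DZ"
      using ind by (simp add: DA_def DZ_def restrict_UNIV)
    finally show ?thesis unfolding law .
  qed
  have [measurable]: "(\<lambda>\<omega>. \<lambda>p\<in>UNIV. W p \<omega>) \<in> measurable P ?BB" by (intro measurable_restrict) auto
  have [measurable]: "(\<lambda>\<omega> p. W p \<omega>) \<in> measurable P ?BB" by (intro measurable_PiM_single') auto
  have [measurable_cong]: "sets (DA \<Otimes>\<^sub>M DZ) = sets (?B \<Otimes>\<^sub>M ?B)" by (auto simp: DA_def DZ_def intro!: sets_pair_measure_cong)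
  have "(LINT \<omega>|P. \<Psi> (\<lambda>p\<in>UNIV. W p \<omega>)) = (LINT w|distr P ?BB (\<lambda>\<omega>. \<lambda>p\<in>UNIV. W p \<omega>). \<Psi> w)"
    by (subst integral_distr) auto
  also have "\<dots> = (LINT z|(DA \<Otimes>\<^sub>M DZ). \<Psi> (\<phi> z))" unfolding law2 by (subst integral_distr) auto
  finally show ?eq unfolding \<phi>_def using fun_cong[OF vec] by simp
  have "integrable P (\<lambda>\<omega>. \<Psi> (\<lambda>p\<in>UNIV. W p \<omega>)) \<longleftrightarrow> integrable (distr P ?BB (\<lambda>\<omega>. \<lambda>p\<in>UNIV. W p \<omega>)) \<Psi>"
    by (rule integrable_distr_eq[symmetric]) auto
  also have "\<dots> \<longleftrightarrow> integrable (DA \<Otimes>\<^sub>M DZ) (\<lambda>z. \<Psi> (\<phi> z))" unfolding law2 by (rule integrable_distr_eq) auto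
  finally show ?int unfolding \<phi>_def using fun_cong[OF vec] by simp
qed

lemma pw_split:
  assumes "L_power \<alpha> k" "B \<in> sets borel"
  shows "pw \<alpha> k = pw \<alpha> (\<lambda>x. indicator (- B) x * k x) + pw \<alpha> (\<lambda>x. indicator B x * k x)"
proof -
  have split: "indicator (- B) x * k x + indicator B x * k x = k x" for x
    by (auto split: split_indicator)
  have "pw \<alpha> (\<lambda>x. indicator (- B) x * k x + indicator B x * k x) = pw \<alpha> (\<lambda>x. indicator (- B) x * k x) + pw \<alpha> (\<lambda>x. indicator B x * k x)"
    using assms by (intro pw_disjoint_add L_power_indicator) (auto simp: indicator_def)
  thus ?thesis unfolding split .
qed

end

context stable_functional
begin

definition cond :: "(real \<Rightarrow> real) \<Rightarrow> ('w \<Rightarrow> real) \<Rightarrow> 'w \<Rightarrow> real" where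
  "cond k X \<omega> = Kr (\<tau> - pw \<alpha> k) (X \<omega>)"

lemma cond_measurable:
  assumes "SI k X" "pw \<alpha> k \<le> \<tau>" shows "cond k X \<in> borel_measurable P"
proof -
  note [measurable] = SI_measurable[OF assms(1)]
  have [measurable]: "Kr (\<tau> - pw \<alpha> k) \<in> borel_measurable borel" using assms by (intro Kr_measurable) auto
  show ?thesis unfolding cond_def by measurable
qed

lemma cond_L2:
  assumes "SI k X" "pw \<alpha> k \<le> \<tau>"
  shows "integrable P (\<lambda>\<omega>. (cond k X \<omega>)\<^sup>2)" "(LINT \<omega>|P. (cond k X \<omega>)\<^sup>2) = v (pw \<alpha> k)"
proof -
  have [measurable]: "Kr (\<tau> - pw \<alpha> k) \<in> borel_measurable borel" using assms by (intro Kr_measurable) auto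
  show "integrable P (\<lambda>\<omega>. (cond k X \<omega>)\<^sup>2)"
    unfolding cond_def using Kr_L2[of "pw \<alpha> k"] assms by (subst SI_integral(2)[OF assms(1), of "\<lambda>y. (Kr (\<tau> - pw \<alpha> k) y)\<^sup>2"]) auto
  show "(LINT \<omega>|P. (cond k X \<omega>)\<^sup>2) = v (pw \<alpha> k)"
    unfolding cond_def v_def by (subst SI_integral(1)[OF assms(1), of "\<lambda>y. (Kr (\<tau> - pw \<alpha> k) y)\<^sup>2"]) auto
qed

lemma cond_mean:
  assumes "SI k X" "pw \<alpha> k \<le> \<tau>" shows "(LINT \<omega>|P. cond k X \<omega>) = Kr \<tau> 0"
proof -
  have [measurable]: "Kr (\<tau> - pw \<alpha> k) \<in> borel_measurable borel" using assms by (intro Kr_measurable) auto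
  have "(LINT \<omega>|P. cond k X \<omega>) = (LINT y|mu (pw \<alpha> k). Kr (\<tau> - pw \<alpha> k) (0 + y))"
    unfolding cond_def by (subst SI_integral(1)[OF assms(1)]) auto
  also have "\<dots> = Kr \<tau> 0" using assms by (subst Kr_add(2)) auto
  finally show ?thesis .
qed

lemma removal_step:
  fixes k :: "bool \<Rightarrow> real \<Rightarrow> real" and X A :: "bool \<Rightarrow> 'w \<Rightarrow> real"
  assumes X: "\<And>i. SI (k i) (X i)" and B: "B \<in> sets borel"
    and A: "\<And>i. SI (\<lambda>x. indicator (- B) x * k i x) (A i)" and le: "\<And>i. pw \<alpha> (k i) \<le> \<tau>"
  shows "\<bar>(LINT \<omega>|P. cond (k True) (X True) \<omega> * cond (k False) (X False) \<omega>) -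
      (LINT \<omega>|P. cond (\<lambda>x. indicator (- B) x * k True x) (A True) \<omega> * cond (\<lambda>x. indicator (- B) x * k False x) (A False) \<omega>)\<bar> \<le>
    sqrt (v (pw \<alpha> (k True)) - v (pw \<alpha> (\<lambda>x. indicator (- B) x * k True x))) *
    sqrt (v (pw \<alpha> (k False)) - v (pw \<alpha> (\<lambda>x. indicator (- B) x * k False x)))"
    and "(LINT \<omega>|P. (cond (k i) (X i) \<omega> - cond (\<lambda>x. indicator (- B) x * k i x) (A i) \<omega>)\<^sup>2) =
      v (pw \<alpha> (k i)) - v (pw \<alpha> (\<lambda>x. indicator (- B) x * k i x))"
proof -
  define k' where "k' i = (\<lambda>x. indicator (- B) x * k i x)" for i
  define DA where "DA = distr P (PiM UNIV (\<lambda>_. borel)) (\<lambda>\<omega> i. A i \<omega>)"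
  have "\<forall>i. \<exists>Z. SI (\<lambda>x. indicator B x * k i x) Z" using SI_restrict[OF X B] by blast
  then obtain Z where Z: "\<And>i. SI (\<lambda>x. indicator B x * k i x) (Z i)" by metis
  note [measurable] = SI_measurable[OF X] SI_measurable[OF A] SI_measurable[OF Z]
  let ?PB = "PiM UNIV (\<lambda>_. borel) :: (bool \<Rightarrow> real) measure"
  define DZ where "DZ = distr P ?PB (\<lambda>\<omega> i. Z i \<omega>)"
  have [measurable]: "(\<lambda>\<omega> i. A i \<omega>) \<in> measurable P ?PB" "(\<lambda>\<omega> i. Z i \<omega>) \<in> measurable P ?PB"
    by (auto intro!: measurable_PiM_single')
  have [measurable_cong, simp]: "sets DA = sets ?PB" "sets DZ = sets ?PB" by (auto simp: DA_def DZ_def)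
  interpret DA: prob_space DA unfolding DA_def by (rule prob_space_distr) simp
  interpret DZ: prob_space DZ unfolding DZ_def by (rule prob_space_distr) simp
  interpret D: pair_prob_space DA DZ ..
  note dec = decouple[where k = k and X = X and A = A and Z = Z and B = B, OF X B A Z, folded DA_def DZ_def]
  have c: "pw \<alpha> (k i) = pw \<alpha> (k' i) + pw \<alpha> (\<lambda>x. indicator B x * k i x)" for i
    unfolding k'_def by (rule pw_split[OF SI_L_power[OF X] B])
  have c0: "0 \<le> pw \<alpha> (k' i)" "pw \<alpha> (k' i) \<le> \<tau>" "0 \<le> \<tau> - pw \<alpha> (k' i)" "0 \<le> \<tau> - pw \<alpha> (k i)" for i
    using c[of i] le[of i] pw_nonneg[where f = "\<lambda>x. indicator B x * k i x" and \<alpha> = \<alpha>] pw_nonneg[where f = "k' i" and \<alpha> = \<alpha>] by linarith+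
  define K1 where "K1 i = Kr (\<tau> - pw \<alpha> (k i))" for i
  define K2 where "K2 i = Kr (\<tau> - pw \<alpha> (k' i))" for i
  have [measurable]: "K1 i \<in> borel_measurable borel" "K2 i \<in> borel_measurable borel" for i
    unfolding K1_def K2_def using c0 by (auto intro!: Kr_measurable)
  have comp[measurable]: "(\<lambda>w. w p) \<in> borel_measurable (PiM UNIV (\<lambda>_. borel))" for p :: "bool \<times> bool"
    by (rule measurable_component_singleton) simp
  have comp'[measurable]: "(\<lambda>w. w p) \<in> borel_measurable ?PB" for p :: bool
    by (rule measurable_component_singleton) simp
  define f where "f i z = K1 i (fst z i + snd z i)" for i and z :: "(bool \<Rightarrow> real) \<times> (bool \<Rightarrow> real)"
  have [measurable]: "(\<lambda>z. fst z i) \<in> borel_measurable (DA \<Otimes>\<^sub>M DZ)" "(\<lambda>z. snd z i) \<in> borel_measurable (DA \<Otimes>\<^sub>M DZ)" for i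
  proof -
    have "sets (DA \<Otimes>\<^sub>M DZ) = sets (?PB \<Otimes>\<^sub>M ?PB)" by (intro sets_pair_measure_cong) simp_all
    note eq = measurable_cong_sets[OF this refl, of "borel :: real measure"]
    show "(\<lambda>z. fst z i) \<in> borel_measurable (DA \<Otimes>\<^sub>M DZ)" "(\<lambda>z. snd z i) \<in> borel_measurable (DA \<Otimes>\<^sub>M DZ)"
      unfolding eq using measurable_compose[OF measurable_fst comp'[of i]] measurable_compose[OF measurable_snd comp'[of i]] by auto
  qed
  have fm[measurable]: "f i \<in> borel_measurable (DA \<Otimes>\<^sub>M DZ)" for i unfolding f_def by measurable
  have cX: "cond (k i) (X i) \<omega> = K1 i (X i \<omega>)" and cA: "cond (k' i) (A i) \<omega> = K2 i (A i \<omega>)" for i \<omega>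
    by (simp_all add: cond_def K1_def K2_def)
  have fsq: "integrable (DA \<Otimes>\<^sub>M DZ) (\<lambda>z. (f i z)\<^sup>2)" "(LINT z|(DA \<Otimes>\<^sub>M DZ). (f i z)\<^sup>2) = v (pw \<alpha> (k i))" for i
    using dec[of "\<lambda>w. (K1 i (w (i, False)))\<^sup>2"] cond_L2[OF X[of i] le[of i]] by (simp_all add: cX f_def)
  have pf: "D.proj (f i) a = K2 i (a i)" for i a
  proof -
    have "D.proj (f i) a = (LINT \<omega>|P. K1 i (a i + Z i \<omega>))"
      unfolding D.proj_def f_def fst_conv snd_conv unfolding DZ_def by (subst integral_distr) auto
    also have "\<dots> = (LINT y|mu (pw \<alpha> (\<lambda>x. indicator B x * k i x)). K1 i (a i + y))"
      by (rule SI_integral(1)[OF Z]) measurable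
    also have "\<dots> = K2 i (a i)" unfolding K1_def K2_def using c0(4)[of i] c[of i]
      by (subst Kr_add(2)) (auto intro!: arg_cong2[where f = Kr])
    finally show ?thesis .
  qed
  have psq: "(LINT a|DA. (D.proj (f i) a)\<^sup>2) = v (pw \<alpha> (k' i))" for i
  proof -
    have "(LINT a|DA. (D.proj (f i) a)\<^sup>2) = (LINT \<omega>|P. (cond (k' i) (A i) \<omega>)\<^sup>2)"
      unfolding pf cA DA_def by (subst integral_distr) auto
    also have "\<dots> = v (pw \<alpha> (k' i))" using A[of i] c0(2)[of i] by (intro cond_L2) (auto simp: k'_def)
    finally show ?thesis .
  qed
  have "(LINT \<omega>|P. cond (k True) (X True) \<omega> * cond (k False) (X False) \<omega>) = (LINT z|(DA \<Otimes>\<^sub>M DZ). f True z * f False z)"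
    using dec(1)[of "\<lambda>w. K1 True (w (True, False)) * K1 False (w (False, False))"] by (simp add: cX f_def)
  moreover have "(LINT \<omega>|P. cond (k' True) (A True) \<omega> * cond (k' False) (A False) \<omega>) = (LINT a|DA. D.proj (f True) a * D.proj (f False) a)"
    unfolding pf cA DA_def by (subst integral_distr) auto
  ultimately show "\<bar>(LINT \<omega>|P. cond (k True) (X True) \<omega> * cond (k False) (X False) \<omega>) -
      (LINT \<omega>|P. cond (\<lambda>x. indicator (- B) x * k True x) (A True) \<omega> * cond (\<lambda>x. indicator (- B) x * k False x) (A False) \<omega>)\<bar> \<le>
    sqrt (v (pw \<alpha> (k True)) - v (pw \<alpha> (\<lambda>x. indicator (- B) x * k True x))) *
    sqrt (v (pw \<alpha> (k False)) - v (pw \<alpha> (\<lambda>x. indicator (- B) x * k False x)))"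
    using D.proj_covariance[OF fm fsq(1) fm fsq(1), of True False]
    unfolding fsq(2) psq unfolding k'_def by simp
  have "(LINT \<omega>|P. (cond (k i) (X i) \<omega> - cond (k' i) (A i) \<omega>)\<^sup>2) = (LINT z|(DA \<Otimes>\<^sub>M DZ). (f i z - D.proj (f i) (fst z))\<^sup>2)"
    using dec(1)[of "\<lambda>w. (K1 i (w (i, False)) - K2 i (w (i, True)))\<^sup>2"] by (simp add: cX cA f_def pf)
  thus "(LINT \<omega>|P. (cond (k i) (X i) \<omega> - cond (\<lambda>x. indicator (- B) x * k i x) (A i) \<omega>)\<^sup>2) =
      v (pw \<alpha> (k i)) - v (pw \<alpha> (\<lambda>x. indicator (- B) x * k i x))"
    unfolding D.proj_residual_square[OF fm fsq(1)] fsq(2) psq unfolding k'_def .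
qed

end

section \<open>Covariances of a moving average\<close>

lemma lborel_reflect: fixes f :: "real \<Rightarrow> real" shows "(LINT x|lborel. f (c - x)) = (LINT x|lborel. f x)"
  using lborel_integral_real_affine[of "-1" f c] by simp

lemma lborel_shift: fixes f :: "real \<Rightarrow> real" shows "(LINT x|lborel. f (x - c)) = (LINT x|lborel. f x)"
  using lborel_integral_real_affine[of 1 f "-c"] by (simp add: add.commute)

context stable_functional
begin

lemma removal_pair:
  assumes "SI k X" "SI l Y" "B \<in> sets borel" "SI (\<lambda>x. indicator (- B) x * k x) A" "SI (\<lambda>x. indicator (- B) x * l x) C"
    and "pw \<alpha> k \<le> \<tau>" "pw \<alpha> l \<le> \<tau>"
  shows "\<bar>(LINT \<omega>|P. cond k X \<omega> * cond l Y \<omega>) -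
      (LINT \<omega>|P. cond (\<lambda>x. indicator (- B) x * k x) A \<omega> * cond (\<lambda>x. indicator (- B) x * l x) C \<omega>)\<bar> \<le>
    sqrt (v (pw \<alpha> k) - v (pw \<alpha> (\<lambda>x. indicator (- B) x * k x))) * sqrt (v (pw \<alpha> l) - v (pw \<alpha> (\<lambda>x. indicator (- B) x * l x)))"
    and "(LINT \<omega>|P. (cond k X \<omega> - cond (\<lambda>x. indicator (- B) x * k x) A \<omega>)\<^sup>2) =
      v (pw \<alpha> k) - v (pw \<alpha> (\<lambda>x. indicator (- B) x * k x))"
proof -
  let ?k = "\<lambda>b. if b then k else l" and ?X = "\<lambda>b. if b then X else Y" and ?A = "\<lambda>b. if b then A else C"
  have 1: "SI (?k i) (?X i)" and 2: "SI (\<lambda>x. indicator (- B) x * ?k i x) (?A i)" and 3: "pw \<alpha> (?k i) \<le> \<tau>" for i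
    using assms by auto
  show "\<bar>(LINT \<omega>|P. cond k X \<omega> * cond l Y \<omega>) -
      (LINT \<omega>|P. cond (\<lambda>x. indicator (- B) x * k x) A \<omega> * cond (\<lambda>x. indicator (- B) x * l x) C \<omega>)\<bar> \<le>
    sqrt (v (pw \<alpha> k) - v (pw \<alpha> (\<lambda>x. indicator (- B) x * k x))) * sqrt (v (pw \<alpha> l) - v (pw \<alpha> (\<lambda>x. indicator (- B) x * l x)))"
    using removal_step(1)[of ?k ?X B ?A, OF 1 assms(3) 2 3] by simp
  show "(LINT \<omega>|P. (cond k X \<omega> - cond (\<lambda>x. indicator (- B) x * k x) A \<omega>)\<^sup>2) =
      v (pw \<alpha> k) - v (pw \<alpha> (\<lambda>x. indicator (- B) x * k x))"
    using removal_step(2)[of ?k ?X B ?A True, OF 1 assms(3) 2 3] by simp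
qed

end

locale moving_average = stable_functional P \<alpha> \<Phi> K x0 \<beta> CK \<tau>
  for P :: "'w measure" and \<alpha> \<Phi> K x0 \<beta> CK \<tau> +
  fixes a :: "real \<Rightarrow> real" and \<xi> :: "nat \<Rightarrow> 'w \<Rightarrow> real"
  assumes kernel: "L_power \<alpha> a" "\<And>x. x < 0 \<Longrightarrow> a x = 0"
    and SI_\<xi>: "\<And>n. SI (\<lambda>x. a (real n - x)) (\<xi> n)"
    and tau_eq: "\<tau> = pw \<alpha> a"
    and summable_kernel:
      "summable (\<lambda>m::nat. sqrt (LINT x:{real m..real (Suc m)}|lborel. \<bar>a x\<bar> powr \<alpha>))"
begin

text \<open>\<open>J i W\<close> is the part of \<open>\<xi> i\<close> that comes from the noise in \<open>W\<close>, and \<open>Z i W\<close> is the conditional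
  mean of \<open>K (\<xi> i)\<close> given that noise. The first branch of \<open>J\<close> makes \<open>Z i W = K (\<xi> i)\<close> hold pointwise
  when the noise outside \<open>W\<close> does not contribute to \<open>\<xi> i\<close>.\<close>

definition \<kappa> :: "nat \<Rightarrow> real set \<Rightarrow> real \<Rightarrow> real" where "\<kappa> i W x = indicator W x * a (real i - x)"

definition J :: "nat \<Rightarrow> real set \<Rightarrow> 'w \<Rightarrow> real" where
  "J i W = (if \<kappa> i W = \<kappa> i UNIV then \<xi> i else (SOME X. SI (\<kappa> i W) X))"

definition Z :: "nat \<Rightarrow> real set \<Rightarrow> 'w \<Rightarrow> real" where "Z i W = cond (\<kappa> i W) (J i W)"

definition \<sigma> :: "nat \<Rightarrow> real" where "\<sigma> m = pw \<alpha> (\<lambda>y. indicator {..<real m} y * a y)"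

lemma SI_J: assumes "W \<in> sets borel" shows "SI (\<kappa> i W) (J i W)"
proof (cases "\<kappa> i W = \<kappa> i UNIV")
  case True
  have "\<kappa> i UNIV = (\<lambda>x. a (real i - x))" by (simp add: \<kappa>_def fun_eq_iff)
  thus ?thesis using SI_\<xi>[of i] True by (simp add: J_def)
next
  case False
  have "\<exists>X. SI (\<kappa> i W) X" using SI_restrict[OF SI_\<xi>[of i] assms] by (simp add: \<kappa>_def[abs_def])
  thus ?thesis using False by (simp add: J_def someI_ex)
qed

lemma L_power_\<kappa>: "W \<in> sets borel \<Longrightarrow> L_power \<alpha> (\<kappa> i W)" by (rule SI_L_power[OF SI_J])

lemma \<kappa>_cong: assumes "\<And>x. x \<le> real i \<Longrightarrow> x \<in> W \<longleftrightarrow> x \<in> V" shows "\<kappa> i W = \<kappa> i V"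
proof
  fix x
  show "\<kappa> i W x = \<kappa> i V x"
  proof (cases "x \<le> real i")
    case True
    thus ?thesis using assms[OF True] by (auto simp: \<kappa>_def split: split_indicator)
  qed (use kernel(2)[of "real i - x"] in \<open>simp add: \<kappa>_def\<close>)
qed

lemma pw_\<kappa>_UNIV: "pw \<alpha> (\<kappa> i UNIV) = \<tau>"
  unfolding tau_eq \<kappa>_def using lborel_reflect[of "\<lambda>x. \<bar>a x\<bar> powr \<alpha>" "real i"] by simp

lemma pw_\<kappa>_add:
  assumes "W \<in> sets borel" "V \<in> sets borel" "W \<inter> V = {}"
  shows "pw \<alpha> (\<kappa> i (W \<union> V)) = pw \<alpha> (\<kappa> i W) + pw \<alpha> (\<kappa> i V)"
proof -
  have "indicator (W \<union> V) x = indicator W x + (indicator V x :: real)" for x using assms(3) by (auto split: split_indicator)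
  hence "\<kappa> i (W \<union> V) x = \<kappa> i W x + \<kappa> i V x" for x by (simp add: \<kappa>_def algebra_simps)
  hence "pw \<alpha> (\<kappa> i (W \<union> V)) = pw \<alpha> (\<lambda>x. \<kappa> i W x + \<kappa> i V x)" by simp
  also have "\<dots> = pw \<alpha> (\<kappa> i W) + pw \<alpha> (\<kappa> i V)"
    using assms by (intro pw_disjoint_add L_power_\<kappa>) (auto simp: \<kappa>_def split: split_indicator)
  finally show ?thesis .
qed

lemma pw_\<kappa>_mono:
  assumes "W \<in> sets borel" "V \<in> sets borel" "W \<subseteq> V" shows "pw \<alpha> (\<kappa> i W) \<le> pw \<alpha> (\<kappa> i V)"
proof -
  have "pw \<alpha> (\<kappa> i (W \<union> (V - W))) = pw \<alpha> (\<kappa> i W) + pw \<alpha> (\<kappa> i (V - W))" using assms by (intro pw_\<kappa>_add) auto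
  moreover have "W \<union> (V - W) = V" using assms by auto
  ultimately show ?thesis using pw_nonneg[where f = "\<kappa> i (V - W)" and \<alpha> = \<alpha>] by simp
qed

lemma pw_\<kappa>_le: "W \<in> sets borel \<Longrightarrow> pw \<alpha> (\<kappa> i W) \<le> \<tau>"
  using pw_\<kappa>_mono[of W UNIV i] pw_\<kappa>_UNIV[of i] by simp

lemma pw_\<kappa>_recent: "pw \<alpha> (\<kappa> i {real i - real m<..}) = \<sigma> m"
proof -
  have "pw \<alpha> (\<kappa> i {real i - real m<..}) = (LINT x|lborel. \<bar>indicator {..<real m} (real i - x) * a (real i - x)\<bar> powr \<alpha>)"
    by (intro Bochner_Integration.integral_cong) (auto simp: \<kappa>_def split: split_indicator)
  also have "\<dots> = \<sigma> m" unfolding \<sigma>_def by (rule lborel_reflect)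
  finally show ?thesis .
qed

lemma pw_\<kappa>_past: "pw \<alpha> (\<kappa> i {..real i - real m}) = \<tau> - \<sigma> m"
proof -
  have "pw \<alpha> (\<kappa> i ({..real i - real m} \<union> {real i - real m<..})) = pw \<alpha> (\<kappa> i {..real i - real m}) + pw \<alpha> (\<kappa> i {real i - real m<..})"
    by (intro pw_\<kappa>_add) auto
  moreover have "{..real i - real m} \<union> {real i - real m<..} = UNIV" by auto
  ultimately show ?thesis using pw_\<kappa>_UNIV[of i] by (simp add: pw_\<kappa>_recent)
qed

lemma sigma_le: "\<sigma> m \<le> \<tau>" and sigma_nonneg: "0 \<le> \<sigma> m"
  using pw_\<kappa>_le[of "{real 0 - real m<..}" 0] pw_\<kappa>_recent[of 0 m] pw_nonneg[where f = "\<kappa> 0 {real 0 - real m<..}" and \<alpha> = \<alpha>] by auto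

lemma sigma_mono: "m \<le> n \<Longrightarrow> \<sigma> m \<le> \<sigma> n"
  using pw_\<kappa>_mono[of "{real 0 - real m<..}" "{real 0 - real n<..}" 0] by (simp add: pw_\<kappa>_recent[of 0, simplified])

lemma sigma_tendsto: "\<sigma> \<longlonglongrightarrow> \<tau>"
proof -
  have i: "integrable lborel (\<lambda>y. \<bar>a y\<bar> powr \<alpha>)" and [measurable]: "a \<in> borel_measurable borel"
    using kernel by (auto simp: L_power_def)
  have "(\<lambda>m. LINT y|lborel. \<bar>indicator {..<real m} y * a y\<bar> powr \<alpha>) \<longlonglongrightarrow> (LINT y|lborel. \<bar>a y\<bar> powr \<alpha>)"
  proof (rule integral_dominated_convergence[OF _ _ i])
    show "AE y in lborel. (\<lambda>m. \<bar>indicator {..<real m} y * a y\<bar> powr \<alpha>) \<longlonglongrightarrow> \<bar>a y\<bar> powr \<alpha>"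
    proof (intro AE_I2 tendsto_eventually)
      fix y :: real
      obtain n :: nat where "y < real n" using reals_Archimedean2 by blast
      thus "\<forall>\<^sub>F m in sequentially. \<bar>indicator {..<real m} y * a y\<bar> powr \<alpha> = \<bar>a y\<bar> powr \<alpha>"
        unfolding eventually_sequentially by (intro exI[of _ n]) (auto split: split_indicator)
    qed
  qed (auto split: split_indicator)
  thus ?thesis by (simp add: \<sigma>_def[abs_def] tau_eq)
qed

definition A :: "nat \<Rightarrow> real" where "A m = (LINT x:{real m..real (Suc m)}|lborel. \<bar>a x\<bar> powr \<alpha>)"

lemma pw_\<kappa>_slab:
  assumes "W \<in> sets borel"
  shows "pw \<alpha> (\<kappa> i (W \<inter> {..real i - real l})) \<le> pw \<alpha> (\<kappa> i (W \<inter> {..real i - real (Suc l)})) + A l"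
proof -
  let ?S = "{real i - real (Suc l)<..real i - real l}"
  have [measurable]: "a \<in> borel_measurable borel" and ia: "integrable lborel (\<lambda>y. \<bar>a y\<bar> powr \<alpha>)"
    using kernel by (auto simp: L_power_def)
  have "pw \<alpha> (\<kappa> i ((W \<inter> {..real i - real (Suc l)}) \<union> (W \<inter> ?S))) = pw \<alpha> (\<kappa> i (W \<inter> {..real i - real (Suc l)})) + pw \<alpha> (\<kappa> i (W \<inter> ?S))"
    using assms by (intro pw_\<kappa>_add) auto
  also have "(W \<inter> {..real i - real (Suc l)}) \<union> (W \<inter> ?S) = W \<inter> {..real i - real l}" by auto
  also have "pw \<alpha> (\<kappa> i (W \<inter> ?S)) \<le> A l"
  proof -
    have "pw \<alpha> (\<kappa> i (W \<inter> ?S)) \<le> pw \<alpha> (\<kappa> i ?S)" using assms by (intro pw_\<kappa>_mono) auto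
    also have "\<dots> = (LINT x|lborel. \<bar>indicator {real l..<real (Suc l)} (real i - x) * a (real i - x)\<bar> powr \<alpha>)"
      by (intro Bochner_Integration.integral_cong) (auto simp: \<kappa>_def split: split_indicator)
    also have "\<dots> = (LINT x|lborel. \<bar>indicator {real l..<real (Suc l)} x * a x\<bar> powr \<alpha>)" by (rule lborel_reflect)
    also have "\<dots> \<le> (LINT x|lborel. indicator {real l..real (Suc l)} x * \<bar>a x\<bar> powr \<alpha>)"
      by (intro integral_mono Bochner_Integration.integrable_bound[OF ia])
         (auto intro!: AE_I2 split: split_indicator)
    finally show ?thesis by (simp add: A_def set_lebesgue_integral_def)
  qed
  finally show ?thesis by simp
qed

lemma decay:
  obtains \<theta> \<epsilon> :: "nat \<Rightarrow> real" where "\<And>l. 0 \<le> \<theta> l" "summable \<theta>" "\<epsilon> \<longlonglongrightarrow> 0"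
    "\<And>i W l. W \<in> sets borel \<Longrightarrow> v (pw \<alpha> (\<kappa> i (W \<inter> {..real i - real l}))) - v (pw \<alpha> (\<kappa> i (W \<inter> {..real i - real (Suc l)}))) \<le> (\<theta> l)\<^sup>2"
    "\<And>i W l. W \<in> sets borel \<Longrightarrow> v (pw \<alpha> (\<kappa> i (W \<inter> {..real i - real l}))) - v 0 \<le> \<epsilon> l"
proof (cases "\<tau> = 0")
  case True
  have z: "pw \<alpha> (\<kappa> i W) = 0" if "W \<in> sets borel" for i W
    using pw_\<kappa>_le[OF that, of i] pw_nonneg[where f = "\<kappa> i W" and \<alpha> = \<alpha>] True by simp
  show ?thesis by (rule that[of "\<lambda>_. 0" "\<lambda>_. 0"]) (auto simp: z)
next
  case False
  hence pos: "0 < \<tau>" using tau by simp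
  obtain k0 where k0: "0 < \<sigma> k0"
    using order_tendstoD(1)[OF sigma_tendsto pos] by (auto simp: eventually_sequentially)
  obtain C where C: "C \<ge> 0" "\<And>t b. 0 \<le> t \<Longrightarrow> 0 \<le> b \<Longrightarrow> t + b \<le> \<tau> - \<sigma> k0 \<Longrightarrow> v (t + b) - v t \<le> C * b"
    using v_lipschitz[OF k0] by blast
  have A0: "0 \<le> A l" for l unfolding A_def set_lebesgue_integral_def by (rule integral_nonneg_AE) auto
  have lip: "v t - v s \<le> C * (t - s)" if "0 \<le> s" "s \<le> t" "t \<le> \<tau> - \<sigma> k0" for s t using C(2)[of s "t - s"] that by simp
  have crude: "v t - v s \<le> v \<tau>" if "0 \<le> t" "t \<le> \<tau>" for s t using v_mono[of t \<tau>] v_nonneg[of s] that by simp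
  have past: "pw \<alpha> (\<kappa> i (W \<inter> {..real i - real l})) \<le> \<tau> - \<sigma> l" if "W \<in> sets borel" for i W l
    using pw_\<kappa>_mono[of "W \<inter> {..real i - real l}" "{..real i - real l}" i] that by (simp add: pw_\<kappa>_past)
  have past0: "pw \<alpha> (\<kappa> i (W \<inter> {..real i - real l})) \<le> \<tau> - \<sigma> k0" if "W \<in> sets borel" "k0 \<le> l" for i W l
    using past[OF that(1), of i l] sigma_mono[OF that(2)] by simp
  define \<theta> where "\<theta> l = (if l < k0 then sqrt (v \<tau>) else sqrt C * sqrt (A l))" for l
  define \<epsilon> where "\<epsilon> l = (if l < k0 then v \<tau> else C * (\<tau> - \<sigma> l))" for l
  show ?thesis
  proof (rule that[of \<theta> \<epsilon>])
    show "0 \<le> \<theta> l" for l using A0 C(1) v_nonneg[of \<tau>] by (simp add: \<theta>_def)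
    have "summable (\<lambda>l. sqrt C * sqrt (A l))" using summable_kernel unfolding A_def by (rule summable_mult)
    moreover have "\<forall>\<^sub>F l in sequentially. sqrt C * sqrt (A l) = \<theta> l"
      using eventually_ge_at_top[of k0] by eventually_elim (simp add: \<theta>_def)
    ultimately show "summable \<theta>" using summable_cong[of "\<lambda>l. sqrt C * sqrt (A l)" \<theta>] by simp
    have "(\<lambda>l. C * (\<tau> - \<sigma> l)) \<longlonglongrightarrow> C * (\<tau> - \<tau>)" by (intro tendsto_intros sigma_tendsto)
    moreover have "\<forall>\<^sub>F l in sequentially. C * (\<tau> - \<sigma> l) = \<epsilon> l"
      using eventually_ge_at_top[of k0] by eventually_elim (simp add: \<epsilon>_def)
    ultimately show "\<epsilon> \<longlonglongrightarrow> 0" using tendsto_cong by force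
  next
    fix i l and W :: "real set" assume W: "W \<in> sets borel"
    let ?t = "pw \<alpha> (\<kappa> i (W \<inter> {..real i - real l}))" and ?s = "pw \<alpha> (\<kappa> i (W \<inter> {..real i - real (Suc l)}))"
    have ts: "0 \<le> ?s" "?s \<le> ?t" "?t \<le> \<tau>" "0 \<le> ?t"
      using W by (auto intro!: pw_nonneg pw_\<kappa>_mono pw_\<kappa>_le)
    have slab: "?t \<le> ?s + A l" by (rule pw_\<kappa>_slab[OF W])
    show "v ?t - v ?s \<le> (\<theta> l)\<^sup>2"
    proof (cases "l < k0")
      case True
      thus ?thesis using crude[OF ts(4,3), of ?s] v_nonneg[of \<tau>] by (simp add: \<theta>_def)
    next
      case False
      hence "v ?t - v ?s \<le> C * (?t - ?s)" using past0[OF W, of l i] by (intro lip ts) auto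
      also have "\<dots> \<le> C * A l" using slab C(1) by (intro mult_left_mono) auto
      finally show ?thesis using False C(1) A0[of l] by (simp add: \<theta>_def power_mult_distrib)
    qed
    show "v ?t - v 0 \<le> \<epsilon> l"
    proof (cases "l < k0")
      case True
      thus ?thesis using crude[OF ts(4,3), of 0] by (simp add: \<epsilon>_def)
    next
      case False
      hence "v ?t - v 0 \<le> C * (?t - 0)" using past0[OF W, of l i] by (intro lip ts) auto
      also have "\<dots> \<le> C * (\<tau> - \<sigma> l)" using past[OF W, of i l] C(1) by (intro mult_left_mono) auto
      finally show ?thesis using False by (simp add: \<epsilon>_def)
    qed
  qed
qed

lemma Z_measurable [measurable]: "W \<in> sets borel \<Longrightarrow> Z i W \<in> borel_measurable P"
  unfolding Z_def by (intro cond_measurable SI_J pw_\<kappa>_le)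

lemma Z_L2:
  assumes "W \<in> sets borel"
  shows "integrable P (\<lambda>\<omega>. (Z i W \<omega>)\<^sup>2)" "(LINT \<omega>|P. (Z i W \<omega>)\<^sup>2) = v (pw \<alpha> (\<kappa> i W))" "(LINT \<omega>|P. Z i W \<omega>) = Kr \<tau> 0"
  unfolding Z_def using assms by (intro cond_L2 cond_mean SI_J pw_\<kappa>_le; simp)+

lemma Z_UNIV: "Z i UNIV \<omega> = K (\<xi> i \<omega>)"
  by (simp add: Z_def cond_def pw_\<kappa>_UNIV J_def Kr_0)

lemma Z_step:
  assumes W: "W \<in> sets borel" "V \<in> sets borel" and B: "B \<in> sets borel"
  shows "\<bar>(LINT \<omega>|P. Z i W \<omega> * Z j V \<omega>) - (LINT \<omega>|P. Z i (W - B) \<omega> * Z j (V - B) \<omega>)\<bar> \<le>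
      sqrt (v (pw \<alpha> (\<kappa> i W)) - v (pw \<alpha> (\<kappa> i (W - B)))) * sqrt (v (pw \<alpha> (\<kappa> j V)) - v (pw \<alpha> (\<kappa> j (V - B))))"
    and "(LINT \<omega>|P. (Z i W \<omega> - Z i (W - B) \<omega>)\<^sup>2) = v (pw \<alpha> (\<kappa> i W)) - v (pw \<alpha> (\<kappa> i (W - B)))"
proof -
  have eq: "(\<lambda>x. indicator (- B) x * \<kappa> i W x) = \<kappa> i (W - B)" for i W
    by (auto simp: \<kappa>_def fun_eq_iff split: split_indicator)
  have "SI (\<lambda>x. indicator (- B) x * \<kappa> i W x) (J i (W - B))" if "W \<in> sets borel" for i W
    unfolding eq using that B by (intro SI_J) auto
  note rp = removal_pair[OF SI_J[OF W(1), of i] SI_J[OF W(2), of j] B this[OF W(1)] this[OF W(2)] pw_\<kappa>_le[OF W(1)] pw_\<kappa>_le[OF W(2)]]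
  have pe: "pw \<alpha> (\<lambda>x. indicator (- B) x * \<kappa> i W x) = pw \<alpha> (\<kappa> i (W - B))" for i W
    using arg_cong[OF eq, of "pw \<alpha>"] .
  show "\<bar>(LINT \<omega>|P. Z i W \<omega> * Z j V \<omega>) - (LINT \<omega>|P. Z i (W - B) \<omega> * Z j (V - B) \<omega>)\<bar> \<le>
      sqrt (v (pw \<alpha> (\<kappa> i W)) - v (pw \<alpha> (\<kappa> i (W - B)))) * sqrt (v (pw \<alpha> (\<kappa> j V)) - v (pw \<alpha> (\<kappa> j (V - B))))"
    using rp(1) unfolding pe eq Z_def .
  show "(LINT \<omega>|P. (Z i W \<omega> - Z i (W - B) \<omega>)\<^sup>2) = v (pw \<alpha> (\<kappa> i W)) - v (pw \<alpha> (\<kappa> i (W - B)))"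
    using rp(2) unfolding pe eq Z_def .
qed

lemma Z_empty: "(LINT \<omega>|P. Z i {} \<omega> * Z j {} \<omega>) = (Kr \<tau> 0)\<^sup>2"
proof -
  have z: "pw \<alpha> (\<kappa> i {}) = 0" for i by (simp add: \<kappa>_def)
  have "AE \<omega> in P. J i {} \<omega> = 0" for i
  proof -
    have [measurable]: "J i {} \<in> borel_measurable P" by (rule SI_measurable[OF SI_J]) simp
    have "AE y in distr P borel (J i {}). y = 0"
      unfolding SI_distr[OF SI_J[of "{}" i, simplified]] z mu_0 by (subst AE_return) auto
    thus ?thesis by (subst (asm) AE_distr_iff) auto
  qed
  hence "AE \<omega> in P. Z i {} \<omega> * Z j {} \<omega> = (Kr \<tau> 0)\<^sup>2"
  proof -
    assume ae: "\<And>i. AE \<omega> in P. J i {} \<omega> = 0"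
    show ?thesis using ae[of i] ae[of j] by eventually_elim (simp add: Z_def cond_def z power2_eq_square)
  qed
  hence "(LINT \<omega>|P. Z i {} \<omega> * Z j {} \<omega>) = (LINT \<omega>|P. (Kr \<tau> 0)\<^sup>2)" by (intro integral_cong_AE) auto
  thus ?thesis by (simp add: prob_space)
qed

text \<open>The noise is discarded slab by slab, starting at time \<open>i + k\<close> and moving back; the slab at distance
  \<open>l\<close> from \<open>i + k\<close> is at distance \<open>l - k\<close> from \<open>i\<close> and changes the mixed moment by at most
  \<open>\<theta> (l - k) * \<theta> l\<close>, or not at all if \<open>l < k\<close>.\<close>

lemma covariance_decay:
  obtains c where "summable c" "\<And>k. 0 \<le> (c k :: real)"
    "\<And>i k W V. W \<in> sets borel \<Longrightarrow> V \<in> sets borel \<Longrightarrow>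
      \<bar>(LINT \<omega>|P. Z i W \<omega> * Z (i + k) V \<omega>) - (Kr \<tau> 0)\<^sup>2\<bar> \<le> c k"
proof -
  obtain \<theta> \<epsilon> :: "nat \<Rightarrow> real" where \<theta>: "\<And>l. 0 \<le> \<theta> l" "summable \<theta>" and \<epsilon>: "\<epsilon> \<longlonglongrightarrow> 0"
    and step: "\<And>i W l. W \<in> sets borel \<Longrightarrow> v (pw \<alpha> (\<kappa> i (W \<inter> {..real i - real l}))) - v (pw \<alpha> (\<kappa> i (W \<inter> {..real i - real (Suc l)}))) \<le> (\<theta> l)\<^sup>2"
    and last: "\<And>i W l. W \<in> sets borel \<Longrightarrow> v (pw \<alpha> (\<kappa> i (W \<inter> {..real i - real l}))) - v 0 \<le> \<epsilon> l"
    using decay by blast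
  have \<theta>b: "\<theta> l \<le> suminf \<theta>" for l using sum_le_suminf[OF \<theta>(2), of "{l}"] \<theta>(1) by auto
  have prod_summable: "summable (\<lambda>l. \<theta> l * \<theta> (l + k))" for k
    by (rule summable_comparison_test[OF _ summable_mult2[OF \<theta>(2), of "suminf \<theta>"]])
       (use \<theta>(1) \<theta>b in \<open>auto intro!: mult_left_mono\<close>)
  define c where "c k = (\<Sum>l. \<theta> l * \<theta> (l + k))" for k
  have c0: "0 \<le> c k" for k unfolding c_def using \<theta>(1) by (intro suminf_nonneg prod_summable) auto
  have "summable c"
  proof (rule summableI_nonneg_bounded)
    fix n
    have "(\<Sum>k<n. c k) = (\<Sum>l. \<Sum>k<n. \<theta> l * \<theta> (l + k))"
      unfolding c_def by (rule suminf_sum[symmetric]) (rule prod_summable)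
    also have "\<dots> \<le> (\<Sum>l. \<theta> l * suminf \<theta>)"
    proof (rule suminf_le)
      fix l
      have "(\<Sum>k<n. \<theta> (l + k)) = sum \<theta> {l..<l + n}"
        using sum.shift_bounds_nat_ivl[of \<theta> 0 l n] by (simp add: atLeast0LessThan add.commute)
      also have "\<dots> \<le> suminf \<theta>" using \<theta> by (intro sum_le_suminf) auto
      finally show "(\<Sum>k<n. \<theta> l * \<theta> (l + k)) \<le> \<theta> l * suminf \<theta>"
        using \<theta>(1)[of l] by (simp add: sum_distrib_left[symmetric] mult_left_mono)
    qed (use \<theta>(2) in \<open>auto intro!: summable_sum prod_summable summable_mult2\<close>)
    also have "\<dots> = suminf \<theta> * suminf \<theta>" using \<theta>(2) by (rule suminf_mult2[symmetric])
    finally show "(\<Sum>k<n. c k) \<le> suminf \<theta> * suminf \<theta>" .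
  qed (rule c0)
  moreover have "\<bar>(LINT \<omega>|P. Z i W \<omega> * Z (i + k) V \<omega>) - (Kr \<tau> 0)\<^sup>2\<bar> \<le> c k"
    if W: "W \<in> sets borel" "V \<in> sets borel" for i k W V
  proof -
    define j where "j = i + k"
    define q where "q U l = pw \<alpha> (\<kappa> i (U \<inter> {..real j - real l}))" for U l
    define E where "E l = (LINT \<omega>|P. Z i (W \<inter> {..real j - real l}) \<omega> * Z j (V \<inter> {..real j - real l}) \<omega>)" for l
    have inc_mono: "v (pw \<alpha> (\<kappa> i' (U - B))) \<le> v (pw \<alpha> (\<kappa> i' U))" if "U \<in> sets borel" "B \<in> sets borel" for i' U B
      using that by (intro v_mono pw_nonneg pw_\<kappa>_mono pw_\<kappa>_le) auto
    have stepE: "\<bar>E l - E (Suc l)\<bar> \<le> (if l < k then 0 else \<theta> (l - k) * \<theta> l)" for l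
    proof -
      let ?B = "{real j - real (Suc l)<..real j - real l}"
      have diff: "U \<inter> {..real j - real l} - ?B = U \<inter> {..real j - real (Suc l)}" for U by auto
      have st: "\<bar>E l - E (Suc l)\<bar> \<le>
          sqrt (v (pw \<alpha> (\<kappa> i (W \<inter> {..real j - real l}))) - v (pw \<alpha> (\<kappa> i (W \<inter> {..real j - real (Suc l)})))) *
          sqrt (v (pw \<alpha> (\<kappa> j (V \<inter> {..real j - real l}))) - v (pw \<alpha> (\<kappa> j (V \<inter> {..real j - real (Suc l)}))))"
        using Z_step(1)[of "W \<inter> {..real j - real l}" "V \<inter> {..real j - real l}" ?B i j] W unfolding diff E_def by auto
      show ?thesis
      proof (cases "l < k")
        case True
        have "\<kappa> i (W \<inter> {..real j - real l}) = \<kappa> i (W \<inter> {..real j - real (Suc l)})"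
          using True by (intro \<kappa>_cong) (auto simp: j_def)
        thus ?thesis using st True by simp
      next
        case False
        have ji: "{..real j - real l} = {..real i - real (l - k)}" "{..real j - real (Suc l)} = {..real i - real (Suc (l - k))}"
          using False by (auto simp: j_def)
        have "sqrt (v (pw \<alpha> (\<kappa> i (W \<inter> {..real j - real l}))) - v (pw \<alpha> (\<kappa> i (W \<inter> {..real j - real (Suc l)})))) \<le> \<theta> (l - k)"
          unfolding ji by (rule real_le_lsqrt[OF \<theta>(1) step[OF W(1)]])
        moreover have "sqrt (v (pw \<alpha> (\<kappa> j (V \<inter> {..real j - real l}))) - v (pw \<alpha> (\<kappa> j (V \<inter> {..real j - real (Suc l)})))) \<le> \<theta> l"
          by (rule real_le_lsqrt[OF \<theta>(1) step[OF W(2)]])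
        moreover have "0 \<le> sqrt (v (pw \<alpha> (\<kappa> j (V \<inter> {..real j - real l}))) - v (pw \<alpha> (\<kappa> j (V \<inter> {..real j - real (Suc l)}))))"
          using inc_mono[of "V \<inter> {..real j - real l}" ?B j] W unfolding diff by simp
        ultimately show ?thesis using order_trans[OF st mult_mono] False \<theta>(1) by auto
      qed
    qed
    have E0: "E 0 = (LINT \<omega>|P. Z i W \<omega> * Z j V \<omega>)"
    proof -
      have "Z i' (U \<inter> {..real j}) \<omega> = Z i' U \<omega>" if "i' \<le> j" for i' U \<omega>
      proof -
        have "\<kappa> i' (U \<inter> {..real j}) = \<kappa> i' U" using that by (intro \<kappa>_cong) auto
        thus ?thesis by (simp add: Z_def J_def)
      qed
      thus ?thesis by (simp add: E_def j_def)
    qed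
    have tele: "\<bar>E 0 - E n\<bar> \<le> c k" for n
    proof -
      have "\<bar>E 0 - E n\<bar> \<le> (\<Sum>l<n. \<bar>E l - E (Suc l)\<bar>)"
        by (induction n) auto
      also have "\<dots> \<le> (\<Sum>l<n. if l < k then 0 else \<theta> (l - k) * \<theta> l)" by (intro sum_mono stepE)
      also have "\<dots> = (\<Sum>l\<in>{k..<n}. \<theta> (l - k) * \<theta> l)"
        by (rule sum.mono_neutral_cong_right) auto
      also have "\<dots> = (\<Sum>l<n - k. \<theta> l * \<theta> (l + k))"
        by (rule sum.reindex_bij_witness[of _ "\<lambda>l. l + k" "\<lambda>l. l - k"]) auto
      also have "\<dots> \<le> c k" unfolding c_def using \<theta>(1) by (intro sum_le_suminf prod_summable) auto
      finally show ?thesis .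
    qed
    have "(\<lambda>n. E n) \<longlonglongrightarrow> (Kr \<tau> 0)\<^sup>2"
    proof (rule LIM_zero_cancel, rule Lim_null_comparison)
      show "\<forall>\<^sub>F n in sequentially. norm (E n - (Kr \<tau> 0)\<^sup>2) \<le> sqrt (v \<tau>) * sqrt (\<epsilon> n)"
      proof (intro always_eventually allI)
        fix n
        have "norm (E n - (Kr \<tau> 0)\<^sup>2) \<le> sqrt (v (pw \<alpha> (\<kappa> i (W \<inter> {..real j - real n}))) - v (pw \<alpha> (\<kappa> i {}))) *
            sqrt (v (pw \<alpha> (\<kappa> j (V \<inter> {..real j - real n}))) - v (pw \<alpha> (\<kappa> j {})))"
          using Z_step(1)[of "W \<inter> {..real j - real n}" "V \<inter> {..real j - real n}" UNIV i j] W by (simp add: E_def Z_empty)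
        also have "\<dots> \<le> sqrt (v \<tau>) * sqrt (\<epsilon> n)"
        proof (rule mult_mono)
          have "v (pw \<alpha> (\<kappa> i (W \<inter> {..real j - real n}))) \<le> v \<tau>"
            using W by (intro v_mono pw_nonneg pw_\<kappa>_le) auto
          thus "sqrt (v (pw \<alpha> (\<kappa> i (W \<inter> {..real j - real n}))) - v (pw \<alpha> (\<kappa> i {}))) \<le> sqrt (v \<tau>)"
            using v_nonneg[of "pw \<alpha> (\<kappa> i {})"] by simp
          have "pw \<alpha> (\<kappa> j {}) = 0" by (simp add: \<kappa>_def)
          thus "sqrt (v (pw \<alpha> (\<kappa> j (V \<inter> {..real j - real n}))) - v (pw \<alpha> (\<kappa> j {}))) \<le> sqrt (\<epsilon> n)"
            using last[OF W(2), of j n] by simp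
          show "0 \<le> sqrt (v (pw \<alpha> (\<kappa> j (V \<inter> {..real j - real n}))) - v (pw \<alpha> (\<kappa> j {})))"
            using inc_mono[of "V \<inter> {..real j - real n}" UNIV j] W by simp
        qed (use v_nonneg in auto)
        finally show "norm (E n - (Kr \<tau> 0)\<^sup>2) \<le> sqrt (v \<tau>) * sqrt (\<epsilon> n)" .
      qed
      have "(\<lambda>n. sqrt (v \<tau>) * sqrt (\<epsilon> n)) \<longlonglongrightarrow> sqrt (v \<tau>) * sqrt 0" by (intro tendsto_intros \<epsilon>)
      thus "(\<lambda>n. sqrt (v \<tau>) * sqrt (\<epsilon> n)) \<longlonglongrightarrow> 0" by simp
    qed
    hence "(\<lambda>n. \<bar>E 0 - E n\<bar>) \<longlonglongrightarrow> \<bar>E 0 - (Kr \<tau> 0)\<^sup>2\<bar>" by (intro tendsto_intros)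
    hence "\<bar>E 0 - (Kr \<tau> 0)\<^sup>2\<bar> \<le> c k" by (rule LIMSEQ_le_const2) (use tele in auto)
    thus ?thesis by (simp add: E0 j_def)
  qed
  ultimately show ?thesis using c0 that by blast
qed

lemma J_stationary:
  assumes I: "finite I" and t: "\<And>p. p \<in> I \<Longrightarrow> t p = s p + n"
    and W: "\<And>p. p \<in> I \<Longrightarrow> W p \<in> sets borel" "\<And>p. p \<in> I \<Longrightarrow> V p \<in> sets borel"
    and shift: "\<And>p x. p \<in> I \<Longrightarrow> x + real n \<in> W p \<longleftrightarrow> x \<in> V p"
  shows "distr P (PiM I (\<lambda>_. borel)) (\<lambda>\<omega>. \<lambda>p\<in>I. J (t p) (W p) \<omega>) = distr P (PiM I (\<lambda>_. borel)) (\<lambda>\<omega>. \<lambda>p\<in>I. J (s p) (V p) \<omega>)"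
proof (rule SI_law[OF I])
  fix u :: "'a \<Rightarrow> real"
  have eq: "\<kappa> (t p) (W p) x = \<kappa> (s p) (V p) (x - real n)" if "p \<in> I" for p x
    using shift[OF that, of "x - real n"] t[OF that] by (auto simp: \<kappa>_def algebra_simps split: split_indicator)
  have "pw \<alpha> (\<lambda>x. \<Sum>p\<in>I. u p * \<kappa> (t p) (W p) x) = pw \<alpha> (\<lambda>x. \<Sum>p\<in>I. u p * \<kappa> (s p) (V p) (x - real n))"
    by (simp add: eq cong: sum.cong)
  also have "\<dots> = pw \<alpha> (\<lambda>x. \<Sum>p\<in>I. u p * \<kappa> (s p) (V p) x)"
    by (rule lborel_shift[of "\<lambda>x. \<bar>\<Sum>p\<in>I. u p * \<kappa> (s p) (V p) x\<bar> powr \<alpha>"])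
  finally show "pw \<alpha> (\<lambda>x. \<Sum>p\<in>I. u p * \<kappa> (t p) (W p) x) = pw \<alpha> (\<lambda>x. \<Sum>p\<in>I. u p * \<kappa> (s p) (V p) x)" .
qed (use W SI_J in auto)

definition Y :: "nat \<Rightarrow> nat \<Rightarrow> 'w \<Rightarrow> real" where
  "Y m i \<omega> = Z (Suc i) {real (Suc i) - real m<..} \<omega> - Kr \<tau> 0"

definition X :: "nat \<Rightarrow> 'w \<Rightarrow> real" where "X i \<omega> = K (\<xi> (Suc i) \<omega>) - Kr \<tau> 0"

definition \<gamma> :: "nat \<Rightarrow> real" where "\<gamma> k = (LINT \<omega>|P. (K (\<xi> 0 \<omega>) - Kr \<tau> 0) * (K (\<xi> k \<omega>) - Kr \<tau> 0))"

definition H :: "nat \<Rightarrow> real \<Rightarrow> real" where "H m y = Kr (\<tau> - \<sigma> m) y - Kr \<tau> 0"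

lemma H_measurable [measurable]: "H m \<in> borel_measurable borel"
proof -
  have [measurable]: "Kr (\<tau> - \<sigma> m) \<in> borel_measurable borel" using sigma_le[of m] by (intro Kr_measurable) simp
  show ?thesis unfolding H_def by measurable
qed

lemma Y_eq: "Y m i \<omega> = H m (J (Suc i) {real (Suc i) - real m<..} \<omega>)"
  unfolding Y_def Z_def cond_def pw_\<kappa>_recent H_def ..

lemma X_eq: "X i \<omega> = Z (Suc i) UNIV \<omega> - Kr \<tau> 0" by (simp add: X_def Z_UNIV)

lemma J_measurable [measurable]: "W \<in> sets borel \<Longrightarrow> J i W \<in> borel_measurable P"
  by (rule SI_measurable[OF SI_J])

lemma const_L2: "integrable P (\<lambda>\<omega>. (c :: real)\<^sup>2)" by simp

lemma centered_L2: "W \<in> sets borel \<Longrightarrow> integrable P (\<lambda>\<omega>. (Z i W \<omega> - c)\<^sup>2)"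
  by (intro L2_diff_integrable Z_L2 const_L2) auto

lemma centered_product:
  assumes "W \<in> sets borel" "V \<in> sets borel"
  shows "(LINT \<omega>|P. (Z i W \<omega> - Kr \<tau> 0) * (Z j V \<omega> - Kr \<tau> 0)) = (LINT \<omega>|P. Z i W \<omega> * Z j V \<omega>) - (Kr \<tau> 0)\<^sup>2"
proof -
  let ?m = "Kr \<tau> 0"
  have ZZ: "integrable P (\<lambda>\<omega>. Z i W \<omega> * Z j V \<omega>)" using assms by (intro L2_mult_integrable Z_L2) auto
  have i: "integrable P (Z i W)" if "W \<in> sets borel" for i W
    using that L2_mult_integrable[of "Z i W" P "\<lambda>_. 1"] Z_L2[of W i] by simp
  have "(LINT \<omega>|P. (Z i W \<omega> - ?m) * (Z j V \<omega> - ?m)) = (LINT \<omega>|P. Z i W \<omega> * Z j V \<omega> - ?m * Z i W \<omega> - ?m * Z j V \<omega> + ?m * ?m)"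
    by (simp add: algebra_simps)
  also have "\<dots> = (LINT \<omega>|P. Z i W \<omega> * Z j V \<omega>) - ?m * ?m - ?m * ?m + ?m * ?m"
    using ZZ i assms Z_L2(3)[OF assms(1), of i] Z_L2(3)[OF assms(2), of j] by (simp add: prob_space)
  finally show ?thesis by (simp add: power2_eq_square)
qed

lemma block_char:
  "(CLINT \<omega>|P. iexp (u * (\<Sum>j<n. \<Sum>l<L. Y m (j * (L + m) + l) \<omega>))) = (CLINT \<omega>|P. iexp (u * (\<Sum>l<L. Y m l \<omega>))) ^ n"
proof (induction n)
  case 0
  show ?case by (simp add: prob_space)
next
  case (Suc n)
  define p where "p = L + m"
  define I where "I = {..<n} \<times> {..<L}"
  define W where "W i = {real (Suc i) - real m<..}" for i
  define A where "A q = J (Suc (fst q * p + snd q)) (W (fst q * p + snd q))" for q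
  define B where "B l = J (Suc (n * p + l)) (W (n * p + l))" for l
  define C where "C l = J (Suc l) (W l)" for l
  let ?PI = "PiM I (\<lambda>_. borel) :: (nat \<times> nat \<Rightarrow> real) measure" and ?PL = "PiM {..<L} (\<lambda>_. borel) :: (nat \<Rightarrow> real) measure"
  have [measurable]: "W i \<in> sets borel" for i unfolding W_def by simp
  have [measurable]: "A q \<in> borel_measurable P" "B l \<in> borel_measurable P" "C l \<in> borel_measurable P" for q l
    unfolding A_def B_def C_def by measurable
  have [measurable]: "(\<lambda>\<omega>. \<lambda>q\<in>I. A q \<omega>) \<in> measurable P ?PI" "(\<lambda>\<omega>. \<lambda>l\<in>{..<L}. B l \<omega>) \<in> measurable P ?PL"
    "(\<lambda>\<omega>. \<lambda>l\<in>{..<L}. C l \<omega>) \<in> measurable P ?PL" by (auto intro!: measurable_restrict)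
  have "distr P (?PI \<Otimes>\<^sub>M ?PL) (\<lambda>\<omega>. (\<lambda>q\<in>I. A q \<omega>, \<lambda>l\<in>{..<L}. B l \<omega>)) =
      distr P ?PI (\<lambda>\<omega>. \<lambda>q\<in>I. A q \<omega>) \<Otimes>\<^sub>M distr P ?PL (\<lambda>\<omega>. \<lambda>l\<in>{..<L}. B l \<omega>)"
  proof (rule SI_indep[where f = "\<lambda>q. \<kappa> (Suc (fst q * p + snd q)) (W (fst q * p + snd q))"
        and g = "\<lambda>l. \<kappa> (Suc (n * p + l)) (W (n * p + l))" and B = "{..real (n * p) - real m}"])
    fix q x assume q: "q \<in> I" and x: "x \<notin> {..real (n * p) - real m}"
    have "fst q * p + p \<le> n * p" using q mult_le_mono1[of "Suc (fst q)" n p] by (auto simp: I_def)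
    hence "Suc (fst q * p + snd q) + m \<le> n * p" using q by (auto simp: I_def p_def)
    hence "real (Suc (fst q * p + snd q)) + real m \<le> real (n * p)" by (metis of_nat_add of_nat_le_iff)
    hence "real (Suc (fst q * p + snd q)) - x < 0" using x by simp
    thus "\<kappa> (Suc (fst q * p + snd q)) (W (fst q * p + snd q)) x = 0" using kernel(2) by (simp add: \<kappa>_def)
  next
    fix l x assume "x \<in> {..real (n * p) - real m}"
    thus "\<kappa> (Suc (n * p + l)) (W (n * p + l)) x = 0" by (simp add: \<kappa>_def W_def)
  qed (auto simp: I_def A_def B_def intro!: SI_J)
  note ind = this
  define F where "F w = u * (\<Sum>j<n. \<Sum>l<L. H m (w (j, l)))" for w :: "nat \<times> nat \<Rightarrow> real"
  define G where "G w = u * (\<Sum>l<L. H m (w l))" for w :: "nat \<Rightarrow> real"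
  have Hc: "(\<lambda>w. H m (w q)) \<in> borel_measurable (PiM Q (\<lambda>_. borel))" if "q \<in> Q"  for q and Q :: "'q set"
    by (rule measurable_compose[OF measurable_component_singleton[OF that, of "\<lambda>_. borel"] H_measurable])
  have [measurable]: "F \<in> borel_measurable ?PI"
    unfolding F_def by (intro borel_measurable_times borel_measurable_const borel_measurable_sum Hc) (auto simp: I_def)
  have [measurable]: "G \<in> borel_measurable ?PL"
    unfolding G_def by (intro borel_measurable_times borel_measurable_const borel_measurable_sum Hc) auto
  have FA: "F (\<lambda>q\<in>I. A q \<omega>) = u * (\<Sum>j<n. \<Sum>l<L. Y m (j * p + l) \<omega>)" for \<omega>
    unfolding F_def by (intro arg_cong2[where f = times] refl sum.cong) (auto simp: I_def A_def W_def Y_eq)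
  have GB: "G (\<lambda>l\<in>{..<L}. B l \<omega>) = u * (\<Sum>l<L. Y m (n * p + l) \<omega>)" for \<omega>
    unfolding G_def by (intro arg_cong2[where f = times] refl sum.cong) (auto simp: B_def W_def Y_eq)
  have GC: "G (\<lambda>l\<in>{..<L}. C l \<omega>) = u * (\<Sum>l<L. Y m l \<omega>)" for \<omega>
    unfolding G_def by (intro arg_cong2[where f = times] refl sum.cong) (auto simp: C_def W_def Y_eq)
  have ind': "indep_var borel (F \<circ> (\<lambda>\<omega>. \<lambda>q\<in>I. A q \<omega>)) borel (G \<circ> (\<lambda>\<omega>. \<lambda>l\<in>{..<L}. B l \<omega>))"
  proof -
    let ?A = "\<lambda>\<omega>. \<lambda>q\<in>I. A q \<omega>" and ?B = "\<lambda>\<omega>. \<lambda>l\<in>{..<L}. B l \<omega>"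
    interpret G: prob_space "distr (distr P ?PL ?B) borel G" by (intro prob_space.prob_space_distr prob_space_distr) auto
    have "distr P (borel \<Otimes>\<^sub>M borel) (\<lambda>\<omega>. (F (?A \<omega>), G (?B \<omega>))) =
        distr (distr P (?PI \<Otimes>\<^sub>M ?PL) (\<lambda>\<omega>. (?A \<omega>, ?B \<omega>))) (borel \<Otimes>\<^sub>M borel) (\<lambda>(x, y). (F x, G y))"
      by (subst distr_distr) (auto simp: o_def)
    also have "\<dots> = distr (distr P ?PI ?A) borel F \<Otimes>\<^sub>M distr (distr P ?PL ?B) borel G"
      unfolding ind by (rule pair_measure_distr[symmetric]) (auto intro: G.sigma_finite_measure_axioms)
    also have "\<dots> = distr P borel (F \<circ> ?A) \<Otimes>\<^sub>M distr P borel (G \<circ> ?B)" by (simp add: distr_distr)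
    finally show ?thesis by (simp add: indep_var_distribution_eq o_def)
  qed
  have cd: "char (distr P borel S) 1 = (CLINT \<omega>|P. iexp (S \<omega>))" if [measurable]: "S \<in> borel_measurable P" for S
    unfolding char_def by (subst integral_distr) auto
  have mF: "(\<lambda>\<omega>. F (\<lambda>q\<in>I. A q \<omega>)) \<in> borel_measurable P" and mG: "(\<lambda>\<omega>. G (\<lambda>l\<in>{..<L}. B l \<omega>)) \<in> borel_measurable P" by measurable
  have "(CLINT \<omega>|P. iexp (F (\<lambda>q\<in>I. A q \<omega>) + G (\<lambda>l\<in>{..<L}. B l \<omega>))) =
      (CLINT \<omega>|P. iexp (F (\<lambda>q\<in>I. A q \<omega>))) * (CLINT \<omega>|P. iexp (G (\<lambda>l\<in>{..<L}. B l \<omega>)))"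
    using char_distr_add[OF ind', of 1] cd[OF mF] cd[OF mG] cd[OF borel_measurable_add[OF mF mG]] by (simp add: o_def)
  also have "(CLINT \<omega>|P. iexp (G (\<lambda>l\<in>{..<L}. B l \<omega>))) = (CLINT \<omega>|P. iexp (G (\<lambda>l\<in>{..<L}. C l \<omega>)))"
  proof -
    have law: "distr P ?PL (\<lambda>\<omega>. \<lambda>l\<in>{..<L}. B l \<omega>) = distr P ?PL (\<lambda>\<omega>. \<lambda>l\<in>{..<L}. C l \<omega>)"
      unfolding B_def C_def
      by (rule J_stationary[where t = "\<lambda>l. Suc (n * p + l)" and s = Suc and n = "n * p" and W = "\<lambda>l. W (n * p + l)" and V = W])
         (auto simp: W_def)
    have "(CLINT \<omega>|P. iexp (G (\<lambda>l\<in>{..<L}. B l \<omega>))) = (CLINT w|distr P ?PL (\<lambda>\<omega>. \<lambda>l\<in>{..<L}. B l \<omega>). iexp (G w))"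
      by (subst integral_distr) auto
    also have "\<dots> = (CLINT \<omega>|P. iexp (G (\<lambda>l\<in>{..<L}. C l \<omega>)))" unfolding law by (subst integral_distr) auto
    finally show ?thesis .
  qed
  finally show ?case unfolding FA GB GC p_def[symmetric] using Suc.IH unfolding p_def[symmetric]
    by (simp add: algebra_simps)
qed

lemma stationary: "(LINT \<omega>|P. X i \<omega> * X (i + k) \<omega>) = \<gamma> k"
proof -
  let ?B = "PiM UNIV (\<lambda>_. borel) :: (bool \<Rightarrow> real) measure"
  define F where "F w = (K (w False) - Kr \<tau> 0) * (K (w True) - Kr \<tau> 0)" for w :: "bool \<Rightarrow> real"
  have [measurable]: "(\<lambda>w. w b) \<in> borel_measurable ?B" for b by (rule measurable_component_singleton) simp
  have [measurable]: "F \<in> borel_measurable ?B" unfolding F_def by measurable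
  define t where "t b = Suc i + (if b then k else 0)" for b
  define s where "s b = (if b then k else 0)" for b
  have J: "J n UNIV = \<xi> n" for n by (simp add: J_def)
  have [measurable]: "\<xi> n \<in> borel_measurable P" for n by (rule SI_measurable[OF SI_\<xi>])
  have [measurable]: "(\<lambda>\<omega>. \<lambda>b\<in>UNIV. \<xi> (r b) \<omega>) \<in> measurable P ?B" for r by (auto intro!: measurable_restrict)
  have law: "distr P ?B (\<lambda>\<omega>. \<lambda>b\<in>UNIV. \<xi> (t b) \<omega>) = distr P ?B (\<lambda>\<omega>. \<lambda>b\<in>UNIV. \<xi> (s b) \<omega>)"
    using J_stationary[of UNIV t s "Suc i" "\<lambda>_. UNIV" "\<lambda>_. UNIV"] by (simp add: J t_def s_def)
  have "(LINT \<omega>|P. F (\<lambda>b\<in>UNIV. \<xi> (t b) \<omega>)) = (LINT w|distr P ?B (\<lambda>\<omega>. \<lambda>b\<in>UNIV. \<xi> (t b) \<omega>). F w)"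
    by (subst integral_distr) auto
  also have "\<dots> = (LINT \<omega>|P. F (\<lambda>b\<in>UNIV. \<xi> (s b) \<omega>))" unfolding law by (subst integral_distr) auto
  finally show ?thesis by (simp add: F_def t_def s_def X_def \<gamma>_def)
qed

lemma block_approximation:
  obtains c \<delta> where "block_approximation P X Y c \<gamma> \<delta>"
proof -
  let ?m = "Kr \<tau> 0"
  obtain c where c: "summable c" "\<And>k. 0 \<le> (c k :: real)"
    "\<And>i k W V. W \<in> sets borel \<Longrightarrow> V \<in> sets borel \<Longrightarrow> \<bar>(LINT \<omega>|P. Z i W \<omega> * Z (i + k) V \<omega>) - ?m\<^sup>2\<bar> \<le> c k"
    using covariance_decay by blast
  define W where "W m i = {real (Suc i) - real m<..}" for m i
  have W[measurable]: "W m i \<in> sets borel" for m i by (simp add: W_def)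
  have X: "X i = (\<lambda>\<omega>. Z (Suc i) UNIV \<omega> - ?m)" and Y: "Y m i = (\<lambda>\<omega>. Z (Suc i) (W m i) \<omega> - ?m)" for m i
    by (simp_all add: fun_eq_iff X_eq Y_def W_def)
  have meas: "X i \<in> borel_measurable P" "Y m i \<in> borel_measurable P" for m i unfolding X Y by measurable
  have L2: "integrable P (\<lambda>\<omega>. (X i \<omega>)\<^sup>2)" "integrable P (\<lambda>\<omega>. (Y m i \<omega>)\<^sup>2)" for m i
    unfolding X Y by (auto intro!: centered_L2)
  have bd: "\<bar>LINT \<omega>|P. (Z (Suc i) U \<omega> - ?m) * (Z (Suc (i + k)) V \<omega> - ?m)\<bar> \<le> c k"
    if "U \<in> sets borel" "V \<in> sets borel" for i k U V
    using c(3)[OF that, of "Suc i" k] that by (simp add: centered_product)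
  define \<delta> where "\<delta> m = v \<tau> - v (\<sigma> m)" for m
  have "block_approximation P X Y (\<lambda>k. 4 * c k) \<gamma> \<delta>"
  proof
    show "summable (\<lambda>k. 4 * c k)" using c(1) by (rule summable_mult)
    show "\<bar>LINT \<omega>|P. X i \<omega> * X (i + k) \<omega>\<bar> \<le> 4 * c k" for i k
      using bd[of UNIV UNIV i k] c(2)[of k] by (simp add: X)
    show "\<bar>LINT \<omega>|P. Y m i \<omega> * Y m (i + k) \<omega>\<bar> \<le> 4 * c k" for m i k
      using bd[of "W m i" "W m (i + k)" i k] c(2)[of k] by (simp add: Y)
    show "\<bar>LINT \<omega>|P. (X i \<omega> - Y m i \<omega>) * (X (i + k) \<omega> - Y m (i + k) \<omega>)\<bar> \<le> 4 * c k" for m i k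
    proof -
      let ?j = "i + k"
      have int: "integrable P (\<lambda>\<omega>. X i \<omega> * X ?j \<omega>)" "integrable P (\<lambda>\<omega>. X i \<omega> * Y m ?j \<omega>)"
        "integrable P (\<lambda>\<omega>. Y m i \<omega> * X ?j \<omega>)" "integrable P (\<lambda>\<omega>. Y m i \<omega> * Y m ?j \<omega>)"
        by (auto intro!: L2_mult_integrable meas L2)
      have "(LINT \<omega>|P. (X i \<omega> - Y m i \<omega>) * (X ?j \<omega> - Y m ?j \<omega>)) =
          (LINT \<omega>|P. X i \<omega> * X ?j \<omega> - X i \<omega> * Y m ?j \<omega> - Y m i \<omega> * X ?j \<omega> + Y m i \<omega> * Y m ?j \<omega>)"
        by (simp add: algebra_simps)
      also have "\<dots> = (LINT \<omega>|P. X i \<omega> * X ?j \<omega>) - (LINT \<omega>|P. X i \<omega> * Y m ?j \<omega>) - (LINT \<omega>|P. Y m i \<omega> * X ?j \<omega>) + (LINT \<omega>|P. Y m i \<omega> * Y m ?j \<omega>)"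
        using int by simp
      finally show ?thesis
        using bd[of UNIV UNIV i k] bd[of UNIV "W m ?j" i k] bd[of "W m i" UNIV i k] bd[of "W m i" "W m ?j" i k]
        by (simp add: X Y abs_le_iff)
    qed
    show "(LINT \<omega>|P. (X i \<omega> - Y m i \<omega>)\<^sup>2) \<le> \<delta> m" for m i
    proof -
      have "UNIV - {..real (Suc i) - real m} = W m i" by (auto simp: W_def)
      thus ?thesis using Z_step(2)[of UNIV UNIV "{..real (Suc i) - real m}" "Suc i"]
        by (simp add: X Y \<delta>_def W_def pw_\<kappa>_recent[of "Suc i", simplified] pw_\<kappa>_UNIV)
    qed
    show "\<delta> \<longlonglongrightarrow> 0"
    proof (rule tendstoI)
      fix e :: real assume "e > 0"
      then obtain d where d: "d > 0" "\<And>b. 0 \<le> b \<Longrightarrow> b \<le> \<tau> \<Longrightarrow> b < d \<Longrightarrow> v \<tau> - v (\<tau> - b) < e"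
        using v_left_continuous by blast
      have "\<forall>\<^sub>F m in sequentially. \<tau> - d < \<sigma> m" using d(1) by (intro order_tendstoD(1)[OF sigma_tendsto]) simp
      thus "\<forall>\<^sub>F m in sequentially. dist (\<delta> m) 0 < e"
      proof eventually_elim
        case (elim m)
        have "v \<tau> - v (\<tau> - (\<tau> - \<sigma> m)) < e" using elim sigma_le[of m] sigma_nonneg[of m] by (intro d(2)) auto
        moreover have "v (\<sigma> m) \<le> v \<tau>" using sigma_le[of m] sigma_nonneg[of m] by (intro v_mono) auto
        ultimately show ?case by (simp add: \<delta>_def)
      qed
    qed
    show "(LINT \<omega>|P. X i \<omega> * X (i + k) \<omega>) = \<gamma> k" for i k by (rule stationary)
    show "expectation (Y m i) = 0" for m i
    proof -
      have "integrable P (Z (Suc i) (W m i))"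
        using L2_mult_integrable[of "Z (Suc i) (W m i)" P "\<lambda>_. 1"] Z_L2(1)[OF W, of "Suc i" m i] by simp
      thus ?thesis using Z_L2(3)[OF W, of "Suc i" m i] by (simp add: Y prob_space)
    qed
  qed (use meas L2 block_char in auto)
  thus ?thesis by (rule that)
qed

end

section \<open>The limit theorem\<close>

lemma normal_law_char:
  assumes "0 \<le> s"
  shows "real_distribution (normal_law 0 s)" "char (normal_law 0 s) u = complex_of_real (exp (- (u\<^sup>2 * s / 2)))"
proof -
  have "real_distribution (normal_law 0 s) \<and> char (normal_law 0 s) u = complex_of_real (exp (- (u\<^sup>2 * s / 2)))"
  proof (cases "s = 0")
    case True
    interpret R: prob_space "return borel (0::real)" by (rule prob_space_return) simp
    have "real_distribution (return borel (0::real))" by unfold_locales auto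
    thus ?thesis using True by (simp add: normal_law_def char_def integral_return)
  next
    case False
    hence s: "0 < sqrt s" using assms by simp
    let ?N = "std_normal_distribution"
    interpret N: real_distribution ?N by (rule real_dist_normal_dist)
    have "distributed ?N lborel (\<lambda>x. x) (normal_density 0 1)"
      unfolding distributed_def by (auto simp: distr_id2)
    from N.normal_density_affine[OF this, of "sqrt s" 0] s
    have "distributed ?N lborel (\<lambda>x. sqrt s * x) (normal_density 0 (sqrt s))" by simp
    hence "distr ?N lborel (\<lambda>x. sqrt s * x) = density lborel (normal_density 0 (sqrt s))" by (rule distributed_distr_eq_density)
    moreover have "distr ?N lborel (\<lambda>x. sqrt s * x) = distr ?N borel (\<lambda>x. sqrt s * x)" by (rule distr_cong) auto
    ultimately have eq: "normal_law 0 s = distr ?N borel (\<lambda>x. sqrt s * x)" using False by (simp add: normal_law_def)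
    have "char (normal_law 0 s) u = char ?N (u * sqrt s)"
      unfolding eq char_def by (subst integral_distr) (auto simp: mult.assoc)
    also have "\<dots> = complex_of_real (exp (- (u\<^sup>2 * s / 2)))"
      using assms by (simp add: char_std_normal_distribution power_mult_distrib)
    finally show ?thesis unfolding eq by (auto intro!: N.real_distribution_distr)
  qed
  thus "real_distribution (normal_law 0 s)" "char (normal_law 0 s) u = complex_of_real (exp (- (u\<^sup>2 * s / 2)))" by auto
qed

lemma K3_integrable:
  assumes [measurable]: "K \<in> borel_measurable borel" and "K3 x0 K"
  shows "integrable lborel (\<lambda>x. indicator {-x0..x0} x * K x)"
proof -
  obtain S where S: "finite S" "\<And>\<epsilon>. \<epsilon> > 0 \<Longrightarrow> bounded (K ` {x \<in> {-x0..x0}. \<forall>s\<in>S. \<epsilon> \<le> \<bar>x - s\<bar>})"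
    "\<And>s. s \<in> S \<Longrightarrow> \<exists>\<epsilon>>0. set_integrable lborel {s - \<epsilon><..<s + \<epsilon>} K"
    using assms(2) unfolding K3_def by blast
  obtain e where e: "\<And>s. s \<in> S \<Longrightarrow> e s > 0" "\<And>s. s \<in> S \<Longrightarrow> set_integrable lborel {s - e s<..<s + e s} K"
    using S(3) by metis
  define \<epsilon> where "\<epsilon> = Min (insert 1 (e ` S))"
  have \<epsilon>: "\<epsilon> > 0" "\<And>s. s \<in> S \<Longrightarrow> \<epsilon> \<le> e s" using S(1) e(1) by (auto simp: \<epsilon>_def)
  obtain b where b: "\<And>x. x \<in> {-x0..x0} \<Longrightarrow> \<forall>s\<in>S. \<epsilon> \<le> \<bar>x - s\<bar> \<Longrightarrow> \<bar>K x\<bar> \<le> b"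
    using S(2)[OF \<epsilon>(1)] by (fastforce simp: bounded_iff)
  show ?thesis
  proof (rule Bochner_Integration.integrable_bound)
    let ?g = "\<lambda>x. \<bar>b\<bar> * indicator {-x0..x0} x + (\<Sum>s\<in>S. \<bar>indicator {s - e s<..<s + e s} x * K x\<bar>)"
    show "integrable lborel ?g"
      using e(2) S(1) by (auto simp: set_integrable_def emeasure_lborel_Icc_eq intro!: Bochner_Integration.integrable_add Bochner_Integration.integrable_sum integrable_abs integrable_mult_right integrable_real_indicator)
    show "AE x in lborel. norm (indicator {-x0..x0} x * K x) \<le> norm (?g x)"
    proof (intro AE_I2)
      fix x
      let ?t = "\<lambda>s. \<bar>indicator {s - e s<..<s + e s} x * K x\<bar>"
      have nn: "0 \<le> sum ?t S" by (rule sum_nonneg) simp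
      show "norm (indicator {-x0..x0} x * K x) \<le> norm (?g x)"
      proof (cases "x \<in> {-x0..x0} \<and> (\<exists>s\<in>S. \<bar>x - s\<bar> < \<epsilon>)")
        case True
        then obtain s where s: "s \<in> S" "\<bar>x - s\<bar> < \<epsilon>" by blast
        have "?t s \<le> sum ?t S" using S(1) s(1) by (intro member_le_sum) auto
        moreover have "?t s = \<bar>K x\<bar>" using s \<epsilon>(2)[OF s(1)] by (auto split: split_indicator)
        ultimately show ?thesis using True nn by (simp add: add_increasing)
      next
        case False
        show ?thesis
        proof (cases "x \<in> {-x0..x0}")
          case True
          hence "\<bar>K x\<bar> \<le> b" using False b[of x] by (force simp: not_less)
          thus ?thesis using True by (simp add: add_increasing2 sum_nonneg)
        qed (use nn in simp)
      qed
    qed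
  qed measurable
qed

theorem theorem6p1:
  fixes P :: "'w measure" and \<alpha> :: real and \<Phi> :: "real set \<Rightarrow> 'w \<Rightarrow> real"
    and a :: "real \<Rightarrow> real" and \<xi> :: "nat \<Rightarrow> 'w \<Rightarrow> real"
    and K :: "real \<Rightarrow> real" and x0 :: real
  assumes P: "prob_space P"
    and alpha: "1 < \<alpha>" "\<alpha> < 2"
    and random_measure: "sas_random_measure P \<alpha> \<Phi>"
    and kernel: "L_power \<alpha> a" "\<And>x. x < 0 \<Longrightarrow> a x = 0"
    and moving_average: "\<And>n. is_stable_integral P \<alpha> \<Phi> (\<lambda>x. a (real n - x)) (\<xi> n)"
    and K_measurable: "K \<in> borel_measurable borel"
    and x0: "0 < x0"
    and K1: "K1 \<alpha> x0 K" and K2: "K2 x0 K" and K3: "K3 x0 K"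
    and finite_variance: "integrable P (\<lambda>\<omega>. (K (\<xi> 0 \<omega>))\<^sup>2)"
    and summable_kernel:
      "summable (\<lambda>m::nat. sqrt (LINT x:{real m..real (Suc m)}|lborel. \<bar>a x\<bar> powr \<alpha>))"
    and summable_bracket:
      "summable (\<lambda>n::nat. bracket1 \<alpha> (\<lambda>x. a (- x)) (\<lambda>x. a (real (Suc n) - x)))"
  defines "S \<equiv> \<lambda>(N::nat) \<omega>. \<Sum>n=1..N. (K (\<xi> n \<omega>) - prob_space.expectation P (\<lambda>\<omega>'. K (\<xi> n \<omega>')))"
    and "sigma2 \<equiv> prob_space.variance P (\<lambda>\<omega>. K (\<xi> 0 \<omega>)) +
      2 * (\<Sum>n. covariance P (\<lambda>\<omega>. K (\<xi> 0 \<omega>)) (\<lambda>\<omega>. K (\<xi> (Suc n) \<omega>)))"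
  shows "(\<forall>n. integrable P (\<lambda>\<omega>. (K (\<xi> n \<omega>))\<^sup>2)) \<and>
    summable (\<lambda>n. \<bar>covariance P (\<lambda>\<omega>. K (\<xi> 0 \<omega>)) (\<lambda>\<omega>. K (\<xi> (Suc n) \<omega>))\<bar>) \<and>
    (\<lambda>N. prob_space.variance P (S N) / real N) \<longlonglongrightarrow> sigma2 \<and>
    weak_conv_m (\<lambda>N. distr P borel (\<lambda>\<omega>. S N \<omega> / sqrt (real N))) (normal_law 0 sigma2)"
proof -
  interpret prob_space P by (rule P)
  interpret stable_noise P \<alpha> \<Phi> by unfold_locales (use alpha random_measure in auto)
  obtain \<beta> C where \<beta>: "0 < \<beta>" "\<beta> < \<alpha> / 2" "\<And>x. x0 < \<bar>x\<bar> \<Longrightarrow> \<bar>K x\<bar> \<le> C * \<bar>x\<bar> powr \<beta>"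
    using K1 unfolding K1_def by blast
  have SI: "SI (\<lambda>x. a (real n - x)) (\<xi> n)" for n by (rule SI_stable_integral[OF moving_average])
  have pw0: "pw \<alpha> (\<lambda>x. a (real 0 - x)) = pw \<alpha> a" by (rule lborel_reflect)
  have L2: "integrable (mu (pw \<alpha> a)) (\<lambda>x. (K x)\<^sup>2)"
    using SI_integral(2)[OF SI[of 0], of "\<lambda>y. (K y)\<^sup>2"] K_measurable finite_variance unfolding pw0 by auto
  interpret moving_average P \<alpha> \<Phi> K x0 \<beta> C "pw \<alpha> a" a \<xi>
    by unfold_locales
      (use K_measurable \<beta> K3_integrable[OF K_measurable K3] L2 kernel SI summable_kernel in \<open>auto intro!: pw_nonneg\<close>)
  obtain c \<delta> where "block_approximation P X Y c \<gamma> \<delta>" using block_approximation by blast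
  then interpret B: block_approximation P X Y c \<gamma> \<delta> .
  let ?m = "Kr (pw \<alpha> a) 0"
  have K2: "integrable P (\<lambda>\<omega>. (K (\<xi> n \<omega>))\<^sup>2)" and mean: "expectation (\<lambda>\<omega>. K (\<xi> n \<omega>)) = ?m" for n
    using Z_L2(1,3)[of UNIV n] by (simp_all add: Z_UNIV)
  have cov: "covariance P (\<lambda>\<omega>. K (\<xi> 0 \<omega>)) (\<lambda>\<omega>. K (\<xi> n \<omega>)) = \<gamma> n" for n by (simp add: covariance_def mean \<gamma>_def)
  have var: "variance (\<lambda>\<omega>. K (\<xi> 0 \<omega>)) = \<gamma> 0" by (simp add: mean \<gamma>_def power2_eq_square)
  have s2: "sigma2 = B.sigma2" unfolding sigma2_def B.sigma2_def cov var ..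
  have S: "S N \<omega> = (\<Sum>i<N. X i \<omega>)" for N \<omega> by (simp add: S_def mean X_def sum.atLeast1_atMost_eq)
  have X0: "integrable P (X i)" "expectation (X i) = 0" for i
  proof -
    show i: "integrable P (X i)" using L2_mult_integrable[of "X i" P "\<lambda>_. 1"] B.X[of i] by simp
    have "integrable P (\<lambda>\<omega>. X i \<omega> + ?m)" using i by simp
    hence "integrable P (\<lambda>\<omega>. K (\<xi> (Suc i) \<omega>))" by (simp add: X_def)
    thus "expectation (X i) = 0" using mean[of "Suc i"] by (simp add: X_def[abs_def] prob_space)
  qed
  have var_S: "variance (S N) = expectation (\<lambda>\<omega>. (\<Sum>i<N. X i \<omega>)\<^sup>2)" for N
  proof -
    have "expectation (S N) = 0" using X0 by (simp add: S[abs_def])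
    thus ?thesis by (simp add: S)
  qed
  have "weak_conv_m (\<lambda>N. distr P borel (\<lambda>\<omega>. S N \<omega> / sqrt (real N))) (normal_law 0 sigma2)"
  proof (rule levy_continuity)
    have meas: "(\<lambda>\<omega>. S N \<omega> / sqrt (real N)) \<in> borel_measurable P" for N unfolding S using B.X(1) by measurable
    show "real_distribution (distr P borel (\<lambda>\<omega>. S N \<omega> / sqrt (real N)))" for N
      by (intro real_distribution_distr meas)
    show "real_distribution (normal_law 0 sigma2)" unfolding s2 by (rule normal_law_char[OF B.sigma2_nonneg])
    fix u
    have "char (distr P borel (\<lambda>\<omega>. S N \<omega> / sqrt (real N))) u = (CLINT \<omega>|P. iexp (u / sqrt (real N) * (\<Sum>i<N. X i \<omega>)))" for N
      unfolding char_def using meas by (subst integral_distr) (auto simp: S)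
    thus "(\<lambda>N. char (distr P borel (\<lambda>\<omega>. S N \<omega> / sqrt (real N))) u) \<longlonglongrightarrow> char (normal_law 0 sigma2) u"
      using B.char_limit[of u] by (simp add: s2 normal_law_char(2)[OF B.sigma2_nonneg])
  qed
  thus ?thesis using K2 B.summable_gamma B.sigma2_limit by (simp add: cov var_S s2)
qed

end
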